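(* Let $(\mathcal{C},\otimes)$ be an Abelian tensor category. The functors of cooperads $$\mathfrak{AW}:(\mathcal{C}^{\Delta^{\mathrm{op}}},\otimes)^\vee\to(\mathcal{C}^{\Delta^{\mathrm{op}}},\widetilde\otimes)^\vee,\qquad \mathfrak{EZ}:(\mathcal{C}^{\Delta^{\mathrm{op}}},\widetilde\otimes)^\vee\to(\mathcal{C}^{\Delta^{\mathrm{op}}},\otimes)^\vee$$ are the identity on objects and satisfy $\mathfrak{AW}\circ\mathfrak{EZ}=\mathrm{id}$. Moreover, with the morphisms $H_k:\Delta_1\otimes\delta_k^*\to\delta_k^*$ (the Shih operators) defined in the context, the assignment $$\big(f:X\to Y_1\otimes\dots\otimes Y_k\big)\ \mapsto\ \big(\Delta_1\otimes X\xrightarrow{\Delta_1\otimes f}\Delta_1\otimes(Y_1\otimes\dots\otimes Y_k)\xrightarrow{H_k}Y_1\otimes\dots\otimes Y_k\big)$$ is an element of $\underline{\mathrm{Def}}\big((\mathcal{C}^{\Delta^{\mathrm{op}}},\otimes)^\vee,(\mathcal{C}^{\Delta^{\mathrm{op}}},\otimes)^\vee\big)_{\mathrm{id},[1]}$ which constitutes a homotopy between $\mathfrak{EZ}\circ\mathfrak{AW}$ and $\mathrm{id}$. Likewise, the same operators, interpreted as deformations of $\otimes$, i.e. the assignment $$\big(f:X_1\otimes\dots\otimes X_k\to Y\big)\ \mapsto\ \big(\Delta_1\otimes(X_1\otimes\dots\otimes X_k)\xrightarrow{H_k}X_1\otimes\dots\otimes X_k\xrightarrow{f}Y\big),$$ constitute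 an element of $\underline{\mathrm{Def}}\big((\mathcal{C}^{\Delta^{\mathrm{op}}},\otimes),(\mathcal{C}^{\Delta^{\mathrm{op}}},\otimes)\big)_{\mathrm{id},[1]}$.
   Context: An Abelian tensor category is an abelian category with a monoidal product $\otimes$, additive in each variable. Operads and cooperads are planar; for a monoidal category $\mathcal{M}$, the operad $\mathcal{M}$ has multi-morphisms $\mathrm{Hom}(X_1\otimes\dots\otimes X_k,Y)$ and the cooperad $\mathcal{M}^\vee$ has multi-morphisms $\mathrm{Hom}(X,Y_1\otimes\dots\otimes Y_k)$, $k\ge0$. $\delta_k:\Delta^{\mathrm{op}}\to(\Delta^{\mathrm{op}})^k$ is the diagonal, $\mathrm{dec}_k:(\Delta^{\mathrm{op}})^k\to\Delta^{\mathrm{op}}$ concatenation $([n_1],\dots,[n_k])\mapsto[n_1]\ast\dots\ast[n_k]$ with $[n]\ast[m]=[n+m+1]$; $\mathrm{dec}_{k,*}$ is right adjoint to $\mathrm{dec}_k^*$; $\mathrm{dec}=\mathrm{dec}_2$. On $\mathcal{C}^{\Delta^{\mathrm{op}}}$ there are the monoidal products $X\otimes Y=\delta_2^*(X\boxtimes Y)$ (point-wise) and $X\mathbin{\widetilde\otimes}Y=\mathrm{dec}_*(X\boxtimes Y)$ (under Dold–Kan the usual tensor product of non-negatively graded complexes), where $(X\boxtimes Y)_{[n],[m]}=X_{[n]}\otimes Y_{[m]}$; the unit is the constant simplicial object $1$ in both cases. $\mathrm{Aw}_k:\delta_k^*\to\mathrm{dec}_{k,*}$ is adjoint to the map $\mathrm{dec}_k^*\delta_k^*X\to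 X$ which at $([n_1],\dots,[n_k])$ is induced by the inclusions $[n_i]\hookrightarrow[n_1]\ast\dots\ast[n_k]$. $\mathrm{Ez}_k:\mathrm{dec}_{k,*}\to\delta_k^*$ is defined as follows. Let $\iota:\Delta\to\mathrm{FinSet}$ be the forgetful functor to non-empty finite sets. Let $\mathfrak{C}:\mathcal{C}^{\Delta^{\mathrm{op}}}\to\mathcal{C}^{\mathrm{FinSet}^{\mathrm{op}}}$, $\mathfrak{C}(X)_{[n]}=\mathrm{Hom}(\Delta_n^\circ,X)$ ($X$ viewed as a complex by Dold–Kan), where $\Delta^\circ_n$ is the normalized chain complex of the standard simplex with basis the non-empty subsets of $\{0,\dots,n\}$, and a map of finite sets sends a basis element $[S]$ to its image with the sign of the induced permutation if it is injective on $S$ and to $0$ otherwise; there is a canonical isomorphism $\mathrm{id}\cong\iota^*\mathfrak{C}$. The fold maps $S\coprod\dots\coprod S\to S$ induce $\mathfrak{C}X\to\delta_{k,s}^*\mathrm{dec}_{k,s}^*\mathfrak{C}X$ ($\mathrm{dec}_{k,s}$ the $k$-fold coproduct, $\delta_{k,s}$ the diagonal of $\mathrm{FinSet}$), and applying $\iota^*$ one gets $\gamma:\mathrm{id}\to\delta_k^*\mathrm{dec}_k^*$; then $\mathrm{Ez}_k$ is $\mathrm{dec}_{k,*}\xrightarrow{\gamma}\delta_k^*\mathrm{dec}_k^*\mathrm{dec}_{k,*}\to\delta_k^*$ (counit). For $k=0$ both are the identity. $\mathfrak{AW}$ sends $f:X\to Y_1\otimes\dots\otimes Y_k$ to $\mathrm{Aw}_k\circ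 f$ and $\mathfrak{EZ}$ sends $g:X\to Y_1\mathbin{\widetilde\otimes}\dots\mathbin{\widetilde\otimes}Y_k$ to $\mathrm{Ez}_k\circ g$. Shih operators. Put $E_k=\mathrm{Ez}_k\mathrm{Aw}_k:\delta_k^*\to\delta_k^*$, a natural endomorphism on $k$-fold simplicial objects. For a $k$-fold simplicial object $Z$ let $\mathcal{E}_{[a],[b]}$ be the endomorphism of $(\mathrm{dec}^*\delta_k^*Z)_{[a],[b]}=Z_{[a]\ast[b],\dots,[a]\ast[b]}$ obtained by applying $E_k$ (evaluated at $[b]$) to the $k$-fold simplicial object $Z_{[a]\ast-,\dots,[a]\ast-}$; it is a natural endomorphism of $\mathrm{dec}^*\delta_k^*Z$. By the adjunction isomorphism $\mathrm{Hom}(\mathrm{dec}^*X,\mathrm{dec}^*Y)\cong\mathrm{Hom}(\Delta_1\otimes X,Y)$, where $(K\otimes X)_{[n]}=\coprod_{K_{[n]}}X_{[n]}$, it corresponds to $H_k:\Delta_1\otimes\delta_k^*Z\to\delta_k^*Z$; explicitly on the copy indexed by $\varphi:[n]\to[1]$ with $\varphi^{-1}(0)=\{0,\dots,i\}$, $-1\le i\le n$, $H_k$ is $\mathcal{E}_{[i],[n-i-1]}$ for $0\le i\le n-1$, the identity for $i=n$ and $E_k$ for $i=-1$. For $k=0$, $H_0$ is the projection $\Delta_1\otimes1\to1$. Naive deformations. For a simplicial set $K$, a map $K\to\underline{\mathrm{Def}}(\mathcal{M}^\vee,\mathcal{M}^\vee)_{\mathrm{id}}$ with $\mathcal{M}=(\mathcal{C}^{\Delta^{\mathrm{op}}},\otimes)$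 is a rule assigning to every multi-morphism $f:X\to Y_1\otimes\dots\otimes Y_k$ (discrete structure on the source) a morphism $\mu_f:K\otimes X\to Y_1\otimes\dots\otimes Y_k$ such that $\mu_f=f\circ\mathrm{pr}$ for $k=1$ and such that $\mu$ is compatible with composition of multi-morphisms, where $K$-families $\mu_f$ and $\mu_{g_1},\dots,\mu_{g_k}$ are composed using the diagonal $K\to K^{k+1}$ and $K^k\otimes(Y_1\otimes\dots\otimes Y_k)\to(K\otimes Y_1)\otimes\dots\otimes(K\otimes Y_k)$. Similarly for the operad $\mathcal{M}$. The index $[1]$ means $K=\Delta_1$; such an element is a homotopy between the two functors (identity on objects) obtained by restriction to the two vertices of $\Delta_1$. *)

theory Defs
  imports
    "HOL-Algebra.FiniteProduct"
    "HOL-Combinatorics.Permutations"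
begin

section \<open>Categories, functors, universal arrows\<close>

text \<open>Hom-sets are not required to be disjoint, so operations that depend on the endpoints of an
  arrow take them as arguments.  This allows the same notion to be used for the simplex category
  (arrows are lists of values, the codomain is not part of the arrow) and for categories of
  functors (arrows are families of components).\<close>

record ('o, 'm) cat =
  Obj :: "'o set"
  Hom :: "'o \<Rightarrow> 'o \<Rightarrow> 'm set"
  Idm :: "'o \<Rightarrow> 'm"
  Cmp :: "'m \<Rightarrow> 'm \<Rightarrow> 'm" (infixr \<open>\<cdot>\<index>\<close> 70)

locale category =
  fixes C :: "('o, 'm, 'z) cat_scheme" (structure)
  assumes id_in: "a \<in> Obj C \<Longrightarrow> Idm C a \<in> Hom C a a"
    and comp_in: "\<lbrakk>a \<in> Obj C; b \<in> Obj C; c \<in> Obj C; f \<in> Hom C a b; g \<in> Hom C b c\<rbrakk>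
      \<Longrightarrow> g \<cdot> f \<in> Hom C a c"
    and id_left: "\<lbrakk>a \<in> Obj C; b \<in> Obj C; f \<in> Hom C a b\<rbrakk> \<Longrightarrow> Idm C b \<cdot> f = f"
    and id_right: "\<lbrakk>a \<in> Obj C; b \<in> Obj C; f \<in> Hom C a b\<rbrakk> \<Longrightarrow> f \<cdot> Idm C a = f"
    and comp_assoc: "\<lbrakk>a \<in> Obj C; b \<in> Obj C; c \<in> Obj C; d \<in> Obj C;
        f \<in> Hom C a b; g \<in> Hom C b c; h \<in> Hom C c d\<rbrakk>
      \<Longrightarrow> (h \<cdot> g) \<cdot> f = h \<cdot> (g \<cdot> f)"

definition inverse_pair :: "('o, 'm, 'z) cat_scheme \<Rightarrow> 'o \<Rightarrow> 'o \<Rightarrow> 'm \<Rightarrow> 'm \<Rightarrow> bool" where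
  "inverse_pair C a b f g \<longleftrightarrow> f \<in> Hom C a b \<and> g \<in> Hom C b a \<and>
     g \<cdot>\<^bsub>C\<^esub> f = Idm C a \<and> f \<cdot>\<^bsub>C\<^esub> g = Idm C b"

definition is_isom :: "('o, 'm, 'z) cat_scheme \<Rightarrow> 'o \<Rightarrow> 'o \<Rightarrow> 'm \<Rightarrow> bool" where
  "is_isom C a b f \<longleftrightarrow> (\<exists>g. inverse_pair C a b f g)"

definition inv_mor :: "('o, 'm, 'z) cat_scheme \<Rightarrow> 'o \<Rightarrow> 'o \<Rightarrow> 'm \<Rightarrow> 'm" where
  "inv_mor C a b f = (THE g. inverse_pair C a b f g)"

definition op_cat :: "('o, 'm, 'z) cat_scheme \<Rightarrow> ('o, 'm) cat" where
  "op_cat A = \<lparr>Obj = Obj A, Hom = (\<lambda>a b. Hom A b a), Idm = Idm A, Cmp = (\<lambda>g f. f \<cdot>\<^bsub>A\<^esub> g)\<rparr>"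

text \<open>The \<open>k\<close>-fold power of a category; objects and arrows are lists of length \<open>k\<close>.\<close>

definition pow_cat :: "nat \<Rightarrow> ('o, 'm, 'z) cat_scheme \<Rightarrow> ('o list, 'm list) cat" where
  "pow_cat k A =
    \<lparr>Obj = {as. length as = k \<and> set as \<subseteq> Obj A},
     Hom = (\<lambda>as bs. {fs. length fs = k \<and> (\<forall>i<k. fs ! i \<in> Hom A (as ! i) (bs ! i))}),
     Idm = map (Idm A),
     Cmp = map2 (Cmp A)\<rparr>"

record ('i, 'j, 'o, 'm) ftor =
  Fo :: "'i \<Rightarrow> 'o"
  Fm :: "'i \<Rightarrow> 'i \<Rightarrow> 'j \<Rightarrow> 'm"

definition is_functor ::
  "('i, 'j, 'y) cat_scheme \<Rightarrow> ('o, 'm, 'z) cat_scheme \<Rightarrow> ('i, 'j, 'o, 'm) ftor \<Rightarrow> bool" where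
  "is_functor A C F \<longleftrightarrow>
     (\<forall>a\<in>Obj A. Fo F a \<in> Obj C) \<and>
     (\<forall>a\<in>Obj A. \<forall>b\<in>Obj A. \<forall>f\<in>Hom A a b. Fm F a b f \<in> Hom C (Fo F a) (Fo F b)) \<and>
     (\<forall>a\<in>Obj A. Fm F a a (Idm A a) = Idm C (Fo F a)) \<and>
     (\<forall>a\<in>Obj A. \<forall>b\<in>Obj A. \<forall>c\<in>Obj A. \<forall>f\<in>Hom A a b. \<forall>g\<in>Hom A b c.
        Fm F a c (g \<cdot>\<^bsub>A\<^esub> f) = Fm F b c g \<cdot>\<^bsub>C\<^esub> Fm F a b f)"

definition is_nat_trans ::
  "('i, 'j, 'y) cat_scheme \<Rightarrow> ('o, 'm, 'z) cat_scheme \<Rightarrow>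
   ('i, 'j, 'o, 'm) ftor \<Rightarrow> ('i, 'j, 'o, 'm) ftor \<Rightarrow> ('i \<Rightarrow> 'm) \<Rightarrow> bool" where
  "is_nat_trans A C F G \<eta> \<longleftrightarrow>
     (\<forall>a\<in>Obj A. \<eta> a \<in> Hom C (Fo F a) (Fo G a)) \<and>
     (\<forall>a\<in>Obj A. \<forall>b\<in>Obj A. \<forall>f\<in>Hom A a b.
        Fm G a b f \<cdot>\<^bsub>C\<^esub> \<eta> a = \<eta> b \<cdot>\<^bsub>C\<^esub> Fm F a b f)"

text \<open>The restriction \<open>H\<^sup>* F\<close> of \<open>F\<close> along \<open>H\<close>.\<close>

definition restr :: "('b, 'k, 'o, 'm) ftor \<Rightarrow> ('i, 'j, 'b, 'k) ftor \<Rightarrow> ('i, 'j, 'o, 'm) ftor" where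
  "restr F H =
    \<lparr>Fo = (\<lambda>a. Fo F (Fo H a)), Fm = (\<lambda>a b f. Fm F (Fo H a) (Fo H b) (Fm H a b f))\<rparr>"

definition pow_ftor :: "nat \<Rightarrow> ('i, 'j, 'o, 'm) ftor \<Rightarrow> ('i list, 'j list, 'o list, 'm list) ftor" where
  "pow_ftor k F =
    \<lparr>Fo = map (Fo F),
     Fm = (\<lambda>as bs fs. map (\<lambda>i. Fm F (as ! i) (bs ! i) (fs ! i)) [0..<k])\<rparr>"

text \<open>\<open>(D, \<epsilon>)\<close> is the value at \<open>Z\<close> of a right adjoint of \<open>H\<^sup>*\<close>, together with its counit
  \<open>\<epsilon> : H\<^sup>* D \<rightarrow> Z\<close> (a universal arrow from \<open>H\<^sup>*\<close> to \<open>Z\<close>).\<close>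

definition is_right_adjoint_value ::
  "('i, 'j, 'y) cat_scheme \<Rightarrow> ('b, 'k, 'x) cat_scheme \<Rightarrow> ('o, 'm, 'z) cat_scheme \<Rightarrow>
   ('i, 'j, 'b, 'k) ftor \<Rightarrow> ('i, 'j, 'o, 'm) ftor \<Rightarrow> ('b, 'k, 'o, 'm) ftor \<Rightarrow> ('i \<Rightarrow> 'm) \<Rightarrow> bool"
where
  "is_right_adjoint_value A B C H Z D \<epsilon> \<longleftrightarrow>
     is_functor B C D \<and> is_nat_trans A C (restr D H) Z \<epsilon> \<and>
     (\<forall>X \<psi>. is_functor B C X \<and> is_nat_trans A C (restr X H) Z \<psi> \<longrightarrow>
        (\<exists>\<phi>. is_nat_trans B C X D \<phi> \<and> (\<forall>a\<in>Obj A. \<epsilon> a \<cdot>\<^bsub>C\<^esub> \<phi> (Fo H a) = \<psi> a) \<and>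
          (\<forall>\<phi>'. is_nat_trans B C X D \<phi>' \<and> (\<forall>a\<in>Obj A. \<epsilon> a \<cdot>\<^bsub>C\<^esub> \<phi>' (Fo H a) = \<psi> a) \<longrightarrow>
             (\<forall>b\<in>Obj B. \<phi>' b = \<phi> b))))"


section \<open>Monoidal categories\<close>

record ('o, 'm) mon_cat = "('o, 'm) cat" +
  TensO :: "'o \<Rightarrow> 'o \<Rightarrow> 'o"
  TensM :: "'m \<Rightarrow> 'm \<Rightarrow> 'm"
  TUnit :: 'o
  Assoc :: "'o \<Rightarrow> 'o \<Rightarrow> 'o \<Rightarrow> 'm"
  LUnit :: "'o \<Rightarrow> 'm"
  RUnit :: "'o \<Rightarrow> 'm"

locale monoidal_category = category C
  for C :: "('o, 'm, 'z) mon_cat_scheme" (structure) +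
  assumes tens_obj: "\<lbrakk>a \<in> Obj C; b \<in> Obj C\<rbrakk> \<Longrightarrow> TensO C a b \<in> Obj C"
    and unit_obj: "TUnit C \<in> Obj C"
    and tens_in: "\<lbrakk>a \<in> Obj C; b \<in> Obj C; c \<in> Obj C; d \<in> Obj C; f \<in> Hom C a b; g \<in> Hom C c d\<rbrakk>
      \<Longrightarrow> TensM C f g \<in> Hom C (TensO C a c) (TensO C b d)"
    and tens_id: "\<lbrakk>a \<in> Obj C; b \<in> Obj C\<rbrakk>
      \<Longrightarrow> TensM C (Idm C a) (Idm C b) = Idm C (TensO C a b)"
    and tens_comp: "\<lbrakk>a \<in> Obj C; b \<in> Obj C; c \<in> Obj C; a' \<in> Obj C; b' \<in> Obj C; c' \<in> Obj C;
        f \<in> Hom C a b; g \<in> Hom C b c; f' \<in> Hom C a' b'; g' \<in> Hom C b' c'\<rbrakk>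
      \<Longrightarrow> TensM C (g \<cdot> f) (g' \<cdot> f') = TensM C g g' \<cdot> TensM C f f'"
    and assoc_iso: "\<lbrakk>a \<in> Obj C; b \<in> Obj C; c \<in> Obj C\<rbrakk>
      \<Longrightarrow> is_isom C (TensO C (TensO C a b) c) (TensO C a (TensO C b c)) (Assoc C a b c)"
    and assoc_nat: "\<lbrakk>a \<in> Obj C; b \<in> Obj C; c \<in> Obj C; a' \<in> Obj C; b' \<in> Obj C; c' \<in> Obj C;
        f \<in> Hom C a a'; g \<in> Hom C b b'; h \<in> Hom C c c'\<rbrakk>
      \<Longrightarrow> Assoc C a' b' c' \<cdot> TensM C (TensM C f g) h = TensM C f (TensM C g h) \<cdot> Assoc C a b c"
    and lunit_iso: "a \<in> Obj C \<Longrightarrow> is_isom C (TensO C (TUnit C) a) a (LUnit C a)"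
    and lunit_nat: "\<lbrakk>a \<in> Obj C; b \<in> Obj C; f \<in> Hom C a b\<rbrakk>
      \<Longrightarrow> LUnit C b \<cdot> TensM C (Idm C (TUnit C)) f = f \<cdot> LUnit C a"
    and runit_iso: "a \<in> Obj C \<Longrightarrow> is_isom C (TensO C a (TUnit C)) a (RUnit C a)"
    and runit_nat: "\<lbrakk>a \<in> Obj C; b \<in> Obj C; f \<in> Hom C a b\<rbrakk>
      \<Longrightarrow> RUnit C b \<cdot> TensM C f (Idm C (TUnit C)) = f \<cdot> RUnit C a"
    and triangle: "\<lbrakk>a \<in> Obj C; b \<in> Obj C\<rbrakk>
      \<Longrightarrow> TensM C (Idm C a) (LUnit C b) \<cdot> Assoc C a (TUnit C) b = TensM C (RUnit C a) (Idm C b)"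
    and pentagon: "\<lbrakk>a \<in> Obj C; b \<in> Obj C; c \<in> Obj C; d \<in> Obj C\<rbrakk>
      \<Longrightarrow> TensM C (Idm C a) (Assoc C b c d) \<cdot> Assoc C a (TensO C b c) d
            \<cdot> TensM C (Assoc C a b c) (Idm C d)
          = Assoc C a b (TensO C c d) \<cdot> Assoc C (TensO C a b) c d"

text \<open>Iterated products \<open>Y\<^sub>1 \<otimes> (Y\<^sub>2 \<otimes> (\<dots> \<otimes> Y\<^sub>k))\<close>; the product of \<open>[Y]\<close> is \<open>Y\<close> itself.\<close>

fun tensO :: "('o, 'm, 'z) mon_cat_scheme \<Rightarrow> 'o list \<Rightarrow> 'o" where
  "tensO C [] = TUnit C"
| "tensO C [x] = x"
| "tensO C (x # y # r) = TensO C x (tensO C (y # r))"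

fun tensM :: "('o, 'm, 'z) mon_cat_scheme \<Rightarrow> 'm list \<Rightarrow> 'm" where
  "tensM C [] = Idm C (TUnit C)"
| "tensM C [f] = f"
| "tensM C (f # g # r) = TensM C f (tensM C (g # r))"

text \<open>The coherence isomorphisms \<open>\<Otimes>xs \<otimes> \<Otimes>ys \<rightarrow> \<Otimes>(xs @ ys)\<close> and
  \<open>\<Otimes>\<^sub>i (\<Otimes>(xss ! i)) \<rightarrow> \<Otimes>(concat xss)\<close>.\<close>

fun tens_append :: "('o, 'm, 'z) mon_cat_scheme \<Rightarrow> 'o list \<Rightarrow> 'o list \<Rightarrow> 'm" where
  "tens_append C [] ys = LUnit C (tensO C ys)"
| "tens_append C [x] ys =
     (if ys = [] then RUnit C x else Idm C (TensO C x (tensO C ys)))"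
| "tens_append C (x # y # r) ys =
     TensM C (Idm C x) (tens_append C (y # r) ys) \<cdot>\<^bsub>C\<^esub> Assoc C x (tensO C (y # r)) (tensO C ys)"

fun tens_flat :: "('o, 'm, 'z) mon_cat_scheme \<Rightarrow> 'o list list \<Rightarrow> 'm" where
  "tens_flat C [] = Idm C (TUnit C)"
| "tens_flat C [xs] = Idm C (tensO C xs)"
| "tens_flat C (xs # ys # r) =
     tens_append C xs (concat (ys # r)) \<cdot>\<^bsub>C\<^esub>
       TensM C (Idm C (tensO C xs)) (tens_flat C (ys # r))"


section \<open>Abelian tensor categories\<close>

record ('o, 'm) ab_mon_cat = "('o, 'm) mon_cat" +
  Plus :: "'m \<Rightarrow> 'm \<Rightarrow> 'm"
  Zero :: "'o \<Rightarrow> 'o \<Rightarrow> 'm"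

text \<open>The additive group of morphisms, in the multiplicative notation of the library.\<close>

definition hom_group :: "('o, 'm, 'z) ab_mon_cat_scheme \<Rightarrow> 'o \<Rightarrow> 'o \<Rightarrow> 'm monoid" where
  "hom_group C a b = \<lparr>carrier = Hom C a b, monoid.mult = Plus C, one = Zero C a b\<rparr>"

definition is_mono :: "('o, 'm, 'z) cat_scheme \<Rightarrow> 'o \<Rightarrow> 'o \<Rightarrow> 'm \<Rightarrow> bool" where
  "is_mono C a b f \<longleftrightarrow> f \<in> Hom C a b \<and>
     (\<forall>x\<in>Obj C. \<forall>g\<in>Hom C x a. \<forall>h\<in>Hom C x a. f \<cdot>\<^bsub>C\<^esub> g = f \<cdot>\<^bsub>C\<^esub> h \<longrightarrow> g = h)"

definition is_epi :: "('o, 'm, 'z) cat_scheme \<Rightarrow> 'o \<Rightarrow> 'o \<Rightarrow> 'm \<Rightarrow> bool" where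
  "is_epi C a b f \<longleftrightarrow> f \<in> Hom C a b \<and>
     (\<forall>x\<in>Obj C. \<forall>g\<in>Hom C b x. \<forall>h\<in>Hom C b x. g \<cdot>\<^bsub>C\<^esub> f = h \<cdot>\<^bsub>C\<^esub> f \<longrightarrow> g = h)"

text \<open>\<open>i : k \<rightarrow> a\<close> is a kernel, resp. \<open>q : b \<rightarrow> c\<close> is a cokernel, of \<open>f : a \<rightarrow> b\<close>.\<close>

definition is_kernel ::
  "('o, 'm, 'z) ab_mon_cat_scheme \<Rightarrow> 'o \<Rightarrow> 'o \<Rightarrow> 'm \<Rightarrow> 'o \<Rightarrow> 'm \<Rightarrow> bool" where
  "is_kernel C a b f k i \<longleftrightarrow> k \<in> Obj C \<and> i \<in> Hom C k a \<and> f \<cdot>\<^bsub>C\<^esub> i = Zero C k b \<and>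
     (\<forall>x\<in>Obj C. \<forall>g\<in>Hom C x a. f \<cdot>\<^bsub>C\<^esub> g = Zero C x b \<longrightarrow>
        (\<exists>!h. h \<in> Hom C x k \<and> i \<cdot>\<^bsub>C\<^esub> h = g))"

definition is_cokernel ::
  "('o, 'm, 'z) ab_mon_cat_scheme \<Rightarrow> 'o \<Rightarrow> 'o \<Rightarrow> 'm \<Rightarrow> 'o \<Rightarrow> 'm \<Rightarrow> bool" where
  "is_cokernel C a b f c q \<longleftrightarrow> c \<in> Obj C \<and> q \<in> Hom C b c \<and> q \<cdot>\<^bsub>C\<^esub> f = Zero C a c \<and>
     (\<forall>x\<in>Obj C. \<forall>g\<in>Hom C b x. g \<cdot>\<^bsub>C\<^esub> f = Zero C a x \<longrightarrow>
        (\<exists>!h. h \<in> Hom C c x \<and> h \<cdot>\<^bsub>C\<^esub> q = g))"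

definition is_biproduct ::
  "('o, 'm, 'z) ab_mon_cat_scheme \<Rightarrow> 'o \<Rightarrow> 'o \<Rightarrow> 'o \<Rightarrow> 'm \<Rightarrow> 'm \<Rightarrow> 'm \<Rightarrow> 'm \<Rightarrow> bool" where
  "is_biproduct C a b s i j p q \<longleftrightarrow> s \<in> Obj C \<and>
     i \<in> Hom C a s \<and> j \<in> Hom C b s \<and> p \<in> Hom C s a \<and> q \<in> Hom C s b \<and>
     p \<cdot>\<^bsub>C\<^esub> i = Idm C a \<and> q \<cdot>\<^bsub>C\<^esub> j = Idm C b \<and>
     p \<cdot>\<^bsub>C\<^esub> j = Zero C b a \<and> q \<cdot>\<^bsub>C\<^esub> i = Zero C a b \<and>
     Plus C (i \<cdot>\<^bsub>C\<^esub> p) (j \<cdot>\<^bsub>C\<^esub> q) = Idm C s"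

locale abelian_tensor_category = monoidal_category C
  for C :: "('o, 'm, 'z) ab_mon_cat_scheme" (structure) +
  assumes hom_comm_group: "\<lbrakk>a \<in> Obj C; b \<in> Obj C\<rbrakk> \<Longrightarrow> comm_group (hom_group C a b)"
    and comp_add_left: "\<lbrakk>a \<in> Obj C; b \<in> Obj C; c \<in> Obj C;
        f \<in> Hom C a b; g \<in> Hom C b c; g' \<in> Hom C b c\<rbrakk>
      \<Longrightarrow> Plus C g g' \<cdot> f = Plus C (g \<cdot> f) (g' \<cdot> f)"
    and comp_add_right: "\<lbrakk>a \<in> Obj C; b \<in> Obj C; c \<in> Obj C;
        f \<in> Hom C a b; f' \<in> Hom C a b; g \<in> Hom C b c\<rbrakk>
      \<Longrightarrow> g \<cdot> Plus C f f' = Plus C (g \<cdot> f) (g \<cdot> f')"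
    and zero_object: "\<exists>z\<in>Obj C. Idm C z = Zero C z z"
    and biproducts: "\<lbrakk>a \<in> Obj C; b \<in> Obj C\<rbrakk> \<Longrightarrow> \<exists>s i j p q. is_biproduct C a b s i j p q"
    and kernels: "\<lbrakk>a \<in> Obj C; b \<in> Obj C; f \<in> Hom C a b\<rbrakk> \<Longrightarrow> \<exists>k i. is_kernel C a b f k i"
    and cokernels: "\<lbrakk>a \<in> Obj C; b \<in> Obj C; f \<in> Hom C a b\<rbrakk> \<Longrightarrow> \<exists>c q. is_cokernel C a b f c q"
    and mono_normal: "\<lbrakk>a \<in> Obj C; b \<in> Obj C; is_mono C a b f\<rbrakk>
      \<Longrightarrow> \<exists>c\<in>Obj C. \<exists>g\<in>Hom C b c. is_kernel C b c g a f"
    and epi_normal: "\<lbrakk>a \<in> Obj C; b \<in> Obj C; is_epi C a b f\<rbrakk>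
      \<Longrightarrow> \<exists>c\<in>Obj C. \<exists>g\<in>Hom C c a. is_cokernel C c a g b f"
    and tens_add_left: "\<lbrakk>a \<in> Obj C; b \<in> Obj C; c \<in> Obj C; d \<in> Obj C;
        f \<in> Hom C a b; f' \<in> Hom C a b; g \<in> Hom C c d\<rbrakk>
      \<Longrightarrow> TensM C (Plus C f f') g = Plus C (TensM C f g) (TensM C f' g)"
    and tens_add_right: "\<lbrakk>a \<in> Obj C; b \<in> Obj C; c \<in> Obj C; d \<in> Obj C;
        f \<in> Hom C a b; g \<in> Hom C c d; g' \<in> Hom C c d\<rbrakk>
      \<Longrightarrow> TensM C f (Plus C g g') = Plus C (TensM C f g) (TensM C f g')"


section \<open>The simplex category\<close>

text \<open>A map \<open>\<alpha> : {0,\<dots>,m} \<rightarrow> {0,\<dots>,n}\<close> is encoded by the list \<open>[\<alpha> 0, \<dots>, \<alpha> m]\<close> of its values.\<close>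

definition Simp :: "(nat, nat list) cat" where
  "Simp =
    \<lparr>Obj = UNIV,
     Hom = (\<lambda>m n. {\<alpha>. length \<alpha> = Suc m \<and> sorted \<alpha> \<and> set \<alpha> \<subseteq> {..n}}),
     Idm = (\<lambda>n. [0..<Suc n]),
     Cmp = (\<lambda>\<beta> \<alpha>. map ((!) \<beta>) \<alpha>)\<rparr>"

abbreviation Simp_op :: "(nat, nat list) cat" where
  "Simp_op \<equiv> op_cat Simp"

type_synonym ('o, 'm) sobj = "(nat, nat list, 'o, 'm) ftor"
type_synonym ('o, 'm) multi_sobj = "(nat list, nat list list, 'o, 'm) ftor"

text \<open>Concatenation: \<open>[n\<^sub>1] \<star> \<dots> \<star> [n\<^sub>k] = [conc ns]\<close> for \<open>k \<ge> 1\<close>.  In \<open>join ms \<alpha>s\<close>, \<open>ms\<close> are the codomains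
  of the maps \<open>\<alpha>s\<close>.  The subset \<open>[n\<^sub>i]\<close> of \<open>[conc ns]\<close> is the image of \<open>incl ns i\<close>.\<close>

definition conc :: "nat list \<Rightarrow> nat" where
  "conc ns = sum_list (map Suc ns) - 1"

fun join :: "nat list \<Rightarrow> nat list list \<Rightarrow> nat list" where
  "join (m # ms) (\<alpha> # \<alpha>s) = \<alpha> @ map ((+) (Suc m)) (join ms \<alpha>s)"
| "join _ _ = []"

definition incl :: "nat list \<Rightarrow> nat \<Rightarrow> nat list" where
  "incl ns i = (let s = sum_list (map Suc (take i ns)) in [s..<s + Suc (ns ! i)])"

text \<open>\<open>\<delta>\<^sub>k\<close>, \<open>dec\<^sub>k\<close> (\<open>k \<ge> 1\<close>) and \<open>[a] \<star> -\<close>.  An arrow \<open>ms \<rightarrow> ns\<close> of \<open>(\<Delta>\<^sup>o\<^sup>p)\<^sup>k\<close> is a tuple of maps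
  \<open>[n\<^sub>i] \<rightarrow> [m\<^sub>i]\<close>.\<close>

definition diag :: "nat \<Rightarrow> (nat, nat list, nat list, nat list list) ftor" where
  "diag k = \<lparr>Fo = replicate k, Fm = (\<lambda>m n. replicate k)\<rparr>"

definition dec :: "(nat list, nat list list, nat, nat list) ftor" where
  "dec = \<lparr>Fo = conc, Fm = (\<lambda>ms ns. join ms)\<rparr>"

definition shift :: "nat \<Rightarrow> (nat, nat list, nat, nat list) ftor" where
  "shift a = \<lparr>Fo = (\<lambda>n. conc [a, n]), Fm = (\<lambda>m n \<alpha>. join [a, m] [Idm Simp a, \<alpha>])\<rparr>"


section \<open>The monoidal category of simplicial objects with the point-wise product\<close>

definition box :: "('o, 'm, 'z) mon_cat_scheme \<Rightarrow> ('o, 'm) sobj list \<Rightarrow> ('o, 'm) multi_sobj" where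
  "box C Ys =
    \<lparr>Fo = (\<lambda>ns. tensO C (map2 Fo Ys ns)),
     Fm = (\<lambda>ms ns \<alpha>s.
       tensM C (map (\<lambda>i. Fm (Ys ! i) (ms ! i) (ns ! i) (\<alpha>s ! i)) [0..<length Ys]))\<rparr>"

definition box_map :: "('o, 'm, 'z) mon_cat_scheme \<Rightarrow> (nat \<Rightarrow> 'm) list \<Rightarrow> nat list \<Rightarrow> 'm" where
  "box_map C gs ns = tensM C (map2 (\<lambda>g n. g n) gs ns)"

definition Sim :: "('o, 'm, 'z) mon_cat_scheme \<Rightarrow> (('o, 'm) sobj, nat \<Rightarrow> 'm) mon_cat" where
  "Sim C =
    \<lparr>Obj = {X. is_functor Simp_op C X},
     Hom = (\<lambda>X Y. {\<eta>. is_nat_trans Simp_op C X Y \<eta>}),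
     Idm = (\<lambda>X n. Idm C (Fo X n)),
     Cmp = (\<lambda>g f n. g n \<cdot>\<^bsub>C\<^esub> f n),
     TensO = (\<lambda>X Y. restr (box C [X, Y]) (diag 2)),
     TensM = (\<lambda>f g n. TensM C (f n) (g n)),
     TUnit = \<lparr>Fo = (\<lambda>n. TUnit C), Fm = (\<lambda>m n \<alpha>. Idm C (TUnit C))\<rparr>,
     Assoc = (\<lambda>X Y Z n. Assoc C (Fo X n) (Fo Y n) (Fo Z n)),
     LUnit = (\<lambda>X n. LUnit C (Fo X n)),
     RUnit = (\<lambda>X n. RUnit C (Fo X n))\<rparr>"


section \<open>The right adjoint of \<open>dec\<^sub>k\<^sup>*\<close>\<close>

text \<open>The pair of \<open>dec\<^sub>k\<^sub>,\<^sub>* Z\<close> and the counit \<open>dec\<^sub>k\<^sup>* dec\<^sub>k\<^sub>,\<^sub>* Z \<rightarrow> Z\<close>.  For \<open>k = 1\<close> we have \<open>dec\<^sub>1 = id\<close> and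
  take \<open>dec\<^sub>1\<^sub>,\<^sub>* = id\<close>; for \<open>k = 0\<close>, where the empty concatenation is not an object of \<open>\<Delta>\<close>, the value is
  by convention the constant simplicial object (the family of identities is then a dummy).\<close>

definition dec_lower ::
  "('o, 'm, 'z) cat_scheme \<Rightarrow> nat \<Rightarrow> ('o, 'm) multi_sobj \<Rightarrow> ('o, 'm) sobj \<times> (nat list \<Rightarrow> 'm)" where
  "dec_lower C k Z =
    (if k \<le> 1 then (restr Z (diag k), \<lambda>ns. Idm C (Fo Z ns))
     else (SOME (D, \<epsilon>). is_right_adjoint_value (pow_cat k Simp_op) Simp_op C dec Z D \<epsilon>))"

abbreviation dec_obj where "dec_obj C k Z \<equiv> fst (dec_lower C k Z)"
abbreviation dec_counit where "dec_counit C k Z \<equiv> snd (dec_lower C k Z)"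

definition dec_map ::
  "('o, 'm, 'z) mon_cat_scheme \<Rightarrow> nat \<Rightarrow> ('o, 'm) multi_sobj \<Rightarrow> ('o, 'm) multi_sobj \<Rightarrow>
   (nat list \<Rightarrow> 'm) \<Rightarrow> nat \<Rightarrow> 'm" where
  "dec_map C k Z Z' \<psi> =
    (if k = 0 then (\<lambda>n. \<psi> [])
     else (THE \<phi>. \<phi> \<in> Hom (Sim C) (dec_obj C k Z) (dec_obj C k Z') \<and>
            (\<forall>ns. length ns = k \<longrightarrow>
               dec_counit C k Z' ns \<cdot>\<^bsub>C\<^esub> \<phi> (conc ns) = \<psi> ns \<cdot>\<^bsub>C\<^esub> dec_counit C k Z ns)))"

text \<open>For \<open>\<alpha> : [n\<^sub>1] \<star> \<dots> \<star> [n\<^sub>k] \<rightarrow> [m]\<close> the projection of \<open>(dec\<^sub>k\<^sub>,\<^sub>* Z)\<close> at \<open>[m]\<close> to \<open>Z\<close> at \<open>ns\<close>.  For \<open>k = 0\<close> the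
  empty map \<open>\<alpha> = []\<close> gives the identity.\<close>

definition dec_proj ::
  "('o, 'm, 'z) cat_scheme \<Rightarrow> nat \<Rightarrow> ('o, 'm) multi_sobj \<Rightarrow> nat \<Rightarrow> nat list \<Rightarrow> nat list \<Rightarrow> 'm" where
  "dec_proj C k Z m ns \<alpha> =
    (if k = 0 then Idm C (Fo Z [])
     else dec_counit C k Z ns \<cdot>\<^bsub>C\<^esub> Fm (dec_obj C k Z) m (conc ns) \<alpha>)"


section \<open>The Alexander-Whitney map\<close>

definition Aw :: "('o, 'm, 'z) mon_cat_scheme \<Rightarrow> nat \<Rightarrow> ('o, 'm) multi_sobj \<Rightarrow> nat \<Rightarrow> 'm" where
  "Aw C k Z =
    (if k = 0 then (\<lambda>n. Idm C (Fo Z []))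
     else (THE \<phi>. \<phi> \<in> Hom (Sim C) (restr Z (diag k)) (dec_obj C k Z) \<and>
            (\<forall>ns. length ns = k \<longrightarrow>
               dec_counit C k Z ns \<cdot>\<^bsub>C\<^esub> \<phi> (conc ns) =
               Fm Z (replicate k (conc ns)) ns (map (incl ns) [0..<k]))))"


section \<open>Extension of simplicial objects to non-empty finite sets\<close>

text \<open>The normalized complex of \<open>X\<close>, with \<open>N\<^sub>j\<close> the quotient of \<open>X\<^sub>j\<close> by all degeneracies.\<close>

definition face :: "nat \<Rightarrow> nat \<Rightarrow> nat list" where
  "face j i = [0..<i] @ [Suc i..<Suc j]"  \<comment> \<open>\<open>[j - 1] \<rightarrow> [j]\<close>, omitting \<open>i \<le> j\<close>\<close>

definition degen :: "nat \<Rightarrow> nat \<Rightarrow> nat list" where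
  "degen j i = [0..<Suc i] @ [i..<j]"  \<comment> \<open>\<open>[j] \<rightarrow> [j - 1]\<close>, taking the value \<open>i < j\<close> twice\<close>

definition is_norm_quotient ::
  "('o, 'm, 'z) ab_mon_cat_scheme \<Rightarrow> ('o, 'm) sobj \<Rightarrow> nat \<Rightarrow> 'o \<Rightarrow> 'm \<Rightarrow> bool" where
  "is_norm_quotient C X j N q \<longleftrightarrow> N \<in> Obj C \<and> q \<in> Hom C (Fo X j) N \<and>
     (\<forall>i<j. q \<cdot>\<^bsub>C\<^esub> Fm X (j - 1) j (degen j i) = Zero C (Fo X (j - 1)) N) \<and>
     (\<forall>b\<in>Obj C. \<forall>f\<in>Hom C (Fo X j) b.
        (\<forall>i<j. f \<cdot>\<^bsub>C\<^esub> Fm X (j - 1) j (degen j i) = Zero C (Fo X (j - 1)) b) \<longrightarrow>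
        (\<exists>!h. h \<in> Hom C N b \<and> h \<cdot>\<^bsub>C\<^esub> q = f))"

definition norm_quotient ::
  "('o, 'm, 'z) ab_mon_cat_scheme \<Rightarrow> ('o, 'm) sobj \<Rightarrow> nat \<Rightarrow> 'o \<times> 'm" where
  "norm_quotient C X j = (SOME (N, q). is_norm_quotient C X j N q)"

abbreviation norm_obj where "norm_obj C X j \<equiv> fst (norm_quotient C X j)"
abbreviation norm_proj where "norm_proj C X j \<equiv> snd (norm_quotient C X j)"

definition alt_sum ::
  "('o, 'm, 'z) ab_mon_cat_scheme \<Rightarrow> 'o \<Rightarrow> 'o \<Rightarrow> (nat \<Rightarrow> 'm) \<Rightarrow> nat \<Rightarrow> 'm" where
  "alt_sum C a b f j =
    finprod (hom_group C a b) (\<lambda>i. f i [^]\<^bsub>hom_group C a b\<^esub> ((- 1 :: int) ^ i)) {..j}"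

definition norm_diff :: "('o, 'm, 'z) ab_mon_cat_scheme \<Rightarrow> ('o, 'm) sobj \<Rightarrow> nat \<Rightarrow> 'm" where
  "norm_diff C X j =
    (THE d. d \<in> Hom C (norm_obj C X j) (norm_obj C X (j - 1)) \<and>
       d \<cdot>\<^bsub>C\<^esub> norm_proj C X j =
       norm_proj C X (j - 1) \<cdot>\<^bsub>C\<^esub>
         alt_sum C (Fo X j) (Fo X (j - 1)) (\<lambda>i. Fm X j (j - 1) (face j i)) j)"

text \<open>The complex \<open>\<Delta>\<^sup>o\<^sub>n\<close> has basis \<open>[S]\<close>, \<open>S \<subseteq> {0,\<dots>,n}\<close> non-empty, in degree \<open>card S - 1\<close>, with differential
  \<open>[S] \<mapsto> \<Sum>\<^sub>i (-1)\<^sup>i [S - {s\<^sub>i}]\<close> where \<open>S = {s\<^sub>0 < s\<^sub>1 < \<dots>}\<close>.  A chain map from it to the complex of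
  abelian groups \<open>Hom(A, N X)\<close> is given by its values \<open>p S\<close> on the basis.\<close>

definition nonempty_subsets :: "nat \<Rightarrow> nat set set" where
  "nonempty_subsets n = {S. S \<noteq> {} \<and> S \<subseteq> {..n}}"

definition is_chain_map ::
  "('o, 'm, 'z) ab_mon_cat_scheme \<Rightarrow> ('o, 'm) sobj \<Rightarrow> nat \<Rightarrow> 'o \<Rightarrow> (nat set \<Rightarrow> 'm) \<Rightarrow> bool" where
  "is_chain_map C X n A p \<longleftrightarrow>
     (\<forall>S\<in>nonempty_subsets n. p S \<in> Hom C A (norm_obj C X (card S - 1))) \<and>
     (\<forall>S\<in>nonempty_subsets n. 2 \<le> card S \<longrightarrow>
        norm_diff C X (card S - 1) \<cdot>\<^bsub>C\<^esub> p S =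
        alt_sum C A (norm_obj C X (card S - 2))
          (\<lambda>i. p (S - {sorted_list_of_set S ! i})) (card S - 1))"

text \<open>\<open>(H, p)\<close> is the object \<open>Hom(\<Delta>\<^sup>o\<^sub>n, X)\<close> of \<open>C\<close> with its universal chain map.\<close>

definition is_hom_complex ::
  "('o, 'm, 'z) ab_mon_cat_scheme \<Rightarrow> ('o, 'm) sobj \<Rightarrow> nat \<Rightarrow> 'o \<Rightarrow> (nat set \<Rightarrow> 'm) \<Rightarrow> bool" where
  "is_hom_complex C X n H p \<longleftrightarrow> H \<in> Obj C \<and> is_chain_map C X n H p \<and>
     (\<forall>A\<in>Obj C. \<forall>r. is_chain_map C X n A r \<longrightarrow>
        (\<exists>!h. h \<in> Hom C A H \<and> (\<forall>S\<in>nonempty_subsets n. p S \<cdot>\<^bsub>C\<^esub> h = r S)))"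

definition hom_complex ::
  "('o, 'm, 'z) ab_mon_cat_scheme \<Rightarrow> ('o, 'm) sobj \<Rightarrow> nat \<Rightarrow> 'o \<times> (nat set \<Rightarrow> 'm)" where
  "hom_complex C X n = (SOME (H, p). is_hom_complex C X n H p)"

text \<open>For \<open>\<sigma>\<close> injective on \<open>S = {s\<^sub>0 < s\<^sub>1 < \<dots>}\<close>, the permutation sending \<open>i\<close> to the position of \<open>\<sigma> s\<^sub>i\<close> in the
  ordered set \<open>\<sigma> S\<close>.\<close>

definition induced_perm :: "nat list \<Rightarrow> nat set \<Rightarrow> nat \<Rightarrow> nat" where
  "induced_perm \<sigma> S i =
    (if i < card S then card {t \<in> S. \<sigma> ! t < \<sigma> ! (sorted_list_of_set S ! i)} else i)"

text \<open>The functor \<open>\<CC>(X)\<close> on the opposite of the category of finite sets, restricted to its skeleton of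
  the sets \<open>{0,\<dots>,n}\<close>; arbitrary maps \<open>\<sigma> : {0,\<dots>,m} \<rightarrow> {0,\<dots>,n}\<close> are again lists of values.\<close>

definition fin_ext :: "('o, 'm, 'z) ab_mon_cat_scheme \<Rightarrow> ('o, 'm) sobj \<Rightarrow> ('o, 'm) sobj" where
  "fin_ext C X =
    \<lparr>Fo = (\<lambda>n. fst (hom_complex C X n)),
     Fm = (\<lambda>n m \<sigma>. THE h. h \<in> Hom C (fst (hom_complex C X n)) (fst (hom_complex C X m)) \<and>
       (\<forall>S\<in>nonempty_subsets m. snd (hom_complex C X m) S \<cdot>\<^bsub>C\<^esub> h =
          (let G = hom_group C (fst (hom_complex C X n)) (norm_obj C X (card S - 1)) in
           if inj_on ((!) \<sigma>) S
           then snd (hom_complex C X n) ((!) \<sigma> ` S) [^]\<^bsub>G\<^esub> (sign (induced_perm \<sigma> S) :: int)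
           else \<one>\<^bsub>G\<^esub>)))\<rparr>"

text \<open>The canonical isomorphism \<open>X \<rightarrow> \<iota>\<^sup>* \<CC>(X)\<close>: the simplex \<open>S \<subseteq> {0,\<dots>,n}\<close> acts by restriction to \<open>S\<close>.\<close>

definition fin_ext_can :: "('o, 'm, 'z) ab_mon_cat_scheme \<Rightarrow> ('o, 'm) sobj \<Rightarrow> nat \<Rightarrow> 'm" where
  "fin_ext_can C X n =
    (THE h. h \<in> Hom C (Fo X n) (Fo (fin_ext C X) n) \<and>
       (\<forall>S\<in>nonempty_subsets n. snd (hom_complex C X n) S \<cdot>\<^bsub>C\<^esub> h =
          norm_proj C X (card S - 1) \<cdot>\<^bsub>C\<^esub> Fm X n (card S - 1) (sorted_list_of_set S)))"


section \<open>The Eilenberg-Zilber map\<close>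

definition fold_map :: "nat \<Rightarrow> nat \<Rightarrow> nat list" where
  "fold_map k n = concat (replicate k [0..<Suc n])"  \<comment> \<open>\<open>[n] \<star> \<dots> \<star> [n] \<rightarrow> [n]\<close>, \<open>k\<close> copies\<close>

text \<open>The component \<open>X\<^sub>n \<rightarrow> X\<^sub>n\<^sub>\<star>\<^sub>\<dots>\<^sub>\<star>\<^sub>n\<close> of \<open>\<gamma> : id \<rightarrow> \<delta>\<^sub>k\<^sup>* dec\<^sub>k\<^sup>*\<close> (\<open>k \<ge> 1\<close>).\<close>

definition gam ::
  "('o, 'm, 'z) ab_mon_cat_scheme \<Rightarrow> nat \<Rightarrow> ('o, 'm) sobj \<Rightarrow> nat \<Rightarrow> 'm" where
  "gam C k X n =
    (let N = conc (replicate k n) in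
     inv_mor C (Fo X N) (Fo (fin_ext C X) N) (fin_ext_can C X N) \<cdot>\<^bsub>C\<^esub>
       Fm (fin_ext C X) n N (fold_map k n) \<cdot>\<^bsub>C\<^esub> fin_ext_can C X n)"

definition Ez :: "('o, 'm, 'z) ab_mon_cat_scheme \<Rightarrow> nat \<Rightarrow> ('o, 'm) multi_sobj \<Rightarrow> nat \<Rightarrow> 'm" where
  "Ez C k Z n =
    (if k = 0 then Idm C (Fo Z [])
     else dec_counit C k Z (replicate k n) \<cdot>\<^bsub>C\<^esub> gam C k (dec_obj C k Z) n)"


section \<open>Copowers and simplicial tensors\<close>

definition is_copower ::
  "('o, 'm, 'z) cat_scheme \<Rightarrow> 'k set \<Rightarrow> 'o \<Rightarrow> 'o \<Rightarrow> ('k \<Rightarrow> 'm) \<Rightarrow> bool" where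
  "is_copower C I a s \<iota> \<longleftrightarrow> s \<in> Obj C \<and> (\<forall>i\<in>I. \<iota> i \<in> Hom C a s) \<and>
     (\<forall>b\<in>Obj C. \<forall>f. (\<forall>i\<in>I. f i \<in> Hom C a b) \<longrightarrow>
        (\<exists>!h. h \<in> Hom C s b \<and> (\<forall>i\<in>I. h \<cdot>\<^bsub>C\<^esub> \<iota> i = f i)))"

definition copower :: "('o, 'm, 'z) cat_scheme \<Rightarrow> 'k set \<Rightarrow> 'o \<Rightarrow> 'o \<times> ('k \<Rightarrow> 'm)" where
  "copower C I a = (SOME (s, \<iota>). is_copower C I a s \<iota>)"

definition copower_desc ::
  "('o, 'm, 'z) cat_scheme \<Rightarrow> 'k set \<Rightarrow> 'o \<Rightarrow> 'o \<Rightarrow> ('k \<Rightarrow> 'm) \<Rightarrow> 'm" where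
  "copower_desc C I a b f =
    (THE h. h \<in> Hom C (fst (copower C I a)) b \<and> (\<forall>i\<in>I. h \<cdot>\<^bsub>C\<^esub> snd (copower C I a) i = f i))"

type_synonym 'k sset = "(nat, nat list, 'k set, 'k \<Rightarrow> 'k) ftor"

definition Delta1 :: "nat list sset" where
  "Delta1 = \<lparr>Fo = (\<lambda>n. Hom Simp n 1), Fm = (\<lambda>n m \<alpha> \<phi>. \<phi> \<cdot>\<^bsub>Simp\<^esub> \<alpha>)\<rparr>"

definition sset_pow :: "nat \<Rightarrow> 'k sset \<Rightarrow> 'k list sset" where
  "sset_pow k K =
    \<lparr>Fo = (\<lambda>n. {\<kappa>s. length \<kappa>s = k \<and> set \<kappa>s \<subseteq> Fo K n}), Fm = (\<lambda>n m \<alpha>. map (Fm K n m \<alpha>))\<rparr>"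

text \<open>\<open>K \<otimes> X\<close>, its coprojections, and the morphism out of \<open>K \<otimes> X\<close> with components \<open>h n \<kappa> : X\<^sub>n \<rightarrow> Y\<^sub>n\<close>.\<close>

definition sten :: "('o, 'm, 'z) cat_scheme \<Rightarrow> 'k sset \<Rightarrow> ('o, 'm) sobj \<Rightarrow> ('o, 'm) sobj" where
  "sten C K X =
    \<lparr>Fo = (\<lambda>n. fst (copower C (Fo K n) (Fo X n))),
     Fm = (\<lambda>n m \<alpha>. copower_desc C (Fo K n) (Fo X n) (fst (copower C (Fo K m) (Fo X m)))
       (\<lambda>\<kappa>. snd (copower C (Fo K m) (Fo X m)) (Fm K n m \<alpha> \<kappa>) \<cdot>\<^bsub>C\<^esub> Fm X n m \<alpha>))\<rparr>"

definition sten_in :: "('o, 'm, 'z) cat_scheme \<Rightarrow> 'k sset \<Rightarrow> ('o, 'm) sobj \<Rightarrow> nat \<Rightarrow> 'k \<Rightarrow> 'm" where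
  "sten_in C K X n = snd (copower C (Fo K n) (Fo X n))"

definition sten_desc ::
  "('o, 'm, 'z) cat_scheme \<Rightarrow> 'k sset \<Rightarrow> ('o, 'm) sobj \<Rightarrow> ('o, 'm) sobj \<Rightarrow>
   (nat \<Rightarrow> 'k \<Rightarrow> 'm) \<Rightarrow> nat \<Rightarrow> 'm" where
  "sten_desc C K X Y h n = copower_desc C (Fo K n) (Fo X n) (Fo Y n) (h n)"

definition sten_pr :: "('o, 'm, 'z) cat_scheme \<Rightarrow> 'k sset \<Rightarrow> ('o, 'm) sobj \<Rightarrow> nat \<Rightarrow> 'm" where
  "sten_pr C K X = sten_desc C K X X (\<lambda>n \<kappa>. Idm C (Fo X n))"

definition sten_map ::
  "('o, 'm, 'z) cat_scheme \<Rightarrow> 'k sset \<Rightarrow> ('o, 'm) sobj \<Rightarrow> ('o, 'm) sobj \<Rightarrow>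
   (nat \<Rightarrow> 'm) \<Rightarrow> nat \<Rightarrow> 'm" where
  "sten_map C K X Y f = sten_desc C K X (sten C K Y) (\<lambda>n \<kappa>. sten_in C K Y n \<kappa> \<cdot>\<^bsub>C\<^esub> f n)"

text \<open>The diagonal \<open>K \<rightarrow> K\<^sup>k\<^sup>+\<^sup>1\<close>, as \<open>K \<otimes> X \<rightarrow> K\<^sup>k \<otimes> (K \<otimes> X)\<close> and as \<open>K \<otimes> X \<rightarrow> K \<otimes> (K\<^sup>k \<otimes> X)\<close>.\<close>

definition sten_diag ::
  "('o, 'm, 'z) cat_scheme \<Rightarrow> nat \<Rightarrow> 'k sset \<Rightarrow> ('o, 'm) sobj \<Rightarrow> nat \<Rightarrow> 'm" where
  "sten_diag C k K X = sten_desc C K X (sten C (sset_pow k K) (sten C K X))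
    (\<lambda>n \<kappa>. sten_in C (sset_pow k K) (sten C K X) n (replicate k \<kappa>) \<cdot>\<^bsub>C\<^esub> sten_in C K X n \<kappa>)"

definition sten_diag' ::
  "('o, 'm, 'z) cat_scheme \<Rightarrow> nat \<Rightarrow> 'k sset \<Rightarrow> ('o, 'm) sobj \<Rightarrow> nat \<Rightarrow> 'm" where
  "sten_diag' C k K X = sten_desc C K X (sten C K (sten C (sset_pow k K) X))
    (\<lambda>n \<kappa>. sten_in C K (sten C (sset_pow k K) X) n \<kappa> \<cdot>\<^bsub>C\<^esub>
            sten_in C (sset_pow k K) X n (replicate k \<kappa>))"

text \<open>\<open>K\<^sup>k \<otimes> (Y\<^sub>1 \<otimes> \<dots> \<otimes> Y\<^sub>k) \<rightarrow> (K \<otimes> Y\<^sub>1) \<otimes> \<dots> \<otimes> (K \<otimes> Y\<^sub>k)\<close>\<close>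

definition sten_distr ::
  "('o, 'm, 'z) mon_cat_scheme \<Rightarrow> 'k sset \<Rightarrow> ('o, 'm) sobj list \<Rightarrow> nat \<Rightarrow> 'm" where
  "sten_distr C K Ys =
    sten_desc C (sset_pow (length Ys) K) (tensO (Sim C) Ys) (tensO (Sim C) (map (sten C K) Ys))
      (\<lambda>n \<kappa>s. tensM C (map2 (\<lambda>Y \<kappa>. sten_in C K Y n \<kappa>) Ys \<kappa>s))"


section \<open>Planar cooperads and operads\<close>

text \<open>In \<open>CCmp P X Ys Zss f gs\<close>, \<open>f : X \<rightarrow> Y\<^sub>1, \<dots>, Y\<^sub>k\<close> and \<open>gs ! i : Ys ! i \<rightarrow> Zss ! i\<close>; dually in
  \<open>OCmp P Xss Ys Z gs f\<close>.\<close>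

record ('x, 'm) cooperad =
  CObj :: "'x set"
  CMor :: "'x \<Rightarrow> 'x list \<Rightarrow> 'm set"
  CId :: "'x \<Rightarrow> 'm"
  CCmp :: "'x \<Rightarrow> 'x list \<Rightarrow> 'x list list \<Rightarrow> 'm \<Rightarrow> 'm list \<Rightarrow> 'm"

record ('x, 'm) operad =
  OObj :: "'x set"
  OMor :: "'x list \<Rightarrow> 'x \<Rightarrow> 'm set"
  OId :: "'x \<Rightarrow> 'm"
  OCmp :: "'x list list \<Rightarrow> 'x list \<Rightarrow> 'x \<Rightarrow> 'm list \<Rightarrow> 'm \<Rightarrow> 'm"

definition composable_coop ::
  "('x, 'm) cooperad \<Rightarrow> 'x \<Rightarrow> 'x list \<Rightarrow> 'x list list \<Rightarrow> 'm \<Rightarrow> 'm list \<Rightarrow> bool" where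
  "composable_coop P X Ys Zss f gs \<longleftrightarrow>
     X \<in> CObj P \<and> set Ys \<subseteq> CObj P \<and> set (concat Zss) \<subseteq> CObj P \<and> f \<in> CMor P X Ys \<and>
     length Zss = length Ys \<and> length gs = length Ys \<and>
     (\<forall>i<length Ys. gs ! i \<in> CMor P (Ys ! i) (Zss ! i))"

definition composable_op ::
  "('x, 'm) operad \<Rightarrow> 'x list list \<Rightarrow> 'x list \<Rightarrow> 'x \<Rightarrow> 'm list \<Rightarrow> 'm \<Rightarrow> bool" where
  "composable_op P Xss Ys Z gs f \<longleftrightarrow>
     Z \<in> OObj P \<and> set Ys \<subseteq> OObj P \<and> set (concat Xss) \<subseteq> OObj P \<and> f \<in> OMor P Ys Z \<and>
     length Xss = length Ys \<and> length gs = length Ys \<and>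
     (\<forall>i<length Ys. gs ! i \<in> OMor P (Xss ! i) (Ys ! i))"

record ('x, 'm, 'x2, 'm2) coop_map =
  cmo :: "'x \<Rightarrow> 'x2"
  cmm :: "'x \<Rightarrow> 'x list \<Rightarrow> 'm \<Rightarrow> 'm2"

definition is_coop_functor ::
  "('x, 'm) cooperad \<Rightarrow> ('x2, 'm2) cooperad \<Rightarrow> ('x, 'm, 'x2, 'm2) coop_map \<Rightarrow> bool" where
  "is_coop_functor P Q F \<longleftrightarrow>
     (\<forall>X\<in>CObj P. cmo F X \<in> CObj Q) \<and>
     (\<forall>X\<in>CObj P. \<forall>Ys. set Ys \<subseteq> CObj P \<longrightarrow>
        (\<forall>f\<in>CMor P X Ys. cmm F X Ys f \<in> CMor Q (cmo F X) (map (cmo F) Ys))) \<and>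
     (\<forall>X\<in>CObj P. cmm F X [X] (CId P X) = CId Q (cmo F X)) \<and>
     (\<forall>X Ys Zss f gs. composable_coop P X Ys Zss f gs \<longrightarrow>
        cmm F X (concat Zss) (CCmp P X Ys Zss f gs) =
        CCmp Q (cmo F X) (map (cmo F) Ys) (map (map (cmo F)) Zss) (cmm F X Ys f)
          (map (\<lambda>i. cmm F (Ys ! i) (Zss ! i) (gs ! i)) [0..<length Ys]))"

definition coop_id :: "('x, 'm, 'x, 'm) coop_map" where
  "coop_id = \<lparr>cmo = (\<lambda>X. X), cmm = (\<lambda>X Ys f. f)\<rparr>"

definition coop_comp ::
  "('x2, 'm2, 'x3, 'm3) coop_map \<Rightarrow> ('x, 'm, 'x2, 'm2) coop_map \<Rightarrow> ('x, 'm, 'x3, 'm3) coop_map" where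
  "coop_comp G F =
    \<lparr>cmo = (\<lambda>X. cmo G (cmo F X)),
     cmm = (\<lambda>X Ys f. cmm G (cmo F X) (map (cmo F) Ys) (cmm F X Ys f))\<rparr>"

definition coop_map_eq ::
  "('x, 'm) cooperad \<Rightarrow> ('x, 'm, 'x2, 'm2) coop_map \<Rightarrow> ('x, 'm, 'x2, 'm2) coop_map \<Rightarrow> bool" where
  "coop_map_eq P F G \<longleftrightarrow>
     (\<forall>X\<in>CObj P. cmo F X = cmo G X) \<and>
     (\<forall>X\<in>CObj P. \<forall>Ys. set Ys \<subseteq> CObj P \<longrightarrow> (\<forall>f\<in>CMor P X Ys. cmm F X Ys f = cmm G X Ys f))"

text \<open>The cooperad \<open>M\<^sup>\<or>\<close> and the operad \<open>M\<close> of a monoidal category \<open>M\<close>.\<close>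

definition coop_of :: "('x, 'm, 'z) mon_cat_scheme \<Rightarrow> ('x, 'm) cooperad" where
  "coop_of M =
    \<lparr>CObj = Obj M,
     CMor = (\<lambda>X Ys. Hom M X (tensO M Ys)),
     CId = Idm M,
     CCmp = (\<lambda>X Ys Zss f gs. tens_flat M Zss \<cdot>\<^bsub>M\<^esub> tensM M gs \<cdot>\<^bsub>M\<^esub> f)\<rparr>"

text \<open>The inverse of the coherence isomorphism \<open>\<Otimes>\<^sub>i (\<Otimes>(xss ! i)) \<rightarrow> \<Otimes>(concat xss)\<close>.\<close>

definition tens_unflat :: "('x, 'm, 'z) mon_cat_scheme \<Rightarrow> 'x list list \<Rightarrow> 'm" where
  "tens_unflat M Xss =
    inv_mor M (tensO M (map (tensO M) Xss)) (tensO M (concat Xss)) (tens_flat M Xss)"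

definition op_of :: "('x, 'm, 'z) mon_cat_scheme \<Rightarrow> ('x, 'm) operad" where
  "op_of M =
    \<lparr>OObj = Obj M,
     OMor = (\<lambda>Xs Y. Hom M (tensO M Xs) Y),
     OId = Idm M,
     OCmp = (\<lambda>Xss Ys Z gs f. f \<cdot>\<^bsub>M\<^esub> tensM M gs \<cdot>\<^bsub>M\<^esub> tens_unflat M Xss)\<rparr>"


section \<open>The cooperad of the product \<open>dec\<^sub>*\<close>\<close>

text \<open>\<open>Y\<^sub>1 \<otimes>~ \<dots> \<otimes>~ Y\<^sub>k = dec\<^sub>k\<^sub>,\<^sub>* (Y\<^sub>1 \<boxtimes> \<dots> \<boxtimes> Y\<^sub>k)\<close>\<close>

definition ttens :: "('o, 'm, 'z) mon_cat_scheme \<Rightarrow> ('o, 'm) sobj list \<Rightarrow> ('o, 'm) sobj" where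
  "ttens C Ys = dec_obj C (length Ys) (box C Ys)"

definition ttens_map ::
  "('o, 'm, 'z) mon_cat_scheme \<Rightarrow> ('o, 'm) sobj list \<Rightarrow> ('o, 'm) sobj list \<Rightarrow>
   (nat \<Rightarrow> 'm) list \<Rightarrow> nat \<Rightarrow> 'm" where
  "ttens_map C Ys Ys' gs = dec_map C (length Ys) (box C Ys) (box C Ys') (box_map C gs)"

abbreviation ttens_proj where
  "ttens_proj C Ys m ns \<alpha> \<equiv> dec_proj C (length Ys) (box C Ys) m ns \<alpha>"

text \<open>The canonical morphism \<open>\<Otimes>~\<^sub>i (\<Otimes>~(Zss ! i)) \<rightarrow> \<Otimes>~(concat Zss)\<close>.  If no list \<open>Zss ! i\<close> is empty it is the
  adjoint of the composite of counits, i.e. it is determined by the condition below with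
  \<open>concat \<beta>s\<close> an identity.  The formulation by all projections also covers empty lists \<open>Zss ! i\<close>
  (factors equal to the constant object \<open>1\<close>): there \<open>\<beta>s ! i\<close> is arbitrary, as \<open>1\<close> is constant, and it is
  dropped on the left hand side.\<close>

definition ttens_flat :: "('o, 'm, 'z) mon_cat_scheme \<Rightarrow> ('o, 'm) sobj list list \<Rightarrow> nat \<Rightarrow> 'm" where
  "ttens_flat C Zss =
    (THE \<phi>. \<phi> \<in> Hom (Sim C) (ttens C (map (ttens C) Zss)) (ttens C (concat Zss)) \<and>
      (\<forall>m mss \<beta>s.
         length mss = length Zss \<and> length \<beta>s = length Zss \<and>
         (\<forall>i<length Zss. length (mss ! i) = length (Zss ! i) \<and> \<beta>s ! i \<noteq> [] \<and>
            (Zss ! i \<noteq> [] \<longrightarrow> length (\<beta>s ! i) = Suc (conc (mss ! i)))) \<and>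
         sorted (concat \<beta>s) \<and> set (concat \<beta>s) \<subseteq> {..m} \<longrightarrow>
         ttens_proj C (concat Zss) m (concat mss)
             (concat (map (\<lambda>i. if Zss ! i = [] then [] else \<beta>s ! i) [0..<length Zss]))
           \<cdot>\<^bsub>C\<^esub> \<phi> m
         = tens_flat C (map2 (map2 Fo) Zss mss)
           \<cdot>\<^bsub>C\<^esub> tensM C (map (\<lambda>i. let b = length (\<beta>s ! i) - 1 in
                  ttens_proj C (Zss ! i) b (mss ! i) (Idm Simp b)) [0..<length Zss])
           \<cdot>\<^bsub>C\<^esub> ttens_proj C (map (ttens C) Zss) m (map (\<lambda>\<beta>. length \<beta> - 1) \<beta>s) (concat \<beta>s)))"

definition tcoop :: "('o, 'm, 'z) mon_cat_scheme \<Rightarrow> (('o, 'm) sobj, nat \<Rightarrow> 'm) cooperad" where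
  "tcoop C =
    \<lparr>CObj = Obj (Sim C),
     CMor = (\<lambda>X Ys. Hom (Sim C) X (ttens C Ys)),
     CId = Idm (Sim C),
     CCmp = (\<lambda>X Ys Zss f gs.
       ttens_flat C Zss \<cdot>\<^bsub>Sim C\<^esub> ttens_map C Ys (map (ttens C) Zss) gs \<cdot>\<^bsub>Sim C\<^esub> f)\<rparr>"

type_synonym ('o, 'm) sim_coop_map =
  "(('o, 'm) sobj, nat \<Rightarrow> 'm, ('o, 'm) sobj, nat \<Rightarrow> 'm) coop_map"

definition AW :: "('o, 'm, 'z) mon_cat_scheme \<Rightarrow> ('o, 'm) sim_coop_map" where
  "AW C = \<lparr>cmo = (\<lambda>X. X), cmm = (\<lambda>X Ys f. Aw C (length Ys) (box C Ys) \<cdot>\<^bsub>Sim C\<^esub> f)\<rparr>"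

definition EZ :: "('o, 'm, 'z) ab_mon_cat_scheme \<Rightarrow> ('o, 'm) sim_coop_map" where
  "EZ C = \<lparr>cmo = (\<lambda>X. X), cmm = (\<lambda>X Ys g. Ez C (length Ys) (box C Ys) \<cdot>\<^bsub>Sim C\<^esub> g)\<rparr>"


section \<open>The Shih operators\<close>

definition EzAw :: "('o, 'm, 'z) ab_mon_cat_scheme \<Rightarrow> nat \<Rightarrow> ('o, 'm) multi_sobj \<Rightarrow> nat \<Rightarrow> 'm" where
  "EzAw C k Z = Ez C k Z \<cdot>\<^bsub>Sim C\<^esub> Aw C k Z"

definition shifted_EzAw ::
  "('o, 'm, 'z) ab_mon_cat_scheme \<Rightarrow> nat \<Rightarrow> ('o, 'm) multi_sobj \<Rightarrow> nat \<Rightarrow> nat \<Rightarrow> 'm" where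
  "shifted_EzAw C k Z a b = EzAw C k (restr Z (pow_ftor k (shift a))) b"

text \<open>The component at \<open>\<phi> : [n] \<rightarrow> [1]\<close>; below \<open>c = i + 1\<close> is the cardinality of the fibre
  \<open>{0,\<dots>,i}\<close> over \<open>0\<close>.\<close>

definition Shih_component ::
  "('o, 'm, 'z) ab_mon_cat_scheme \<Rightarrow> nat \<Rightarrow> ('o, 'm) multi_sobj \<Rightarrow> nat \<Rightarrow> nat list \<Rightarrow> 'm" where
  "Shih_component C k Z n \<phi> =
    (let c = length (filter (\<lambda>x. x = 0) \<phi>) in
     if c = 0 then EzAw C k Z n
     else if c = Suc n then Idm C (Fo Z (replicate k n))
     else shifted_EzAw C k Z (c - 1) (n - c))"

definition Shih :: "('o, 'm, 'z) ab_mon_cat_scheme \<Rightarrow> nat \<Rightarrow> ('o, 'm) multi_sobj \<Rightarrow> nat \<Rightarrow> 'm" where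
  "Shih C k Z =
    sten_desc C Delta1 (restr Z (diag k)) (restr Z (diag k)) (Shih_component C k Z)"


section \<open>Naive deformations of the identity\<close>

text \<open>Deformations of the identity of \<open>(C\<^sup>\<Delta>\<^sup>o\<^sup>p, \<otimes>)\<^sup>\<or>\<close>, parametrized by a simplicial set \<open>K\<close>.  The composite of the
  families \<open>\<mu>\<^sub>f\<close> and \<open>\<mu>\<^sub>g\<^sub>1, \<dots>, \<mu>\<^sub>g\<^sub>k\<close> is
  \<open>K \<otimes> X \<rightarrow> K\<^sup>k \<otimes> (K \<otimes> X) \<rightarrow> K\<^sup>k \<otimes> \<Otimes>\<^sub>i Y\<^sub>i \<rightarrow> \<Otimes>\<^sub>i (K \<otimes> Y\<^sub>i) \<rightarrow> \<Otimes>\<^sub>i \<Otimes>(Zss ! i) \<rightarrow> \<Otimes>(concat Zss)\<close>.\<close>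

definition is_coop_deformation ::
  "('o, 'm, 'z) mon_cat_scheme \<Rightarrow> 'k sset \<Rightarrow>
   (('o, 'm) sobj \<Rightarrow> ('o, 'm) sobj list \<Rightarrow> (nat \<Rightarrow> 'm) \<Rightarrow> nat \<Rightarrow> 'm) \<Rightarrow> bool" where
  "is_coop_deformation C K \<mu> \<longleftrightarrow>
     (let M = Sim C; P = coop_of M in
       (\<forall>X\<in>CObj P. \<forall>Ys. set Ys \<subseteq> CObj P \<longrightarrow>
          (\<forall>f\<in>CMor P X Ys. \<mu> X Ys f \<in> Hom M (sten C K X) (tensO M Ys))) \<and>
       (\<forall>X\<in>CObj P. \<forall>Y\<in>CObj P. \<forall>f\<in>CMor P X [Y]. \<mu> X [Y] f = f \<cdot>\<^bsub>M\<^esub> sten_pr C K X) \<and>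
       (\<forall>X Ys Zss f gs. composable_coop P X Ys Zss f gs \<longrightarrow>
          \<mu> X (concat Zss) (CCmp P X Ys Zss f gs) =
            tens_flat M Zss
            \<cdot>\<^bsub>M\<^esub> tensM M (map (\<lambda>i. \<mu> (Ys ! i) (Zss ! i) (gs ! i)) [0..<length Ys])
            \<cdot>\<^bsub>M\<^esub> sten_distr C K Ys
            \<cdot>\<^bsub>M\<^esub> sten_map C (sset_pow (length Ys) K) (sten C K X) (tensO M Ys) (\<mu> X Ys f)
            \<cdot>\<^bsub>M\<^esub> sten_diag C (length Ys) K X))"

text \<open>Deformations of the identity of the operad \<open>(C\<^sup>\<Delta>\<^sup>o\<^sup>p, \<otimes>)\<close>; the composite is, with
  \<open>W = \<Otimes>\<^sub>i \<Otimes>(Xss ! i)\<close>,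
  \<open>K \<otimes> \<Otimes>(concat Xss) \<rightarrow> K \<otimes> W \<rightarrow> K \<otimes> (K\<^sup>k \<otimes> W) \<rightarrow> K \<otimes> \<Otimes>\<^sub>i (K \<otimes> \<Otimes>(Xss ! i)) \<rightarrow> K \<otimes> \<Otimes>\<^sub>i Y\<^sub>i \<rightarrow> Z\<close>.\<close>

definition is_op_deformation ::
  "('o, 'm, 'z) mon_cat_scheme \<Rightarrow> 'k sset \<Rightarrow>
   (('o, 'm) sobj list \<Rightarrow> ('o, 'm) sobj \<Rightarrow> (nat \<Rightarrow> 'm) \<Rightarrow> nat \<Rightarrow> 'm) \<Rightarrow> bool" where
  "is_op_deformation C K \<mu> \<longleftrightarrow>
     (let M = Sim C; P = op_of M in
       (\<forall>Y\<in>OObj P. \<forall>Xs. set Xs \<subseteq> OObj P \<longrightarrow>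
          (\<forall>f\<in>OMor P Xs Y. \<mu> Xs Y f \<in> Hom M (sten C K (tensO M Xs)) Y)) \<and>
       (\<forall>X\<in>OObj P. \<forall>Y\<in>OObj P. \<forall>f\<in>OMor P [X] Y. \<mu> [X] Y f = f \<cdot>\<^bsub>M\<^esub> sten_pr C K X) \<and>
       (\<forall>Xss Ys Z gs f. composable_op P Xss Ys Z gs f \<longrightarrow>
          \<mu> (concat Xss) Z (OCmp P Xss Ys Z gs f) =
            (let k = length Ys; Vs = map (tensO M) Xss; W = tensO M Vs;
                 KV = tensO M (map (sten C K) Vs) in
             \<mu> Ys Z f
             \<cdot>\<^bsub>M\<^esub> sten_map C K KV (tensO M Ys)
                    (tensM M (map (\<lambda>i. \<mu> (Xss ! i) (Ys ! i) (gs ! i)) [0..<k]))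
             \<cdot>\<^bsub>M\<^esub> sten_map C K (sten C (sset_pow k K) W) KV (sten_distr C K Vs)
             \<cdot>\<^bsub>M\<^esub> sten_diag' C k K W
             \<cdot>\<^bsub>M\<^esub> sten_map C K (tensO M (concat Xss)) W (tens_unflat M Xss))))"

text \<open>Restriction of a \<open>\<Delta>\<^sub>1\<close>-family to the vertex \<open>v\<close> (0 or 1), along \<open>X = \<Delta>\<^sub>0 \<otimes> X \<rightarrow> \<Delta>\<^sub>1 \<otimes> X\<close>.\<close>

definition at_vertex ::
  "('o, 'm, 'z) mon_cat_scheme \<Rightarrow> nat \<Rightarrow>
   (('o, 'm) sobj \<Rightarrow> ('o, 'm) sobj list \<Rightarrow> (nat \<Rightarrow> 'm) \<Rightarrow> nat \<Rightarrow> 'm) \<Rightarrow> ('o, 'm) sim_coop_map" where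
  "at_vertex C v \<mu> =
    \<lparr>cmo = (\<lambda>X. X),
     cmm = (\<lambda>X Ys f. \<mu> X Ys f \<cdot>\<^bsub>Sim C\<^esub> (\<lambda>n. sten_in C Delta1 X n (replicate (Suc n) v)))\<rparr>"

text \<open>\<open>\<mu>\<close> is a homotopy from \<open>F\<close> (vertex 0) to \<open>G\<close> (vertex 1).\<close>

definition is_coop_homotopy ::
  "('o, 'm, 'z) mon_cat_scheme \<Rightarrow>
   (('o, 'm) sobj \<Rightarrow> ('o, 'm) sobj list \<Rightarrow> (nat \<Rightarrow> 'm) \<Rightarrow> nat \<Rightarrow> 'm) \<Rightarrow>
   ('o, 'm) sim_coop_map \<Rightarrow> ('o, 'm) sim_coop_map \<Rightarrow> bool" where
  "is_coop_homotopy C \<mu> F G \<longleftrightarrow>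
     is_coop_deformation C Delta1 \<mu> \<and>
     coop_map_eq (coop_of (Sim C)) (at_vertex C 0 \<mu>) F \<and>
     coop_map_eq (coop_of (Sim C)) (at_vertex C 1 \<mu>) G"

definition Shih_coop ::
  "('o, 'm, 'z) ab_mon_cat_scheme \<Rightarrow> ('o, 'm) sobj \<Rightarrow> ('o, 'm) sobj list \<Rightarrow> (nat \<Rightarrow> 'm) \<Rightarrow> nat \<Rightarrow> 'm"
where
  "Shih_coop C X Ys f =
    Shih C (length Ys) (box C Ys) \<cdot>\<^bsub>Sim C\<^esub> sten_map C Delta1 X (tensO (Sim C) Ys) f"

definition Shih_op ::
  "('o, 'm, 'z) ab_mon_cat_scheme \<Rightarrow> ('o, 'm) sobj list \<Rightarrow> ('o, 'm) sobj \<Rightarrow> (nat \<Rightarrow> 'm) \<Rightarrow> nat \<Rightarrow> 'm"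
where
  "Shih_op C Xs Y f = f \<cdot>\<^bsub>Sim C\<^esub> Shih C (length Xs) (box C Xs)"

end

theory Submission
 imports Defs
begin

text \<open>Let \<open>\<gamma>(s) : X\<^sub>n \<rightarrow> X\<^sub>m\<close> be the action of an arbitrary map \<open>s : {0,\<dots>,m} \<rightarrow> {0,\<dots>,n}\<close> on the extension of \<open>X\<close> to finite
 sets. If \<open>u\<close> is \<open>s\<close> with the values at \<open>i\<close> and \<open>j\<close> exchanged, and \<open>v\<close>, \<open>w\<close> arise from \<open>s\<close> by replacing one of these
 values by the other, then \<open>\<gamma>(s) + \<gamma>(u) = \<gamma>(v) + \<gamma>(w)\<close>. A family of morphisms with this exchange property is determined
 by its members at monotone sequences, where \<open>\<gamma>\<close> is the simplicial structure; so every identity for the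
 Eilenberg-Zilber maps reduces to monotone sequences and there to the universal property of \<open>dec\<^sub>*\<close>.

 In this way the canonical morphism \<open>F\<close> of the products \<open>dec\<^sub>*\<close> for a partition into blocks, which is the flattening \<open>\<phi>\<close> of
 the point-wise products conjugated by EZ and AW, satisfies \<open>EZ F = \<phi> (\<Otimes>\<^sub>i EZ) EZ\<close> and \<open>F AW (\<Otimes>\<^sub>i AW) = AW \<phi>\<close>. These are
 the functorialities of EZ and AW, and together they give \<open>E \<phi> = \<phi> (\<Otimes>\<^sub>i E) E\<close> for \<open>E = EZ AW\<close>. The components of the Shih
 operators are the operators \<open>E\<close> of shifted simplicial objects, so the same equation makes them compatible with
 composition, and naturality of \<open>E\<close> makes them simplicial.\<close>

text \<open>The exchange property reflects the sign rule. Test it on a face S of the simplex: if S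
  contains both i and j, the terms of s and u are opposite and those of v and w vanish for lack of
  injectivity; otherwise the four terms agree in pairs. Being linear, the relation survives
  composition with fixed morphisms and passes into one factor of a tensor product, so both sides of
  an identity inherit it.

  Two obstacles shape the development. Normalized quotients, Hom objects and right adjoints are
  arbitrary choices known only by universal properties. Hence X_n itself is shown to be an object of
  chain maps on the simplex, so that \<gamma>(s) is recognized by its composites with the
  projections to normalized faces; for the right adjoint, the projections indexed by tuples of
  consecutive blocks do the same service. The other obstacle is arity zero: the empty concatenation
  is no object of \<Delta>, and a unit factor is a constant object. Such factors receive an
  arbitrary dummy block, which is cut out again on the flattened side.\<close>

abbreviation "rep \<equiv> replicate"

section \<open>Lists of values\<close>

text \<open>Selection sort as an induction principle: the outer induction is on the number
  \<open>p\<close> of leading positions that hold minima of what follows, the inner one on the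
  number of later entries below entry \<open>p\<close>. The three lists in the exchange case are
  those that an exchange relation ties to \<open>s\<close>.\<close>

lemma exchange_induct [consumes 2, case_names sorted exchange]:
 assumes "length s = L" "set s \<subseteq> {..n::nat}"
  and sorted: "!!s. [|length s = L; set s \<subseteq> {..n}; sorted s|] ==> P s"
  and exchange: "!!s i j. [|length s = L; set s \<subseteq> {..n}; i < j; j < L; s ! j < s ! i;
   P (s[j := s ! i]); P (s[i := s ! j]); P (s[i := s ! j, j := s ! i])|] ==> P s"
 shows "P s"
proof -
 define Q where "Q = (\<lambda>p s::nat list. length s = L \<and> set s \<subseteq> {..n} \<and> (\<forall>i<p. \<forall>j<L. i < j --> s ! i \<le> s ! j))"
 define N where "N = (\<lambda>p s::nat list. {k. p < k \<and> k < L \<and> s ! k < s ! p})"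
 have fin: "finite (N p s)" for p s by (simp add: N_def)
 have main: "Q p s ==> P s" for p s
 proof (induction "L - p" arbitrary: p s)
  case 0
  hence "sorted s" by (auto simp: Q_def sorted_iff_nth_mono_less)
  thus ?case using 0 sorted by (auto simp: Q_def)
 next
  case (Suc d)
  have pL: "p < L" using Suc.hyps(2) by simp
  from Suc.prems show ?case
  proof (induction "card (N p s)" arbitrary: s rule: less_induct)
   case less
   show ?case
   proof (cases "N p s = {}")
    case True
    have "Q (Suc p) s"
     using less.prems True unfolding Q_def N_def
     by (auto simp: less_Suc_eq)
    thus ?thesis using Suc.hyps(1)[of "Suc p" s] Suc.hyps(2) by simp
   next
    case False
    then obtain j where j: "p < j" "j < L" "s ! j < s ! p" by (auto simp: N_def)
    have len: "length s = L" and vals: "set s \<subseteq> {..n}" using less.prems by (auto simp: Q_def)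
    have srt: "s ! i \<le> s ! k" if "i < p" "i < k" "k < L" for i k
     using less.prems that by (auto simp: Q_def)
    have in_n: "s ! i \<le> n" if "i < L" for i using vals that len nth_mem by fastforce
    have Q1: "Q p (s[j := s ! p])"
     unfolding Q_def using len vals srt in_n pL j
     by (auto simp: nth_list_update dest!: in_set_conv_nth[THEN iffD1])
    have Q2: "Q p (s[p := s ! j])"
     unfolding Q_def using len vals srt in_n pL j
     by (auto simp: nth_list_update dest!: in_set_conv_nth[THEN iffD1])
    have Q3: "Q p (s[p := s ! j, j := s ! p])"
     unfolding Q_def using len vals srt in_n pL j
     by (auto simp: nth_list_update dest!: in_set_conv_nth[THEN iffD1])
    have jN: "j \<in> N p s" using j by (auto simp: N_def)
    \<comment> \<open>In each of the three lists entry \<open>j\<close> no longer lies below entry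
      \<open>p\<close>, and entry \<open>p\<close> does not increase, so no new position
      enters.\<close>
    have "N p (s[j := s ! p]) \<subseteq> N p s - {j}" "N p (s[p := s ! j]) \<subseteq> N p s - {j}"
     "N p (s[p := s ! j, j := s ! p]) \<subseteq> N p s - {j}"
     using j pL len by (auto simp: N_def nth_list_update split: if_splits)
    hence "card (N p (s[j := s ! p])) < card (N p s)" "card (N p (s[p := s ! j])) < card (N p s)"
     "card (N p (s[p := s ! j, j := s ! p])) < card (N p s)"
     using jN fin by (metis (no_types) DiffE Diff_subset psubsetI psubset_card_mono singletonI subset_trans subsetD)+
    thus ?thesis
     using exchange[OF len vals j(1,2,3)] less.hyps Q1 Q2 Q3 by blast
   qed
  qed
 qed
 show ?thesis using main[of 0 s] assms(1,2) by (simp add: Q_def)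
qed

section \<open>The simplex category\<close>

lemma Simp_hom: "a \<in> Hom Simp m n \<longleftrightarrow> length a = Suc m \<and> sorted a \<and> set a \<subseteq> {..n}"
 by (simp add: Simp_def)

lemma Simp_obj [simp]: "Obj Simp = UNIV" "Obj Simp_op = UNIV"
 by (simp_all add: Simp_def op_cat_def)

lemma Simp_op_hom [simp]: "Hom Simp_op m n = Hom Simp n m"
 by (simp add: op_cat_def)

lemma Simp_cmp [simp]: "b \<cdot>\<^bsub>Simp\<^esub> a = map ((!) b) a" "a \<cdot>\<^bsub>Simp_op\<^esub> b = map ((!) b) a"
 by (simp_all add: Simp_def op_cat_def)

lemma Simp_idm: "Idm Simp n = [0..<Suc n]" "Idm Simp_op n = [0..<Suc n]"
 by (simp_all add: Simp_def op_cat_def)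

lemma Simp_id_hom: "[0..<Suc n] \<in> Hom Simp n n"
 by (auto simp: Simp_hom simp del: upt_Suc)

lemma sorted_map_nth:
 assumes "sorted b" "sorted a" "set a \<subseteq> {..<length b}"
 shows "sorted (map ((!) b) a)"
 using assms by (auto simp: sorted_iff_nth_mono subset_iff)

lemma set_map_nth: "set a \<subseteq> {..<length b} ==> set (map ((!) b) a) \<subseteq> set b"
 by auto

lemma Simp_comp_hom:
 assumes "a \<in> Hom Simp l m" "b \<in> Hom Simp m n"
 shows "map ((!) b) a \<in> Hom Simp l n"
proof -
 have "set a \<subseteq> {..<length b}" using assms by (auto simp: Simp_hom)
 thus ?thesis using assms sorted_map_nth[of b a] set_map_nth[of a b]
  by (auto simp: Simp_hom)
qed

lemma map_nth_map_nth:
 "set g \<subseteq> {..<length b} ==> map ((!) (map ((!) a) b)) g = map ((!) a) (map ((!) b) g)"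
 by auto

lemma map_nth_upt: "set b \<subseteq> {..<n} ==> map ((!) [0..<n]) b = b"
 by (rule map_idI) auto

lemma map_nth_upt': "length a = n ==> map ((!) a) [0..<n] = a"
 using map_nth by blast

lemma map_nth_list_update:
 assumes "distinct r" "i < length r" "set r \<subseteq> {..<length s}"
 shows "map ((!) (s[r ! i := x])) r = (map ((!) s) r)[i := x]"
 using assms by (intro nth_equalityI) (auto simp: nth_list_update nth_eq_iff_index_eq subset_iff)

section \<open>Cosimplicial identities for lists of values\<close>

lemma face_hom: "i \<le> Suc j ==> face (Suc j) i \<in> Hom Simp j (Suc j)"
 by (auto simp: face_def Simp_hom sorted_append simp del: upt_Suc)

lemma face_length: "i \<le> j ==> length (face j i) = j"
 by (auto simp: face_def simp del: upt_Suc)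

lemma face_nth: "[|i \<le> Suc j; k \<le> j|] ==> face (Suc j) i ! k = (if k < i then k else Suc k)"
 by (auto simp: face_def nth_append simp del: upt_Suc)

lemma degen_hom: "i \<le> j ==> degen (Suc j) i \<in> Hom Simp (Suc j) j"
 by (auto simp: degen_def Simp_hom sorted_append simp del: upt_Suc)

lemma degen_length: "i < j ==> length (degen j i) = Suc j"
 by (auto simp: degen_def simp del: upt_Suc)

lemma degen_nth: "[|i \<le> j; k \<le> Suc j|] ==> degen (Suc j) i ! k = (if k \<le> i then k else k - 1)"
 by (auto simp: degen_def nth_append simp del: upt_Suc)

lemma face_face:
 "[|i < j; j \<le> Suc (Suc n)|] ==>
  map ((!) (face (Suc (Suc n)) j)) (face (Suc n) i) = map ((!) (face (Suc (Suc n)) i)) (face (Suc n) (j - 1))"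
 by (rule nth_equalityI) (auto simp: face_length face_nth)

lemma degen_face_id:
 "[|i = k \<or> i = Suc k; k \<le> n|] ==> map ((!) (degen (Suc n) k)) (face (Suc n) i) = [0..<Suc n]"
 by (rule nth_equalityI) (auto simp: face_length face_nth degen_nth simp del: upt_Suc)

lemma degen_face_less:
 "[|i < k; k \<le> Suc n|] ==>
  map ((!) (degen (Suc (Suc n)) k)) (face (Suc (Suc n)) i) = map ((!) (face (Suc n) i)) (degen (Suc n) (k - 1))"
 by (rule nth_equalityI) (auto simp: face_length face_nth degen_nth degen_length)

lemma degen_face_greater:
 "[|Suc k < i; i \<le> Suc (Suc n)|] ==>
  map ((!) (degen (Suc (Suc n)) k)) (face (Suc (Suc n)) i) = map ((!) (face (Suc n) (i - 1))) (degen (Suc n) k)"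
 by (rule nth_equalityI) (auto simp: face_length face_nth degen_nth degen_length)

lemma degen_degen:
 "[|i \<le> j; j \<le> n|] ==>
  map ((!) (degen (Suc n) j)) (degen (Suc (Suc n)) i) = map ((!) (degen (Suc n) i)) (degen (Suc (Suc n)) (Suc j))"
 by (rule nth_equalityI) (auto simp: degen_nth degen_length)

section \<open>Additive structure and finite limits\<close>

lemmas (in category) assoc = comp_assoc

context abelian_tensor_category
begin

definition Neg :: "'o => 'o => 'm => 'm" where
 "Neg a b f = inv\<^bsub>hom_group C a b\<^esub> f"

definition Sub :: "'o => 'o => 'm => 'm => 'm" where
 "Sub a b f g = Plus C f (Neg a b g)"

lemma hom_group_simps [simp]:
 "carrier (hom_group C a b) = Hom C a b"
 "f \<otimes>\<^bsub>hom_group C a b\<^esub> g = Plus C f g"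
 "\<one>\<^bsub>hom_group C a b\<^esub> = Zero C a b"
 by (simp_all add: hom_group_def)

context
 fixes a b
 assumes ab: "a \<in> Obj C" "b \<in> Obj C"
begin

interpretation G: comm_group "hom_group C a b"
 using ab by (rule hom_comm_group)

lemma zero_in: "Zero C a b \<in> Hom C a b"
 using G.one_closed by simp

lemma plus_in: "[|f \<in> Hom C a b; g \<in> Hom C a b|] ==> Plus C f g \<in> Hom C a b"
 using G.m_closed[of f g] by simp

lemma neg_in: "f \<in> Hom C a b ==> Neg a b f \<in> Hom C a b"
 using G.inv_closed[of f] by (simp add: Neg_def)

lemma plus_assoc:
 "[|f \<in> Hom C a b; g \<in> Hom C a b; h \<in> Hom C a b|] ==> Plus C (Plus C f g) h = Plus C f (Plus C g h)"
 using G.m_assoc[of f g h] by simp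

lemma plus_comm: "[|f \<in> Hom C a b; g \<in> Hom C a b|] ==> Plus C f g = Plus C g f"
 using G.m_comm[of f g] by simp

lemma plus_zero: "f \<in> Hom C a b ==> Plus C f (Zero C a b) = f" "f \<in> Hom C a b ==> Plus C (Zero C a b) f = f"
 using G.r_one[of f] G.l_one[of f] by simp_all

lemma plus_neg: "f \<in> Hom C a b ==> Plus C f (Neg a b f) = Zero C a b"
 "f \<in> Hom C a b ==> Plus C (Neg a b f) f = Zero C a b"
 using G.r_inv[of f] G.l_inv[of f] by (simp_all add: Neg_def)

lemma plus_cancel:
 "[|f \<in> Hom C a b; g \<in> Hom C a b; h \<in> Hom C a b|] ==> Plus C f h = Plus C g h \<longleftrightarrow> f = g"
 using G.right_cancel[of h f g] by simp

lemma plus_self_zero: "[|f \<in> Hom C a b; Plus C f f = f|] ==> f = Zero C a b"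
 using G.l_cancel_one[of f f] by simp

lemma neg_unique: "[|f \<in> Hom C a b; g \<in> Hom C a b; Plus C f g = Zero C a b|] ==> Neg a b f = g"
 using G.inv_equality[of g f] plus_comm[of f g] by (simp add: Neg_def)

lemma neg_zero: "Neg a b (Zero C a b) = Zero C a b"
 using G.inv_one by (simp add: Neg_def)

lemma neg_neg: "f \<in> Hom C a b ==> Neg a b (Neg a b f) = f"
 using G.inv_inv[of f] by (simp add: Neg_def)

lemma sub_in: "[|f \<in> Hom C a b; g \<in> Hom C a b|] ==> Sub a b f g \<in> Hom C a b"
 by (simp add: Sub_def plus_in neg_in)

lemma sub_eq_zero_iff: "[|f \<in> Hom C a b; g \<in> Hom C a b|] ==> Sub a b f g = Zero C a b \<longleftrightarrow> f = g"
 by (metis Sub_def neg_in neg_neg neg_unique plus_comm plus_neg(1))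

lemma sub_plus: "[|f \<in> Hom C a b; g \<in> Hom C a b|] ==> Plus C (Sub a b f g) g = f"
 by (simp add: Sub_def plus_assoc neg_in plus_neg plus_zero)

lemma plus_sub: "[|f \<in> Hom C a b; g \<in> Hom C a b|] ==> Plus C g (Sub a b f g) = f"
 by (metis sub_plus plus_comm sub_in)

lemma sub_eq_iff:
 "[|f \<in> Hom C a b; g \<in> Hom C a b; h \<in> Hom C a b|] ==> Sub a b f g = h \<longleftrightarrow> f = Plus C h g"
 by (metis plus_cancel sub_in sub_plus)

lemma sub_self: "f \<in> Hom C a b ==> Sub a b f f = Zero C a b"
 by (simp add: Sub_def plus_neg)

end

context
 fixes a b c
 assumes abc: "a \<in> Obj C" "b \<in> Obj C" "c \<in> Obj C"
begin

text \<open>From \<open>g 0 = g (0 + 0) = g 0 + g 0\<close>; an element equal to its double is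
  zero.\<close>

lemma comp_zero_right: "g \<in> Hom C b c ==> g \<cdot> Zero C a b = Zero C a c"
 using abc comp_add_right[of a b c "Zero C a b" "Zero C a b" g]
 by (intro plus_self_zero) (simp_all add: zero_in plus_zero comp_in[of a b c])

lemma comp_zero_left: "f \<in> Hom C a b ==> Zero C b c \<cdot> f = Zero C a c"
 using abc comp_add_left[of a b c f "Zero C b c" "Zero C b c"]
 by (intro plus_self_zero) (simp_all add: zero_in plus_zero comp_in[of a b c])

lemma comp_neg_right: "[|f \<in> Hom C a b; g \<in> Hom C b c|] ==> g \<cdot> Neg a b f = Neg a c (g \<cdot> f)"
 using abc comp_add_right[of a b c f "Neg a b f" g]
 by (intro neg_unique[symmetric]) (simp_all add: comp_zero_right plus_neg neg_in comp_in[of a b c])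

lemma comp_neg_left: "[|f \<in> Hom C a b; g \<in> Hom C b c|] ==> Neg b c g \<cdot> f = Neg a c (g \<cdot> f)"
 using abc comp_add_left[of a b c f g "Neg b c g"]
 by (intro neg_unique[symmetric]) (simp_all add: comp_zero_left plus_neg neg_in comp_in[of a b c])

lemma comp_sub_right:
 "[|f \<in> Hom C a b; f' \<in> Hom C a b; g \<in> Hom C b c|] ==> g \<cdot> Sub a b f f' = Sub a c (g \<cdot> f) (g \<cdot> f')"
 using abc by (simp add: Sub_def comp_add_right[of a b c] neg_in comp_neg_right)

lemma comp_sub_left:
 "[|f \<in> Hom C a b; g \<in> Hom C b c; g' \<in> Hom C b c|] ==> Sub b c g g' \<cdot> f = Sub a c (g \<cdot> f) (g' \<cdot> f)"
 using abc by (simp add: Sub_def comp_add_left[of a b c] neg_in comp_neg_left)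

end

lemma zero_object_zero:
 assumes z: "z \<in> Obj C" "Idm C z = Zero C z z" and a: "a \<in> Obj C"
 shows "f \<in> Hom C a z ==> f = Zero C a z" "f \<in> Hom C z a ==> f = Zero C z a"
proof -
 show "f = Zero C a z" if "f \<in> Hom C a z"
  using id_left[OF a z(1) that] comp_zero_left[OF a z(1) z(1) that] z(2) by simp
 show "f = Zero C z a" if "f \<in> Hom C z a"
  using id_right[OF z(1) a that] comp_zero_right[OF z(1) z(1) a that] z(2) by simp
qed

text \<open>A biproduct is given by equations only. Its property as a product follows by splitting
  any \<open>h\<close> along \<open>i p + j q = 1\<close>.\<close>

lemma biproduct_pair:
 assumes "a \<in> Obj C" "b \<in> Obj C" "x \<in> Obj C" "is_biproduct C a b s i j p q"
  "f \<in> Hom C x a" "g \<in> Hom C x b"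
 shows "\<exists>!h. h \<in> Hom C x s \<and> p \<cdot> h = f \<and> q \<cdot> h = g"
proof -
 have s: "s \<in> Obj C" "i \<in> Hom C a s" "j \<in> Hom C b s" "p \<in> Hom C s a" "q \<in> Hom C s b"
  "p \<cdot> i = Idm C a" "q \<cdot> j = Idm C b" "p \<cdot> j = Zero C b a" "q \<cdot> i = Zero C a b"
  "Plus C (i \<cdot> p) (j \<cdot> q) = Idm C s"
  using assms(4) by (auto simp: is_biproduct_def)
 note o = assms(1-3) s(1)
 have ins: "i \<cdot> f \<in> Hom C x s" "j \<cdot> g \<in> Hom C x s" "i \<cdot> p \<in> Hom C s s" "j \<cdot> q \<in> Hom C s s"
  using assms s o by (simp_all add: comp_in[of _ a] comp_in[of _ b])
 have rep: "h = Plus C (i \<cdot> (p \<cdot> h)) (j \<cdot> (q \<cdot> h))" if "h \<in> Hom C x s" for h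
  using comp_add_left[OF o(3,4,4) that ins(3,4)] s o that
  by (simp add: id_left assoc[of x s a s] assoc[of x s b s])
 have pij: "p \<cdot> (i \<cdot> f) = f" "p \<cdot> (j \<cdot> g) = Zero C x a" "q \<cdot> (i \<cdot> f) = Zero C x b" "q \<cdot> (j \<cdot> g) = g"
  using o s assms(5,6) by (simp_all add: assoc[of x a s a, symmetric] assoc[of x b s a, symmetric]
    assoc[of x a s b, symmetric] assoc[of x b s b, symmetric] comp_zero_left id_left)
 show ?thesis
 proof (rule ex1I)
  show "Plus C (i \<cdot> f) (j \<cdot> g) \<in> Hom C x s \<and> p \<cdot> Plus C (i \<cdot> f) (j \<cdot> g) = f \<and> q \<cdot> Plus C (i \<cdot> f) (j \<cdot> g) = g"
   using ins o s assms comp_add_right[of x s a "i \<cdot> f" "j \<cdot> g" p] comp_add_right[of x s b "i \<cdot> f" "j \<cdot> g" q]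
    pij by (simp add: plus_in plus_zero)
 next
  fix h assume h: "h \<in> Hom C x s \<and> p \<cdot> h = f \<and> q \<cdot> h = g"
  hence "Plus C (i \<cdot> (p \<cdot> h)) (j \<cdot> (q \<cdot> h)) = Plus C (i \<cdot> f) (j \<cdot> g)" by simp
  moreover have "h = Plus C (i \<cdot> (p \<cdot> h)) (j \<cdot> (q \<cdot> h))" using rep h by blast
  ultimately show "h = Plus C (i \<cdot> f) (j \<cdot> g)" by (rule trans[rotated])
 qed
qed

lemma biproduct_copair:
 assumes "a \<in> Obj C" "b \<in> Obj C" "x \<in> Obj C" "is_biproduct C a b s i j p q"
  "f \<in> Hom C a x" "g \<in> Hom C b x"
 shows "\<exists>!h. h \<in> Hom C s x \<and> h \<cdot> i = f \<and> h \<cdot> j = g"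
proof -
 have s: "s \<in> Obj C" "i \<in> Hom C a s" "j \<in> Hom C b s" "p \<in> Hom C s a" "q \<in> Hom C s b"
  "p \<cdot> i = Idm C a" "q \<cdot> j = Idm C b" "p \<cdot> j = Zero C b a" "q \<cdot> i = Zero C a b"
  "Plus C (i \<cdot> p) (j \<cdot> q) = Idm C s"
  using assms(4) by (auto simp: is_biproduct_def)
 note o = assms(1-3) s(1)
 have ins: "f \<cdot> p \<in> Hom C s x" "g \<cdot> q \<in> Hom C s x" "i \<cdot> p \<in> Hom C s s" "j \<cdot> q \<in> Hom C s s"
  using assms s o by (simp_all add: comp_in[of _ a] comp_in[of _ b])
 have pij: "(f \<cdot> p) \<cdot> i = f" "(g \<cdot> q) \<cdot> i = Zero C a x" "(f \<cdot> p) \<cdot> j = Zero C b x" "(g \<cdot> q) \<cdot> j = g"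
  using o s assms(5,6) by (simp_all add: assoc[of a s a x] assoc[of a s b x]
    assoc[of b s a x] assoc[of b s b x] comp_zero_right id_right)
 have rep: "h = Plus C ((h \<cdot> i) \<cdot> p) ((h \<cdot> j) \<cdot> q)" if "h \<in> Hom C s x" for h
  using comp_add_right[OF o(4,4,3) ins(3,4) that] s o that
  by (simp add: id_right assoc[of s a s x] assoc[of s b s x])
 show ?thesis
 proof (rule ex1I)
  show "Plus C (f \<cdot> p) (g \<cdot> q) \<in> Hom C s x \<and> Plus C (f \<cdot> p) (g \<cdot> q) \<cdot> i = f \<and> Plus C (f \<cdot> p) (g \<cdot> q) \<cdot> j = g"
   using ins o s assms comp_add_left[of a s x i "f \<cdot> p" "g \<cdot> q"] comp_add_left[of b s x j "f \<cdot> p" "g \<cdot> q"]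
    pij by (simp add: plus_in plus_zero)
 next
  fix h assume h: "h \<in> Hom C s x \<and> h \<cdot> i = f \<and> h \<cdot> j = g"
  hence "Plus C ((h \<cdot> i) \<cdot> p) ((h \<cdot> j) \<cdot> q) = Plus C (f \<cdot> p) (g \<cdot> q)" by simp
  moreover have "h = Plus C ((h \<cdot> i) \<cdot> p) ((h \<cdot> j) \<cdot> q)" using rep h by blast
  ultimately show "h = Plus C (f \<cdot> p) (g \<cdot> q)" by (rule trans[rotated])
 qed
qed

section \<open>Finite limits and copowers\<close>

text \<open>A diagram is encoded by its objects and a set of conditions
  \<open>f p_i = g p_j\<close>, so that a limit can be built by imposing one condition after
  another. The entry \<open>b\<close> records the common codomain, which the difference of the two
  composites refers to and which an arrow alone does not determine.\<close>

definition is_finite_limit ::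
 "'i set => ('i => 'o) => ('i \<times> 'i \<times> 'm \<times> 'm \<times> 'o) set => 'o => ('i => 'm) => bool" where
 "is_finite_limit I A R L p \<longleftrightarrow> L \<in> Obj C \<and> (\<forall>i\<in>I. p i \<in> Hom C L (A i)) \<and>
   (\<forall>(i, j, f, g, b)\<in>R. f \<cdot> p i = g \<cdot> p j) \<and>
   (\<forall>x\<in>Obj C. \<forall>r. (\<forall>i\<in>I. r i \<in> Hom C x (A i)) \<and> (\<forall>(i, j, f, g, b)\<in>R. f \<cdot> r i = g \<cdot> r j) -->
    (\<exists>!h. h \<in> Hom C x L \<and> (\<forall>i\<in>I. p i \<cdot> h = r i)))"

lemma finite_product_exists:
 assumes "finite I" "!!i. i \<in> I ==> A i \<in> Obj C"
 shows "\<exists>L p. is_finite_limit I A {} L p"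
 using assms
proof (induction I)
 case empty
 obtain z where z: "z \<in> Obj C" "Idm C z = Zero C z z" using zero_object by blast
 hence "is_finite_limit {} A {} z p" for p
  unfolding is_finite_limit_def using zero_object_zero(1)[OF z] zero_in by (auto intro!: ex1I)
 thus ?case by blast
next
 case (insert k I)
 then obtain L p where L: "is_finite_limit I A {} L p" by blast
 have LO: "L \<in> Obj C" and pI: "!!i. i \<in> I ==> p i \<in> Hom C L (A i)"
  and Ak: "A k \<in> Obj C" and AI: "!!i. i \<in> I ==> A i \<in> Obj C"
  using L insert.prems by (auto simp: is_finite_limit_def)
 obtain s i j q r where s: "is_biproduct C (A k) L s i j q r" using biproducts[OF Ak LO] by blast
 hence so: "s \<in> Obj C" "q \<in> Hom C s (A k)" "r \<in> Hom C s L" by (auto simp: is_biproduct_def)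
 define p' where "p' = (\<lambda>i. if i = k then q else p i \<cdot> r)"
 have p'I: "p' i = p i \<cdot> r" if "i \<in> I" for i using that insert.hyps by (auto simp: p'_def)
 have p'k: "p' k = q" by (simp add: p'_def)
 have "\<exists>!h. h \<in> Hom C x s \<and> (\<forall>i\<in>insert k I. p' i \<cdot> h = t i)"
  if x: "x \<in> Obj C" and t: "\<forall>i\<in>insert k I. t i \<in> Hom C x (A i)" for x t
 proof -
  have "\<exists>!u. u \<in> Hom C x L \<and> (\<forall>i\<in>I. p i \<cdot> u = t i)"
   using L x t by (simp add: is_finite_limit_def)
  then obtain u where u: "u \<in> Hom C x L" "!!i. i \<in> I ==> p i \<cdot> u = t i"
   and uu: "!!u'. u' \<in> Hom C x L ==> (!!i. i \<in> I ==> p i \<cdot> u' = t i) ==> u' = u"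
   by (elim ex1E) blast
  have bp: "\<exists>!h. h \<in> Hom C x s \<and> q \<cdot> h = t k \<and> r \<cdot> h = u"
   using biproduct_pair[OF Ak LO x s] t u by blast
  have eq: "p' i \<cdot> h = p i \<cdot> (r \<cdot> h)" if "i \<in> I" "h \<in> Hom C x s" for i h
   using that by (simp add: p'I assoc[OF x so(1) LO AI that(2) so(3) pI])
  have rh: "r \<cdot> h \<in> Hom C x L" if "h \<in> Hom C x s" for h using comp_in[OF x so(1) LO that so(3)] .
  have "(\<forall>i\<in>insert k I. p' i \<cdot> h = t i) \<longleftrightarrow> q \<cdot> h = t k \<and> r \<cdot> h = u" if h: "h \<in> Hom C x s" for h
   using eq[OF _ h] u uu[OF rh[OF h]] by (auto simp: p'k)
  hence "(h \<in> Hom C x s \<and> (\<forall>i\<in>insert k I. p' i \<cdot> h = t i)) \<longleftrightarrow> (h \<in> Hom C x s \<and> q \<cdot> h = t k \<and> r \<cdot> h = u)" for h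
   by blast
  thus ?thesis using bp by simp
 qed
 moreover have "\<forall>i\<in>insert k I. p' i \<in> Hom C s (A i)"
  using p'I p'k so comp_in[OF so(1) LO AI so(3) pI] by auto
 ultimately have "is_finite_limit (insert k I) A {} s p'"
  using so unfolding is_finite_limit_def by blast
 thus ?case by blast
qed

text \<open>Starting from the product, each further condition is imposed by passing to the kernel of
  the difference of its two composites.\<close>

lemma finite_limit_exists:
 assumes "finite I" "finite R" "!!i. i \<in> I ==> A i \<in> Obj C"
  and R: "!!i j f g b. (i, j, f, g, b) \<in> R ==>
   i \<in> I \<and> j \<in> I \<and> b \<in> Obj C \<and> f \<in> Hom C (A i) b \<and> g \<in> Hom C (A j) b"
 shows "\<exists>L p. is_finite_limit I A R L p"
 using assms(2) R
proof (induction R)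
 case empty
 thus ?case using finite_product_exists[of I A] assms(1,3) by blast
next
 case (insert c R)
 obtain i j f g b where c: "c = (i, j, f, g, b)" by (cases c)
 have cI: "i \<in> I" "j \<in> I" "b \<in> Obj C" "f \<in> Hom C (A i) b" "g \<in> Hom C (A j) b"
  using insert.prems[of i j f g b] c by auto
 obtain L p where L: "is_finite_limit I A R L p" using insert.IH insert.prems by blast
 have LO: "L \<in> Obj C" and pI: "!!i. i \<in> I ==> p i \<in> Hom C L (A i)"
  and pR: "!!i j f g b. (i, j, f, g, b) \<in> R ==> f \<cdot> p i = g \<cdot> p j"
  using L by (auto simp: is_finite_limit_def)
 note A = assms(3)
 have fp: "f \<cdot> p i \<in> Hom C L b" "g \<cdot> p j \<in> Hom C L b"
  using comp_in[OF LO A cI(3) pI] cI by blast+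
 define d where "d = Sub L b (f \<cdot> p i) (g \<cdot> p j)"
 have d: "d \<in> Hom C L b" unfolding d_def using LO cI(3) fp by (rule sub_in)
 obtain E e where E: "is_kernel C L b d E e" using kernels[OF LO cI(3) d] by blast
 hence EO: "E \<in> Obj C" "e \<in> Hom C E L" "d \<cdot> e = Zero C E b" by (auto simp: is_kernel_def)
 have dz: "d \<cdot> u = Zero C x b \<longleftrightarrow> f \<cdot> (p i \<cdot> u) = g \<cdot> (p j \<cdot> u)" if "x \<in> Obj C" "u \<in> Hom C x L" for x u
 proof -
  have "d \<cdot> u = Sub x b (f \<cdot> (p i \<cdot> u)) (g \<cdot> (p j \<cdot> u))"
   unfolding d_def using that LO cI fp A pI
   by (simp add: comp_sub_left assoc[of x L "A i" b] assoc[of x L "A j" b])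
  moreover have "f \<cdot> (p i \<cdot> u) \<in> Hom C x b" "g \<cdot> (p j \<cdot> u) \<in> Hom C x b"
   using comp_in[OF that(1) A cI(3) comp_in[OF that(1) LO A that(2) pI]] cI by blast+
  ultimately show ?thesis using that cI by (simp add: sub_eq_zero_iff)
 qed
 define p' where "p' = (\<lambda>i. p i \<cdot> e)"
 have p'in: "\<forall>i\<in>I. p' i \<in> Hom C E (A i)" using comp_in[OF EO(1) LO A EO(2) pI] by (simp add: p'_def)
 have p'R: "f \<cdot> p' i = g \<cdot> p' j" if "(i, j, f, g, b) \<in> insert c R" for i j f g b
 proof (cases "(i, j, f, g, b) \<in> R")
  case True
  have "i \<in> I" "j \<in> I" "b \<in> Obj C" "f \<in> Hom C (A i) b" "g \<in> Hom C (A j) b"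
   using insert.prems[of i j f g b] True by auto
  thus ?thesis using pR[OF True] assoc[OF EO(1) LO A _ EO(2) pI] by (metis (no_types) p'_def)
 next
  case False
  thus ?thesis using that c dz[OF EO(1,2)] EO(3) by (auto simp: p'_def)
 qed
 have "\<exists>!h. h \<in> Hom C x E \<and> (\<forall>i\<in>I. p' i \<cdot> h = t i)"
  if x: "x \<in> Obj C" and t: "\<forall>i\<in>I. t i \<in> Hom C x (A i)"
   and tR: "\<forall>(i, j, f, g, b)\<in>insert c R. f \<cdot> t i = g \<cdot> t j" for x t
 proof -
  have "\<exists>!u. u \<in> Hom C x L \<and> (\<forall>i\<in>I. p i \<cdot> u = t i)"
   using L x t tR by (simp add: is_finite_limit_def)
  then obtain u where u: "u \<in> Hom C x L" "!!i. i \<in> I ==> p i \<cdot> u = t i"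
   and uu: "!!u'. u' \<in> Hom C x L ==> (!!i. i \<in> I ==> p i \<cdot> u' = t i) ==> u' = u"
   by (elim ex1E) blast
  have "d \<cdot> u = Zero C x b" using dz[OF x u(1)] u(2) cI tR c by auto
  hence ex: "\<exists>!h. h \<in> Hom C x E \<and> e \<cdot> h = u"
   using E x u(1) by (auto simp: is_kernel_def)
  have eq: "p' i \<cdot> h = p i \<cdot> (e \<cdot> h)" if "i \<in> I" "h \<in> Hom C x E" for i h
   unfolding p'_def using assoc[OF x EO(1) LO A that(2) EO(2) pI] that(1) by blast
  have eh: "e \<cdot> h \<in> Hom C x L" if "h \<in> Hom C x E" for h using comp_in[OF x EO(1) LO that EO(2)] .
  have "(\<forall>i\<in>I. p' i \<cdot> h = t i) \<longleftrightarrow> e \<cdot> h = u" if h: "h \<in> Hom C x E" for h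
   using eq[OF _ h] u uu[OF eh[OF h]] by auto
  hence "(h \<in> Hom C x E \<and> (\<forall>i\<in>I. p' i \<cdot> h = t i)) \<longleftrightarrow> (h \<in> Hom C x E \<and> e \<cdot> h = u)" for h
   by blast
  thus ?thesis using ex by simp
 qed
 moreover have "\<forall>(i, j, f, g, b)\<in>insert c R. f \<cdot> p' i = g \<cdot> p' j"
 proof clarify
  fix i j f g b assume "(i, j, f, g, b) \<in> insert c R"
  thus "f \<cdot> p' i = g \<cdot> p' j" by (rule p'R)
 qed
 ultimately have "is_finite_limit I A (insert c R) E p'"
  using EO(1) p'in unfolding is_finite_limit_def by simp
 thus ?case by blast
qed

text \<open>Dual to finite products. Finite index sets cover all tensors below, because
  \<open>Delta1\<close> and its powers are finite in every degree.\<close>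

lemma copower_exists:
 assumes "finite I" "a \<in> Obj C"
 shows "\<exists>s b. is_copower C I a s b"
 using assms(1)
proof (induction I)
 case empty
 obtain z where z: "z \<in> Obj C" "Idm C z = Zero C z z" using zero_object by blast
 hence "is_copower C {} a z b" for b
  unfolding is_copower_def using zero_object_zero(2)[OF z] zero_in by (auto intro!: ex1I)
 thus ?case by blast
next
 case (insert k I)
 then obtain L b where L: "is_copower C I a L b" by blast
 have LO: "L \<in> Obj C" and iI: "!!i. i \<in> I ==> b i \<in> Hom C a L"
  using L by (auto simp: is_copower_def)
 obtain s i j q r where s: "is_biproduct C a L s i j q r" using biproducts[OF assms(2) LO] by blast
 hence so: "s \<in> Obj C" "i \<in> Hom C a s" "j \<in> Hom C L s" by (auto simp: is_biproduct_def)
 define b' where "b' = (\<lambda>l. if l = k then i else j \<cdot> b l)"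
 have p'I: "b' l = j \<cdot> b l" if "l \<in> I" for l using that insert.hyps by (auto simp: b'_def)
 have p'k: "b' k = i" by (simp add: b'_def)
 have "\<exists>!h. h \<in> Hom C s x \<and> (\<forall>l\<in>insert k I. h \<cdot> b' l = t l)"
  if x: "x \<in> Obj C" and t: "\<forall>l\<in>insert k I. t l \<in> Hom C a x" for x t
 proof -
  have "\<exists>!u. u \<in> Hom C L x \<and> (\<forall>l\<in>I. u \<cdot> b l = t l)"
   using L x t by (simp add: is_copower_def)
  then obtain u where u: "u \<in> Hom C L x" "!!l. l \<in> I ==> u \<cdot> b l = t l"
   and uu: "!!u'. u' \<in> Hom C L x ==> (!!l. l \<in> I ==> u' \<cdot> b l = t l) ==> u' = u"
   by (elim ex1E) blast
  have bp: "\<exists>!h. h \<in> Hom C s x \<and> h \<cdot> i = t k \<and> h \<cdot> j = u"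
   using biproduct_copair[OF assms(2) LO x s] t u by blast
  have eq: "h \<cdot> b' l = (h \<cdot> j) \<cdot> b l" if "l \<in> I" "h \<in> Hom C s x" for l h
   using that by (simp add: p'I assoc[OF assms(2) LO so(1) x iI so(3) that(2)])
  have rh: "h \<cdot> j \<in> Hom C L x" if "h \<in> Hom C s x" for h using comp_in[OF LO so(1) x so(3) that] .
  have "(\<forall>l\<in>insert k I. h \<cdot> b' l = t l) \<longleftrightarrow> h \<cdot> i = t k \<and> h \<cdot> j = u" if h: "h \<in> Hom C s x" for h
   using eq[OF _ h] u uu[OF rh[OF h]] by (auto simp: p'k)
  hence "(h \<in> Hom C s x \<and> (\<forall>l\<in>insert k I. h \<cdot> b' l = t l)) \<longleftrightarrow> (h \<in> Hom C s x \<and> h \<cdot> i = t k \<and> h \<cdot> j = u)" for h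
   by blast
  thus ?thesis using bp by simp
 qed
 moreover have "\<forall>l\<in>insert k I. b' l \<in> Hom C a s"
  using p'I p'k so comp_in[OF assms(2) LO so(1) iI so(3)] by auto
 ultimately have "is_copower C (insert k I) a s b'"
  using so unfolding is_copower_def by blast
 thus ?case by blast
qed

lemma is_copower_copower:
 assumes "finite I" "a \<in> Obj C"
 shows "is_copower C I a (fst (copower C I a)) (snd (copower C I a))"
proof -
 have "\<exists>z. case z of (s, i) => is_copower C I a s i" using copower_exists[OF assms] by auto
 hence "case copower C I a of (s, i) => is_copower C I a s i"
  unfolding copower_def by (rule someI_ex)
 thus ?thesis by (simp add: case_prod_unfold)
qed

lemma copower_obj: "[|finite I; a \<in> Obj C|] ==> fst (copower C I a) \<in> Obj C"
 and copower_in: "[|finite I; a \<in> Obj C; i \<in> I|] ==> snd (copower C I a) i \<in> Hom C a (fst (copower C I a))"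
 using is_copower_copower by (auto simp: is_copower_def)

lemma copower_desc:
 assumes "finite I" "a \<in> Obj C" "b \<in> Obj C" "!!i. i \<in> I ==> f i \<in> Hom C a b"
 shows "copower_desc C I a b f \<in> Hom C (fst (copower C I a)) b"
  and "i \<in> I ==> copower_desc C I a b f \<cdot> snd (copower C I a) i = f i"
proof -
 have "\<exists>!h. h \<in> Hom C (fst (copower C I a)) b \<and> (\<forall>i\<in>I. h \<cdot> snd (copower C I a) i = f i)"
  using is_copower_copower[OF assms(1,2)] assms by (auto simp: is_copower_def)
 from theI'[OF this] show "copower_desc C I a b f \<in> Hom C (fst (copower C I a)) b"
  "i \<in> I ==> copower_desc C I a b f \<cdot> snd (copower C I a) i = f i"
  by (auto simp: copower_desc_def)
qed

lemma copower_ext: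
 assumes "finite I" "a \<in> Obj C" "b \<in> Obj C" "g \<in> Hom C (fst (copower C I a)) b"
  "h \<in> Hom C (fst (copower C I a)) b"
  "!!i. i \<in> I ==> g \<cdot> snd (copower C I a) i = h \<cdot> snd (copower C I a) i"
 shows "g = h"
proof -
 have "!!i. i \<in> I ==> h \<cdot> snd (copower C I a) i \<in> Hom C a b"
  using assms by (simp add: comp_in[of a "fst (copower C I a)"] copower_obj copower_in)
 hence "\<exists>!g. g \<in> Hom C (fst (copower C I a)) b \<and>
   (\<forall>i\<in>I. g \<cdot> snd (copower C I a) i = h \<cdot> snd (copower C I a) i)"
  using is_copower_copower[OF assms(1,2)] assms(3) by (auto simp: is_copower_def)
 thus ?thesis using assms by metis
qed

end

section \<open>Simplicial objects and their normalized quotients\<close>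

lemma Sim_simps [simp]:
 "Obj (Sim C) = {X. is_functor Simp_op C X}"
 "Hom (Sim C) X Y = {h. is_nat_trans Simp_op C X Y h}"
 "Idm (Sim C) X = (\<lambda>n. Idm C (Fo X n))"
 "g \<cdot>\<^bsub>Sim C\<^esub> f = (\<lambda>n. g n \<cdot>\<^bsub>C\<^esub> f n)"
 by (simp_all add: Sim_def)

context category
begin

abbreviation "simplicial \<equiv> is_functor Simp_op C"

abbreviation "snat \<equiv> is_nat_trans Simp_op C"

abbreviation "msimplicial k \<equiv> is_functor (pow_cat k Simp_op) C"

abbreviation "mnat k \<equiv> is_nat_trans (pow_cat k Simp_op) C"

context
 fixes X
 assumes X: "simplicial X"
begin

lemma sobj_obj: "Fo X n \<in> Obj C"
 using X by (simp add: is_functor_def)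

lemma sobj_map: "a \<in> Hom Simp m n ==> Fm X n m a \<in> Hom C (Fo X n) (Fo X m)"
 using X by (simp add: is_functor_def)

lemma sobj_id: "Fm X n n [0..<Suc n] = Idm C (Fo X n)"
 using X by (simp add: is_functor_def Simp_idm del: upt_Suc)

lemma sobj_comp:
 "[|a \<in> Hom Simp l m; b \<in> Hom Simp m n|] ==> Fm X m l a \<cdot> Fm X n m b = Fm X n l (map ((!) b) a)"
 using X by (simp add: is_functor_def)

lemma sobj_map_in:
 "[|a \<in> Obj C; x \<in> Hom C a (Fo X n); b \<in> Hom Simp m n|] ==> Fm X n m b \<cdot> x \<in> Hom C a (Fo X m)"
 using comp_in[of a "Fo X n" "Fo X m" x] sobj_obj sobj_map by blast

lemma sobj_comp_map:
 "[|a \<in> Obj C; x \<in> Hom C a (Fo X n); b \<in> Hom Simp l m; s \<in> Hom Simp m n|]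
  ==> Fm X m l b \<cdot> (Fm X n m s \<cdot> x) = Fm X n l (map ((!) s) b) \<cdot> x"
 using assoc[of a "Fo X n" "Fo X m" "Fo X l" x "Fm X n m s" "Fm X m l b"] sobj_obj sobj_map sobj_comp
 by simp

lemma sobj_id_map: "[|a \<in> Obj C; x \<in> Hom C a (Fo X n)|] ==> Fm X n n [0..<Suc n] \<cdot> x = x"
 using id_left sobj_obj by (simp add: sobj_id del: upt_Suc)

end

lemma snat_in: "snat X Y p ==> p n \<in> Hom C (Fo X n) (Fo Y n)"
 by (simp add: is_nat_trans_def)

lemma snat_nat:
 "[|snat X Y p; a \<in> Hom Simp m n|] ==> Fm Y n m a \<cdot> p n = p m \<cdot> Fm X n m a"
 by (simp add: is_nat_trans_def)

end

context abelian_tensor_category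
begin

section \<open>Alternating sums of morphisms\<close>

lemma alt_sum_0: "[|a \<in> Obj C; b \<in> Obj C; f 0 \<in> Hom C a b|] ==> alt_sum C a b f 0 = f 0"
proof -
 assume *: "a \<in> Obj C" "b \<in> Obj C" "f 0 \<in> Hom C a b"
 interpret G: comm_group "hom_group C a b" using * by (intro hom_comm_group)
 have "f 0 [^]\<^bsub>hom_group C a b\<^esub> (1::int) = f 0" using * by (simp add: G.int_pow_1)
 thus ?thesis using * by (simp add: alt_sum_def G.finprod_singleton plus_zero)
qed

text \<open>Replaces the group exponent by a case distinction. Only the exponents 1 and -1 occur, so
  every value other than 1 is read as -1.\<close>

definition signed :: "'o => 'o => int => 'm => 'm" where
 "signed a b z f = (if z = 1 then f else Neg a b f)"

lemma signed_in: "[|a \<in> Obj C; b \<in> Obj C; f \<in> Hom C a b|] ==> signed a b z f \<in> Hom C a b"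
 by (simp add: signed_def neg_in)

lemma int_pow_signed:
 assumes "a \<in> Obj C" "b \<in> Obj C" "f \<in> Hom C a b" "z = 1 \<or> z = -1"
 shows "f [^]\<^bsub>hom_group C a b\<^esub> (z::int) = signed a b z f"
proof -
 interpret G: comm_group "hom_group C a b" using assms by (intro hom_comm_group)
 show ?thesis using assms G.int_pow_1[of f] G.int_pow_neg[of f 1] by (auto simp: signed_def Neg_def)
qed

lemma signed_comp:
 assumes "a \<in> Obj C" "b \<in> Obj C" "c \<in> Obj C" "f \<in> Hom C a b" "g \<in> Hom C b c"
 shows "g \<cdot> signed a b z f = signed a c z (g \<cdot> f)" "signed b c z g \<cdot> f = signed a c z (g \<cdot> f)"
 using assms by (simp_all add: signed_def comp_neg_left comp_neg_right)

lemma alt_sum_in: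
 assumes "a \<in> Obj C" "b \<in> Obj C" "!!i. i \<le> j ==> f i \<in> Hom C a b"
 shows "alt_sum C a b f j \<in> Hom C a b"
proof -
 interpret G: comm_group "hom_group C a b" using assms by (intro hom_comm_group)
 have "f i [^]\<^bsub>hom_group C a b\<^esub> ((- 1 :: int) ^ i) \<in> carrier (hom_group C a b)" if "i \<le> j" for i
  using G.int_pow_closed[of "f i"] assms that by auto
 hence "(\<lambda>i. f i [^]\<^bsub>hom_group C a b\<^esub> ((- 1 :: int) ^ i)) \<in> {..j} \<rightarrow> carrier (hom_group C a b)"
  by auto
 from G.finprod_closed[OF this] show ?thesis by (simp add: alt_sum_def)
qed

lemma alt_sum_Suc:
 assumes "a \<in> Obj C" "b \<in> Obj C" "!!i. i \<le> Suc j ==> f i \<in> Hom C a b"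
 shows "alt_sum C a b f (Suc j) = Plus C (alt_sum C a b f j) (signed a b ((-1) ^ Suc j) (f (Suc j)))"
proof -
 interpret G: comm_group "hom_group C a b" using assms by (intro hom_comm_group)
 let ?g = "\<lambda>i. f i [^]\<^bsub>hom_group C a b\<^esub> ((- 1 :: int) ^ i)"
 have g: "?g i \<in> carrier (hom_group C a b)" if "i \<le> Suc j" for i
  using G.int_pow_closed[of "f i"] assms that by auto
 hence *: "?g \<in> {..j} \<rightarrow> carrier (hom_group C a b)" "?g (Suc j) \<in> carrier (hom_group C a b)"
  using g[of "Suc j"] by (auto simp del: power_Suc)
 have "alt_sum C a b f (Suc j) = Plus C (?g (Suc j)) (alt_sum C a b f j)"
  using G.finprod_insert[of "{..j}" "Suc j" ?g] * by (simp add: alt_sum_def atMost_Suc)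
 also have "?g (Suc j) = signed a b ((-1) ^ Suc j) (f (Suc j))"
  using assms minus_one_power_iff[of "Suc j", where 'a = int] by (intro int_pow_signed) (auto split: if_splits)
 finally show ?thesis
  using assms by (simp add: plus_comm alt_sum_in signed_in)
qed

lemma alt_sum_cong:
 assumes "a \<in> Obj C" "b \<in> Obj C" "!!i. i \<le> j ==> f i \<in> Hom C a b" "!!i. i \<le> j ==> f i = g i"
 shows "alt_sum C a b f j = alt_sum C a b g j"
proof -
 have "!!i. i \<le> j ==> g i \<in> Hom C a b" using assms(3,4) by metis
 thus ?thesis using assms(3,4)
 proof (induction j)
  case (Suc j) thus ?case using assms(1,2) by (simp add: alt_sum_Suc)
 qed (use assms(1,2) in \<open>simp add: alt_sum_0\<close>)
qed

lemma comp_alt_sum: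
 assumes o: "a \<in> Obj C" "b \<in> Obj C" "c \<in> Obj C" and g: "g \<in> Hom C b c"
  and f: "!!i. i \<le> j ==> f i \<in> Hom C a b"
 shows "g \<cdot> alt_sum C a b f j = alt_sum C a c (\<lambda>i. g \<cdot> f i) j"
 using f
proof (induction j)
 case 0 thus ?case using o g by (simp add: alt_sum_0 comp_in[of a b c])
next
 case (Suc j)
 have "g \<cdot> alt_sum C a b f (Suc j) = g \<cdot> Plus C (alt_sum C a b f j) (signed a b ((-1) ^ Suc j) (f (Suc j)))"
  using o Suc.prems by (simp only: alt_sum_Suc)
 also have "\<dots> = Plus C (alt_sum C a c (\<lambda>i. g \<cdot> f i) j) (signed a c ((-1) ^ Suc j) (g \<cdot> f (Suc j)))"
  using o g Suc by (simp add: comp_add_right[OF o] alt_sum_in signed_in signed_comp[OF o])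
 also have "\<dots> = alt_sum C a c (\<lambda>i. g \<cdot> f i) (Suc j)"
  using o g Suc.prems by (simp only: alt_sum_Suc comp_in[of a b c])
 finally show ?case .
qed

lemma alt_sum_comp:
 assumes o: "a \<in> Obj C" "b \<in> Obj C" "c \<in> Obj C" and g: "g \<in> Hom C a b"
  and f: "!!i. i \<le> j ==> f i \<in> Hom C b c"
 shows "alt_sum C b c f j \<cdot> g = alt_sum C a c (\<lambda>i. f i \<cdot> g) j"
 using f
proof (induction j)
 case 0 thus ?case using o g by (simp add: alt_sum_0 comp_in[of a b c])
next
 case (Suc j)
 have "alt_sum C b c f (Suc j) \<cdot> g = Plus C (alt_sum C b c f j) (signed b c ((-1) ^ Suc j) (f (Suc j))) \<cdot> g"
  using o Suc.prems by (simp only: alt_sum_Suc)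
 also have "\<dots> = Plus C (alt_sum C a c (\<lambda>i. f i \<cdot> g) j) (signed a c ((-1) ^ Suc j) (f (Suc j) \<cdot> g))"
  using o g Suc by (simp add: comp_add_left[OF o] alt_sum_in signed_in signed_comp[OF o])
 also have "\<dots> = alt_sum C a c (\<lambda>i. f i \<cdot> g) (Suc j)"
  using o g Suc.prems by (simp only: alt_sum_Suc comp_in[of a b c])
 finally show ?case .
qed

text \<open>Compares the boundaries of two elements that share all faces of positive index.\<close>

lemma alt_sum_sub:
 assumes o: "a \<in> Obj C" "b \<in> Obj C" and "!!i. i \<le> j ==> f i \<in> Hom C a b" "!!i. i \<le> j ==> g i \<in> Hom C a b"
  "!!i. [|0 < i; i \<le> j|] ==> f i = g i"
 shows "Sub a b (alt_sum C a b f j) (alt_sum C a b g j) = Sub a b (f 0) (g 0)"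
 using assms(3-5)
proof (induction j)
 case 0 thus ?case using o by (simp add: alt_sum_0)
next
 case (Suc j)
 let ?s = "signed a b ((-1) ^ Suc j) (g (Suc j))"
 have in1: "alt_sum C a b f j \<in> Hom C a b" "alt_sum C a b g j \<in> Hom C a b" "?s \<in> Hom C a b"
  using o Suc.prems by (simp_all add: alt_sum_in signed_in)
 have "alt_sum C a b f (Suc j) = Plus C (alt_sum C a b f j) ?s"
  using o Suc.prems(1) Suc.prems(3)[of "Suc j"] by (simp add: alt_sum_Suc)
 moreover have "alt_sum C a b g (Suc j) = Plus C (alt_sum C a b g j) ?s"
  using o Suc.prems(2) by (simp add: alt_sum_Suc)
 moreover have "Sub a b (Plus C u v) (Plus C w v) = Sub a b u w"
  if "u \<in> Hom C a b" "v \<in> Hom C a b" "w \<in> Hom C a b" for u v w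
  using o that by (subst sub_eq_iff) (simp_all add: plus_in sub_in plus_assoc[symmetric] sub_plus)
 ultimately show ?case using Suc in1 by simp
qed

lemma alt_sum_single:
 assumes o: "a \<in> Obj C" "b \<in> Obj C" and "!!i. i \<le> j ==> f i \<in> Hom C a b"
  "!!i. [|0 < i; i \<le> j|] ==> f i = Zero C a b"
 shows "alt_sum C a b f j = f 0"
 using assms(3-)
proof (induction j)
 case 0 thus ?case using o by (simp add: alt_sum_0)
next
 case (Suc j)
 thus ?case using o by (simp add: alt_sum_Suc signed_def neg_zero plus_zero)
qed

text \<open>The shape of a boundary of a degenerate element: the terms at \<open>k\<close> and
  \<open>k + 1\<close> are equal and carry opposite signs, everything else vanishes.\<close>

lemma alt_sum_pair:
 assumes o: "a \<in> Obj C" "b \<in> Obj C" and f: "!!i. i \<le> j ==> f i \<in> Hom C a b"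
  and k: "k < j" "f k = f (Suc k)"
  and zero: "!!i. [|i \<le> j; i \<noteq> k; i \<noteq> Suc k|] ==> f i = Zero C a b"
 shows "alt_sum C a b f j = Zero C a b"
proof -
 have z: "signed a b z (Zero C a b) = Zero C a b" for z using o by (simp add: signed_def neg_zero)
 have lt: "alt_sum C a b f i = Zero C a b" if "i < k" for i
  using that
 proof (induction i)
  case 0 thus ?case using o zero[of 0] k by (simp add: alt_sum_0 zero_in)
 next
  case (Suc i)
  hence "alt_sum C a b f (Suc i) = Plus C (alt_sum C a b f i) (signed a b ((-1) ^ Suc i) (f (Suc i)))"
   using o f k by (intro alt_sum_Suc) auto
  thus ?case using Suc o zero[of "Suc i"] k by (simp add: z plus_zero zero_in)
 qed
 have eq: "alt_sum C a b f k = signed a b ((-1) ^ k) (f k)"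
 proof (cases k)
  case 0 thus ?thesis using o f by (simp add: alt_sum_0 signed_def)
 next
  case (Suc i)
  hence "alt_sum C a b f (Suc i) = Plus C (alt_sum C a b f i) (signed a b ((-1) ^ Suc i) (f (Suc i)))"
   using o f k by (intro alt_sum_Suc) auto
  moreover have "f (Suc i) \<in> Hom C a b" using f[of "Suc i"] k Suc by simp
  ultimately show ?thesis using Suc o lt[of i] by (simp add: plus_zero signed_in)
 qed
 have fk: "f k \<in> Hom C a b" using f k by simp
 have s: "alt_sum C a b f (Suc k) = Zero C a b"
 proof -
  have "alt_sum C a b f (Suc k) = Plus C (signed a b ((-1) ^ k) (f k)) (signed a b ((-1) ^ Suc k) (f k))"
   using o f k by (subst alt_sum_Suc) (auto simp: eq)
  also have "\<dots> = Zero C a b"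
   using o fk minus_one_power_iff[of k, where 'a = int] by (auto simp: signed_def plus_neg split: if_splits)
  finally show ?thesis .
 qed
 have "alt_sum C a b f i = Zero C a b" if "Suc k \<le> i" "i \<le> j" for i
  using that
 proof (induction i rule: dec_induct)
  case base show ?case by (rule s)
 next
  case (step i)
  hence "alt_sum C a b f (Suc i) = Plus C (alt_sum C a b f i) (signed a b ((-1) ^ Suc i) (f (Suc i)))"
   using o f by (intro alt_sum_Suc) auto
  thus ?case using step o zero[of "Suc i"] by (simp add: z plus_zero zero_in)
 qed
 thus ?thesis using k by simp
qed

section \<open>Horn filling in simplicial objects\<close>

context
 fixes X
 assumes X: "simplicial X"
begin

text \<open>Morphisms from \<open>a\<close> serve as generalized elements. Adding
  \<open>s_i (x - d_{i+1} w)\<close> makes face \<open>i + 1\<close> equal to \<open>x\<close>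
  because \<open>d_{i+1} s_i = 1\<close>. A higher face \<open>j\<close> stays the same for
  compatible \<open>x\<close>, since \<open>d_j s_i = s_i d_{j-1}\<close> and \<open>d_{j-1}\<close>
  kills \<open>x - d_{i+1} w\<close>.\<close>

lemma face_degen_corr:
 assumes a: "a \<in> Obj C" and w: "w \<in> Hom C a (Fo X (Suc n))" and x: "x \<in> Hom C a (Fo X n)" and i: "i \<le> n"
 defines "w' \<equiv> Plus C w (Fm X n (Suc n) (degen (Suc n) i) \<cdot> Sub a (Fo X n) x (Fm X (Suc n) n (face (Suc n) (Suc i)) \<cdot> w))"
 shows "w' \<in> Hom C a (Fo X (Suc n))"
  and "Fm X (Suc n) n (face (Suc n) (Suc i)) \<cdot> w' = x"
  and "[|Suc i < j; j \<le> Suc n;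
     Fm X n (n - 1) (face n (j - 1)) \<cdot> x = Fm X n (n - 1) (face n (Suc i)) \<cdot> (Fm X (Suc n) n (face (Suc n) j) \<cdot> w)|]
   ==> Fm X (Suc n) n (face (Suc n) j) \<cdot> w' = Fm X (Suc n) n (face (Suc n) j) \<cdot> w"
proof -
 let ?s = "Fm X n (Suc n) (degen (Suc n) i)" and ?d = "\<lambda>i. Fm X (Suc n) n (face (Suc n) i)"
 let ?z = "Sub a (Fo X n) x (?d (Suc i) \<cdot> w)"
 note o = sobj_obj[OF X]
 have dw: "?d j \<cdot> w \<in> Hom C a (Fo X n)" if "j \<le> Suc n" for j
  using that by (intro sobj_map_in[OF X a w] face_hom)
 have z: "?z \<in> Hom C a (Fo X n)" using a o x dw i by (intro sub_in) auto
 have sz: "?s \<cdot> ?z \<in> Hom C a (Fo X (Suc n))" using i by (intro sobj_map_in[OF X a z] degen_hom)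
 show w': "w' \<in> Hom C a (Fo X (Suc n))" unfolding w'_def using a o w sz by (intro plus_in)
 have dw': "?d j \<cdot> w' = Plus C (?d j \<cdot> w) (?d j \<cdot> (?s \<cdot> ?z))" if "j \<le> Suc n" for j
  unfolding w'_def using that by (intro comp_add_right[OF a o[of "Suc n"] o[of n] w sz] sobj_map[OF X] face_hom)
 have ds: "?d (Suc i) \<cdot> (?s \<cdot> ?z) = ?z"
  using i sobj_comp_map[OF X a z face_hom[of "Suc i" n] degen_hom[of i n]]
  by (simp add: degen_face_id sobj_id_map[OF X a z] del: upt_Suc)
 show "?d (Suc i) \<cdot> w' = x"
  using i dw'[of "Suc i"] ds plus_sub[OF a o x dw[of "Suc i"]] by simp
 show "?d j \<cdot> w' = ?d j \<cdot> w" if j: "Suc i < j" "j \<le> Suc n"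
  and eq: "Fm X n (n - 1) (face n (j - 1)) \<cdot> x = Fm X n (n - 1) (face n (Suc i)) \<cdot> (?d j \<cdot> w)"
 proof -
  obtain m where m: "n = Suc m" using i j by (cases n) auto
  have fh: "face n (j - 1) \<in> Hom Simp m n" "face n (Suc i) \<in> Hom Simp m n"
   using j i unfolding m by (auto intro!: face_hom)
  have dh: "degen n i \<in> Hom Simp n m" using j i unfolding m by (intro degen_hom) auto
  have "?d j \<cdot> (?s \<cdot> ?z) = Fm X m n (degen n i) \<cdot> (Fm X n m (face n (j - 1)) \<cdot> ?z)"
   using j i sobj_comp_map[OF X a z face_hom[of j n] degen_hom[of i n]]
    sobj_comp_map[OF X a z dh fh(1)]
   unfolding m by (simp add: degen_face_greater)
  also have "Fm X n m (face n (j - 1)) \<cdot> ?z =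
    Sub a (Fo X m) (Fm X n m (face n (j - 1)) \<cdot> x) (Fm X n m (face n (j - 1)) \<cdot> (?d (Suc i) \<cdot> w))"
   using i by (intro comp_sub_right[OF a o[of n] o[of m] x dw] sobj_map[OF X] fh) auto
  also have "Fm X n m (face n (j - 1)) \<cdot> (?d (Suc i) \<cdot> w) = Fm X n m (face n (Suc i)) \<cdot> (?d j \<cdot> w)"
   using j i sobj_comp_map[OF X a w fh(1) face_hom[of "Suc i" n]] sobj_comp_map[OF X a w fh(2) face_hom[of j n]]
    face_face[of "Suc i" j m] m by simp
  also have "Sub a (Fo X m) (Fm X n m (face n (j - 1)) \<cdot> x) (Fm X n m (face n (Suc i)) \<cdot> (?d j \<cdot> w)) = Zero C a (Fo X m)"
  proof -
   have "Fm X n m (face n (Suc i)) \<cdot> (?d j \<cdot> w) \<in> Hom C a (Fo X m)"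
    using sobj_map_in[OF X a dw[OF j(2)] fh(2)] .
   thus ?thesis using eq m a o by (simp add: sub_self)
  qed
  also have "Fm X m n (degen n i) \<cdot> Zero C a (Fo X m) = Zero C a (Fo X n)"
   using i j m by (intro comp_zero_right[OF a o[of m] o[of n]] sobj_map[OF X]) (auto intro: degen_hom)
  finally have *: "?d j \<cdot> (?s \<cdot> ?z) = Zero C a (Fo X n)" .
  show ?thesis using dw'[OF j(2)] dw[OF j(2)] a o unfolding * by (simp add: plus_zero)
 qed
qed

lemma kan_filler:
 assumes a: "a \<in> Obj C" and x: "!!i. [|0 < i; i \<le> Suc n|] ==> x i \<in> Hom C a (Fo X n)"
  and compat: "!!i j. [|0 < i; i < j; j \<le> Suc n|] ==>
   Fm X n (n - 1) (face n (j - 1)) \<cdot> x i = Fm X n (n - 1) (face n i) \<cdot> x j"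
 shows "\<exists>w\<in>Hom C a (Fo X (Suc n)). \<forall>i. 0 < i \<and> i \<le> Suc n --> Fm X (Suc n) n (face (Suc n) i) \<cdot> w = x i"
proof -
 have "\<exists>w\<in>Hom C a (Fo X (Suc n)). \<forall>i. Suc n - r < i \<and> i \<le> Suc n --> Fm X (Suc n) n (face (Suc n) i) \<cdot> w = x i"
  if "r \<le> Suc n" for r
  using that
 proof (induction r)
  case 0
  show ?case using zero_in[OF a sobj_obj[OF X]] by (intro bexI[of _ "Zero C a (Fo X (Suc n))"]) auto
 next
  case (Suc r)
  then obtain w where w: "w \<in> Hom C a (Fo X (Suc n))"
   "!!i. Suc n - r < i ==> i \<le> Suc n ==> Fm X (Suc n) n (face (Suc n) i) \<cdot> w = x i"
   by auto
  let ?i = "n - r"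
  have i: "?i \<le> n" "Suc ?i = Suc n - r" using Suc.prems by auto
  note c = face_degen_corr[OF a w(1) x[of "Suc ?i"] i(1)]
  let ?w = "Plus C w (Fm X n (Suc n) (degen (Suc n) ?i) \<cdot> Sub a (Fo X n) (x (Suc ?i)) (Fm X (Suc n) n (face (Suc n) (Suc ?i)) \<cdot> w))"
  have "Fm X (Suc n) n (face (Suc n) j) \<cdot> ?w = x j" if j: "Suc n - Suc r < j" "j \<le> Suc n" for j
  proof (cases "j = Suc ?i")
   case True thus ?thesis using c(2) i by simp
  next
   case False
   hence "Suc ?i < j" using j i by auto
   thus ?thesis using c(3)[of j] i w(2)[of j] j compat[of "Suc ?i" j] by simp
  qed
  moreover have "?w \<in> Hom C a (Fo X (Suc n))" using c(1) i by simp
  ultimately show ?case by blast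
 qed
 from this[of "Suc n"] show ?thesis by auto
qed

end

section \<open>Moore complex and normalized quotient\<close>

abbreviation "nobj \<equiv> norm_obj C"

abbreviation "nproj \<equiv> norm_proj C"

lemma zero_sub: "[|a \<in> Obj C; b \<in> Obj C; f \<in> Hom C a b|] ==> Sub a b (Zero C a b) f = Neg a b f"
 by (simp add: Sub_def plus_zero neg_in)

context
 fixes X
 assumes X: "simplicial X"
begin

text \<open>The idempotent \<open>(1 - s\<^sub>0 d\<^sub>1) \<cdots> (1 - s\<^sub>n\<^sub>-\<^sub>1 d\<^sub>n)\<close> onto the Moore complex splits off the degenerate part.\<close>

lemma moore_projection:
 "\<exists>P\<in>Hom C (Fo X n) (Fo X n).
   (\<forall>i. 0 < i \<and> i \<le> n --> Fm X n (n - 1) (face n i) \<cdot> P = Zero C (Fo X n) (Fo X (n - 1))) \<and>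
   (\<forall>a\<in>Obj C. \<forall>x\<in>Hom C a (Fo X n).
    (\<forall>i. 0 < i \<and> i \<le> n --> Fm X n (n - 1) (face n i) \<cdot> x = Zero C a (Fo X (n - 1))) --> P \<cdot> x = x) \<and>
   (\<forall>b\<in>Obj C. \<forall>q\<in>Hom C (Fo X n) b.
    (\<forall>i<n. q \<cdot> Fm X (n - 1) n (degen n i) = Zero C (Fo X (n - 1)) b) --> q \<cdot> P = q) \<and>
   (\<forall>k<n. P \<cdot> Fm X (n - 1) n (degen n k) = Zero C (Fo X (n - 1)) (Fo X n))"
proof (cases n)
 case 0
 thus ?thesis
  using id_in[OF sobj_obj[OF X]] id_left id_right sobj_obj[OF X] by (intro bexI[of _ "Idm C (Fo X 0)"]) auto
next
 case (Suc m)
 note o = sobj_obj[OF X]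
 define s where "s = (\<lambda>i. Fm X m (Suc m) (degen (Suc m) i))"
 define d where "d = (\<lambda>i. Fm X (Suc m) m (face (Suc m) i))"
 have s_in: "s i \<in> Hom C (Fo X m) (Fo X (Suc m))" if "i \<le> m" for i
  using that sobj_map[OF X degen_hom] by (simp add: s_def)
 have d_in: "d i \<in> Hom C (Fo X (Suc m)) (Fo X m)" if "i \<le> Suc m" for i
  using that sobj_map[OF X face_hom] by (simp add: d_def)
 let ?O = "Fo X (Suc m)"
 \<comment> \<open>\<open>P\<close> is the product of the last \<open>r\<close> factors. The clause
   \<open>P s_k = s_k U\<close> for the degeneracies not yet killed is what lets the next factor
   kill \<open>s_i\<close>, since \<open>(1 - s_i d_{i+1}) s_i = 0\<close>.\<close>
 have "\<exists>P\<in>Hom C ?O ?O.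
   (\<forall>j. Suc m - r < j \<and> j \<le> Suc m --> d j \<cdot> P = Zero C ?O (Fo X m)) \<and>
   (\<forall>a\<in>Obj C. \<forall>x\<in>Hom C a ?O.
    (\<forall>i. 0 < i \<and> i \<le> Suc m --> d i \<cdot> x = Zero C a (Fo X m)) --> P \<cdot> x = x) \<and>
   (\<forall>b\<in>Obj C. \<forall>q\<in>Hom C ?O b. (\<forall>i\<le>m. q \<cdot> s i = Zero C (Fo X m) b) --> q \<cdot> P = q) \<and>
   (\<forall>k\<le>m. (Suc m - r \<le> k --> P \<cdot> s k = Zero C (Fo X m) ?O) \<and>
    (k < Suc m - r --> (\<exists>U\<in>Hom C (Fo X m) (Fo X m). P \<cdot> s k = s k \<cdot> U)))" if "r \<le> Suc m" for r
  using that
 proof (induction r)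
  case 0
  have "\<exists>U\<in>Hom C (Fo X m) (Fo X m). s k = s k \<cdot> U" if "k \<le> m" for k
   using id_in[OF o[of m]] id_right[OF o o s_in[OF that]] by metis
  thus ?case
   using id_in[OF o[of "Suc m"]] id_left[OF _ o] id_right[OF o] s_in[THEN id_left[OF o o]]
   by (intro bexI[of _ "Idm C ?O"]) auto
 next
  case (Suc r)
  from Suc.IH Suc.prems obtain P where P: "P \<in> Hom C ?O ?O"
   and P1: "!!j. [|Suc m - r < j; j \<le> Suc m|] ==> d j \<cdot> P = Zero C ?O (Fo X m)"
   and P2: "!!a x. [|a \<in> Obj C; x \<in> Hom C a ?O; !!i. [|0 < i; i \<le> Suc m|] ==> d i \<cdot> x = Zero C a (Fo X m)|] ==> P \<cdot> x = x"
   and P3: "!!b q. [|b \<in> Obj C; q \<in> Hom C ?O b; !!i. i \<le> m ==> q \<cdot> s i = Zero C (Fo X m) b|] ==> q \<cdot> P = q"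
   and P4: "!!k. [|k \<le> m; Suc m - r \<le> k|] ==> P \<cdot> s k = Zero C (Fo X m) ?O"
   and P5: "!!k. [|k \<le> m; k < Suc m - r|] ==> \<exists>U\<in>Hom C (Fo X m) (Fo X m). P \<cdot> s k = s k \<cdot> U"
   by auto
  define i where "i = m - r"
  have i: "i \<le> m" "Suc i = Suc m - r" using Suc.prems by (auto simp: i_def)
  let ?Z = "Zero C ?O (Fo X m)"
  \<comment> \<open>This is \<open>(1 - s_i d_{i+1}) P\<close>, written as the correction of
    \<open>face_degen_corr\<close> with prescribed face 0, so that its statements on faces
    apply.\<close>
  define P' where "P' = Plus C P (s i \<cdot> Sub ?O (Fo X m) ?Z (d (Suc i) \<cdot> P))"
  have dP: "d (Suc i) \<cdot> P \<in> Hom C ?O (Fo X m)" using i by (intro comp_in[OF o o o P d_in]) auto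
  have n_in: "Neg ?O (Fo X m) (d (Suc i) \<cdot> P) \<in> Hom C ?O (Fo X m)" using o dP by (intro neg_in)
  have sn_in: "s i \<cdot> Neg ?O (Fo X m) (d (Suc i) \<cdot> P) \<in> Hom C ?O ?O" using i by (intro comp_in[OF o o o n_in] s_in)
  have P'_eq: "P' = Plus C P (s i \<cdot> Neg ?O (Fo X m) (d (Suc i) \<cdot> P))"
   using o dP by (simp add: P'_def zero_sub)
  note corr = face_degen_corr[OF X o P zero_in[OF o o] i(1), folded s_def d_def P'_def]
  have P': "P' \<in> Hom C ?O ?O" using corr(1) by (simp add: P'_def s_def d_def)
  have P'_comp: "P' \<cdot> h = Plus C (P \<cdot> h) (s i \<cdot> Neg a (Fo X m) (d (Suc i) \<cdot> (P \<cdot> h)))"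
   if a: "a \<in> Obj C" and h: "h \<in> Hom C a ?O" for a h
  proof -
   have "P' \<cdot> h = Plus C (P \<cdot> h) ((s i \<cdot> Neg ?O (Fo X m) (d (Suc i) \<cdot> P)) \<cdot> h)"
    unfolding P'_eq by (rule comp_add_left[OF a o o h P sn_in])
   also have "(s i \<cdot> Neg ?O (Fo X m) (d (Suc i) \<cdot> P)) \<cdot> h = s i \<cdot> (Neg ?O (Fo X m) (d (Suc i) \<cdot> P) \<cdot> h)"
    by (rule assoc[OF a o o o h n_in s_in[OF i(1)]])
   also have "Neg ?O (Fo X m) (d (Suc i) \<cdot> P) \<cdot> h = Neg a (Fo X m) ((d (Suc i) \<cdot> P) \<cdot> h)"
    by (rule comp_neg_left[OF a o o h dP])
   also have "(d (Suc i) \<cdot> P) \<cdot> h = d (Suc i) \<cdot> (P \<cdot> h)"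
    using i by (intro assoc[OF a o o o h P d_in]) auto
   finally show ?thesis .
  qed
  show ?case
  proof (intro bexI[OF _ P'] conjI ballI allI impI)
   fix j assume j: "Suc m - Suc r < j \<and> j \<le> Suc m"
   show "d j \<cdot> P' = Zero C ?O (Fo X m)"
   proof (cases "j = Suc i")
    case True
    thus ?thesis using corr(2) by (simp add: P'_def s_def d_def)
   next
    case False
    hence j': "Suc i < j" "j \<le> Suc m" using i j by auto
    have dj: "d j \<cdot> P = ?Z" using P1 j' i by simp
    have "Fm X m (m - 1) (face m (j - 1)) \<cdot> ?Z = Fm X m (m - 1) (face m (Suc i)) \<cdot> (d j \<cdot> P)"
    proof -
     obtain l where l: "m = Suc l" using j' by (cases m) auto
     have "Fm X m (m - 1) (face m (j - 1)) \<cdot> ?Z = Zero C ?O (Fo X l)"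
      "Fm X m (m - 1) (face m (Suc i)) \<cdot> ?Z = Zero C ?O (Fo X l)"
      using j' l by (auto intro!: comp_zero_right[OF o o o sobj_map[OF X face_hom]])
     thus ?thesis by (simp add: dj)
    qed
    hence "d j \<cdot> P' = d j \<cdot> P" using corr(3)[of j] j' by (simp add: P'_def s_def d_def)
    thus ?thesis using dj by simp
   qed
  next
   fix a x assume ax: "a \<in> Obj C" "x \<in> Hom C a ?O" "\<forall>i. 0 < i \<and> i \<le> Suc m --> d i \<cdot> x = Zero C a (Fo X m)"
   hence "P \<cdot> x = x" "d (Suc i) \<cdot> x = Zero C a (Fo X m)" using P2 i by auto
   thus "P' \<cdot> x = x"
    using P'_comp[OF ax(1,2)] ax o comp_zero_right[OF ax(1) o o s_in[OF i(1)]] by (simp add: neg_zero plus_zero)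
  next
   fix b q assume bq: "b \<in> Obj C" "q \<in> Hom C ?O b" "\<forall>i\<le>m. q \<cdot> s i = Zero C (Fo X m) b"
   have "q \<cdot> P' = Plus C (q \<cdot> P) (q \<cdot> (s i \<cdot> Neg ?O (Fo X m) (d (Suc i) \<cdot> P)))"
    unfolding P'_eq by (rule comp_add_right[OF o o bq(1) P sn_in bq(2)])
   also have "q \<cdot> (s i \<cdot> Neg ?O (Fo X m) (d (Suc i) \<cdot> P)) = (q \<cdot> s i) \<cdot> Neg ?O (Fo X m) (d (Suc i) \<cdot> P)"
    by (rule assoc[OF o o o bq(1) n_in s_in[OF i(1)] bq(2), symmetric])
   also have "\<dots> = Zero C ?O b" using bq i comp_zero_left[OF o o bq(1) n_in] by simp
   finally show "q \<cdot> P' = q" using P3[OF bq(1,2)] bq o by (simp add: plus_zero)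
  next
   fix k assume k: "k \<le> m" "Suc m - Suc r \<le> k"
   show "P' \<cdot> s k = Zero C (Fo X m) ?O"
   proof (cases "k = i")
    case True
    then obtain U where U: "U \<in> Hom C (Fo X m) (Fo X m)" "P \<cdot> s i = s i \<cdot> U" using P5[of i] i k by auto
    have "d (Suc i) \<cdot> (s i \<cdot> U) = U"
     using sobj_comp_map[OF X o U(1) face_hom[of "Suc i" m] degen_hom[of i m]] i sobj_id_map[OF X o U(1)]
     by (simp add: d_def s_def degen_face_id del: upt_Suc)
    hence "P' \<cdot> s i = Plus C (s i \<cdot> U) (s i \<cdot> Neg (Fo X m) (Fo X m) U)"
     using P'_comp[OF o s_in[OF i(1)]] U by simp
    also have "\<dots> = s i \<cdot> Plus C U (Neg (Fo X m) (Fo X m) U)"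
     by (rule comp_add_right[OF o o o U(1) neg_in[OF o o U(1)] s_in[OF i(1)], symmetric])
    also have "\<dots> = Zero C (Fo X m) ?O"
     using U(1) o comp_zero_right[OF o o o s_in[OF i(1)]] by (simp add: plus_neg)
    finally show ?thesis using True by simp
   next
    case False
    hence "P \<cdot> s k = Zero C (Fo X m) ?O" using P4[of k] k i by auto
    moreover have "d (Suc i) \<cdot> Zero C (Fo X m) ?O = Zero C (Fo X m) (Fo X m)"
     using i by (intro comp_zero_right[OF o o o d_in]) auto
    ultimately show ?thesis
     using P'_comp[OF o s_in[OF k(1)]] o comp_zero_right[OF o o o s_in[OF i(1)]]
     by (simp add: neg_zero plus_zero zero_in)
   qed
  next
   fix k assume k: "k \<le> m" "k < Suc m - Suc r"
   hence ki: "k < i" using i by auto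
   then obtain U where U: "U \<in> Hom C (Fo X m) (Fo X m)" "P \<cdot> s k = s k \<cdot> U" using P5[of k] i k by auto
   obtain l where l: "m = Suc l" using ki i by (cases m) auto
   have dh: "degen m k \<in> Hom Simp m l" "degen m (i - 1) \<in> Hom Simp m l" "face m i \<in> Hom Simp l m"
    using ki i unfolding l by (auto intro!: face_hom degen_hom)
   let ?y = "Fm X m l (face m i) \<cdot> U"
   have y: "?y \<in> Hom C (Fo X m) (Fo X l)" by (rule sobj_map_in[OF X o U(1) dh(3)])
   have ny: "Neg (Fo X m) (Fo X l) ?y \<in> Hom C (Fo X m) (Fo X l)" by (rule neg_in[OF o o y])
   \<comment> \<open>From \<open>d_{i+1} s_k = s_k d_i\<close> and
     \<open>s_i s_k = s_k s_{i-1}\<close> the new right factor of \<open>s_k\<close> is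
     \<open>U - s_{i-1} d_i U\<close>.\<close>
   let ?V = "Fm X l m (degen m (i - 1)) \<cdot> Neg (Fo X m) (Fo X l) ?y"
   have V: "?V \<in> Hom C (Fo X m) (Fo X m)" by (rule sobj_map_in[OF X o ny dh(2)])
   have "d (Suc i) \<cdot> (s k \<cdot> U) = Fm X l m (degen m k) \<cdot> ?y"
    using sobj_comp_map[OF X o U(1) face_hom[of "Suc i" m] degen_hom[of k m]]
     sobj_comp_map[OF X o U(1) dh(1,3)] ki i(1)
    unfolding d_def s_def l by (simp add: degen_face_greater)
   hence "P' \<cdot> s k = Plus C (s k \<cdot> U) (s i \<cdot> Neg (Fo X m) (Fo X m) (Fm X l m (degen m k) \<cdot> ?y))"
    using P'_comp[OF o s_in[OF k(1)]] U by simp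
   also have "Neg (Fo X m) (Fo X m) (Fm X l m (degen m k) \<cdot> ?y) = Fm X l m (degen m k) \<cdot> Neg (Fo X m) (Fo X l) ?y"
    by (rule comp_neg_right[OF o o o y sobj_map[OF X dh(1)], symmetric])
   also have "s i \<cdot> (Fm X l m (degen m k) \<cdot> Neg (Fo X m) (Fo X l) ?y) = s k \<cdot> ?V"
    using sobj_comp_map[OF X o ny degen_hom[OF i(1)] dh(1)] sobj_comp_map[OF X o ny degen_hom[OF k(1)] dh(2)]
     degen_degen[of k "i - 1" l] ki i(1)
    unfolding s_def l by simp
   also have "Plus C (s k \<cdot> U) (s k \<cdot> ?V) = s k \<cdot> Plus C U ?V"
    by (rule comp_add_right[OF o o o U(1) V s_in[OF k(1)], symmetric])
   finally show "\<exists>U\<in>Hom C (Fo X m) (Fo X m). P' \<cdot> s k = s k \<cdot> U"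
    using plus_in[OF o o U(1) V] by blast
  qed
 qed
 from this[of "Suc m"] obtain P where "P \<in> Hom C ?O ?O"
  "\<forall>j. 0 < j \<and> j \<le> Suc m --> d j \<cdot> P = Zero C ?O (Fo X m)"
  "\<forall>a\<in>Obj C. \<forall>x\<in>Hom C a ?O.
    (\<forall>i. 0 < i \<and> i \<le> Suc m --> d i \<cdot> x = Zero C a (Fo X m)) --> P \<cdot> x = x"
  "\<forall>b\<in>Obj C. \<forall>q\<in>Hom C ?O b. (\<forall>i\<le>m. q \<cdot> s i = Zero C (Fo X m) b) --> q \<cdot> P = q"
  "\<forall>k\<le>m. P \<cdot> s k = Zero C (Fo X m) ?O"
  by auto
 thus ?thesis unfolding Suc s_def d_def
  by (intro bexI[of _ P]) (simp_all add: less_Suc_eq_le)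
qed

text \<open>A morphism kills all degeneracies exactly if it is fixed by composition with the Moore
  projector \<open>P\<close>. So the quotient by all degeneracies is the cokernel of the single
  endomorphism \<open>1 - P\<close>.\<close>

lemma norm_quotient_exists: "\<exists>N q. is_norm_quotient C X n N q"
proof -
 note o = sobj_obj[OF X]
 obtain P where P: "P \<in> Hom C (Fo X n) (Fo X n)"
  and P3: "\<forall>b\<in>Obj C. \<forall>q\<in>Hom C (Fo X n) b.
    (\<forall>i<n. q \<cdot> Fm X (n - 1) n (degen n i) = Zero C (Fo X (n - 1)) b) --> q \<cdot> P = q"
  and P4: "\<forall>k<n. P \<cdot> Fm X (n - 1) n (degen n k) = Zero C (Fo X (n - 1)) (Fo X n)"
  using moore_projection by metis
 let ?c = "Sub (Fo X n) (Fo X n) (Idm C (Fo X n)) P"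
 have c: "?c \<in> Hom C (Fo X n) (Fo X n)" using o P by (intro sub_in id_in)
 obtain N q where Nq: "is_cokernel C (Fo X n) (Fo X n) ?c N q" using cokernels[OF o o c] by blast
 hence N: "N \<in> Obj C" and q: "q \<in> Hom C (Fo X n) N" by (auto simp: is_cokernel_def)
 have iff: "f \<cdot> ?c = Zero C (Fo X n) b \<longleftrightarrow> f \<cdot> P = f" if "b \<in> Obj C" "f \<in> Hom C (Fo X n) b" for b f
  using that o P comp_in[OF o o that(1) P that(2)]
  by (auto simp: comp_sub_right[OF o o that(1)] id_in id_right sub_eq_zero_iff)
 have "is_norm_quotient C X n N q"
  unfolding is_norm_quotient_def
 proof (intro conjI N q allI impI ballI)
  fix i assume i: "i < n"
  have s: "Fm X (n - 1) n (degen n i) \<in> Hom C (Fo X (n - 1)) (Fo X n)"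
   using i sobj_map[OF X degen_hom[of i "n - 1"]] by simp
  have "q \<cdot> P = q" using Nq iff[OF N q] by (simp add: is_cokernel_def)
  thus "q \<cdot> Fm X (n - 1) n (degen n i) = Zero C (Fo X (n - 1)) N"
   using assoc[OF o o o N s P q] P4 i comp_zero_right[OF o o N q] by simp
 next
  fix b f assume "b \<in> Obj C" "f \<in> Hom C (Fo X n) b"
   "\<forall>i<n. f \<cdot> Fm X (n - 1) n (degen n i) = Zero C (Fo X (n - 1)) b"
  thus "\<exists>!h. h \<in> Hom C N b \<and> h \<cdot> q = f"
   using P3 iff Nq by (simp add: is_cokernel_def)
 qed
 thus ?thesis by blast
qed

lemma norm_quotient: "is_norm_quotient C X n (nobj X n) (nproj X n)"
proof -
 have "\<exists>z. case z of (N, q) => is_norm_quotient C X n N q" using norm_quotient_exists by auto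
 hence "case norm_quotient C X n of (N, q) => is_norm_quotient C X n N q"
  unfolding norm_quotient_def by (rule someI_ex)
 thus ?thesis by (simp add: case_prod_unfold)
qed

lemma norm_obj: "nobj X n \<in> Obj C"
 and norm_proj_in: "nproj X n \<in> Hom C (Fo X n) (nobj X n)"
 and norm_proj_degen: "i < n ==> nproj X n \<cdot> Fm X (n - 1) n (degen n i) = Zero C (Fo X (n - 1)) (nobj X n)"
 using norm_quotient[of n] by (simp_all add: is_norm_quotient_def)

lemma norm_proj_univ:
 "[|b \<in> Obj C; f \<in> Hom C (Fo X n) b; !!i. i < n ==> f \<cdot> Fm X (n - 1) n (degen n i) = Zero C (Fo X (n - 1)) b|]
  ==> \<exists>!h. h \<in> Hom C (nobj X n) b \<and> h \<cdot> nproj X n = f"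
 using norm_quotient[of n] by (simp add: is_norm_quotient_def)

text \<open>The Moore projector factors through the quotient \<open>q\<close> as
  \<open>P = s q\<close>, and \<open>q P = q\<close> gives \<open>q s = 1\<close>. This identifies
  the quotient by degeneracies with the common kernel of the faces of positive index: the first part
  is injectivity, the second surjectivity of the identification.\<close>

lemma norm_proj_moore:
 shows moore_unique: "[|a \<in> Obj C; x \<in> Hom C a (Fo X n);
   !!i. [|0 < i; i \<le> n|] ==> Fm X n (n - 1) (face n i) \<cdot> x = Zero C a (Fo X (n - 1));
   nproj X n \<cdot> x = Zero C a (nobj X n)|] ==> x = Zero C a (Fo X n)"
  and moore_representative: "[|a \<in> Obj C; z \<in> Hom C a (nobj X n)|] ==>
   \<exists>y\<in>Hom C a (Fo X n). nproj X n \<cdot> y = z \<and>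
    (\<forall>i. 0 < i \<and> i \<le> n --> Fm X n (n - 1) (face n i) \<cdot> y = Zero C a (Fo X (n - 1)))"
proof -
 note o = sobj_obj[OF X]
 obtain P where P: "P \<in> Hom C (Fo X n) (Fo X n)"
  and P1: "!!i. 0 < i ==> i \<le> n ==> Fm X n (n - 1) (face n i) \<cdot> P = Zero C (Fo X n) (Fo X (n - 1))"
  and P2: "!!a x. a \<in> Obj C ==> x \<in> Hom C a (Fo X n) ==>
    (!!i. 0 < i ==> i \<le> n ==> Fm X n (n - 1) (face n i) \<cdot> x = Zero C a (Fo X (n - 1))) ==> P \<cdot> x = x"
  and P3: "!!b q. b \<in> Obj C ==> q \<in> Hom C (Fo X n) b ==>
    (!!i. i < n ==> q \<cdot> Fm X (n - 1) n (degen n i) = Zero C (Fo X (n - 1)) b) ==> q \<cdot> P = q"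
  and P4: "!!k. k < n ==> P \<cdot> Fm X (n - 1) n (degen n k) = Zero C (Fo X (n - 1)) (Fo X n)"
  using moore_projection[of n] by auto
 let ?q = "nproj X n" and ?N = "nobj X n"
 note N = norm_obj[of n] and q = norm_proj_in[of n]
 obtain s where s: "s \<in> Hom C ?N (Fo X n)" "s \<cdot> ?q = P"
  using norm_proj_univ[OF o P P4] by auto
 have qP: "?q \<cdot> P = ?q" using P3[OF N q norm_proj_degen] .
 have "(?q \<cdot> s) \<cdot> ?q = ?q" "Idm C ?N \<cdot> ?q = ?q"
  using assoc[OF o N o N q s(1) q] s qP id_left[OF o N q] by simp_all
 hence qs: "?q \<cdot> s = Idm C ?N"
  using norm_proj_univ[OF N q norm_proj_degen] comp_in[OF N o N s(1) q] id_in[OF N] by metis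
 show "x = Zero C a (Fo X n)" if a: "a \<in> Obj C" and x: "x \<in> Hom C a (Fo X n)"
  "!!i. [|0 < i; i \<le> n|] ==> Fm X n (n - 1) (face n i) \<cdot> x = Zero C a (Fo X (n - 1))"
  "?q \<cdot> x = Zero C a ?N" for a x
 proof -
  have "x = P \<cdot> x" using P2[OF a x(1,2)] by simp
  also have "\<dots> = s \<cdot> (?q \<cdot> x)" using assoc[OF a o N o x(1) q s(1)] s(2) by simp
  finally show ?thesis using x(3) comp_zero_right[OF a N o s(1)] by simp
 qed
 show "\<exists>y\<in>Hom C a (Fo X n). ?q \<cdot> y = z \<and>
    (\<forall>i. 0 < i \<and> i \<le> n --> Fm X n (n - 1) (face n i) \<cdot> y = Zero C a (Fo X (n - 1)))"
  if a: "a \<in> Obj C" and z: "z \<in> Hom C a ?N" for a z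
 proof (intro bexI conjI allI impI)
  show sz: "s \<cdot> z \<in> Hom C a (Fo X n)" by (rule comp_in[OF a N o z s(1)])
  show qsz: "?q \<cdot> (s \<cdot> z) = z"
   using assoc[OF a N o N z s(1) q] qs id_left[OF a N z] by simp
  fix i assume i: "0 < i \<and> i \<le> n"
  hence d: "Fm X n (n - 1) (face n i) \<in> Hom C (Fo X n) (Fo X (n - 1))"
   using sobj_map[OF X face_hom[of i "n - 1"]] by simp
  have "s \<cdot> z = P \<cdot> (s \<cdot> z)"
   using assoc[OF a o N o sz q s(1)] s(2) qsz by simp
  hence "Fm X n (n - 1) (face n i) \<cdot> (s \<cdot> z) = (Fm X n (n - 1) (face n i) \<cdot> P) \<cdot> (s \<cdot> z)"
   using assoc[OF a o o o sz P d] by simp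
  thus "Fm X n (n - 1) (face n i) \<cdot> (s \<cdot> z) = Zero C a (Fo X (n - 1))"
   using P1 i comp_zero_left[OF a o o sz] by simp
 qed
qed

end

end

abbreviation "faces \<equiv> nonempty_subsets"

abbreviation "elems \<equiv> sorted_list_of_set"

section \<open>Chain maps on simplices\<close>

lemma facesD:
 assumes "S \<in> faces n"
 shows "finite S" "0 < card S" "Suc (card S - 1) = card S" "elems S \<in> Hom Simp (card S - 1) n"
  "length (elems S) = card S" "set (elems S) = S"
proof -
 show fin: "finite S" using assms finite_subset by (auto simp: nonempty_subsets_def)
 thus "0 < card S" using assms by (auto simp: nonempty_subsets_def card_gt_0_iff)
 thus "Suc (card S - 1) = card S" by simp
 with fin show "elems S \<in> Hom Simp (card S - 1) n"
  "length (elems S) = card S" "set (elems S) = S"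
  using assms by (auto simp: Simp_hom nonempty_subsets_def)
qed

lemma image_faces:
 "[|S \<in> faces m; length s = Suc m; set s \<subseteq> {..n}|] ==> (!) s ` S \<in> faces n"
proof -
 assume a: "S \<in> faces m" "length s = Suc m" "set s \<subseteq> {..n}"
 have "s ! t \<le> n" if "t \<in> S" for t
 proof -
  have "t < length s" using a(1,2) that by (auto simp: nonempty_subsets_def)
  thus ?thesis using a(3) nth_mem by blast
 qed
 thus ?thesis using a(1) by (auto simp: nonempty_subsets_def)
qed

lemma sorted_list_of_set_unique: "[|sorted xs; distinct xs; set xs = S|] ==> elems S = xs"
 using sorted_list_of_set.idem_if_sorted_distinct by blast

lemma sorted_list_of_image:
 assumes S: "S \<in> faces l" and a: "a \<in> Hom Simp l m" and inj: "inj_on ((!) a) S"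
 shows "elems ((!) a ` S) = map ((!) a) (elems S)"
proof (rule sorted_list_of_set_unique)
 have "S \<subseteq> {..<length a}" using S a by (auto simp: nonempty_subsets_def Simp_hom)
 thus "sorted (map ((!) a) (elems S))"
  using sorted_map_nth[of a "elems S"] a facesD(6)[OF S] by (simp add: Simp_hom)
 show "distinct (map ((!) a) (elems S))"
  using inj facesD[OF S] by (simp add: distinct_map)
qed (use facesD[OF S] in simp)

text \<open>Ties the differential of the standard simplex, which deletes the i-th smallest vertex,
  to precomposition with the i-th coface.\<close>

lemma face_sorted_list:
 assumes S: "S \<in> faces n" and c: "card S = Suc (Suc j)" and i: "i \<le> Suc j"
 shows "elems (S - {elems S ! i}) = map ((!) (elems S)) (face (Suc j) i)"
proof (rule sorted_list_of_set_unique)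
 let ?l = "elems S"
 have l: "length ?l = Suc (Suc j)" "set ?l = S" "sorted ?l" "distinct ?l"
  using facesD[OF S] c by auto
 have f: "sorted (face (Suc j) i)" "distinct (face (Suc j) i)" "set (face (Suc j) i) = {..Suc j} - {i}"
  using i by (auto simp: face_def sorted_append simp del: upt_Suc)
 thus "sorted (map ((!) ?l) (face (Suc j) i))" using l by (intro sorted_map_nth) auto
 have inj: "inj_on ((!) ?l) {..Suc j}" using l by (auto simp: inj_on_def nth_eq_iff_index_eq)
 thus "distinct (map ((!) ?l) (face (Suc j) i))"
  using f by (auto simp: distinct_map intro: inj_on_subset)
 have "S = (!) ?l ` {..Suc j}"
  using arg_cong[OF map_nth[of ?l], of set] l by (simp add: atLeast0LessThan lessThan_Suc_atMost del: map_nth upt_Suc)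
 thus "set (map ((!) ?l) (face (Suc j) i)) = S - {?l ! i}"
  using f inj i by (auto simp: inj_on_def)
qed

lemma face_image_faces:
 "[|T \<in> faces n; i \<le> Suc n|] ==> (!) (face (Suc n) i) ` T \<in> faces (Suc n)"
 using face_hom[of i n] by (intro image_faces) (auto simp: Simp_hom)

lemma inj_face: "i \<le> Suc n ==> inj_on ((!) (face (Suc n) i)) {..n}"
 by (auto simp: inj_on_def face_nth split: if_splits)

text \<open>Any omitted vertex \<open>i\<close> exhibits a proper face as coming from the facet
  opposite to \<open>i\<close>. This is the case distinction for passing from dimension
  \<open>n\<close> to \<open>n + 1\<close>.\<close>

lemma faces_cases:
 assumes "S \<in> faces (Suc n)"
 obtains "S = {..Suc n}" | i T where "i \<le> Suc n" "T \<in> faces n" "S = (!) (face (Suc n) i) ` T"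
proof (cases "S = {..Suc n}")
 case False
 then obtain i where i: "i \<le> Suc n" "i \<notin> S" using assms by (auto simp: nonempty_subsets_def)
 define T where "T = {t. t \<le> n \<and> face (Suc n) i ! t \<in> S}"
 have surj: "\<exists>t\<le>n. s = face (Suc n) i ! t" if "s \<in> S" for s
 proof (cases "s < i")
  case True thus ?thesis using i by (intro exI[of _ s]) (auto simp: face_nth)
 next
  case False
  hence "i < s" "s \<le> Suc n" using i that assms by (auto simp: nonempty_subsets_def nat_neq_iff)
  thus ?thesis using i by (intro exI[of _ "s - 1"]) (auto simp: face_nth)
 qed
 have "S = (!) (face (Suc n) i) ` T" using surj by (fastforce simp: T_def)
 moreover have "T \<in> faces n"
 proof -
  have "T \<noteq> {}" using calculation assms unfolding nonempty_subsets_def by fast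
  thus ?thesis by (auto simp: nonempty_subsets_def T_def)
 qed
 ultimately show ?thesis using that(2) i by blast
qed (use that in blast)

context abelian_tensor_category
begin

text \<open>The chain map on the standard simplex that belongs to the universal
  \<open>n\<close>-simplex, the identity of \<open>X_n\<close>. It will turn out to be a universal
  one.\<close>

definition sproj :: "('o, 'm) sobj => nat => nat set => 'm" where
 "sproj X n S = nproj X (card S - 1) \<cdot> Fm X n (card S - 1) (elems S)"

context
 fixes X
 assumes X: "simplicial X"
begin

text \<open>A monotone sequence with a repetition repeats a value at adjacent positions, so it
  factors through a degeneracy.\<close>

lemma norm_proj_not_distinct:
 assumes a: "a \<in> Hom Simp m n" and "\<not> distinct a"
 shows "nproj X m \<cdot> Fm X n m a = Zero C (Fo X n) (nobj X m)"
proof -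
 have "\<not> (\<forall>i. Suc i < length a --> a ! i < a ! Suc i)"
  using assms strict_sorted_iff sorted_wrt_iff_nth_Suc_transp[of "(<)" a] by auto
 then obtain i where i: "Suc i < length a" "a ! i = a ! Suc i"
  using a by (auto simp: Simp_hom sorted_iff_nth_Suc)
 then obtain l where m: "m = Suc l" "i \<le> l" using a by (cases m) (auto simp: Simp_hom)
 let ?b = "map ((!) a) (face m i)"
 have b: "?b \<in> Hom Simp l n" using Simp_comp_hom[OF _ a] face_hom[of i l] m by auto
 have dg: "degen m i \<in> Hom Simp m l" using m degen_hom by simp
 have "map ((!) ?b) (degen m i) = a"
  using a m i by (intro nth_equalityI) (auto simp: degen_length degen_nth face_length face_nth Simp_hom not_le)
 hence "Fm X n m a = Fm X l m (degen m i) \<cdot> Fm X n l ?b"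
  using sobj_comp[OF X dg b] by simp
 moreover have "nproj X m \<cdot> (Fm X l m (degen m i) \<cdot> Fm X n l ?b) =
   (nproj X m \<cdot> Fm X l m (degen m i)) \<cdot> Fm X n l ?b"
  by (rule assoc[OF sobj_obj[OF X] sobj_obj[OF X] sobj_obj[OF X] norm_obj[OF X] sobj_map[OF X b] sobj_map[OF X dg]
     norm_proj_in[OF X], symmetric])
 ultimately show ?thesis
  using norm_proj_degen[OF X, of i m] m comp_zero_left[OF sobj_obj[OF X] sobj_obj[OF X] norm_obj[OF X] sobj_map[OF X b]]
  by simp
qed

lemma sproj_in: "S \<in> faces n ==> sproj X n S \<in> Hom C (Fo X n) (nobj X (card S - 1))"
 unfolding sproj_def
 by (rule comp_in[OF sobj_obj[OF X] sobj_obj[OF X] norm_obj[OF X] sobj_map[OF X] norm_proj_in[OF X]])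
  (rule facesD)

text \<open>A face on which \<open>a\<close> is not injective becomes degenerate and dies in the
  normalized quotient; otherwise \<open>a\<close> carries the increasing list of \<open>S\<close> to
  that of its image.\<close>

lemma sproj_comp:
 assumes a: "a \<in> Hom Simp l m" and S: "S \<in> faces l"
 shows "sproj X l S \<cdot> Fm X m l a =
  (if inj_on ((!) a) S then sproj X m ((!) a ` S) else Zero C (Fo X m) (nobj X (card S - 1)))"
proof -
 note o = sobj_obj[OF X]
 let ?s = "elems S"
 have s: "?s \<in> Hom Simp (card S - 1) l" by (rule facesD[OF S])
 have "sproj X l S \<cdot> Fm X m l a = nproj X (card S - 1) \<cdot> Fm X m (card S - 1) (map ((!) a) ?s)"
  unfolding sproj_def
  using assoc[OF o o o norm_obj[OF X] sobj_map[OF X a] sobj_map[OF X s] norm_proj_in[OF X]]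
   sobj_comp[OF X s a] by simp
 thus ?thesis
  using sorted_list_of_image[OF S a] norm_proj_not_distinct[OF Simp_comp_hom[OF s a]]
   facesD[OF S] by (auto simp: sproj_def card_image distinct_map)
qed

lemma sproj_map:
 assumes b: "b \<in> Hom Simp l m" and S: "S \<in> faces l" and a: "a \<in> Obj C" and x: "x \<in> Hom C a (Fo X m)"
 shows "sproj X l S \<cdot> (Fm X m l b \<cdot> x) =
  (if inj_on ((!) b) S then sproj X m ((!) b ` S) \<cdot> x else Zero C a (nobj X (card S - 1)))"
 using assoc[OF a sobj_obj[OF X] sobj_obj[OF X] norm_obj[OF X] x sobj_map[OF X b] sproj_in[OF S]]
  sproj_comp[OF b S] comp_zero_left[OF a sobj_obj[OF X] norm_obj[OF X] x] by auto

lemma sproj_face: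
 assumes "T \<in> faces n" "i \<le> Suc n" "a \<in> Obj C" "x \<in> Hom C a (Fo X (Suc n))"
 shows "sproj X n T \<cdot> (Fm X (Suc n) n (face (Suc n) i) \<cdot> x) = sproj X (Suc n) ((!) (face (Suc n) i) ` T) \<cdot> x"
proof -
 have "inj_on ((!) (face (Suc n) i)) T"
  using inj_face[OF assms(2)] assms(1) by (auto simp: nonempty_subsets_def intro: inj_on_subset)
 thus ?thesis using sproj_map[OF face_hom[OF assms(2)] assms(1,3,4)] by simp
qed

lemma sproj_full: "sproj X n {..n} = nproj X n"
proof -
 have "elems {..n} = [0..<Suc n]"
  by (rule sorted_list_of_set_unique) (auto simp del: upt_Suc)
 thus ?thesis
  using id_right[OF sobj_obj[OF X] norm_obj[OF X] norm_proj_in[OF X]]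
  by (simp add: sproj_def sobj_id[OF X] del: upt_Suc)
qed

text \<open>The alternating sum of faces descends to the quotient because it sends degenerate
  elements to degenerate ones: of the faces of \<open>s_k\<close>, those with index \<open>k\<close>
  and \<open>k + 1\<close> are identities and cancel.\<close>

lemma norm_diff_exists:
 "\<exists>!d. d \<in> Hom C (nobj X (Suc j)) (nobj X j) \<and>
   d \<cdot> nproj X (Suc j) =
   nproj X j \<cdot> alt_sum C (Fo X (Suc j)) (Fo X j) (\<lambda>i. Fm X (Suc j) j (face (Suc j) i)) (Suc j)"
proof (rule norm_proj_univ[OF X norm_obj[OF X]])
 note o = sobj_obj[OF X] and N = norm_obj[OF X] and q = norm_proj_in[OF X]
 let ?d = "\<lambda>i. Fm X (Suc j) j (face (Suc j) i)"
 have d: "!!i. i \<le> Suc j ==> ?d i \<in> Hom C (Fo X (Suc j)) (Fo X j)" by (intro sobj_map[OF X] face_hom)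
 have A: "alt_sum C (Fo X (Suc j)) (Fo X j) ?d (Suc j) \<in> Hom C (Fo X (Suc j)) (Fo X j)"
  using d by (intro alt_sum_in[OF o o]) auto
 show "nproj X j \<cdot> alt_sum C (Fo X (Suc j)) (Fo X j) ?d (Suc j) \<in> Hom C (Fo X (Suc j)) (nobj X j)"
  by (rule comp_in[OF o o N A q])
 fix k assume "k < Suc j"
 hence k: "k \<le> j" by simp
 have s: "Fm X j (Suc j) (degen (Suc j) k) \<in> Hom C (Fo X j) (Fo X (Suc j))"
  using k by (intro sobj_map[OF X] degen_hom)
 let ?s = "Fm X j (Suc j) (degen (Suc j) k)"
 have ds: "!!i. i \<le> Suc j ==> ?d i \<cdot> ?s \<in> Hom C (Fo X j) (Fo X j)" using d by (intro comp_in[OF o o o s]) auto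
 have qds: "!!i. i \<le> Suc j ==> nproj X j \<cdot> (?d i \<cdot> ?s) \<in> Hom C (Fo X j) (nobj X j)"
  using ds by (intro comp_in[OF o o N _ q]) auto
 have "(nproj X j \<cdot> alt_sum C (Fo X (Suc j)) (Fo X j) ?d (Suc j)) \<cdot> ?s =
   nproj X j \<cdot> (alt_sum C (Fo X (Suc j)) (Fo X j) ?d (Suc j) \<cdot> ?s)"
  by (rule assoc[OF o o o N s A q])
 also have "\<dots> = nproj X j \<cdot> alt_sum C (Fo X j) (Fo X j) (\<lambda>i. ?d i \<cdot> ?s) (Suc j)"
  using d by (subst alt_sum_comp[OF o o o s]) auto
 also have "\<dots> = alt_sum C (Fo X j) (nobj X j) (\<lambda>i. nproj X j \<cdot> (?d i \<cdot> ?s)) (Suc j)"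
  using ds by (subst comp_alt_sum[OF o o N q]) auto
 also have "\<dots> = Zero C (Fo X j) (nobj X j)"
 proof (rule alt_sum_pair[OF o N qds, where k = k])
  show "nproj X j \<cdot> (?d k \<cdot> ?s) = nproj X j \<cdot> (?d (Suc k) \<cdot> ?s)"
   using k sobj_comp[OF X face_hom[of k j] degen_hom[of k j]] sobj_comp[OF X face_hom[of "Suc k" j] degen_hom[of k j]]
   by (simp add: degen_face_id)
  fix i assume i: "i \<le> Suc j" "i \<noteq> k" "i \<noteq> Suc k"
  then obtain l where j: "j = Suc l" using k by (cases j) auto
  \<comment> \<open>Away from the two cancelling faces, \<open>d_i s_k\<close> is again a degeneracy
    after a face; which index drops by one depends on the side of \<open>k\<close> on which
    \<open>i\<close> lies.\<close>
  have "\<exists>k' i'. k' \<le> l \<and> i' \<le> Suc l \<and> map ((!) (degen (Suc j) k)) (face (Suc j) i) = map ((!) (face (Suc l) i')) (degen (Suc l) k')"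
  proof (cases "i < k")
   case True
   thus ?thesis using k j degen_face_less[of i k l] by (intro exI[of _ "k - 1"] exI[of _ i]) auto
  next
   case False
   thus ?thesis using i k j degen_face_greater[of k i l] by (intro exI[of _ k] exI[of _ "i - 1"]) auto
  qed
  then obtain k' i' where k': "k' \<le> l" "i' \<le> Suc l"
   "map ((!) (degen (Suc j) k)) (face (Suc j) i) = map ((!) (face (Suc l) i')) (degen (Suc l) k')" by blast
  have "?d i \<cdot> ?s = Fm X l j (degen j k') \<cdot> Fm X j l (face j i')"
   using sobj_comp[OF X face_hom[of i j] degen_hom[of k j]] sobj_comp[OF X degen_hom[of k' l] face_hom[of i' l]] k' i k j
   by simp
  moreover have "nproj X j \<cdot> (Fm X l j (degen j k') \<cdot> Fm X j l (face j i')) =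
    (nproj X j \<cdot> Fm X l j (degen j k')) \<cdot> Fm X j l (face j i')"
   using k' j by (auto intro!: assoc[OF o o o N sobj_map[OF X face_hom] sobj_map[OF X degen_hom] q, symmetric])
  moreover have "Zero C (Fo X l) (nobj X j) \<cdot> Fm X j l (face j i') = Zero C (Fo X j) (nobj X j)"
   using k' j by (auto intro!: comp_zero_left[OF o o N sobj_map[OF X face_hom]])
  ultimately show "nproj X j \<cdot> (?d i \<cdot> ?s) = Zero C (Fo X j) (nobj X j)"
   using norm_proj_degen[OF X, of k' j] k' j by simp
 qed (use k in auto)
 finally show "(nproj X j \<cdot> alt_sum C (Fo X (Suc j)) (Fo X j) ?d (Suc j)) \<cdot> Fm X (Suc j - 1) (Suc j) (degen (Suc j) k)
  = Zero C (Fo X (Suc j - 1)) (nobj X j)" by simp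
qed

lemma norm_diff_in: "norm_diff C X (Suc j) \<in> Hom C (nobj X (Suc j)) (nobj X j)"
 and norm_diff_proj: "norm_diff C X (Suc j) \<cdot> nproj X (Suc j) =
   nproj X j \<cdot> alt_sum C (Fo X (Suc j)) (Fo X j) (\<lambda>i. Fm X (Suc j) j (face (Suc j) i)) (Suc j)"
 using theI'[OF norm_diff_exists[of j]] by (simp_all add: norm_diff_def)

lemma norm_diff_map:
 assumes a: "a \<in> Obj C" and x: "x \<in> Hom C a (Fo X (Suc j))"
 shows "norm_diff C X (Suc j) \<cdot> (nproj X (Suc j) \<cdot> x) =
  alt_sum C a (nobj X j) (\<lambda>i. nproj X j \<cdot> (Fm X (Suc j) j (face (Suc j) i) \<cdot> x)) (Suc j)"
proof -
 note o = sobj_obj[OF X] and N = norm_obj[OF X] and q = norm_proj_in[OF X]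
 let ?d = "\<lambda>i. Fm X (Suc j) j (face (Suc j) i)"
 have d: "!!i. i \<le> Suc j ==> ?d i \<in> Hom C (Fo X (Suc j)) (Fo X j)" by (intro sobj_map[OF X] face_hom)
 have A: "alt_sum C (Fo X (Suc j)) (Fo X j) ?d (Suc j) \<in> Hom C (Fo X (Suc j)) (Fo X j)"
  using d by (intro alt_sum_in[OF o o]) auto
 have dx: "!!i. i \<le> Suc j ==> ?d i \<cdot> x \<in> Hom C a (Fo X j)" using d by (intro comp_in[OF a o o x]) auto
 have "norm_diff C X (Suc j) \<cdot> (nproj X (Suc j) \<cdot> x) = (norm_diff C X (Suc j) \<cdot> nproj X (Suc j)) \<cdot> x"
  by (rule assoc[OF a o N N x q norm_diff_in, symmetric])
 also have "\<dots> = nproj X j \<cdot> (alt_sum C (Fo X (Suc j)) (Fo X j) ?d (Suc j) \<cdot> x)"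
  unfolding norm_diff_proj by (rule assoc[OF a o o N x A q])
 also have "\<dots> = nproj X j \<cdot> alt_sum C a (Fo X j) (\<lambda>i. ?d i \<cdot> x) (Suc j)"
  using d by (subst alt_sum_comp[OF a o o x]) auto
 also have "\<dots> = alt_sum C a (nobj X j) (\<lambda>i. nproj X j \<cdot> (?d i \<cdot> x)) (Suc j)"
  using dx by (subst comp_alt_sum[OF a o N q]) auto
 finally show ?thesis .
qed

lemma sproj_chain_map: "is_chain_map C X n (Fo X n) (sproj X n)"
 unfolding is_chain_map_def
proof (intro conjI ballI impI)
 note o = sobj_obj[OF X]
 fix S assume S: "S \<in> faces n" and "2 \<le> card S"
 then obtain j where c: "card S = Suc (Suc j)" by (metis Suc_le_D numeral_2_eq_2 Suc_le_mono)
 let ?s = "elems S"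
 have s: "?s \<in> Hom Simp (Suc j) n" using facesD(4)[OF S] c by simp
 have "norm_diff C X (Suc j) \<cdot> sproj X n S =
  alt_sum C (Fo X n) (nobj X j) (\<lambda>i. nproj X j \<cdot> (Fm X (Suc j) j (face (Suc j) i) \<cdot> Fm X n (Suc j) ?s)) (Suc j)"
  using norm_diff_map[OF o sobj_map[OF X s]] c by (simp add: sproj_def)
 also have "\<dots> = alt_sum C (Fo X n) (nobj X j) (\<lambda>i. sproj X n (S - {?s ! i})) (Suc j)"
 proof (rule alt_sum_cong[OF o norm_obj[OF X]])
  fix i assume i: "i \<le> Suc j"
  have m: "Fm X (Suc j) j (face (Suc j) i) \<cdot> Fm X n (Suc j) ?s = Fm X n j (map ((!) ?s) (face (Suc j) i))"
   using sobj_comp[OF X face_hom[OF i] s] .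
  have m2: "map ((!) ?s) (face (Suc j) i) \<in> Hom Simp j n" using Simp_comp_hom[OF face_hom[OF i] s] .
  show "nproj X j \<cdot> (Fm X (Suc j) j (face (Suc j) i) \<cdot> Fm X n (Suc j) ?s) \<in> Hom C (Fo X n) (nobj X j)"
   unfolding m by (rule comp_in[OF o o norm_obj[OF X] sobj_map[OF X m2] norm_proj_in[OF X]])
  have "?s ! i \<in> S" using i c facesD[OF S] by (metis less_Suc_eq_le nth_mem)
  hence "card (S - {?s ! i}) = Suc j" using c facesD[OF S] by simp
  thus "nproj X j \<cdot> (Fm X (Suc j) j (face (Suc j) i) \<cdot> Fm X n (Suc j) ?s) = sproj X n (S - {?s ! i})"
   unfolding m using face_sorted_list[OF S c i] by (simp add: sproj_def)
 qed
 finally show "norm_diff C X (card S - 1) \<cdot> sproj X n S =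
   alt_sum C (Fo X n) (nobj X (card S - 2)) (\<lambda>i. sproj X n (S - {?s ! i})) (card S - 1)"
  using c by simp
qed (rule sproj_in)

text \<open>By induction all faces of positive index vanish, so \<open>x\<close> lies in the Moore
  complex, and there its class in the normalized quotient detects it.\<close>

lemma sproj_zero:
 "[|a \<in> Obj C; x \<in> Hom C a (Fo X n);
  !!S. S \<in> faces n ==> sproj X n S \<cdot> x = Zero C a (nobj X (card S - 1))|]
  ==> x = Zero C a (Fo X n)"
proof (induction n arbitrary: x)
 case 0
 have "{..0} \<in> faces 0" by (auto simp: nonempty_subsets_def)
 from 0(3)[OF this] have "nproj X 0 \<cdot> x = Zero C a (nobj X 0)" by (simp add: sproj_full del: atMost_0)
 thus ?case using moore_unique[OF X 0(1,2)] by simp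
next
 case (Suc n)
 have full: "{..Suc n} \<in> faces (Suc n)" by (auto simp: nonempty_subsets_def)
 show ?case
 proof (rule moore_unique[OF X Suc.prems(1,2)])
  show "nproj X (Suc n) \<cdot> x = Zero C a (nobj X (Suc n))"
   using Suc.prems(3)[OF full] by (simp add: sproj_full)
  fix i assume i: "0 < i" "i \<le> Suc n"
  have "Fm X (Suc n) n (face (Suc n) i) \<cdot> x = Zero C a (Fo X n)"
  proof (rule Suc.IH[OF Suc.prems(1)])
   show "Fm X (Suc n) n (face (Suc n) i) \<cdot> x \<in> Hom C a (Fo X n)"
    by (rule sobj_map_in[OF X Suc.prems(1,2) face_hom[OF i(2)]])
   fix T assume T: "T \<in> faces n"
   have "card ((!) (face (Suc n) i) ` T) = card T"
    using inj_face[OF i(2)] T by (intro card_image) (auto simp: nonempty_subsets_def intro: inj_on_subset)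
   thus "sproj X n T \<cdot> (Fm X (Suc n) n (face (Suc n) i) \<cdot> x) = Zero C a (nobj X (card T - 1))"
    using sproj_face[OF T i(2) Suc.prems(1,2)] Suc.prems(3)[OF face_image_faces[OF T i(2)]] by simp
  qed
  thus "Fm X (Suc n) (Suc n - 1) (face (Suc n) i) \<cdot> x = Zero C a (Fo X (Suc n - 1))" by simp
 qed
qed

lemma sproj_ext:
 assumes "a \<in> Obj C" "x \<in> Hom C a (Fo X n)" "y \<in> Hom C a (Fo X n)"
  "!!S. S \<in> faces n ==> sproj X n S \<cdot> x = sproj X n S \<cdot> y"
 shows "x = y"
proof -
 note o = sobj_obj[OF X]
 have "Sub a (Fo X n) x y = Zero C a (Fo X n)"
 proof (rule sproj_zero[OF assms(1)])
  show "Sub a (Fo X n) x y \<in> Hom C a (Fo X n)" using assms o by (intro sub_in)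
  fix S assume S: "S \<in> faces n"
  show "sproj X n S \<cdot> Sub a (Fo X n) x y = Zero C a (nobj X (card S - 1))"
   using comp_sub_right[OF assms(1) o norm_obj[OF X] assms(2,3) sproj_in[OF S]] assms(4)[OF S]
    sub_self[OF assms(1) norm_obj[OF X] comp_in[OF assms(1) o norm_obj[OF X] assms(3) sproj_in[OF S]]]
   by simp
 qed
 thus ?thesis using sub_eq_zero_iff[OF assms(1) o assms(2,3)] by simp
qed

text \<open>The i-th coface is increasing, so vertices of \<open>T\<close> and of its image are
  deleted in the same order and with the same signs.\<close>

lemma chain_map_face:
 assumes a: "a \<in> Obj C" and p: "is_chain_map C X (Suc n) a p" and i: "i \<le> Suc n"
 shows "is_chain_map C X n a (\<lambda>T. p ((!) (face (Suc n) i) ` T))"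
 unfolding is_chain_map_def
proof (intro conjI ballI impI)
 fix T assume T: "T \<in> faces n"
 let ?f = "(!) (face (Suc n) i)"
 have Tn: "T \<subseteq> {..n}" using T by (simp add: nonempty_subsets_def)
 have inj: "inj_on ?f T" using inj_face[OF i] Tn by (rule inj_on_subset)
 hence c: "card (?f ` T) = card T" by (rule card_image)
 note fT = face_image_faces[OF T i]
 show "p (?f ` T) \<in> Hom C a (nobj X (card T - 1))"
  using p fT c by (auto simp: is_chain_map_def dest!: bspec)
 assume 2: "2 \<le> card T"
 have sl: "elems (?f ` T) = map ?f (elems T)"
  by (rule sorted_list_of_image[OF T face_hom[OF i] inj])
 have mem: "elems T ! j \<in> T" if "j \<le> card T - 1" for j
  using that facesD[OF T] by (metis le_imp_less_Suc nth_mem)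
 have eq: "p (?f ` T - {elems (?f ` T) ! j}) = p (?f ` (T - {elems T ! j}))"
  if "j \<le> card T - 1" for j
 proof -
  have "elems (?f ` T) ! j = ?f (elems T ! j)"
   using that facesD[OF T] by (simp add: sl)
  moreover have "?f ` (T - {t}) = ?f ` T - {?f t}" if "t \<in> T" for t
   using inj that by (auto simp: inj_on_def)
  ultimately show ?thesis using mem[OF that] by simp
 qed
 have "norm_diff C X (card T - 1) \<cdot> p (?f ` T) = alt_sum C a (nobj X (card T - 2))
   (\<lambda>j. p (?f ` T - {elems (?f ` T) ! j})) (card T - 1)"
  using p fT 2 c by (auto simp: is_chain_map_def dest!: bspec)
 also have "\<dots> = alt_sum C a (nobj X (card T - 2)) (\<lambda>j. p (?f ` (T - {elems T ! j}))) (card T - 1)"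
 proof (rule alt_sum_cong[OF a norm_obj[OF X] _ eq])
  fix j assume j: "j \<le> card T - 1"
  let ?T = "T - {elems T ! j}"
  have cT: "card ?T = card T - 1" using mem[OF j] facesD[OF T] by simp
  hence "?T \<noteq> {}" using 2 by (metis card.empty diff_is_0_eq not_less_eq_eq numeral_2_eq_2 One_nat_def)
  hence "?T \<in> faces n" using Tn by (auto simp: nonempty_subsets_def)
  moreover have "card (?f ` ?T) = card T - 1" using cT inj by (metis Diff_subset card_image inj_on_subset)
  moreover have "card T - 1 - 1 = card T - 2" by simp
  ultimately have "p (?f ` ?T) \<in> Hom C a (nobj X (card T - 2))"
   using p face_image_faces[OF _ i] unfolding is_chain_map_def by metis
  thus "p (?f ` T - {elems (?f ` T) ! j}) \<in> Hom C a (nobj X (card T - 2))"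
   using eq[OF j] by simp
 qed
 finally show "norm_diff C X (card T - 1) \<cdot> p (?f ` T) =
  alt_sum C a (nobj X (card T - 2)) (\<lambda>j. p (?f ` (T - {elems T ! j}))) (card T - 1)" .
qed

end

end

lemma (in category) inverse_pair_unique:
 assumes "a \<in> Obj C" "b \<in> Obj C" "inverse_pair C a b f g" "inverse_pair C a b f g'"
 shows "g = g'"
proof -
 have *: "f \<in> Hom C a b" "g \<in> Hom C b a" "g' \<in> Hom C b a" "g \<cdot> f = Idm C a" "f \<cdot> g' = Idm C b"
  using assms by (auto simp: inverse_pair_def)
 thus ?thesis
  using assoc[OF assms(2,1,2,1) *(3,1,2)] id_left[OF assms(2,1) *(3)] id_right[OF assms(2,1) *(2)] by simp
qed

lemma (in category) inv_mor_eq: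
 assumes "a \<in> Obj C" "b \<in> Obj C" "inverse_pair C a b f g"
 shows "inv_mor C a b f = g"
 unfolding inv_mor_def using assms inverse_pair_unique by blast

lemma (in category) inverse_pair_inv_mor:
 assumes "a \<in> Obj C" "b \<in> Obj C" "is_isom C a b f"
 shows "inverse_pair C a b f (inv_mor C a b f)"
 using assms inv_mor_eq by (metis is_isom_def)

section \<open>Simplices as chain maps on the standard simplex\<close>

context abelian_tensor_category
begin

context
 fixes X
 assumes X: "simplicial X"
begin

text \<open>Dold--Kan: a chain map on the simplex is built by filling the horn of its faces with positive index and
 correcting the filler by an element of the Moore complex.\<close>

lemma chain_map_represented:
 "[|a \<in> Obj C; is_chain_map C X n a p|]
  ==> \<exists>x\<in>Hom C a (Fo X n). \<forall>S\<in>faces n. sproj X n S \<cdot> x = p S"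
proof (induction n arbitrary: p)
 case 0
 have S: "S = {..0}" if "S \<in> faces 0" for S using that by (auto simp: nonempty_subsets_def)
 have "{..0} \<in> faces 0" by (auto simp: nonempty_subsets_def)
 hence "p {..0} \<in> Hom C a (nobj X 0)" using bspec[OF conjunct1[OF 0(2)[unfolded is_chain_map_def]]] by fastforce
 from moore_representative[OF X 0(1) this] obtain y where "y \<in> Hom C a (Fo X 0)" "nproj X 0 \<cdot> y = p {..0}" by blast
 thus ?case using S sproj_full[OF X, of 0] by metis
next
 case (Suc n)
 note o = sobj_obj[OF X] and N = norm_obj[OF X] and q = norm_proj_in[OF X] and a = Suc.prems(1)
 let ?d = "\<lambda>i. Fm X (Suc n) n (face (Suc n) i)"
 let ?b = "\<lambda>i. (!) (face (Suc n) i)"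
 \<comment> \<open>On each facet the restricted chain map is represented by induction; the
   representing elements are the faces that the sought simplex must have.\<close>
 have "\<exists>x\<in>Hom C a (Fo X n). \<forall>T\<in>faces n. sproj X n T \<cdot> x = p (?b i ` T)" if "i \<le> Suc n" for i
  using Suc.IH[OF a chain_map_face[OF X a Suc.prems(2) that]] .
 then obtain x where x: "!!i. i \<le> Suc n ==> x i \<in> Hom C a (Fo X n)"
  and xp: "!!i T. [|i \<le> Suc n; T \<in> faces n|] ==> sproj X n T \<cdot> x i = p (?b i ` T)"
  by metis
 have full: "{..n} \<in> faces n" for n by (auto simp: nonempty_subsets_def)
 \<comment> \<open>Both sides represent the restriction of \<open>p\<close> to the intersection of
   two facets.\<close>
 have compat: "Fm X n (n - 1) (face n (j - 1)) \<cdot> x i = Fm X n (n - 1) (face n i) \<cdot> x j"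
  if ij: "i < j" "j \<le> Suc n" and n: "n = Suc m" for i j m
 proof (rule sproj_ext[OF X a])
  have f: "face n (j - 1) \<in> Hom Simp (n - 1) n" "face n i \<in> Hom Simp (n - 1) n"
   using ij n face_hom[of "j - 1" m] face_hom[of i m] by auto
  show "Fm X n (n - 1) (face n (j - 1)) \<cdot> x i \<in> Hom C a (Fo X (n - 1))"
   "Fm X n (n - 1) (face n i) \<cdot> x j \<in> Hom C a (Fo X (n - 1))"
   using ij f by (auto intro!: sobj_map_in[OF X a x])
  fix T assume T: "T \<in> faces (n - 1)"
  hence T': "T \<in> faces m" using n by simp
  have "sproj X m T \<cdot> (Fm X n m (face n (j - 1)) \<cdot> x i) = p (?b i ` ((!) (face n (j - 1)) ` T))"
   using ij n sproj_face[OF X T' _ a, of "j - 1" "x i"] x[of i] xp[of i] face_image_faces[OF T', of "j - 1"]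
   by simp
  moreover have "sproj X m T \<cdot> (Fm X n m (face n i) \<cdot> x j) = p (?b j ` ((!) (face n i) ` T))"
   using ij n sproj_face[OF X T' _ a, of i "x j"] x[of j] xp[of j] face_image_faces[OF T', of i]
   by simp
  moreover have "?b i ` ((!) (face n (j - 1)) ` T) = ?b j ` ((!) (face n i) ` T)"
   unfolding image_image
  proof (rule image_cong[OF refl])
   fix t assume "t \<in> T"
   hence t: "t < Suc m" using T' by (auto simp: nonempty_subsets_def)
   have "map (?b j) (face n i) ! t = map (?b i) (face n (j - 1)) ! t"
    using face_face[of i j m] ij n by simp
   thus "?b i (face n (j - 1) ! t) = ?b j (face n i ! t)"
    using t ij n by (simp add: face_length)
  qed
  ultimately show "sproj X (n - 1) T \<cdot> (Fm X n (n - 1) (face n (j - 1)) \<cdot> x i) =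
    sproj X (n - 1) T \<cdot> (Fm X n (n - 1) (face n i) \<cdot> x j)"
   using n by simp
 qed
 have "\<exists>w\<in>Hom C a (Fo X (Suc n)). \<forall>i. 0 < i \<and> i \<le> Suc n --> ?d i \<cdot> w = x i"
 proof (rule kan_filler[OF X a])
  fix i j assume ij: "0 < i" "i < j" "j \<le> Suc n"
  then obtain m where "n = Suc m" by (cases n) auto
  thus "Fm X n (n - 1) (face n (j - 1)) \<cdot> x i = Fm X n (n - 1) (face n i) \<cdot> x j" using compat ij by blast
 qed (use x in auto)
 then obtain w where w: "w \<in> Hom C a (Fo X (Suc n))" "!!i. [|0 < i; i \<le> Suc n|] ==> ?d i \<cdot> w = x i" by blast
 have dx: "?d i \<cdot> v \<in> Hom C a (Fo X n)" if "i \<le> Suc n" "v \<in> Hom C a (Fo X (Suc n))" for i v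
  by (rule sobj_map_in[OF X a that(2) face_hom[OF that(1)]])
 have qx: "nproj X n \<cdot> v \<in> Hom C a (nobj X n)" if "v \<in> Hom C a (Fo X n)" for v n
  by (rule comp_in[OF a o N that q])
 let ?p = "p {..Suc n}" and ?qw = "nproj X (Suc n) \<cdot> w"
 have p: "?p \<in> Hom C a (nobj X (Suc n))"
  using bspec[OF conjunct1[OF Suc.prems(2)[unfolded is_chain_map_def]] full[of "Suc n"]] by simp
 have z: "Sub a (nobj X (Suc n)) ?p ?qw \<in> Hom C a (nobj X (Suc n))" by (rule sub_in[OF a N p qx[OF w(1)]])
 \<comment> \<open>\<open>y\<close> will repair the value on the full simplex without touching faces
   of positive index; its face 0 has to be controlled.\<close>
 from moore_representative[OF X a z] obtain y where y: "y \<in> Hom C a (Fo X (Suc n))"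
  "nproj X (Suc n) \<cdot> y = Sub a (nobj X (Suc n)) ?p ?qw"
  "!!i. [|0 < i; i \<le> Suc n|] ==> ?d i \<cdot> y = Zero C a (Fo X n)" by auto
 \<comment> \<open>The defect of the filler \<open>w\<close> at the face that the horn leaves
   open.\<close>
 define e where "e = Sub a (Fo X n) (x 0) (?d 0 \<cdot> w)"
 have e: "e \<in> Hom C a (Fo X n)" unfolding e_def by (intro sub_in[OF a o] x dx w) auto
 have d0y: "?d 0 \<cdot> y \<in> Hom C a (Fo X n)" using dx y(1) by simp
 \<comment> \<open>Apply the differential to \<open>nproj y = p - nproj w\<close>. For
   \<open>y\<close> only face 0 contributes; in the difference for \<open>p\<close> and
   \<open>w\<close> the terms of positive index are equal and drop out.\<close>
 have "nproj X n \<cdot> (?d 0 \<cdot> y) = nproj X n \<cdot> e"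
 proof -
  have "norm_diff C X (Suc n) \<cdot> (nproj X (Suc n) \<cdot> y) =
    alt_sum C a (nobj X n) (\<lambda>i. nproj X n \<cdot> (?d i \<cdot> y)) (Suc n)"
   by (rule norm_diff_map[OF X a y(1)])
  also have "\<dots> = nproj X n \<cdot> (?d 0 \<cdot> y)"
   using dx y comp_zero_right[OF a o N q] by (intro alt_sum_single[OF a N]) (auto intro!: qx)
  finally have 1: "nproj X n \<cdot> (?d 0 \<cdot> y) = norm_diff C X (Suc n) \<cdot> (nproj X (Suc n) \<cdot> y)" ..
  have sl: "elems {..Suc n} = [0..<Suc (Suc n)]"
   by (rule sorted_list_of_set_unique) (auto simp del: upt_Suc)
  have "norm_diff C X (Suc n) \<cdot> ?p =
    alt_sum C a (nobj X n) (\<lambda>i. p ({..Suc n} - {[0..<Suc (Suc n)] ! i})) (Suc n)"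
   using Suc.prems(2) full[of "Suc n"] unfolding is_chain_map_def sl[symmetric]
   by (auto dest!: bspec[where x = "{..Suc n}"])
  also have "\<dots> = alt_sum C a (nobj X n) (\<lambda>i. nproj X n \<cdot> x i) (Suc n)"
  proof (rule alt_sum_cong[OF a N, symmetric])
   fix i assume i: "i \<le> Suc n"
   show "nproj X n \<cdot> x i \<in> Hom C a (nobj X n)" by (rule qx[OF x[OF i]])
   have "?b i ` {..n} = {..Suc n} - {i}"
   proof -
    have "set (face (Suc n) i) = {..Suc n} - {i}" using i by (auto simp: face_def simp del: upt_Suc)
    moreover have "(!) (face (Suc n) i) ` {..n} = set (map ((!) (face (Suc n) i)) [0..<Suc n])"
     by (auto simp del: upt_Suc)
    ultimately show ?thesis using map_nth_upt'[of "face (Suc n) i" "Suc n"] i by (simp add: face_length del: upt_Suc)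
   qed
   moreover have "[0..<Suc (Suc n)] ! i = i" using i by (simp del: upt_Suc)
   ultimately show "nproj X n \<cdot> x i = p ({..Suc n} - {[0..<Suc (Suc n)] ! i})"
    using xp[OF i full] by (simp add: sproj_full[OF X])
  qed
  finally have 2: "norm_diff C X (Suc n) \<cdot> ?p = alt_sum C a (nobj X n) (\<lambda>i. nproj X n \<cdot> x i) (Suc n)" .
  have 3: "norm_diff C X (Suc n) \<cdot> ?qw = alt_sum C a (nobj X n) (\<lambda>i. nproj X n \<cdot> (?d i \<cdot> w)) (Suc n)"
   by (rule norm_diff_map[OF X a w(1)])
  have "norm_diff C X (Suc n) \<cdot> (nproj X (Suc n) \<cdot> y) =
    Sub a (nobj X n) (norm_diff C X (Suc n) \<cdot> ?p) (norm_diff C X (Suc n) \<cdot> ?qw)"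
   unfolding y(2) by (rule comp_sub_right[OF a N N p qx[OF w(1)] norm_diff_in[OF X]])
  also have "\<dots> = Sub a (nobj X n) (nproj X n \<cdot> x 0) (nproj X n \<cdot> (?d 0 \<cdot> w))"
   unfolding 2 3 by (rule alt_sum_sub[OF a N]) (use x w dx in \<open>auto intro!: qx\<close>)
  also have "\<dots> = nproj X n \<cdot> e"
   unfolding e_def using x[of 0] dx[OF _ w(1), of 0] by (intro comp_sub_right[OF a o N _ _ q, symmetric]) auto
  finally show ?thesis using 1 by simp
 qed
 \<comment> \<open>The difference of the two sides has vanishing faces of positive index, so
   equality of classes in the normalized quotient is equality.\<close>
 moreover have "?d 0 \<cdot> y = e" if qe: "nproj X n \<cdot> (?d 0 \<cdot> y) = nproj X n \<cdot> e"
 proof -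
  have "Sub a (Fo X n) (?d 0 \<cdot> y) e = Zero C a (Fo X n)"
  proof (rule moore_unique[OF X a sub_in[OF a o d0y e]])
   show "nproj X n \<cdot> Sub a (Fo X n) (?d 0 \<cdot> y) e = Zero C a (nobj X n)"
    using comp_sub_right[OF a o N d0y e q] qe sub_self[OF a N qx[OF e]] by simp
   fix i assume i: "0 < i" "i \<le> n"
   then obtain m where n: "n = Suc m" by (cases n) auto
   have f: "face n i \<in> Hom Simp m n" "face n 0 \<in> Hom Simp m n" using i n face_hom[of i m] face_hom[of 0 m] by auto
   have dd: "Fm X n m (face n i) \<cdot> (?d 0 \<cdot> v) = Fm X n m (face n 0) \<cdot> (?d (Suc i) \<cdot> v)"
    if "v \<in> Hom C a (Fo X (Suc n))" for v
    using sobj_comp_map[OF X a that f(1) face_hom[of 0 n]] sobj_comp_map[OF X a that f(2) face_hom[of "Suc i" n]]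
     face_face[of 0 "Suc i" m] i n by simp
   have dy: "Fm X n m (face n i) \<cdot> (?d 0 \<cdot> y) = Zero C a (Fo X m)"
    using dd[OF y(1)] y(3)[of "Suc i"] i comp_zero_right[OF a o o sobj_map[OF X f(2)]] by simp
   have "Fm X n m (face n i) \<cdot> (?d 0 \<cdot> w) = Fm X n m (face n i) \<cdot> x 0"
    using dd[OF w(1)] w(2)[of "Suc i"] i compat[of 0 "Suc i" m] n by simp
   hence de: "Fm X n m (face n i) \<cdot> e = Zero C a (Fo X m)"
    unfolding e_def using comp_sub_right[OF a o o x[of 0] dx[OF _ w(1), of 0] sobj_map[OF X f(1)]]
     sub_self[OF a o sobj_map_in[OF X a x[of 0] f(1)]] by simp
   show "Fm X n (n - 1) (face n i) \<cdot> Sub a (Fo X n) (?d 0 \<cdot> y) e = Zero C a (Fo X (n - 1))"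
    using comp_sub_right[OF a o o d0y e sobj_map[OF X f(1)]] dy de n sub_self[OF a o zero_in[OF a o]] by simp
  qed
  thus ?thesis using sub_eq_zero_iff[OF a o d0y e] by simp
 qed
 ultimately have d0: "?d 0 \<cdot> y = e" by blast
 have v: "Plus C w y \<in> Hom C a (Fo X (Suc n))" by (rule plus_in[OF a o w(1) y(1)])
 have dv: "?d i \<cdot> Plus C w y = x i" if i: "i \<le> Suc n" for i
 proof -
  have "?d i \<cdot> Plus C w y = Plus C (?d i \<cdot> w) (?d i \<cdot> y)"
   by (rule comp_add_right[OF a o o w(1) y(1) sobj_map[OF X face_hom[OF i]]])
  thus ?thesis
   using i w(2)[of i] y(3)[of i] d0 plus_sub[OF a o x[of 0] dx[OF _ w(1), of 0]] plus_zero(1)[OF a o x[of i]]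
   by (cases "i = 0") (auto simp: e_def)
 qed
 have "sproj X (Suc n) S \<cdot> Plus C w y = p S" if "S \<in> faces (Suc n)" for S
  using that
 proof (cases rule: faces_cases)
  case 1
  have "nproj X (Suc n) \<cdot> Plus C w y = Plus C ?qw (nproj X (Suc n) \<cdot> y)"
   by (rule comp_add_right[OF a o N w(1) y(1) q])
  thus ?thesis using 1 y(2) plus_sub[OF a N p qx[OF w(1)]] by (simp add: sproj_full[OF X])
 next
  case (2 i T)
  thus ?thesis using sproj_face[OF X 2(2,1) a v] dv xp by simp
 qed
 thus ?case using v by blast
qed

text \<open>Dold-Kan in the form used below: the chosen Hom objects behind \<open>fin_ext\<close>
  may be replaced by the objects \<open>X_n\<close> themselves, with projections
  \<open>sproj\<close>.\<close>

lemma is_hom_complex_self: "is_hom_complex C X n (Fo X n) (sproj X n)"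
 unfolding is_hom_complex_def
proof (intro conjI ballI allI impI)
 fix a r assume a: "a \<in> Obj C" and r: "is_chain_map C X n a r"
 obtain x where x: "x \<in> Hom C a (Fo X n)" "\<forall>S\<in>faces n. sproj X n S \<cdot> x = r S"
  using chain_map_represented[OF a r] by blast
 show "\<exists>!h. h \<in> Hom C a (Fo X n) \<and> (\<forall>S\<in>faces n. sproj X n S \<cdot> h = r S)"
 proof (rule ex1I[of _ x])
  fix h assume "h \<in> Hom C a (Fo X n) \<and> (\<forall>S\<in>faces n. sproj X n S \<cdot> h = r S)"
  thus "h = x" using x by (auto intro: sproj_ext[OF X a])
 qed (use x in auto)
qed (rule sobj_obj[OF X] sproj_chain_map[OF X])+

lemma hom_complex: "is_hom_complex C X n (fst (hom_complex C X n)) (snd (hom_complex C X n))"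
proof -
 have "\<exists>z. case z of (H, p) => is_hom_complex C X n H p" using is_hom_complex_self by auto
 hence "case hom_complex C X n of (H, p) => is_hom_complex C X n H p"
  unfolding hom_complex_def by (rule someI_ex)
 thus ?thesis by (simp add: case_prod_unfold)
qed

text \<open>Two objects with the same universal property. The inverse of the canonical map is the
  morphism representing the chosen universal chain map, and the equations allow both systems of
  projections to be exchanged.\<close>

lemma fin_ext_can_iso:
 "\<exists>g. inverse_pair C (Fo X n) (fst (hom_complex C X n)) (fin_ext_can C X n) g \<and>
   (\<forall>S\<in>faces n. sproj X n S \<cdot> g = snd (hom_complex C X n) S \<and>
    snd (hom_complex C X n) S \<cdot> fin_ext_can C X n = sproj X n S)"
proof -
 let ?H = "fst (hom_complex C X n)" and ?p = "snd (hom_complex C X n)"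
 note o = sobj_obj[OF X] and N = norm_obj[OF X]
 have H: "?H \<in> Obj C" "is_chain_map C X n ?H ?p"
  and U: "!!a r. a \<in> Obj C ==> is_chain_map C X n a r ==> \<exists>!h. h \<in> Hom C a ?H \<and> (\<forall>S\<in>faces n. ?p S \<cdot> h = r S)"
  using hom_complex[of n] by (auto simp: is_hom_complex_def)
 have p: "!!S. S \<in> faces n ==> ?p S \<in> Hom C ?H (nobj X (card S - 1))"
  using H(2) by (simp add: is_chain_map_def)
 have can: "fin_ext_can C X n \<in> Hom C (Fo X n) ?H"
  "!!S. S \<in> faces n ==> ?p S \<cdot> fin_ext_can C X n = sproj X n S"
  using theI'[OF U[OF o sproj_chain_map[OF X]]]
  unfolding fin_ext_can_def by (simp_all add: fin_ext_def sproj_def)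
 obtain g where g: "g \<in> Hom C ?H (Fo X n)" "!!S. S \<in> faces n ==> sproj X n S \<cdot> g = ?p S"
  using chain_map_represented[OF H] by blast
 have "g \<cdot> fin_ext_can C X n = Idm C (Fo X n)"
 proof (rule sproj_ext[OF X o comp_in[OF o H(1) o can(1) g(1)] id_in[OF o]])
  fix S assume S: "S \<in> faces n"
  show "sproj X n S \<cdot> (g \<cdot> fin_ext_can C X n) = sproj X n S \<cdot> Idm C (Fo X n)"
   using assoc[OF o H(1) o N can(1) g(1) sproj_in[OF X S]] g(2)[OF S] can(2)[OF S]
    id_right[OF o N sproj_in[OF X S]] by simp
 qed
 moreover have "fin_ext_can C X n \<cdot> g = Idm C ?H"
 proof -
  have "?p S \<cdot> (fin_ext_can C X n \<cdot> g) = ?p S" "?p S \<cdot> Idm C ?H = ?p S" if S: "S \<in> faces n" for S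
   using assoc[OF H(1) o H(1) N g(1) can(1) p[OF S]] g(2)[OF S] can(2)[OF S] id_right[OF H(1) N p[OF S]] by simp_all
  thus ?thesis
   using U[OF H(1,2)] comp_in[OF H(1) o H(1) g(1) can(1)] id_in[OF H(1)] by blast
 qed
 ultimately have "inverse_pair C (Fo X n) ?H (fin_ext_can C X n) g"
  using can g by (simp add: inverse_pair_def)
 thus ?thesis using g can by blast
qed

end

end

lemma Simp_nth_le: "[|b \<in> Hom Simp m n; x \<le> m|] ==> b ! x \<le> n"
proof -
 assume a: "b \<in> Hom Simp m n" "x \<le> m"
 hence "b ! x \<in> set b" by (intro nth_mem) (simp add: Simp_hom)
 thus ?thesis using a unfolding Simp_hom by (meson atMost_iff subsetD)
qed

section \<open>Signs of induced permutations\<close>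

lemma strict_mono_card_less:
 fixes S :: "'a::linorder set"
 assumes "finite S" "x \<in> S" "x < y"
 shows "card {t \<in> S. t < x} < card {t \<in> S. t < y}"
 using assms by (intro psubset_card_mono) auto

text \<open>The number of smaller elements is a strictly increasing function of an element of the
  finite image, so positions are separated; an injective self-map of a finite set is
  bijective.\<close>

lemma induced_perm_permutes:
 assumes fin: "finite S" and inj: "inj_on ((!) s) S"
 shows "induced_perm s S permutes {..<card S}"
proof (rule bij_imp_permutes)
 let ?l = "elems S"
 have l: "length ?l = card S" "set ?l = S" "distinct ?l" using fin by auto
 have card_eq: "card {t \<in> S. s ! t < s ! x} = card {v \<in> (!) s ` S. v < s ! x}" if "x \<in> S" for x
 proof -
  have "{v \<in> (!) s ` S. v < s ! x} = (!) s ` {t \<in> S. s ! t < s ! x}" by auto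
  thus ?thesis using inj by (simp add: card_image inj_on_subset[of _ S])
 qed
 have mem: "?l ! i \<in> S" if "i < card S" for i using that l by (metis nth_mem)
 have inj': "inj_on (induced_perm s S) {..<card S}"
 proof (rule inj_onI)
  fix i j assume ij: "i \<in> {..<card S}" "j \<in> {..<card S}" "induced_perm s S i = induced_perm s S j"
  hence "card {v \<in> (!) s ` S. v < s ! (?l ! i)} = card {v \<in> (!) s ` S. v < s ! (?l ! j)}"
   using mem card_eq by (simp add: induced_perm_def)
  hence "s ! (?l ! i) = s ! (?l ! j)"
   using strict_mono_card_less[of "(!) s ` S" "s ! (?l ! i)" "s ! (?l ! j)"]
    strict_mono_card_less[of "(!) s ` S" "s ! (?l ! j)" "s ! (?l ! i)"] fin mem ij(1,2)
   by (cases "s ! (?l ! i)" "s ! (?l ! j)" rule: linorder_cases) auto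
  hence "?l ! i = ?l ! j" using inj mem ij by (simp add: inj_on_eq_iff)
  thus "i = j" using ij l by (simp add: nth_eq_iff_index_eq)
 qed
 have "induced_perm s S ` {..<card S} \<subseteq> {..<card S}"
 proof clarify
  fix i assume i: "i < card S"
  have "{t \<in> S. s ! t < s ! (?l ! i)} \<subset> S" using mem[OF i] by auto
  thus "induced_perm s S i < card S" using i fin by (simp add: induced_perm_def psubset_card_mono)
 qed
 thus "bij_betw (induced_perm s S) {..<card S} {..<card S}"
  using inj' by (simp add: bij_betw_def endo_inj_surj)
qed (simp add: induced_perm_def)

lemma card_less_sorted_list:
 assumes "finite S" "k < card S"
 shows "card {t \<in> S. t < elems S ! k} = k"
proof -
 let ?l = "elems S"
 have l: "length ?l = card S" "set ?l = S" "distinct ?l" "sorted_wrt (<) ?l" using assms by auto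
 have "{t \<in> S. t < ?l ! k} = (!) ?l ` {..<k}"
 proof safe
  fix t assume t: "t \<in> S" "t < ?l ! k"
  then obtain i where i: "i < card S" "t = ?l ! i" using l by (metis in_set_conv_nth)
  hence "i < k" using t l assms by (metis linorder_neqE_nat not_less_iff_gr_or_eq sorted_wrt_nth_less)
  thus "t \<in> (!) ?l ` {..<k}" using i by blast
 next
  fix i assume "i < k"
  thus "?l ! i \<in> S" "?l ! i < ?l ! k"
   using l assms by (metis nth_mem order_less_trans, metis sorted_wrt_nth_less)
 qed
 moreover have "inj_on ((!) ?l) {..<k}" using l assms by (auto simp: inj_on_def nth_eq_iff_index_eq)
 ultimately show ?thesis by (simp add: card_image)
qed

lemma induced_perm_mono:
 assumes S: "S \<in> faces m" and s: "s \<in> Hom Simp m n" and inj: "inj_on ((!) s) S"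
 shows "induced_perm s S = id"
proof
 fix i
 note l = facesD[OF S]
 show "induced_perm s S i = id i"
 proof (cases "i < card S")
  case True
  let ?x = "elems S ! i"
  have x: "?x \<in> S" using True l by (metis nth_mem)
  have "s ! t < s ! ?x \<longleftrightarrow> t < ?x" if t: "t \<in> S" for t
  proof -
   have len: "t < length s" "?x < length s" using t x S s by (auto simp: nonempty_subsets_def Simp_hom)
   have srt: "sorted s" using s by (simp add: Simp_hom)
   show ?thesis
    using sorted_nth_mono[OF srt, of t ?x] sorted_nth_mono[OF srt, of ?x t] len inj t x
    by (metis inj_on_eq_iff linorder_not_less nless_le)
  qed
  hence "{t \<in> S. s ! t < s ! ?x} = {t \<in> S. t < ?x}" by auto
  thus ?thesis using True card_less_sorted_list[OF l(1) True] by (simp add: induced_perm_def)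
 qed (simp add: induced_perm_def)
qed

lemma induced_perm_comp:
 assumes S: "S \<in> faces l" and a: "a \<in> Hom Simp l m" and inj: "inj_on ((!) a) S"
 shows "induced_perm (map ((!) s) a) S = induced_perm s ((!) a ` S)"
proof
 fix i
 note l = facesD[OF S]
 have Sl: "t < length a" if "t \<in> S" for t using that S a by (auto simp: nonempty_subsets_def Simp_hom)
 show "induced_perm (map ((!) s) a) S i = induced_perm s ((!) a ` S) i"
 proof (cases "i < card S")
  case True
  let ?x = "elems S ! i"
  have x: "?x \<in> S" using True l by (metis nth_mem)
  have "{u \<in> (!) a ` S. s ! u < s ! (a ! ?x)} = (!) a ` {t \<in> S. s ! (a ! t) < s ! (a ! ?x)}" by auto
  hence "card {u \<in> (!) a ` S. s ! u < s ! (a ! ?x)} = card {t \<in> S. s ! (a ! t) < s ! (a ! ?x)}"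
   using inj by (simp add: card_image inj_on_subset[of _ S])
  moreover have "{t \<in> S. map ((!) s) a ! t < map ((!) s) a ! ?x} = {t \<in> S. s ! (a ! t) < s ! (a ! ?x)}"
   using Sl x by auto
  ultimately show ?thesis
   using True inj l sorted_list_of_image[OF S a inj] by (simp add: induced_perm_def card_image)
 qed (use inj in \<open>simp add: induced_perm_def card_image\<close>)
qed

text \<open>Exchanging two values precomposes the induced permutation with the transposition of the
  places that \<open>i\<close> and \<open>j\<close> occupy in the ordered set
  \<open>S\<close>.\<close>

lemma sign_induced_perm_swap:
 assumes S: "S \<in> faces m" and len: "length s = Suc m" and inj: "inj_on ((!) s) S"
  and ij: "i \<in> S" "j \<in> S" "i \<noteq> j"
 shows "sign (induced_perm (s[i := s ! j, j := s ! i]) S) = - sign (induced_perm s S)"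
proof -
 note l = facesD[OF S]
 let ?l = "elems S" and ?s = "s[i := s ! j, j := s ! i]"
 have d: "distinct ?l" using l(1) by simp
 obtain a b where ab: "a < card S" "b < card S" "?l ! a = i" "?l ! b = j"
  using ij l by (metis in_set_conv_nth)
 have ab': "a \<noteq> b" using ab ij by auto
 have il: "i < length s" "j < length s" using ij S len by (auto simp: nonempty_subsets_def)
 have swap: "?s ! t = s ! (transpose i j t)" for t
  using il ij by (auto simp: nth_list_update transpose_def)
 have tS: "transpose i j ` S = S" using ij by (auto simp: transpose_def image_iff)
 have "induced_perm ?s S = induced_perm s S \<circ> transpose a b"
 proof
  fix k
  show "induced_perm ?s S k = (induced_perm s S \<circ> transpose a b) k"
  proof (cases "k < card S")
   case True
   have tk: "transpose a b k < card S" using True ab by (auto simp: transpose_def)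
   have lk: "transpose i j (?l ! k) = ?l ! (transpose a b k)"
    using ab True l(5) d by (auto simp: transpose_def nth_eq_iff_index_eq)
   have "{t \<in> S. s ! (transpose i j t) < s ! (?l ! (transpose a b k))} =
     transpose i j ` {t \<in> S. s ! t < s ! (?l ! (transpose a b k))}"
   proof (intro equalityI subsetI)
    fix t assume t: "t \<in> {t \<in> S. s ! (transpose i j t) < s ! (?l ! (transpose a b k))}"
    hence "transpose i j t \<in> S" using tS by blast
    thus "t \<in> transpose i j ` {t \<in> S. s ! t < s ! (?l ! (transpose a b k))}"
     using t by (intro image_eqI[of _ _ "transpose i j t"]) auto
   next
    fix t assume "t \<in> transpose i j ` {t \<in> S. s ! t < s ! (?l ! (transpose a b k))}"
    then obtain u where "u \<in> S" "s ! u < s ! (?l ! (transpose a b k))" "t = transpose i j u" by blast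
    moreover have "transpose i j u \<in> S" using tS calculation(1) by blast
    ultimately show "t \<in> {t \<in> S. s ! (transpose i j t) < s ! (?l ! (transpose a b k))}" by simp
   qed
   hence "card {t \<in> S. s ! (transpose i j t) < s ! (?l ! (transpose a b k))} =
     card {t \<in> S. s ! t < s ! (?l ! (transpose a b k))}"
    by (simp add: card_image)
   thus ?thesis using True tk by (simp add: induced_perm_def swap lk)
  next
   case False
   hence "transpose a b k = k" using ab by (auto simp: transpose_def)
   thus ?thesis using False by (simp add: induced_perm_def)
  qed
 qed
 moreover have "permutation (induced_perm s S)"
  using induced_perm_permutes[OF l(1) inj] permutation_permutes by blast
 ultimately show ?thesis
  using ab' by (simp add: sign_compose permutation_swap_id sign_swap_id)
qed

section \<open>The exchange relation\<close>

context abelian_tensor_category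
begin

text \<open>Written with sums on both sides, so that additivity of composition transports it
  directly. Constant families satisfy it as well, which is how identities and unit factors enter
  later.\<close>

definition exchange_rel :: "nat => nat => (nat list => 'm) => bool" where
 "exchange_rel L n F \<longleftrightarrow> (\<forall>s i j. length s = L \<and> set s \<subseteq> {..n} \<and> i < L \<and> j < L \<and> i \<noteq> j -->
   Plus C (F s) (F (s[i := s ! j, j := s ! i])) = Plus C (F (s[j := s ! i])) (F (s[i := s ! j])))"

lemma exchange_relD:
 "[|exchange_rel L n F; length s = L; set s \<subseteq> {..n}; i < L; j < L; i \<noteq> j|] ==>
  Plus C (F s) (F (s[i := s ! j, j := s ! i])) = Plus C (F (s[j := s ! i])) (F (s[i := s ! j]))"
 by (simp add: exchange_rel_def)

lemma list_update_values:
 "[|set s \<subseteq> {..n::nat}; i < length s; j < length s|] ==> set (s[i := s ! j]) \<subseteq> {..n}"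
 "[|set s \<subseteq> {..n::nat}; i < length s; j < length s|] ==> set (s[i := s ! j, j := s ! i]) \<subseteq> {..n}"
 by (meson set_update_subsetI nth_mem subsetD subset_trans)+

text \<open>The relation expresses the value at a list with an inversion through the three lists of
  \<open>exchange_induct\<close>; cancellation in the group of morphisms does the rest.\<close>

lemma exchange_rel_unique:
 assumes a: "a \<in> Obj C" "b \<in> Obj C" and F: "exchange_rel L n F" and G: "exchange_rel L n G"
  and Fin: "!!f. [|length f = L; set f \<subseteq> {..n}|] ==> F f \<in> Hom C a b"
  and Gin: "!!f. [|length f = L; set f \<subseteq> {..n}|] ==> G f \<in> Hom C a b"
  and eq: "!!f. [|length f = L; set f \<subseteq> {..n}; sorted f|] ==> F f = G f"
  and f: "length f = L" "set f \<subseteq> {..n}"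
 shows "F f = G f"
 using f
proof (induction f rule: exchange_induct)
 case (exchange f i j)
 let ?s = "f[i := f ! j, j := f ! i]"
 have s: "length ?s = L" "set ?s \<subseteq> {..n}" using exchange list_update_values(2)[of f n i j] by auto
 have "Plus C (F f) (F ?s) = Plus C (G f) (G ?s)"
  using exchange exchange_relD[OF F, of f i j] exchange_relD[OF G, of f i j] by simp
 thus ?case
  using exchange plus_cancel[OF a Fin[OF exchange(1,2)] Gin[OF exchange(1,2)] Fin[OF s]] by simp
qed (rule eq)

lemma exchange_rel_comp_left:
 assumes o: "a \<in> Obj C" "b \<in> Obj C" "c \<in> Obj C" and F: "exchange_rel L n F"
  and Fin: "!!s. [|length s = L; set s \<subseteq> {..n}|] ==> F s \<in> Hom C a b" and g: "g \<in> Hom C b c"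
 shows "exchange_rel L n (\<lambda>s. g \<cdot> F s)"
 unfolding exchange_rel_def
proof clarify
 fix s i j assume *: "set s \<subseteq> {..n}" "i < length s" "j < length s" "i \<noteq> j" "L = length s"
 thus "Plus C (g \<cdot> F s) (g \<cdot> F (s[i := s ! j, j := s ! i])) = Plus C (g \<cdot> F (s[j := s ! i])) (g \<cdot> F (s[i := s ! j]))"
  using exchange_relD[OF F _ *(1), of i j] list_update_values[of s n i j] list_update_values(1)[of s n j i]
  by (simp add: comp_add_right[OF o _ _ g, symmetric] Fin)
qed

lemma exchange_rel_comp_right:
 assumes o: "a \<in> Obj C" "b \<in> Obj C" "c \<in> Obj C" and F: "exchange_rel L n F"
  and Fin: "!!s. [|length s = L; set s \<subseteq> {..n}|] ==> F s \<in> Hom C b c" and h: "h \<in> Hom C a b"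
 shows "exchange_rel L n (\<lambda>s. F s \<cdot> h)"
 unfolding exchange_rel_def
proof clarify
 fix s i j assume *: "set s \<subseteq> {..n}" "i < length s" "j < length s" "i \<noteq> j" "L = length s"
 thus "Plus C (F s \<cdot> h) (F (s[i := s ! j, j := s ! i]) \<cdot> h) = Plus C (F (s[j := s ! i]) \<cdot> h) (F (s[i := s ! j]) \<cdot> h)"
  using exchange_relD[OF F _ *(1), of i j] list_update_values[of s n i j] list_update_values(1)[of s n j i]
  by (simp add: comp_add_left[OF o h, symmetric] Fin)
qed

text \<open>For a segment of a longer list whose entries are relabelled by \<open>f\<close>:
  updating the segment is updating the whole list at a shifted position.\<close>

lemma exchange_rel_context:
 assumes F: "exchange_rel L n F" and L: "length xs + L' + length ys = L" "set xs \<subseteq> {..n}" "set ys \<subseteq> {..n}"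
  and f: "!!x. x \<le> n' ==> f x \<le> n"
 shows "exchange_rel L' n' (\<lambda>b. F (xs @ map f b @ ys))"
 unfolding exchange_rel_def
proof clarify
 fix b i j assume *: "set b \<subseteq> {..n'}" "i < length b" "j < length b" "i \<noteq> j" "L' = length b"
 let ?s = "xs @ map f b @ ys"
 have s: "length ?s = L" "set ?s \<subseteq> {..n}" using * L f by auto
 have upd: "(xs @ map f t @ ys)[length xs + k := f x] = xs @ map f (t[k := x]) @ ys" if "k < length t" for t k x
  using that by (simp add: list_update_append map_update)
 show "Plus C (F ?s) (F (xs @ map f (b[i := b ! j, j := b ! i]) @ ys)) =
   Plus C (F (xs @ map f (b[j := b ! i]) @ ys)) (F (xs @ map f (b[i := b ! j]) @ ys))"
  using exchange_relD[OF F s, of "length xs + i" "length xs + j"] * L(1) by (simp add: nth_append upd)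
qed

text \<open>For families that read only the positions in \<open>r\<close>. If one of the two
  exchanged positions is not read, the relation degenerates to commutativity of the sum or to
  reflexivity; distinctness of \<open>r\<close> makes an update of a read position a single
  update.\<close>

lemma exchange_rel_select:
 assumes o: "a \<in> Obj C" "b \<in> Obj C" and F: "exchange_rel L n F"
  and Fin: "!!f. [|length f = L; set f \<subseteq> {..n}|] ==> F f \<in> Hom C a b"
  and r: "length r = L" "distinct r" "set r \<subseteq> {..<L'}"
 shows "exchange_rel L' n (\<lambda>f. F (map ((!) f) r))"
 unfolding exchange_rel_def
proof clarify
 fix f i j assume *: "set f \<subseteq> {..n}" "i < length f" "j < length f" "i \<noteq> j" "L' = length f"
 have vals: "length (map ((!) t) r) = L" "set (map ((!) t) r) \<subseteq> {..n}"
  if "length t = length f" "set t \<subseteq> {..n}" for t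
  using that r * set_map_nth[of r t] by auto
 have out: "map ((!) (t[k := x])) r = map ((!) t) r" if "k \<notin> set r" for t :: "nat list" and k x
  using that by (intro map_cong refl nth_list_update_neq) auto
 have upd: "map ((!) (t[r ! k := x])) r = (map ((!) t) r)[k := x]"
  if "k < length r" "length t = length f" for t :: "nat list" and k x
  using that r * by (intro map_nth_list_update) auto
 let ?s = "f[i := f ! j, j := f ! i]"
 have in': "F (map ((!) f) r) \<in> Hom C a b" "F (map ((!) (f[j := f ! i])) r) \<in> Hom C a b"
  using Fin[OF vals] *(1) list_update_values(1)[OF *(1) *(3,2)] by auto
 show "Plus C (F (map ((!) f) r)) (F (map ((!) ?s) r)) =
   Plus C (F (map ((!) (f[j := f ! i])) r)) (F (map ((!) (f[i := f ! j])) r))"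
 proof (cases "i \<in> set r \<and> j \<in> set r")
  case True
  then obtain k l where kl: "k < length r" "l < length r" "i = r ! k" "j = r ! l" by (metis in_set_conv_nth)
  hence "k \<noteq> l" using * by auto
  thus ?thesis
   using exchange_relD[OF F vals[OF refl *(1)], of k l] kl r(1) upd[of k] upd[of l] by simp
 next
  case False
  then consider "i \<notin> set r" | "j \<notin> set r" by blast
  thus ?thesis
  proof cases
   case 1
   have "map ((!) ?s) r = map ((!) (f[j := f ! i])) r"
    unfolding list_update_swap[OF *(4)] by (rule out[OF 1])
   thus ?thesis using out[OF 1, of f] plus_comm[OF o in'] by (simp del: map_eq_conv)
  next
   case 2
   thus ?thesis using out[OF 2] by (simp del: map_eq_conv)
  qed
 qed
qed

section \<open>The action of arbitrary sequences on a simplicial object\<close>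

definition signed_simplex :: "('o, 'm) sobj => nat => nat list => nat set => 'm" where
 "signed_simplex X n s S =
  (if inj_on ((!) s) S
   then signed (Fo X n) (nobj X (card S - 1)) (sign (induced_perm s S)) (sproj X n ((!) s ` S))
   else Zero C (Fo X n) (nobj X (card S - 1)))"

text \<open>The finite-set extension transported back to \<open>X\<close> along the canonical
  isomorphism; \<open>gam\<close> is its value at the fold map. By \<open>gamma_eq\<close> it is the
  morphism whose composites with \<open>sproj\<close> are the morphisms
  \<open>signed_simplex\<close>.\<close>

definition gamma :: "('o, 'm) sobj => nat => nat => nat list => 'm" where
 "gamma X n m s = inv_mor C (Fo X m) (Fo (fin_ext C X) m) (fin_ext_can C X m) \<cdot>
   Fm (fin_ext C X) n m s \<cdot> fin_ext_can C X n"

lemma gam_eq_gamma: "gam C k X n = gamma X n (conc (rep k n)) (fold_map k n)"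
 by (simp add: gam_def gamma_def Let_def)

context
 fixes X
 assumes X: "simplicial X"
begin

lemma signed_simplex_in:
 assumes "S \<in> faces m" "length s = Suc m" "set s \<subseteq> {..n}"
 shows "signed_simplex X n s S \<in> Hom C (Fo X n) (nobj X (card S - 1))"
proof -
 have "sproj X n ((!) s ` S) \<in> Hom C (Fo X n) (nobj X (card S - 1))" if "inj_on ((!) s) S"
  using sproj_in[OF X image_faces[OF assms]] that by (simp add: card_image)
 thus ?thesis
  using sobj_obj[OF X] norm_obj[OF X] by (simp add: signed_simplex_def signed_in zero_in)
qed

lemma signed_simplex_mono:
 assumes "S \<in> faces m" "s \<in> Hom Simp m n"
 shows "signed_simplex X n s S = sproj X m S \<cdot> Fm X n m s"
 using sproj_comp[OF X assms(2,1)] induced_perm_mono[OF assms]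
 by (simp add: signed_simplex_def signed_def)

lemma signed_simplex_cong:
 assumes "S \<in> faces m" "!!t. t \<in> S ==> s ! t = b ! t"
 shows "signed_simplex X n s S = signed_simplex X n b S"
proof -
 have "elems S ! i \<in> S" if "i < card S" for i
  using that facesD[OF assms(1)] by (metis nth_mem)
 hence "induced_perm s S i = induced_perm b S i" for i
  using assms(2) by (auto simp: induced_perm_def intro!: arg_cong[of _ _ card])
 hence "induced_perm s S = induced_perm b S" by blast
 moreover have "inj_on ((!) s) S = inj_on ((!) b) S" "(!) s ` S = (!) b ` S"
  using assms(2) inj_on_cong[of S "(!) s" "(!) b"] by (auto intro: image_cong)
 ultimately show ?thesis by (simp add: signed_simplex_def)
qed

lemma signed_simplex_exchange:
 assumes S: "S \<in> faces m"
 shows "exchange_rel (Suc m) n (\<lambda>b. signed_simplex X n b S)"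
 unfolding exchange_rel_def
proof clarify
 fix b i j assume *: "length b = Suc m" "set b \<subseteq> {..n}" "i < Suc m" "j < Suc m" "i \<noteq> j"
 note o = sobj_obj[OF X] and N = norm_obj[OF X]
 let ?F = "\<lambda>b. signed_simplex X n b S" and ?s = "b[i := b ! j, j := b ! i]"
 have Fin: "?F b \<in> Hom C (Fo X n) (nobj X (card S - 1))"
  "?F (b[j := b ! i]) \<in> Hom C (Fo X n) (nobj X (card S - 1))"
  using signed_simplex_in[OF S *(1,2)] signed_simplex_in[OF S _ list_update_values(1)[OF *(2)], of j i] *
  by simp_all
 show "Plus C (?F b) (?F ?s) = Plus C (?F (b[j := b ! i])) (?F (b[i := b ! j]))"
 proof (cases "i \<in> S \<and> j \<in> S")
  case False
  then consider "i \<notin> S" | "j \<notin> S" by blast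
  thus ?thesis
  proof cases
   case 1
   have "?F ?s = ?F (b[j := b ! i])" "?F (b[i := b ! j]) = ?F b"
    by (rule signed_simplex_cong[OF S]; use 1 in \<open>metis nth_list_update nth_list_update_neq list_update_swap\<close>)+
   thus ?thesis using plus_comm[OF o N Fin] by simp
  next
   case 2
   have "?F ?s = ?F (b[i := b ! j])" "?F (b[j := b ! i]) = ?F b"
    by (rule signed_simplex_cong[OF S]; use 2 in \<open>metis nth_list_update_neq\<close>)+
   thus ?thesis by simp
  qed
 next
  case True
  have "\<not> inj_on ((!) (b[j := b ! i])) S" "\<not> inj_on ((!) (b[i := b ! j])) S"
   using True * inj_onD[of "(!) (b[j := b ! i])" S i j] inj_onD[of "(!) (b[i := b ! j])" S i j]
   by auto
  hence rhs: "Plus C (?F (b[j := b ! i])) (?F (b[i := b ! j])) = Zero C (Fo X n) (nobj X (card S - 1))"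
   using o N by (simp add: signed_simplex_def plus_zero zero_in)
  have swap: "?s ! t = b ! (transpose i j t)" for t
   using * by (auto simp: nth_list_update transpose_def)
  have tS: "transpose i j ` S = S" using True by (auto simp: transpose_def image_iff)
  have eq: "(!) ?s = (!) b \<circ> transpose i j" using swap by auto
  have img: "(!) ?s ` S = (!) b ` S" unfolding eq image_comp[symmetric] tS ..
  have inj: "inj_on ((!) ?s) S \<longleftrightarrow> inj_on ((!) b) S"
   unfolding eq using comp_inj_on_iff[of "transpose i j" S "(!) b"] tS by simp
  show ?thesis
  proof (cases "inj_on ((!) b) S")
   case False
   thus ?thesis using rhs inj o N by (simp add: signed_simplex_def plus_zero zero_in)
  next
   case injb: True
   have sp: "sproj X n ((!) b ` S) \<in> Hom C (Fo X n) (nobj X (card S - 1))"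
    using sproj_in[OF X image_faces[OF S *(1,2)]] injb by (simp add: card_image)
   have "sign (induced_perm ?s S) = - sign (induced_perm b S)"
    using True by (intro sign_induced_perm_swap[OF S *(1) injb _ _ *(5)]) auto
   thus ?thesis
    unfolding rhs using inj injb img sp o N plus_neg[OF o N sp]
    by (auto simp: signed_simplex_def signed_def sign_def split: if_splits)
  qed
 qed
qed

text \<open>Existence comes from the exchange relation, solved for the unsorted list as
  \<open>g1 + g2 - g3\<close>. Thus the compatibility of signs with the differential need not be
  verified: on monotone lists the morphism is a structure map of \<open>X\<close>.\<close>

lemma gamma_exists:
 assumes "length b = Suc m" "set b \<subseteq> {..n}"
 shows "\<exists>g\<in>Hom C (Fo X n) (Fo X m). \<forall>S\<in>faces m. sproj X m S \<cdot> g = signed_simplex X n b S"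
 using assms
proof (induction b rule: exchange_induct)
 case (sorted b)
 hence "b \<in> Hom Simp m n" by (simp add: Simp_hom)
 thus ?case using sobj_map[OF X] signed_simplex_mono by (metis)
next
 case (exchange b i j)
 note o = sobj_obj[OF X] and N = norm_obj[OF X]
 let ?s = "b[i := b ! j, j := b ! i]"
 obtain g1 g2 g3 where g: "g1 \<in> Hom C (Fo X n) (Fo X m)" "g2 \<in> Hom C (Fo X n) (Fo X m)" "g3 \<in> Hom C (Fo X n) (Fo X m)"
  and g1: "\<forall>S\<in>faces m. sproj X m S \<cdot> g1 = signed_simplex X n (b[j := b ! i]) S"
  and g2: "\<forall>S\<in>faces m. sproj X m S \<cdot> g2 = signed_simplex X n (b[i := b ! j]) S"
  and g3: "\<forall>S\<in>faces m. sproj X m S \<cdot> g3 = signed_simplex X n ?s S"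
  using exchange(6-8) by blast
 let ?g = "Sub (Fo X n) (Fo X m) (Plus C g1 g2) g3"
 have p: "Plus C g1 g2 \<in> Hom C (Fo X n) (Fo X m)" by (rule plus_in[OF o o g(1,2)])
 show ?case
 proof (intro bexI[of _ ?g] ballI sub_in[OF o o p g(3)])
  fix S assume S: "S \<in> faces m"
  note q = sproj_in[OF X S]
  have "sproj X m S \<cdot> ?g = Sub (Fo X n) (nobj X (card S - 1))
    (Plus C (sproj X m S \<cdot> g1) (sproj X m S \<cdot> g2)) (sproj X m S \<cdot> g3)"
   using comp_sub_right[OF o o N p g(3) q] comp_add_right[OF o o N g(1,2) q] by simp
  also have "Plus C (sproj X m S \<cdot> g1) (sproj X m S \<cdot> g2) =
    Plus C (signed_simplex X n b S) (sproj X m S \<cdot> g3)"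
   using exchange_relD[OF signed_simplex_exchange[OF S] exchange(1,2), of i j] exchange(3,4) g1 g2 g3 S by simp
  finally show "sproj X m S \<cdot> ?g = signed_simplex X n b S"
   using sub_eq_iff[OF o N plus_in[OF o N] _ signed_simplex_in[OF S exchange(1,2)]]
    comp_in[OF o o N g(3) q] signed_simplex_in[OF S exchange(1,2)] by simp
 qed
qed

text \<open>The recognition principle that removes the definite description in
  \<open>fin_ext\<close> and the chosen Hom objects: everything is moved to \<open>X\<close> along
  the inverses \<open>v\<close> and \<open>w\<close> of the canonical maps.\<close>

lemma gamma_eq:
 assumes s: "length s = Suc m" "set s \<subseteq> {..n}" and g: "g \<in> Hom C (Fo X n) (Fo X m)"
  and gS: "!!S. S \<in> faces m ==> sproj X m S \<cdot> g = signed_simplex X n s S"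
 shows "gamma X n m s = g"
proof -
 note o = sobj_obj[OF X] and N = norm_obj[OF X]
 let ?H = "\<lambda>n. fst (hom_complex C X n)" and ?p = "\<lambda>n. snd (hom_complex C X n)" and ?c = "fin_ext_can C X"
 have H: "?H n \<in> Obj C" and Hp: "is_chain_map C X n (?H n) (?p n)"
  and U: "!!a r. a \<in> Obj C ==> is_chain_map C X n a r ==> \<exists>!h. h \<in> Hom C a (?H n) \<and> (\<forall>S\<in>faces n. ?p n S \<cdot> h = r S)" for n
  using hom_complex[OF X, of n] by (auto simp: is_hom_complex_def)
 have p: "?p n S \<in> Hom C (?H n) (nobj X (card S - 1))" if "S \<in> faces n" for S n
  using Hp[of n] that by (simp add: is_chain_map_def)
 obtain v where v: "inverse_pair C (Fo X n) (?H n) (?c n) v"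
  "!!S. S \<in> faces n ==> sproj X n S \<cdot> v = ?p n S"
  using fin_ext_can_iso[OF X, of n] by blast
 obtain w where w: "inverse_pair C (Fo X m) (?H m) (?c m) w"
  "!!S. S \<in> faces m ==> sproj X m S \<cdot> w = ?p m S"
  "!!S. S \<in> faces m ==> ?p m S \<cdot> ?c m = sproj X m S"
  using fin_ext_can_iso[OF X, of m] by blast
 have vh: "?c n \<in> Hom C (Fo X n) (?H n)" "v \<in> Hom C (?H n) (Fo X n)" "v \<cdot> ?c n = Idm C (Fo X n)"
  and wh: "?c m \<in> Hom C (Fo X m) (?H m)" "w \<in> Hom C (?H m) (Fo X m)" "w \<cdot> ?c m = Idm C (Fo X m)" "?c m \<cdot> w = Idm C (?H m)"
  using v(1) w(1) by (auto simp: inverse_pair_def)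
 have gv: "g \<cdot> v \<in> Hom C (?H n) (Fo X m)" by (rule comp_in[OF H o o vh(2) g])
 \<comment> \<open>The candidate for the map between the chosen Hom objects: \<open>g\<close>
   conjugated by the canonical isomorphisms.\<close>
 let ?h = "?c m \<cdot> (g \<cdot> v)"
 have h: "?h \<in> Hom C (?H n) (?H m)" by (rule comp_in[OF H o H gv wh(1)])
 have inj: "x = y" if "x \<in> Hom C (?H n) (?H m)" "y \<in> Hom C (?H n) (?H m)"
  "!!S. S \<in> faces m ==> ?p m S \<cdot> x = ?p m S \<cdot> y" for x y
 proof -
  have wx: "w \<cdot> z \<in> Hom C (?H n) (Fo X m)" "?c m \<cdot> (w \<cdot> z) = z" if "z \<in> Hom C (?H n) (?H m)" for z
   using comp_in[OF H H o that wh(2)] assoc[OF H H o H that wh(2,1)] wh(4) id_left[OF H H that] by auto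
  have "w \<cdot> x = w \<cdot> y"
  proof (rule sproj_ext[OF X H wx(1)[OF that(1)] wx(1)[OF that(2)]])
   fix S assume S: "S \<in> faces m"
   show "sproj X m S \<cdot> (w \<cdot> x) = sproj X m S \<cdot> (w \<cdot> y)"
    using assoc[OF H H o N that(1) wh(2) sproj_in[OF X S]]
     assoc[OF H H o N that(2) wh(2) sproj_in[OF X S]] w(2)[OF S] that(3)[OF S] by simp
  qed
  thus ?thesis using wx(2)[OF that(1)] wx(2)[OF that(2)] by metis
 qed
 let ?P = "\<lambda>h. h \<in> Hom C (?H n) (?H m) \<and> (\<forall>S\<in>faces m. ?p m S \<cdot> h =
   (let G = hom_group C (?H n) (nobj X (card S - 1)) in
    if inj_on ((!) s) S
    then ?p n ((!) s ` S) [^]\<^bsub>G\<^esub> (sign (induced_perm s S) :: int)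
    else \<one>\<^bsub>G\<^esub>))"
 have Ph: "?P ?h"
 proof (intro conjI ballI h)
  fix S assume S: "S \<in> faces m"
  have "?p m S \<cdot> ?h = sproj X m S \<cdot> (g \<cdot> v)"
   using assoc[OF H o H N gv wh(1) p[OF S]] w(3)[OF S] by simp
  also have "\<dots> = signed_simplex X n s S \<cdot> v"
   using assoc[OF H o o N vh(2) g sproj_in[OF X S]] gS[OF S] by simp
  also have "\<dots> = (let G = hom_group C (?H n) (nobj X (card S - 1)) in
    if inj_on ((!) s) S
    then ?p n ((!) s ` S) [^]\<^bsub>G\<^esub> (sign (induced_perm s S) :: int)
    else \<one>\<^bsub>G\<^esub>)"
  proof (cases "inj_on ((!) s) S")
   case False
   thus ?thesis using comp_zero_left[OF H o N vh(2)] by (simp add: signed_simplex_def)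
  next
   case True
   have ne: "(!) s ` S \<in> faces n" by (rule image_faces[OF S s])
   have c: "card ((!) s ` S) = card S" using True by (rule card_image)
   show ?thesis
    using True signed_comp(2)[OF H o N vh(2) sproj_in[OF X ne]] v(2)[OF ne] p[OF ne] c
     int_pow_signed[OF H N p[OF ne]] by (simp add: signed_simplex_def sign_def)
  qed
  finally show "?p m S \<cdot> ?h = (let G = hom_group C (?H n) (nobj X (card S - 1)) in
    if inj_on ((!) s) S
    then ?p n ((!) s ` S) [^]\<^bsub>G\<^esub> (sign (induced_perm s S) :: int)
    else \<one>\<^bsub>G\<^esub>)" .
 qed
 have "Fm (fin_ext C X) n m s = (THE h. ?P h)" by (simp add: fin_ext_def)
 also have "\<dots> = ?h" using Ph inj by (intro the_equality) auto
 finally have F: "Fm (fin_ext C X) n m s = ?h" .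
 have "inv_mor C (Fo X m) (?H m) (?c m) = w" by (rule inv_mor_eq[OF o H w(1)])
 hence "gamma X n m s = w \<cdot> (?h \<cdot> ?c n)" unfolding gamma_def F by (simp add: fin_ext_def)
 also have "?h \<cdot> ?c n = ?c m \<cdot> g"
  using assoc[OF o H o H vh(1) gv wh(1)] assoc[OF o H o o vh(1,2) g] vh(3) id_right[OF o o g] by simp
 also have "w \<cdot> (?c m \<cdot> g) = g"
  using assoc[OF o o H o g wh(1,2)] wh(3) id_left[OF o o g] by simp
 finally show ?thesis .
qed

context
 fixes s :: "nat list" and m n
 assumes s: "length s = Suc m" "set s \<subseteq> {..n}"
begin

lemma gamma_in: "gamma X n m s \<in> Hom C (Fo X n) (Fo X m)"
 and sproj_gamma: "S \<in> faces m ==> sproj X m S \<cdot> gamma X n m s = signed_simplex X n s S"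
 using gamma_exists[OF s] gamma_eq[OF s] by auto

end

lemma gamma_mono: "s \<in> Hom Simp m n ==> gamma X n m s = Fm X n m s"
 using sobj_map[OF X] signed_simplex_mono by (intro gamma_eq) (auto simp: Simp_hom)

text \<open>The projections to normalized faces are jointly monic, so the relation is inherited from
  \<open>signed_simplex\<close>.\<close>

lemma gamma_exchange: "exchange_rel (Suc m) n (gamma X n m)"
 unfolding exchange_rel_def
proof clarify
 fix b i j assume *: "length b = Suc m" "set b \<subseteq> {..n}" "i < Suc m" "j < Suc m" "i \<noteq> j"
 note o = sobj_obj[OF X] and N = norm_obj[OF X]
 let ?s = "b[i := b ! j, j := b ! i]"
 have vals: "set ?s \<subseteq> {..n}" "set (b[j := b ! i]) \<subseteq> {..n}" "set (b[i := b ! j]) \<subseteq> {..n}"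
  using * list_update_values[of b n i j] list_update_values(1)[of b n j i] by auto
 have g: "gamma X n m b \<in> Hom C (Fo X n) (Fo X m)" "gamma X n m ?s \<in> Hom C (Fo X n) (Fo X m)"
  "gamma X n m (b[j := b ! i]) \<in> Hom C (Fo X n) (Fo X m)" "gamma X n m (b[i := b ! j]) \<in> Hom C (Fo X n) (Fo X m)"
  using * vals by (auto intro!: gamma_in)
 show "Plus C (gamma X n m b) (gamma X n m ?s) = Plus C (gamma X n m (b[j := b ! i])) (gamma X n m (b[i := b ! j]))"
 proof (rule sproj_ext[OF X o plus_in[OF o o g(1,2)] plus_in[OF o o g(3,4)]])
  fix S assume S: "S \<in> faces m"
  note q = sproj_in[OF X S]
  show "sproj X m S \<cdot> Plus C (gamma X n m b) (gamma X n m ?s) =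
    sproj X m S \<cdot> Plus C (gamma X n m (b[j := b ! i])) (gamma X n m (b[i := b ! j]))"
   using comp_add_right[OF o o N g(1,2) q] comp_add_right[OF o o N g(3,4) q] * vals
    exchange_relD[OF signed_simplex_exchange[OF S] *]
   by (simp add: sproj_gamma[OF _ _ S])
 qed
qed

text \<open>Checked face by face: \<open>a\<close> may repeat positions, whereas
  \<open>exchange_rel_select\<close> asks for distinct ones. On a face where \<open>a\<close> is
  injective, it is increasing and leaves the induced permutation unchanged.\<close>

lemma gamma_precomp:
 assumes s: "length s = Suc m" "set s \<subseteq> {..n}" and a: "a \<in> Hom Simp l m"
 shows "gamma X n l (map ((!) s) a) = Fm X m l a \<cdot> gamma X n m s"
proof (rule gamma_eq)
 note o = sobj_obj[OF X] and g = gamma_in[OF s]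
 have al: "set a \<subseteq> {..<length s}" using a s by (auto simp: Simp_hom)
 thus "length (map ((!) s) a) = Suc l" "set (map ((!) s) a) \<subseteq> {..n}"
  using a s set_map_nth[OF al] by (auto simp: Simp_hom)
 show "Fm X m l a \<cdot> gamma X n m s \<in> Hom C (Fo X n) (Fo X l)" by (rule sobj_map_in[OF X o g a])
 fix S assume S: "S \<in> faces l"
 have eq: "map ((!) s) a ! t = s ! (a ! t)" if "t \<in> S" for t
  using that S a by (auto simp: nonempty_subsets_def Simp_hom)
 have inj_eq: "inj_on ((!) (map ((!) s) a)) S \<longleftrightarrow> inj_on ((!) a) S \<and> inj_on ((!) s) ((!) a ` S)"
 proof -
  have "inj_on ((!) (map ((!) s) a)) S \<longleftrightarrow> inj_on ((!) s \<circ> (!) a) S" using eq by (intro inj_on_cong) auto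
  thus ?thesis by (meson comp_inj_on inj_on_imageI inj_on_imageI2)
 qed
 have img: "(!) (map ((!) s) a) ` S = (!) s ` ((!) a ` S)" using eq by (auto simp: image_iff)
 show "sproj X l S \<cdot> (Fm X m l a \<cdot> gamma X n m s) = signed_simplex X n (map ((!) s) a) S"
 proof (cases "inj_on ((!) a) S")
  case True
  have ne: "(!) a ` S \<in> faces m" using S a by (intro image_faces) (auto simp: Simp_hom)
  have "sproj X l S \<cdot> (Fm X m l a \<cdot> gamma X n m s) = signed_simplex X n s ((!) a ` S)"
   using sproj_map[OF X a S o g] True sproj_gamma[OF s ne] by simp
  thus ?thesis
   using True inj_eq img induced_perm_comp[OF S a True] by (simp add: signed_simplex_def card_image)
 next
  case False
  thus ?thesis using sproj_map[OF X a S o g] inj_eq by (simp add: signed_simplex_def)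
 qed
qed

end

text \<open>The pattern for all later reductions: both sides are exchange families in
  \<open>s\<close>, and for monotone \<open>s\<close> the claim is naturality for structure
  maps.\<close>

lemma gamma_natural:
 assumes X: "simplicial X" and Y: "simplicial Y" and p: "snat X Y p"
  and s: "length s = Suc m" "set s \<subseteq> {..n}"
 shows "p m \<cdot> gamma X n m s = gamma Y n m s \<cdot> p n"
proof (rule exchange_rel_unique[OF sobj_obj[OF X] sobj_obj[OF Y] _ _ _ _ _ s])
 note o = sobj_obj[OF X] and o' = sobj_obj[OF Y] and f = snat_in[OF p]
 show "exchange_rel (Suc m) n (\<lambda>s. p m \<cdot> gamma X n m s)"
  by (rule exchange_rel_comp_left[OF o o o' gamma_exchange[OF X] gamma_in[OF X] f])
 show "exchange_rel (Suc m) n (\<lambda>s. gamma Y n m s \<cdot> p n)"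
  by (rule exchange_rel_comp_right[OF o o' o' gamma_exchange[OF Y] gamma_in[OF Y] f])
 fix s :: "nat list" assume s: "length s = Suc m" "set s \<subseteq> {..n}"
 show "p m \<cdot> gamma X n m s \<in> Hom C (Fo X n) (Fo Y m)" by (rule comp_in[OF o o o' gamma_in[OF X s] f])
 show "gamma Y n m s \<cdot> p n \<in> Hom C (Fo X n) (Fo Y m)" by (rule comp_in[OF o o' o' f gamma_in[OF Y s]])
 assume "sorted s"
 hence "s \<in> Hom Simp m n" using s by (simp add: Simp_hom)
 thus "p m \<cdot> gamma X n m s = gamma Y n m s \<cdot> p n"
  using gamma_mono[OF X] gamma_mono[OF Y] snat_nat[OF p] by simp
qed

lemma gamma_postcomp:
 assumes X: "simplicial X" and b: "b \<in> Hom Simp n k" and g: "length g = Suc m" "set g \<subseteq> {..n}"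
 shows "gamma X k m (map ((!) b) g) = gamma X n m g \<cdot> Fm X k n b"
proof (rule exchange_rel_unique[OF sobj_obj[OF X] sobj_obj[OF X] _ _ _ _ _ g])
 note o = sobj_obj[OF X]
 have a: "b ! x \<le> k" if "x \<le> n" for x
  using Simp_nth_le[OF b that] .
 have vals: "length (map ((!) b) t) = Suc m" "set (map ((!) b) t) \<subseteq> {..k}"
  if "length t = Suc m" "set t \<subseteq> {..n}" for t using that a by auto
 show "exchange_rel (Suc m) n (\<lambda>g. gamma X k m (map ((!) b) g))"
  using exchange_rel_context[OF gamma_exchange[OF X], where xs = "[]" and ys = "[]" and L' = "Suc m"
    and n' = n and f = "(!) b"] a by simp
 show "exchange_rel (Suc m) n (\<lambda>g. gamma X n m g \<cdot> Fm X k n b)"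
  by (rule exchange_rel_comp_right[OF o o o gamma_exchange[OF X] gamma_in[OF X] sobj_map[OF X b]])
 fix g :: "nat list" assume g: "length g = Suc m" "set g \<subseteq> {..n}"
 show "gamma X k m (map ((!) b) g) \<in> Hom C (Fo X k) (Fo X m)" by (rule gamma_in[OF X vals[OF g]])
 show "gamma X n m g \<cdot> Fm X k n b \<in> Hom C (Fo X k) (Fo X m)"
  by (rule comp_in[OF o o o sobj_map[OF X b] gamma_in[OF X g]])
 assume "sorted g"
 hence s: "g \<in> Hom Simp m n" using g by (simp add: Simp_hom)
 show "gamma X k m (map ((!) b) g) = gamma X n m g \<cdot> Fm X k n b"
  using gamma_mono[OF X s] gamma_mono[OF X Simp_comp_hom[OF s b]] sobj_comp[OF X s b] by simp
qed

end

section \<open>Tuples of consecutive blocks\<close>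

lemma Simp_lessThan: "a \<in> Hom Simp m n ==> set a \<subseteq> {..<Suc n}"
 by (simp add: Simp_hom lessThan_Suc_atMost)

lemma map_add_upt_left: "map ((+) c) [a..<b] = [c + a..<c + b]"
 by (rule nth_equalityI) simp_all

lemma pow_simps [simp]:
 "as \<in> Obj (pow_cat k A) \<longleftrightarrow> length as = k \<and> set as \<subseteq> Obj A"
 "fs \<in> Hom (pow_cat k A) as bs \<longleftrightarrow> length fs = k \<and> (\<forall>i<k. fs ! i \<in> Hom A (as ! i) (bs ! i))"
 "Idm (pow_cat k A) as = map (Idm A) as"
 "gs \<cdot>\<^bsub>pow_cat k A\<^esub> fs = map2 (Cmp A) gs fs"
 by (simp_all add: pow_cat_def)

abbreviation "pObj k \<equiv> Obj (pow_cat k Simp_op)"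

abbreviation "pHom k \<equiv> Hom (pow_cat k Simp_op)"

definition dims :: "nat list list => nat list" where
 "dims bs = map (\<lambda>b. length b - 1) bs"

text \<open>A monotone map \<open>[n_1] \<star> \<dots> \<star> [n_k] \<rightarrow> [m]\<close> cut
  into its restrictions to the summands; the numbers \<open>n_i\<close> are recovered by
  \<open>dims\<close>. For \<open>k = 0\<close> only the empty tuple remains and stands for the
  empty concatenation, which is no object of \<Delta>.\<close>

definition blocks :: "nat => nat => nat list list set" where
 "blocks k m = {bs. length bs = k \<and> [] \<notin> set bs \<and> sorted (concat bs) \<and> set (concat bs) \<subseteq> {..m}}"

text \<open>Precomposition block by block. The same operation is composition in the power of the
  opposite simplex category, see \<open>mcomp\<close>.\<close>

definition brestr :: "nat list list => nat list list => nat list list" where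
 "brestr bs ts = map2 (\<lambda>b t. map ((!) b) t) bs ts"

text \<open>The universal tuple: the identity of a concatenation, cut into blocks.\<close>

definition id_blocks :: "nat list => nat list list" where
 "id_blocks ns = map (incl ns) [0..<length ns]"

lemma length_dims [simp]: "length (dims bs) = length bs"
 by (simp add: dims_def)

lemma dims_Cons: "dims (b # bs) = (length b - 1) # dims bs"
 by (simp add: dims_def)

lemma sorted_concat_iff:
 "sorted (concat xss) \<longleftrightarrow> (\<forall>xs\<in>set xss. sorted xs) \<and> sorted_wrt (\<lambda>xs ys. \<forall>x\<in>set xs. \<forall>y\<in>set ys. x \<le> y) xss"
 by (induction xss) (auto simp: sorted_append)

lemma sorted_concat_mono:
 assumes "sorted (concat bs)" "length gs = length bs"
  "!!i. i < length bs ==> sorted (gs ! i) \<and> set (gs ! i) \<subseteq> set (bs ! i)"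
 shows "sorted (concat gs)"
proof -
 have sw: "sorted_wrt (\<lambda>xs ys. \<forall>x\<in>set xs. \<forall>y\<in>set ys. x \<le> y) bs"
  using assms(1) by (simp add: sorted_concat_iff)
 have "sorted_wrt (\<lambda>xs ys. \<forall>x\<in>set xs. \<forall>y\<in>set ys. x \<le> y) gs"
  unfolding sorted_wrt_iff_nth_less
 proof (intro allI impI ballI)
  fix i j x y assume ij: "i < j" "j < length gs" and x: "x \<in> set (gs ! i)" "y \<in> set (gs ! j)"
  have "x \<in> set (bs ! i)" "y \<in> set (bs ! j)"
   using assms(2) subsetD[OF conjunct2[OF assms(3)], of i x] subsetD[OF conjunct2[OF assms(3)], of j y] ij x
   by simp_all
  thus "x \<le> y" using sw assms(2) ij by (auto simp: sorted_wrt_iff_nth_less)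
 qed
 moreover have "sorted xs" if xs: "xs \<in> set gs" for xs
 proof -
  obtain i where "i < length bs" "xs = gs ! i" using xs assms(2) by (auto simp: in_set_conv_nth)
  thus ?thesis using assms(3) by simp
 qed
 ultimately show ?thesis by (simp add: sorted_concat_iff)
qed

lemma blocksD:
 assumes "bs \<in> blocks k m" "i < k"
 shows "bs ! i \<noteq> []" "sorted (bs ! i)" "set (bs ! i) \<subseteq> {..m}" "Suc (dims bs ! i) = length (bs ! i)"
proof -
 have mem: "bs ! i \<in> set bs" using assms by (auto simp: blocks_def)
 thus "bs ! i \<noteq> []" "sorted (bs ! i)" "set (bs ! i) \<subseteq> {..m}"
  using assms(1) unfolding blocks_def sorted_concat_iff by (auto simp: UN_subset_iff)
 thus "Suc (dims bs ! i) = length (bs ! i)" using assms by (simp add: blocks_def dims_def)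
qed

lemma blocks_mono:
 assumes "bs \<in> blocks k m" "length gs = k"
  "!!i. i < k ==> gs ! i \<noteq> [] \<and> sorted (gs ! i) \<and> set (gs ! i) \<subseteq> set (bs ! i)"
 shows "gs \<in> blocks k m"
proof -
 have "sorted (concat gs)"
 proof (rule sorted_concat_mono[of bs])
  show "sorted (concat bs)" "length gs = length bs" using assms(1,2) by (auto simp: blocks_def)
  fix i assume "i < length bs"
  thus "sorted (gs ! i) \<and> set (gs ! i) \<subseteq> set (bs ! i)" using assms(1) assms(3)[of i] by (simp add: blocks_def)
 qed
 moreover have "[] \<notin> set gs"
 proof
  assume "[] \<in> set gs"
  then obtain i where "i < k" "[] = gs ! i" using assms(2) by (auto simp: in_set_conv_nth)
  thus False using assms(3)[of i] by simp
 qed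
 moreover have "set (concat gs) \<subseteq> {..m}"
 proof
  fix x assume "x \<in> set (concat gs)"
  then obtain g where g: "g \<in> set gs" "x \<in> set g" by auto
  then obtain i where i: "i < k" "x \<in> set (gs ! i)" using assms(2) by (metis in_set_conv_nth)
  thus "x \<in> {..m}" using assms(3)[OF i(1)] blocksD(3)[OF assms(1) i(1)] by blast
 qed
 ultimately show ?thesis using assms(2) by (simp add: blocks_def)
qed

lemma sum_list_Suc_dims: "[] \<notin> set bs ==> sum_list (map Suc (dims bs)) = length (concat bs)"
 by (induction bs) (auto simp: dims_def)

lemma Suc_conc: "ns \<noteq> [] ==> Suc (conc ns) = sum_list (map Suc ns)"
 by (cases ns) (auto simp: conc_def)

lemma concat_hom:
 assumes "bs \<in> blocks k m" "0 < k"
 shows "concat bs \<in> Hom Simp (conc (dims bs)) m"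
proof -
 have "dims bs \<noteq> []" using assms by (auto simp: blocks_def dims_def)
 thus ?thesis
  using assms sum_list_Suc_dims[of bs] Suc_conc[of "dims bs"] by (simp add: blocks_def Simp_hom)
qed

lemma blocks_sub:
 assumes "bs \<in> blocks k m" "ts \<in> pHom k (dims bs) ns" "i < k"
 shows "set (ts ! i) \<subseteq> {..<length (bs ! i)}"
 using Simp_lessThan[of "ts ! i" "ns ! i" "dims bs ! i"] blocksD(4)[OF assms(1,3)] assms by simp

lemma blocks_0: "blocks 0 m = {[]}"
 by (auto simp: blocks_def)

lemma dims_Nil [simp]: "dims [] = []" and brestr_Nil [simp]: "brestr [] ts = []"
 by (simp_all add: dims_def brestr_def)

lemma blocks_hom:
 "bs \<in> blocks k m ==> bs \<in> pHom k (rep k m) (dims bs)"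
 using blocksD[of bs k m] by (auto simp: Simp_hom blocks_def dims_def)

lemma dims_len: "bs \<in> blocks k m ==> length (dims bs) = k"
 by (simp add: blocks_def)

lemma brestr_tuple:
 assumes "bs \<in> blocks k m" "ts \<in> pHom k (dims bs) ns" "length ns = k"
 shows "brestr bs ts \<in> blocks k m" "dims (brestr bs ts) = ns"
proof -
 have len: "length bs = k" "length ts = k" using assms by (auto simp: blocks_def)
 have t: "ts ! i \<in> Hom Simp (ns ! i) (dims bs ! i)" if "i < k" for i using assms that by auto
 have nth: "brestr bs ts ! i = map ((!) (bs ! i)) (ts ! i)" if "i < k" for i
  using that len by (simp add: brestr_def)
 note sub = blocks_sub[OF assms(1,2)]
 show "brestr bs ts \<in> blocks k m"
 proof (rule blocks_mono[OF assms(1)])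
  fix i assume i: "i < k"
  show "brestr bs ts ! i \<noteq> [] \<and> sorted (brestr bs ts ! i) \<and> set (brestr bs ts ! i) \<subseteq> set (bs ! i)"
   unfolding nth[OF i]
   using t[OF i] sorted_map_nth[OF blocksD(2)[OF assms(1) i] _ sub[OF i]] set_map_nth[OF sub[OF i]]
   by (auto simp: Simp_hom)
 qed (use len in \<open>simp add: brestr_def\<close>)
 show "dims (brestr bs ts) = ns"
 proof (rule nth_equalityI)
  fix i assume "i < length (dims (brestr bs ts))"
  hence "i < k" using len by (simp add: brestr_def)
  thus "dims (brestr bs ts) ! i = ns ! i"
   using t nth len by (simp add: dims_def Simp_hom brestr_def)
 qed (use len assms(3) in \<open>simp add: brestr_def\<close>)
qed

lemma block_map_tuple:
 assumes "bs \<in> blocks k m" "f \<in> Hom Simp m n"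
 shows "map (map ((!) f)) bs \<in> blocks k n" "dims (map (map ((!) f)) bs) = dims bs"
proof -
 have "set (concat bs) \<subseteq> {..<length f}" using assms by (auto simp: blocks_def Simp_hom)
 hence "sorted (map ((!) f) (concat bs))" "set (map ((!) f) (concat bs)) \<subseteq> {..n}"
  using assms sorted_map_nth[of f "concat bs"] set_map_nth[of "concat bs" f]
  by (auto simp: blocks_def Simp_hom)
 thus "map (map ((!) f)) bs \<in> blocks k n"
  using assms(1) by (auto simp: blocks_def map_concat)
qed (simp add: dims_def)

text \<open>Makes the block-wise operation a composition with the concatenated map, which is how the
  functor \<open>dec\<close> acts on arrows.\<close>

lemma concat_brestr:
 assumes "length ts = length bs" "[] \<notin> set bs"
  "!!i. i < length bs ==> set (ts ! i) \<subseteq> {..<length (bs ! i)}"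
 shows "concat (brestr bs ts) = map ((!) (concat bs)) (join (dims bs) ts)"
 using assms
proof (induction ts bs rule: list_induct2)
 case Nil thus ?case by (simp add: brestr_def dims_def)
next
 case (Cons t ts b bs)
 have IH: "concat (brestr bs ts) = map ((!) (concat bs)) (join (dims bs) ts)"
  using Cons.prems(1) Cons.prems(2)[of "Suc _"] by (intro Cons.IH) auto
 have t: "set t \<subseteq> {..<length b}" using Cons.prems(2)[of 0] by simp
 have len: "Suc (length b - 1) = length b" using Cons.prems(1) by (cases b) auto
 have 1: "map ((!) (b @ concat bs)) t = map ((!) b) t" using t by (auto simp: nth_append)
 have 2: "map ((!) (b @ concat bs)) (map ((+) (length b)) xs) = map ((!) (concat bs)) xs" for xs by simp
 show ?case using IH 1 2 len by (simp add: brestr_def dims_Cons)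
qed

lemma concat_brestr_tuple:
 assumes "bs \<in> blocks k m" "ts \<in> pHom k (dims bs) ns"
 shows "concat (brestr bs ts) = map ((!) (concat bs)) (join (dims bs) ts)"
 using assms blocks_sub[OF assms] by (intro concat_brestr) (auto simp: blocks_def)

lemma id_blocks_Cons: "id_blocks (n # ns) = [0..<Suc n] # map (map ((+) (Suc n))) (id_blocks ns)"
proof -
 have "incl (n # ns) (Suc i) = map ((+) (Suc n)) (incl ns i)" if "i < length ns" for i
  using that by (simp add: incl_def Let_def map_add_upt_left add.assoc del: upt_Suc)
 thus ?thesis
  by (simp add: id_blocks_def upt_conv_Cons map_Suc_upt[symmetric] incl_def del: upt_Suc)
qed

lemma concat_id_blocks: "concat (id_blocks ns) = [0..<sum_list (map Suc ns)]"
proof (induction ns)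
 case Nil thus ?case by (simp add: id_blocks_def)
next
 case (Cons n ns)
 have "concat (id_blocks (n # ns)) = [0..<Suc n] @ map ((+) (Suc n)) (concat (id_blocks ns))"
  by (simp add: id_blocks_Cons map_concat del: upt_Suc)
 also have "\<dots> = [0..<Suc n] @ [Suc n..<Suc n + sum_list (map Suc ns)]"
  unfolding Cons by (simp add: map_add_upt_left del: upt_Suc)
 also have "\<dots> = [0..<Suc n + sum_list (map Suc ns)]" using upt_add_eq_append[of 0 "Suc n"] by (simp del: upt_Suc)
 finally show ?case by (simp del: upt_Suc)
qed

lemma id_blocks_nth: "i < length ns ==> id_blocks ns ! i = incl ns i"
 by (simp add: id_blocks_def)

lemma length_incl: "length (incl ns i) = Suc (ns ! i)"
 by (simp add: incl_def Let_def)

lemma length_id_blocks [simp]: "length (id_blocks ns) = length ns"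
 by (simp add: id_blocks_def)

lemma dims_id_blocks: "dims (id_blocks ns) = ns"
 by (rule nth_equalityI) (simp_all add: dims_def id_blocks_nth length_incl)

lemma id_blocks_tuple:
 assumes "length ns = k" "0 < k"
 shows "id_blocks ns \<in> blocks k (conc ns)" "concat (id_blocks ns) = [0..<Suc (conc ns)]"
proof -
 have "ns \<noteq> []" using assms by auto
 thus *: "concat (id_blocks ns) = [0..<Suc (conc ns)]" by (simp add: concat_id_blocks Suc_conc)
 have "[] \<notin> set (id_blocks ns)" unfolding id_blocks_def using length_incl[of ns] by (auto simp del: upt_Suc) (metis list.size(3) nat.distinct(1))
 thus "id_blocks ns \<in> blocks k (conc ns)"
  using assms by (auto simp: blocks_def * simp del: upt_Suc set_concat)
qed

lemma blocks_eqI: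
 assumes "bs \<in> blocks k m" "gs \<in> blocks k m'" "concat bs = concat gs" "dims bs = dims gs"
 shows "bs = gs"
proof (rule concat_injective[OF assms(3)])
 show len: "length bs = length gs" using assms by (simp add: blocks_def)
 show "\<forall>(x, y)\<in>set (zip bs gs). length x = length y"
 proof clarify
  fix x y assume "(x, y) \<in> set (zip bs gs)"
  then obtain i where "i < k" "x = bs ! i" "y = gs ! i" using assms by (auto simp: in_set_zip blocks_def)
  thus "length x = length y" using blocksD(4)[OF assms(1)] blocksD(4)[OF assms(2)] assms(4) by metis
 qed
qed

text \<open>A Yoneda statement: a tuple is the image of the universal one under its own
  concatenation. It reduces every projection of the right adjoint to the counit.\<close>

lemma block_map_id_blocks:
 assumes "bs \<in> blocks k m" "0 < k"
 shows "map (map ((!) (concat bs))) (id_blocks (dims bs)) = bs"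
proof (rule blocks_eqI)
 have k: "length (dims bs) = k" using assms by (simp add: blocks_def)
 note c = concat_hom[OF assms] and i = id_blocks_tuple[OF k assms(2)]
 show "map (map ((!) (concat bs))) (id_blocks (dims bs)) \<in> blocks k m" by (rule block_map_tuple[OF i(1) c])
 show "bs \<in> blocks k m" by fact
 show "concat (map (map ((!) (concat bs))) (id_blocks (dims bs))) = concat bs"
  using i(2) map_nth_upt'[of "concat bs" "Suc (conc (dims bs))"] c by (simp add: map_concat[symmetric] Simp_hom del: upt_Suc)
 show "dims (map (map ((!) (concat bs))) (id_blocks (dims bs))) = dims bs"
  using block_map_tuple(2)[OF i(1) c] by (simp add: dims_id_blocks)
qed

lemma brestr_id_blocks:
 assumes t: "ts \<in> pHom k ms ns" and k: "length ms = k" "length ns = k" "0 < k"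
 shows "join ms ts \<in> Hom Simp (conc ns) (conc ms)"
  and "brestr (id_blocks ms) ts = map (map ((!) (join ms ts))) (id_blocks ns)"
proof -
 note im = id_blocks_tuple[OF k(1,3)] and in' = id_blocks_tuple[OF k(2,3)]
 have t': "ts \<in> pHom k (dims (id_blocks ms)) ns" using t by (simp add: dims_id_blocks)
 note r = brestr_tuple[OF im(1) t' k(2)]
 have c: "concat (brestr (id_blocks ms) ts) = map ((!) [0..<Suc (conc ms)]) (join ms ts)"
  using concat_brestr_tuple[OF im(1) t'] im(2) by (simp add: dims_id_blocks del: upt_Suc)
 have cr: "concat (brestr (id_blocks ms) ts) \<in> Hom Simp (conc ns) (conc ms)"
  using concat_hom[OF r(1) k(3)] r(2) by simp
 have jlen: "set (join ms ts) \<subseteq> {..<Suc (conc ms)}"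
 proof -
  have "set (join ms ts) \<subseteq> {..<sum_list (map Suc ms)}"
   if "length ts = length ms" "!!i. i < length ms ==> set (ts ! i) \<subseteq> {..ms ! i}" for ts
   using that
  proof (induction ts ms rule: list_induct2)
   case (Cons t ts m ms)
   have "set (join ms ts) \<subseteq> {..<sum_list (map Suc ms)}"
    using Cons.prems[of "Suc _"] by (intro Cons.IH) auto
   moreover have "set t \<subseteq> {..m}" using Cons.prems[of 0] by simp
   ultimately show ?case by auto
  qed simp
  from this[of ts] show ?thesis using t k Suc_conc[of ms] by (auto simp: Simp_hom)
 qed
 have c': "concat (brestr (id_blocks ms) ts) = join ms ts"
  unfolding c by (rule map_nth_upt[OF jlen])
 thus j: "join ms ts \<in> Hom Simp (conc ns) (conc ms)" using cr by simp
 show "brestr (id_blocks ms) ts = map (map ((!) (join ms ts))) (id_blocks ns)"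
 proof (rule blocks_eqI[OF r(1) block_map_tuple(1)[OF in'(1) j]])
  show "concat (brestr (id_blocks ms) ts) = concat (map (map ((!) (join ms ts))) (id_blocks ns))"
   unfolding c' using in'(2) j map_nth_upt'[of "join ms ts" "Suc (conc ns)"]
   by (simp add: map_concat[symmetric] Simp_hom del: upt_Suc)
  show "dims (brestr (id_blocks ms) ts) = dims (map (map ((!) (join ms ts))) (id_blocks ns))"
   using r(2) block_map_tuple(2)[OF in'(1) j] by (simp add: dims_id_blocks)
 qed
qed

lemma brestr_map:
 assumes "ts \<in> pHom k (dims bs) ns" "bs \<in> blocks k m"
 shows "brestr (map (map ((!) f)) bs) ts = map (map ((!) f)) (brestr bs ts)"
proof (rule nth_equalityI)
 have len: "length bs = k" "length ts = k" using assms by (auto simp: blocks_def)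
 thus "length (brestr (map (map ((!) f)) bs) ts) = length (map (map ((!) f)) (brestr bs ts))"
  by (simp add: brestr_def)
 fix i assume "i < length (brestr (map (map ((!) f)) bs) ts)"
 hence i: "i < k" using len by (simp add: brestr_def)
 show "brestr (map (map ((!) f)) bs) ts ! i = map (map ((!) f)) (brestr bs ts) ! i"
  using blocks_sub[OF assms(2,1) i] i len by (auto simp: brestr_def)
qed

section \<open>Positions in increasing lists\<close>

definition pos :: "nat list => nat => nat" where
 "pos b x = length (takeWhile (\<lambda>y. y < x) b)"

abbreviation support :: "nat list => nat list" where
 "support b \<equiv> elems (set b)"

lemma pos_nth: "[|sorted_wrt (<) s; i < length s|] ==> pos s (s ! i) = i"
proof (induction s arbitrary: i)
 case (Cons b s)
 thus ?case by (cases i) (auto simp: pos_def)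
qed simp

lemma pos_less: "[|sorted_wrt (<) b; x \<in> set b|] ==> pos b x < length b \<and> b ! pos b x = x"
 by (metis in_set_conv_nth pos_nth)

lemma pos_mono: "[|sorted_wrt (<) b; x \<le> y; x \<in> set b; y \<in> set b|] ==> pos b x \<le> pos b y"
 using pos_less[of b x] pos_less[of b y] sorted_wrt_nth_less[of "(<)" b "pos b y" "pos b x"]
 by (metis linorder_not_less)

lemma map_pos_hom:
 assumes "sorted_wrt (<) b" "sorted g" "g \<noteq> []" "set g \<subseteq> set b"
 shows "map (pos b) g \<in> Hom Simp (length g - 1) (length b - 1)" "map ((!) b) (map (pos b) g) = g"
proof -
 have "sorted (map (pos b) g)"
  using assms by (auto simp: sorted_iff_nth_mono intro!: pos_mono)
 moreover have "set (map (pos b) g) \<subseteq> {..length b - 1}"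
  using assms pos_less[OF assms(1)] by fastforce
 ultimately show "map (pos b) g \<in> Hom Simp (length g - 1) (length b - 1)"
  using assms by (simp add: Simp_hom)
 show "map ((!) b) (map (pos b) g) = g"
  using assms pos_less[OF assms(1)] by (auto intro!: map_idI)
qed

section \<open>The right adjoint of concatenation\<close>

text \<open>The non-degenerate tuples. Without repetitions there are only finitely many over a given
  \<open>m\<close>, so that finite limits suffice for the right adjoint.\<close>

definition normal_tuples :: "nat => nat => nat list list set" where
 "normal_tuples k m = {bs \<in> blocks k m. \<forall>b\<in>set bs. distinct b}"

definition block_pos :: "nat list list => nat list list => nat list list" where
 "block_pos bs gs = map2 (\<lambda>b g. map (pos b) g) bs gs"

definition subtuple :: "nat list list => nat list list => bool" where
 "subtuple gs bs \<longleftrightarrow> length gs = length bs \<and> (\<forall>i<length bs. set (gs ! i) \<subseteq> set (bs ! i))"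

lemma finite_normal_tuples: "finite (normal_tuples k m)"
proof (rule finite_subset)
 have "finite {b::nat list. set b \<subseteq> {..m} \<and> distinct b}"
  using finite_subset_distinct[of "{..m}"] by (rule rev_finite_subset) auto
 thus "finite {bs. set bs \<subseteq> {b::nat list. set b \<subseteq> {..m} \<and> distinct b} \<and> length bs = k}"
  by (rule finite_lists_length_eq)
 show "normal_tuples k m \<subseteq> {bs. set bs \<subseteq> {b::nat list. set b \<subseteq> {..m} \<and> distinct b} \<and> length bs = k}"
  by (auto simp: normal_tuples_def blocks_def)
qed

lemma normal_tuplesD:
 assumes "ss \<in> normal_tuples k m"
 shows "ss \<in> blocks k m" "length ss = k" "!!i. i < k ==> sorted_wrt (<) (ss ! i)"
proof -
 show b: "ss \<in> blocks k m" "length ss = k" using assms by (auto simp: normal_tuples_def blocks_def)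
 fix i assume "i < k"
 thus "sorted_wrt (<) (ss ! i)"
  using blocksD(2)[OF b(1), of i] b assms by (auto simp: normal_tuples_def strict_sorted_iff)
qed

lemma block_pos_hom:
 assumes f: "fs \<in> normal_tuples k m" and g: "gs \<in> blocks k m" and s: "subtuple gs fs"
 shows "block_pos fs gs \<in> pHom k (dims fs) (dims gs)"
  and "brestr fs (block_pos fs gs) = gs"
proof -
 note b = normal_tuplesD[OF f]
 have l: "length gs = k" using g by (simp add: blocks_def)
 have *: "map (pos (fs ! i)) (gs ! i) \<in> Hom Simp (dims gs ! i) (dims fs ! i)"
  "map ((!) (fs ! i)) (map (pos (fs ! i)) (gs ! i)) = gs ! i" if "i < k" for i
  using map_pos_hom[OF b(3)[OF that] blocksD(2,1)[OF g that]] s that b l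
  by (simp_all add: subtuple_def dims_def)
 thus "block_pos fs gs \<in> pHom k (dims fs) (dims gs)"
  using b l by (simp add: block_pos_def)
 show "brestr fs (block_pos fs gs) = gs"
  using * b l by (intro nth_equalityI) (auto simp: brestr_def block_pos_def)
qed

text \<open>The epi-mono factorization in \<Delta>, applied in each block: the list of occurring
  values is the non-degenerate part.\<close>

lemma support_tuple:
 assumes "bs \<in> blocks k m"
 shows "map support bs \<in> normal_tuples k m" "subtuple bs (map support bs)"
proof -
 have "map support bs \<in> blocks k m"
 proof (rule blocks_mono[OF assms])
  show "length (map support bs) = k" using assms by (simp add: blocks_def)
  fix i assume "i < k"
  thus "map support bs ! i \<noteq> [] \<and> sorted (map support bs ! i) \<and> set (map support bs ! i) \<subseteq> set (bs ! i)"
   using blocksD(1)[OF assms, of i] assms by (simp add: blocks_def)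
 qed
 thus "map support bs \<in> normal_tuples k m" by (auto simp: normal_tuples_def)
 show "subtuple bs (map support bs)" by (simp add: subtuple_def)
qed

context category
begin

lemma diag_functor:
 assumes Z: "msimplicial k Z"
 shows "simplicial (restr Z (diag k))"
 unfolding is_functor_def
proof (intro conjI ballI)
 note Z' = Z[unfolded is_functor_def]
 fix n
 show "Fo (restr Z (diag k)) n \<in> Obj C" using Z' by (simp add: restr_def diag_def)
 have "Fm Z (rep k n) (rep k n) (Idm (pow_cat k Simp_op) (rep k n)) = Idm C (Fo Z (rep k n))"
  using Z' by (simp del: pow_simps(3))
 thus "Fm (restr Z (diag k)) n n (Idm Simp_op n) = Idm C (Fo (restr Z (diag k)) n)"
  by (simp add: restr_def diag_def)
 fix m a assume a: "a \<in> Hom Simp_op n m"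
 show "Fm (restr Z (diag k)) n m a \<in> Hom C (Fo (restr Z (diag k)) n) (Fo (restr Z (diag k)) m)"
  using Z' a by (simp add: restr_def diag_def)
 fix l b assume b: "b \<in> Hom Simp_op m l"
 have "Fm Z (rep k n) (rep k l) (rep k b \<cdot>\<^bsub>pow_cat k Simp_op\<^esub> rep k a) =
   Fm Z (rep k m) (rep k l) (rep k b) \<cdot> Fm Z (rep k n) (rep k m) (rep k a)"
  using Z' a b by (simp del: pow_simps(4))
 moreover have "rep k b \<cdot>\<^bsub>pow_cat k Simp_op\<^esub> rep k a = rep k (b \<cdot>\<^bsub>Simp_op\<^esub> a)"
  by (intro nth_equalityI) simp_all
 ultimately show "Fm (restr Z (diag k)) n l (b \<cdot>\<^bsub>Simp_op\<^esub> a) = Fm (restr Z (diag k)) m l b \<cdot> Fm (restr Z (diag k)) n m a"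
  by (simp add: restr_def diag_def del: Simp_cmp)
qed

lemma diag_nat:
 assumes q: "mnat k Z Z' q"
 shows "snat (restr Z (diag k)) (restr Z' (diag k)) (\<lambda>n. q (rep k n))"
 using q unfolding is_nat_trans_def by (simp add: restr_def diag_def)

end

context abelian_tensor_category
begin

lemma pow_one_simps:
 "(\<forall>ns\<in>pObj (Suc 0). P ns) \<longleftrightarrow> (\<forall>n. P [n])"
 "(\<forall>as\<in>pHom (Suc 0) [n] [m]. Q as) \<longleftrightarrow> (\<forall>a\<in>Hom Simp m n. Q [a])"
 by (auto simp: length_Suc_conv)

text \<open>Up to the encoding of one-element tuples, concatenation of one simplex is the identity
  functor, so identities form a universal arrow. This puts the special value of
  \<open>dec_lower\<close> at \<open>k = 1\<close> on the same footing as the chosen ones.\<close>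

lemma right_adjoint_one:
 assumes Z: "msimplicial (Suc 0) Z"
 shows "is_right_adjoint_value (pow_cat (Suc 0) Simp_op) Simp_op C dec Z (restr Z (diag (Suc 0))) (\<lambda>ns. Idm C (Fo Z ns))"
proof -
 note D = diag_functor[OF Z]
 note simps = restr_def dec_def diag_def conc_def
 have o: "Fo Z [n] \<in> Obj C" for n using sobj_obj[OF D, of n] by (simp add: simps)
 have m: "Fm Z [n] [m] [a] \<in> Hom C (Fo Z [n]) (Fo Z [m])" if "a \<in> Hom Simp m n" for n m a
  using sobj_map[OF D that] by (simp add: simps)
 have nt: "mnat (Suc 0) (restr X dec) Z q \<longleftrightarrow>
   snat X (restr Z (diag (Suc 0))) (\<lambda>n. q [n])" for X q
  unfolding is_nat_trans_def pow_one_simps by (simp add: simps)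
 have idl: "Idm C (Fo Z [n]) \<cdot> p n = p n"
  if "simplicial X" "snat X (restr Z (diag (Suc 0))) p" for X p n
  using id_left[OF sobj_obj[OF that(1)] o] snat_in[OF that(2), of n] by (simp add: simps)
 show ?thesis
  unfolding is_right_adjoint_value_def nt pow_one_simps
 proof (intro conjI D allI impI)
  show "snat (restr Z (diag (Suc 0))) (restr Z (diag (Suc 0))) (\<lambda>n. Idm C (Fo Z [n]))"
   using id_in[OF o] id_left[OF o o m] id_right[OF o o m] by (simp add: is_nat_trans_def simps)
  fix X q assume "simplicial X \<and> snat X (restr Z (diag (Suc 0))) (\<lambda>n. q [n])"
  thus "\<exists>p. snat X (restr Z (diag (Suc 0))) p \<and> (\<forall>n. Idm C (Fo Z [n]) \<cdot> p (Fo dec [n]) = q [n]) \<and>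
    (\<forall>p'. snat X (restr Z (diag (Suc 0))) p' \<and> (\<forall>n. Idm C (Fo Z [n]) \<cdot> p' (Fo dec [n]) = q [n]) -->
     (\<forall>b\<in>Obj Simp_op. p' b = p b))"
   using idl[of X] by (intro exI[of _ "\<lambda>n. q [n]"] conjI allI impI ballI) (auto simp: dec_def conc_def)
 qed
qed

lemma dec_zero: "Fo (dec_obj C 0 Z) n = Fo Z []" "Fm (dec_obj C 0 Z) m n a = Fm Z [] [] []"
 by (simp_all add: dec_lower_def restr_def diag_def)

text \<open>The projections of the limit that computes the right adjoint in degree \<open>m\<close>;
  the limit runs over all maps from a concatenation to \<open>[m]\<close>.\<close>

definition bproj :: "nat => ('o, 'm) multi_sobj => nat => nat list list => 'm" where
 "bproj k Z m bs = dec_proj C k Z m (dims bs) (concat bs)"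

lemma bproj_0: "bproj 0 Z m bs = Idm C (Fo Z [])"
 by (simp add: bproj_def dec_proj_def)

context
 fixes k Z
 assumes Z: "msimplicial k Z"
begin

lemma mobj: "length ns = k ==> Fo Z ns \<in> Obj C"
 using Z by (simp add: is_functor_def)

lemma mmap:
 "[|length ms = k; length ns = k; ts \<in> pHom k ms ns|] ==> Fm Z ms ns ts \<in> Hom C (Fo Z ms) (Fo Z ns)"
 using Z by (simp add: is_functor_def)

lemma mid: "length ns = k ==> Fm Z ns ns (map (\<lambda>n. [0..<Suc n]) ns) = Idm C (Fo Z ns)"
 using Z by (simp add: is_functor_def Simp_idm[abs_def] del: upt_Suc)

lemma mcomp:
 "[|length ls = k; length ms = k; length ns = k; ts \<in> pHom k ls ms; hs \<in> pHom k ms ns|]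
  ==> Fm Z ms ns hs \<cdot> Fm Z ls ms ts = Fm Z ls ns (brestr ts hs)"
proof -
 assume a: "length ls = k" "length ms = k" "length ns = k" "ts \<in> pHom k ls ms" "hs \<in> pHom k ms ns"
 have "Fm Z ls ns (hs \<cdot>\<^bsub>pow_cat k Simp_op\<^esub> ts) = Fm Z ms ns hs \<cdot> Fm Z ls ms ts"
  using Z a unfolding is_functor_def by (simp del: pow_simps(4))
 moreover have "hs \<cdot>\<^bsub>pow_cat k Simp_op\<^esub> ts = brestr ts hs"
  using a by (intro nth_equalityI) (auto simp: brestr_def)
 ultimately show ?thesis by simp
qed

context
 assumes k: "0 < k"
begin

text \<open>The cones with vertex \<open>a\<close> over the diagram of \<open>Z\<close> indexed by
  the maps from concatenations to \<open>[m]\<close>.\<close>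

definition is_block_family :: "nat => 'o => (nat list list => 'm) => bool" where
 "is_block_family m a r \<longleftrightarrow>
   (\<forall>bs\<in>blocks k m. r bs \<in> Hom C a (Fo Z (dims bs)) \<and>
    (\<forall>ns ts. length ns = k \<and> ts \<in> pHom k (dims bs) ns -->
     Fm Z (dims bs) ns ts \<cdot> r bs = r (brestr bs ts)))"

text \<open>Each tuple factors through its support, so a cone is determined by its members at normal
  tuples, and the limit over these finitely many can be extended to all tuples.\<close>

lemma block_limit_exists:
 "\<exists>L p. L \<in> Obj C \<and> is_block_family m L p \<and>
   (\<forall>a\<in>Obj C. \<forall>r. is_block_family m a r -->
    (\<exists>!h. h \<in> Hom C a L \<and> (\<forall>qs\<in>blocks k m. p qs \<cdot> h = r qs)))"
proof -
 let ?I = "normal_tuples k m" and ?A = "\<lambda>qs. Fo Z (dims qs)"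
 \<comment> \<open>One condition for each inclusion of normal tuples: restricting the projection at
   the larger tuple gives the projection at the smaller one.\<close>
 define R where "R = (\<lambda>(qs, ts). (qs, ts, Fm Z (dims qs) (dims ts) (block_pos qs ts), Idm C (?A ts), ?A ts)) `
  {(qs, ts) \<in> ?I \<times> ?I. subtuple ts qs}"
 have len: "length (dims qs) = k" if "qs \<in> blocks k m" for qs using that by (simp add: blocks_def)
 have A: "?A qs \<in> Obj C" if "qs \<in> blocks k m" for qs using mobj[OF len[OF that]] .
 have pos_in: "Fm Z (dims qs) (dims ts) (block_pos qs ts) \<in> Hom C (?A qs) (?A ts)"
  if "qs \<in> ?I" "ts \<in> blocks k m" "subtuple ts qs" for qs ts
  using that normal_tuplesD(1) block_pos_hom(1)[OF that] by (intro mmap len)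
 have "finite R"
  unfolding R_def
  by (rule finite_imageI, rule finite_subset[of _ "?I \<times> ?I"]) (auto simp: finite_normal_tuples)
 moreover have "i \<in> ?I \<and> j \<in> ?I \<and> b \<in> Obj C \<and> f \<in> Hom C (?A i) b \<and> g \<in> Hom C (?A j) b"
  if R: "(i, j, f, g, b) \<in> R" for i j f g b
 proof -
  have *: "i \<in> ?I" "j \<in> ?I" "subtuple j i" "f = Fm Z (dims i) (dims j) (block_pos i j)" "g = Idm C (?A j)" "b = ?A j"
   using R by (auto simp: R_def)
  show ?thesis
   unfolding *(4-6) using *(1,2) pos_in[OF *(1) normal_tuplesD(1)[OF *(2)] *(3)] A[OF normal_tuplesD(1)[OF *(2)]]
   by (simp add: id_in)
 qed
 ultimately obtain L p where L: "is_finite_limit ?I ?A R L p"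
  using finite_limit_exists[where I = ?I and A = ?A and R = R] finite_normal_tuples A[OF normal_tuplesD(1)] by blast
 have Lo: "L \<in> Obj C" and pin: "!!qs. qs \<in> ?I ==> p qs \<in> Hom C L (?A qs)"
  and U: "!!x r. [|x \<in> Obj C; !!qs. qs \<in> ?I ==> r qs \<in> Hom C x (?A qs); \<forall>(i, j, f, g, b)\<in>R. f \<cdot> r i = g \<cdot> r j|]
   ==> \<exists>!h. h \<in> Hom C x L \<and> (\<forall>qs\<in>?I. p qs \<cdot> h = r qs)"
  using L by (auto simp: is_finite_limit_def)
 have pR: "Fm Z (dims qs) (dims ts) (block_pos qs ts) \<cdot> p qs = p ts"
  if "qs \<in> ?I" "ts \<in> ?I" "subtuple ts qs" for qs ts
 proof -
  have "Fm Z (dims qs) (dims ts) (block_pos qs ts) \<cdot> p qs = Idm C (?A ts) \<cdot> p ts"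
  proof -
   have "\<forall>(i, j, f, g, b)\<in>R. f \<cdot> p i = g \<cdot> p j" using L by (simp add: is_finite_limit_def)
   moreover have "(qs, ts, Fm Z (dims qs) (dims ts) (block_pos qs ts), Idm C (?A ts), ?A ts) \<in> R"
    using that by (auto simp: R_def)
   ultimately show ?thesis by (auto dest: bspec)
  qed
  thus ?thesis using id_left[OF Lo A pin] normal_tuplesD(1) that by simp
 qed
 \<comment> \<open>The projection at an arbitrary tuple: project to its support, then apply the
   degeneracy that restores the repetitions.\<close>
 define P where "P = (\<lambda>qs. Fm Z (dims (map support qs)) (dims qs) (block_pos (map support qs) qs) \<cdot> p (map support qs))"
 have P_in: "P qs \<in> Hom C L (?A qs)" if "qs \<in> blocks k m" for qs
  unfolding P_def using support_tuple[OF that] that normal_tuplesD(1)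
  by (intro comp_in[OF Lo A A pin pos_in]) auto
 \<comment> \<open>Restriction can only shrink the support. Both sides are compared through the
   inclusion of the smaller support into the larger one, where the conditions in \<open>R\<close>
   apply.\<close>
 have P_restrict: "Fm Z (dims qs) ns us \<cdot> P qs = P (brestr qs us)"
  if q: "qs \<in> blocks k m" and ns: "length ns = k" and u: "us \<in> pHom k (dims qs) ns" for qs ns us
 proof -
  let ?t = "brestr qs us"
  note r = brestr_tuple[OF q u ns] and sb = support_tuple[OF q]
  note sr = support_tuple[OF r(1)]
  note nb = normal_tuplesD[OF sb(1)] and nr = normal_tuplesD[OF sr(1)]
  have lb: "length qs = k" and lt: "length us = k" using q u by (auto simp: blocks_def)
  have lg: "length ?t = k" using lb lt by (simp add: brestr_def)
  have ti: "?t ! i = map ((!) (qs ! i)) (us ! i)" if "i < k" for i using that lb lt by (simp add: brestr_def)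
  note sub = blocks_sub[OF q u]
  have incl: "set (?t ! i) \<subseteq> set (qs ! i)" if "i < k" for i
   using set_map_nth[OF sub[OF that]] ti[OF that] by simp
  have sg: "subtuple (map support ?t) (map support qs)" using lb lg incl by (simp add: subtuple_def)
  have sg': "subtuple ?t (map support qs)" using lb lg incl by (simp add: subtuple_def)
  have "Fm Z (dims qs) ns us \<cdot> P qs =
    (Fm Z (dims qs) ns us \<cdot> Fm Z (dims (map support qs)) (dims qs) (block_pos (map support qs) qs)) \<cdot> p (map support qs)"
   unfolding P_def
   by (rule assoc[OF Lo A[OF nb(1)] A[OF q] mobj[OF ns] pin[OF sb(1)] pos_in[OF sb(1) q sb(2)] mmap[OF len[OF q] ns u], symmetric])
  also have "Fm Z (dims qs) ns us \<cdot> Fm Z (dims (map support qs)) (dims qs) (block_pos (map support qs) qs) =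
    Fm Z (dims (map support qs)) ns (block_pos (map support qs) ?t)"
  proof -
   have "brestr (block_pos (map support qs) qs) us = block_pos (map support qs) ?t"
   proof (rule nth_equalityI)
    fix i assume "i < length (brestr (block_pos (map support qs) qs) us)"
    hence "i < k" using lb lt by (simp add: block_pos_def brestr_def)
    thus "brestr (block_pos (map support qs) qs) us ! i = block_pos (map support qs) ?t ! i"
     using sub[of i] lb lt lg ti[of i] by (auto simp: block_pos_def brestr_def)
   qed (use lb lt lg in \<open>simp add: block_pos_def brestr_def\<close>)
   thus ?thesis
    using mcomp[OF len[OF nb(1)] len[OF q] ns block_pos_hom(1)[OF sb(1) q sb(2)] u] by simp
  qed
  also have "\<dots> = Fm Z (dims (map support ?t)) (dims ?t) (block_pos (map support ?t) ?t) \<cdot>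
    Fm Z (dims (map support qs)) (dims (map support ?t)) (block_pos (map support qs) (map support ?t))"
  proof -
   have "brestr (block_pos (map support qs) (map support ?t)) (block_pos (map support ?t) ?t) =
     block_pos (map support qs) ?t" (is "?l = ?r")
   proof (rule nth_equalityI)
    fix i assume "i < length ?l"
    hence i: "i < k" using lb lg by (simp add: block_pos_def brestr_def)
    have "pos (support (?t ! i)) x < length (support (?t ! i)) \<and> support (?t ! i) ! pos (support (?t ! i)) x = x"
     if "x \<in> set (?t ! i)" for x
     using that nr(3)[OF i] lg i by (intro pos_less) auto
    thus "?l ! i = ?r ! i" using i lb lg by (auto simp: block_pos_def brestr_def simp del: length_sorted_list_of_set)
   qed (use lb lg in \<open>simp add: block_pos_def brestr_def\<close>)
   thus ?thesis
    using mcomp[OF len[OF nb(1)] len[OF nr(1)] len[OF r(1)] block_pos_hom(1)[OF sb(1) nr(1) sg]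
      block_pos_hom(1)[OF sr(1) r(1) sr(2)]] r(2) by simp
  qed
  also have "\<dots> \<cdot> p (map support qs) = P ?t"
   unfolding P_def using assoc[OF Lo A[OF nb(1)] A[OF nr(1)] A[OF r(1)] pin[OF sb(1)] pos_in[OF sb(1) nr(1) sg] pos_in[OF sr(1) r(1) sr(2)]]
    pR[OF sb(1) sr(1) sg] by simp
  finally show ?thesis .
 qed
 have famP: "is_block_family m L P"
  unfolding is_block_family_def using P_in P_restrict by blast
 have sup: "map support qs = qs" if "qs \<in> ?I" for qs
 proof (rule map_idI)
  fix q assume "q \<in> set qs"
  thus "support q = q" using that
   by (auto simp: normal_tuples_def blocks_def sorted_concat_iff sorted_list_of_set.idem_if_sorted_distinct)
 qed
 have P_normal: "P qs = p qs" if q: "qs \<in> ?I" for qs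
  unfolding P_def sup[OF q] by (rule pR[OF q q]) (simp add: subtuple_def)
 have uni: "\<exists>!h. h \<in> Hom C a L \<and> (\<forall>qs\<in>blocks k m. P qs \<cdot> h = r qs)"
  if a: "a \<in> Obj C" and r: "is_block_family m a r" for a r
 proof -
  have r1: "r qs \<in> Hom C a (?A qs)" if "qs \<in> blocks k m" for qs using r that by (simp add: is_block_family_def)
  have r2: "Fm Z (dims qs) (dims ts) (block_pos qs ts) \<cdot> r qs = r ts"
   if "qs \<in> ?I" "ts \<in> blocks k m" "subtuple ts qs" for qs ts
   using r that block_pos_hom[OF that] normal_tuplesD(1)[OF that(1)] len[OF that(2)] unfolding is_block_family_def by metis
  have ex: "\<exists>!h. h \<in> Hom C a L \<and> (\<forall>qs\<in>?I. p qs \<cdot> h = r qs)"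
  proof (rule U[OF a])
   show "\<forall>(i, j, f, g, b)\<in>R. f \<cdot> r i = g \<cdot> r j"
    unfolding R_def using r2 id_left[OF a A r1] normal_tuplesD(1) by auto
  qed (use r1 normal_tuplesD(1) in blast)
  have "(\<forall>qs\<in>?I. p qs \<cdot> h = r qs) \<longleftrightarrow> (\<forall>qs\<in>blocks k m. P qs \<cdot> h = r qs)" if h: "h \<in> Hom C a L" for h
  proof
   assume eq: "\<forall>qs\<in>?I. p qs \<cdot> h = r qs"
   show "\<forall>qs\<in>blocks k m. P qs \<cdot> h = r qs"
   proof
    fix qs assume q: "qs \<in> blocks k m"
    note s = support_tuple[OF q]
    show "P qs \<cdot> h = r qs"
     unfolding P_def
     using assoc[OF a Lo A[OF normal_tuplesD(1)[OF s(1)]] A[OF q] h pin[OF s(1)] pos_in[OF s(1) q s(2)]]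
      eq s r2[OF s(1) q s(2)] by simp
   qed
  next
   assume "\<forall>qs\<in>blocks k m. P qs \<cdot> h = r qs"
   thus "\<forall>qs\<in>?I. p qs \<cdot> h = r qs" using P_normal normal_tuplesD(1) by metis
  qed
  thus ?thesis using ex by (metis (no_types, lifting))
 qed
 show ?thesis using Lo famP uni by blast
qed

text \<open>The pointwise formula for a right Kan extension, with the limits of
  \<open>block_limit_exists\<close> as values in the single degrees.\<close>

lemma right_adjoint_exists:
 "\<exists>D e. is_right_adjoint_value (pow_cat k Simp_op) Simp_op C dec Z D e"
proof -
 have "\<forall>m. \<exists>L p. L \<in> Obj C \<and> is_block_family m L p \<and>
   (\<forall>a\<in>Obj C. \<forall>r. is_block_family m a r -->
    (\<exists>!h. h \<in> Hom C a L \<and> (\<forall>ss\<in>blocks k m. p ss \<cdot> h = r ss)))"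
  using block_limit_exists by blast
 then obtain L p where L: "!!m. L m \<in> Obj C" and p: "!!m. is_block_family m (L m) (p m)"
  and U: "!!m a r. [|a \<in> Obj C; is_block_family m a r|] ==>
   \<exists>!h. h \<in> Hom C a (L m) \<and> (\<forall>ss\<in>blocks k m. p m ss \<cdot> h = r ss)"
  by metis
 have len: "length (dims ss) = k" if "ss \<in> blocks k m" for ss m using that by (simp add: blocks_def)
 have A: "Fo Z (dims ss) \<in> Obj C" if "ss \<in> blocks k m" for ss m using mobj[OF len[OF that]] .
 have p1: "p m ss \<in> Hom C (L m) (Fo Z (dims ss))" if "ss \<in> blocks k m" for ss m
  using p[of m] that by (simp add: is_block_family_def)
 have p2: "Fm Z (dims ss) ns ts \<cdot> p m ss = p m (brestr ss ts)"
  if "ss \<in> blocks k m" "length ns = k" "ts \<in> pHom k (dims ss) ns" for ss m ns ts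
  using p[of m] that unfolding is_block_family_def by blast
 have ext: "g = h" if "a \<in> Obj C" "g \<in> Hom C a (L m)" "h \<in> Hom C a (L m)"
  "!!ss. ss \<in> blocks k m ==> p m ss \<cdot> g = p m ss \<cdot> h" for a m g h
 proof -
  have "is_block_family m a (\<lambda>ss. p m ss \<cdot> h)"
   unfolding is_block_family_def
  proof (intro ballI conjI allI impI)
   fix ss assume s: "ss \<in> blocks k m"
   show "p m ss \<cdot> h \<in> Hom C a (Fo Z (dims ss))" by (rule comp_in[OF that(1) L A[OF s] that(3) p1[OF s]])
   fix ns ts assume *: "length ns = k \<and> ts \<in> pHom k (dims ss) ns"
   thus "Fm Z (dims ss) ns ts \<cdot> (p m ss \<cdot> h) = p m (brestr ss ts) \<cdot> h"
    using assoc[OF that(1) L A[OF s] mobj that(3) p1[OF s] mmap[OF len[OF s]]] p2[OF s] by metis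
  qed
  from U[OF that(1) this] show ?thesis using that(2-4) by blast
 qed
 have famf: "is_block_family n (L m) (\<lambda>ss. p m (map (map ((!) f)) ss))" if f: "f \<in> Hom Simp n m" for f m n
  unfolding is_block_family_def
 proof (intro ballI conjI allI impI)
  fix ss assume s: "ss \<in> blocks k n"
  note b = block_map_tuple[OF s f]
  show "p m (map (map ((!) f)) ss) \<in> Hom C (L m) (Fo Z (dims ss))" using p1[OF b(1)] b(2) by simp
  fix ns ts assume *: "length ns = k \<and> ts \<in> pHom k (dims ss) ns"
  thus "Fm Z (dims ss) ns ts \<cdot> p m (map (map ((!) f)) ss) = p m (map (map ((!) f)) (brestr ss ts))"
   using p2[OF b(1), of ns ts] b(2) brestr_map[OF _ s] by metis
 qed
 \<comment> \<open>A monotone \<open>f\<close> acts by relabelling the values in all tuples.\<close>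
 define D where "D = \<lparr>Fo = L, Fm = (\<lambda>m n f. THE h. h \<in> Hom C (L m) (L n) \<and>
  (\<forall>ss\<in>blocks k n. p n ss \<cdot> h = p m (map (map ((!) f)) ss)))\<rparr>"
 have D: "Fm D m n f \<in> Hom C (L m) (L n)"
  "!!ss. ss \<in> blocks k n ==> p n ss \<cdot> Fm D m n f = p m (map (map ((!) f)) ss)"
  if "f \<in> Hom Simp n m" for f m n
  using theI'[OF U[OF L famf[OF that]]] by (simp_all add: D_def)
 have FoD: "Fo D = L" by (simp add: D_def)
 have Dfun: "simplicial D"
  unfolding is_functor_def FoD Simp_obj Simp_op_hom Simp_idm Simp_cmp
 proof (intro conjI ballI)
  fix m n f assume "f \<in> Hom Simp n m" thus "Fm D m n f \<in> Hom C (L m) (L n)" by (rule D)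
 next
  fix m
  show "Fm D m m [0..<Suc m] = Idm C (L m)"
  proof (rule ext[OF L D(1)[OF Simp_id_hom] id_in[OF L]])
   fix ss assume s: "ss \<in> blocks k m"
   have "map (map ((!) [0..<Suc m])) ss = ss"
   proof (rule map_idI)
    fix s assume "s \<in> set ss"
    hence "set s \<subseteq> {..<Suc m}" using s by (auto simp: blocks_def)
    thus "map ((!) [0..<Suc m]) s = s" by (rule map_nth_upt)
   qed
   thus "p m ss \<cdot> Fm D m m [0..<Suc m] = p m ss \<cdot> Idm C (L m)"
    using D(2)[OF Simp_id_hom s] id_right[OF L A[OF s] p1[OF s]] by simp
  qed
 next
  fix l m n f g assume f: "f \<in> Hom Simp m l" and g: "g \<in> Hom Simp n m"
  note fg = Simp_comp_hom[OF g f]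
  show "Fm D l n (map ((!) f) g) = Fm D m n g \<cdot> Fm D l m f"
  proof (rule ext[OF L D(1)[OF fg] comp_in[OF L L L D(1)[OF f] D(1)[OF g]]])
   fix ss assume s: "ss \<in> blocks k n"
   note bg = block_map_tuple[OF s g]
   have "map (map ((!) (map ((!) f) g))) ss = map (map ((!) f)) (map (map ((!) g)) ss)"
   proof -
    have "map ((!) (map ((!) f) g)) s = map ((!) f) (map ((!) g) s)" if "s \<in> set ss" for s
    proof (rule map_nth_map_nth)
     show "set s \<subseteq> {..<length g}" using that s g by (auto simp: blocks_def Simp_hom)
    qed
    thus ?thesis by simp
   qed
   thus "p n ss \<cdot> Fm D l n (map ((!) f) g) = p n ss \<cdot> (Fm D m n g \<cdot> Fm D l m f)"
    using D(2)[OF fg s] assoc[OF L L L A[OF s] D(1)[OF f] D(1)[OF g] p1[OF s]] D(2)[OF g s] D(2)[OF f bg(1)]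
    by (simp del: map_map map_eq_conv)
  qed
 qed (rule L)
 \<comment> \<open>The counit is the projection at the universal tuple.\<close>
 define e where "e = (\<lambda>ns. p (conc ns) (id_blocks ns))"
 have ib: "id_blocks ns \<in> blocks k (conc ns)" if "length ns = k" for ns using id_blocks_tuple(1)[OF that k] .
 have ein: "e ns \<in> Hom C (L (conc ns)) (Fo Z ns)" if "length ns = k" for ns
  using p1[OF ib[OF that]] by (simp add: e_def dims_id_blocks)
 \<comment> \<open>By \<open>block_map_id_blocks\<close> every projection is the counit after a
   structure map, which makes the factorization unique below.\<close>
 have p_e: "p m ss = e (dims ss) \<cdot> Fm D m (conc (dims ss)) (concat ss)" if s: "ss \<in> blocks k m" for ss m
  using D(2)[OF concat_hom[OF s k] ib[OF len[OF s]]] block_map_id_blocks[OF s k] by (simp add: e_def)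
 have enat: "mnat k (restr D dec) Z e"
  unfolding is_nat_trans_def
 proof (intro conjI ballI)
  fix ns assume "ns \<in> pObj k"
  thus "e ns \<in> Hom C (Fo (restr D dec) ns) (Fo Z ns)" using ein by (simp add: restr_def dec_def FoD)
 next
  fix ms ns ts assume "ms \<in> pObj k" "ns \<in> pObj k"
   and t: "ts \<in> pHom k ms ns"
  hence l: "length ms = k" "length ns = k" by auto
  note j = brestr_id_blocks[OF t l k]
  have "Fm Z ms ns ts \<cdot> e ms = p (conc ms) (brestr (id_blocks ms) ts)"
   using p2[OF ib[OF l(1)] l(2)] t by (simp add: e_def dims_id_blocks)
  thus "Fm Z ms ns ts \<cdot> e ms = e ns \<cdot> Fm (restr D dec) ms ns ts"
   using D(2)[OF j(1) ib[OF l(2)]] j(2) by (simp add: e_def restr_def dec_def)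
 qed
 have "is_right_adjoint_value (pow_cat k Simp_op) Simp_op C dec Z D e"
  unfolding is_right_adjoint_value_def
 proof (intro conjI Dfun enat allI impI)
  fix X q assume *: "simplicial X \<and> mnat k (restr X dec) Z q"
  hence X: "simplicial X" by simp
  have qin: "q ns \<in> Hom C (Fo X (conc ns)) (Fo Z ns)" if "length ns = k" for ns
   using * that by (simp add: is_nat_trans_def restr_def dec_def)
  have qnat: "Fm Z ms ns ts \<cdot> q ms = q ns \<cdot> Fm X (conc ms) (conc ns) (join ms ts)"
   if "length ms = k" "length ns = k" "ts \<in> pHom k ms ns" for ms ns ts
   using * that by (simp add: is_nat_trans_def restr_def dec_def)
  note o = sobj_obj[OF X]
  \<comment> \<open>The cone forced by naturality: pull \<open>q\<close> back along the concatenated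
    tuple.\<close>
  define r where "r = (\<lambda>m ss. q (dims ss) \<cdot> Fm X m (conc (dims ss)) (concat ss))"
  have r1: "r m ss \<in> Hom C (Fo X m) (Fo Z (dims ss))" if s: "ss \<in> blocks k m" for m ss
   unfolding r_def by (rule comp_in[OF o o A[OF s] sobj_map[OF X concat_hom[OF s k]] qin[OF len[OF s]]])
  have fam: "is_block_family m (Fo X m) (r m)" for m
   unfolding is_block_family_def
  proof (intro ballI conjI allI impI r1)
   fix ss ns ts assume s: "ss \<in> blocks k m" and "length ns = k \<and> ts \<in> pHom k (dims ss) ns"
   hence ns: "length ns = k" and t: "ts \<in> pHom k (dims ss) ns" by auto
   note cb = concat_hom[OF s k] and j = brestr_id_blocks(1)[OF t len[OF s] ns k]
   note c = concat_brestr_tuple[OF s t]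
   have "Fm Z (dims ss) ns ts \<cdot> r m ss = (Fm Z (dims ss) ns ts \<cdot> q (dims ss)) \<cdot> Fm X m (conc (dims ss)) (concat ss)"
    unfolding r_def by (rule assoc[OF o o A[OF s] mobj[OF ns] sobj_map[OF X cb] qin[OF len[OF s]] mmap[OF len[OF s] ns t], symmetric])
   also have "\<dots> = q ns \<cdot> (Fm X (conc (dims ss)) (conc ns) (join (dims ss) ts) \<cdot> Fm X m (conc (dims ss)) (concat ss))"
    unfolding qnat[OF len[OF s] ns t] by (rule assoc[OF o o o mobj[OF ns] sobj_map[OF X cb] sobj_map[OF X j] qin[OF ns]])
   also have "\<dots> = r m (brestr ss ts)"
    unfolding r_def using sobj_comp[OF X j cb] c brestr_tuple(2)[OF s t ns] by simp
   finally show "Fm Z (dims ss) ns ts \<cdot> r m ss = r m (brestr ss ts)" .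
  qed
  have "\<forall>m. \<exists>h. h \<in> Hom C (Fo X m) (L m) \<and> (\<forall>ss\<in>blocks k m. p m ss \<cdot> h = r m ss)"
   using U[OF o fam] by blast
  then obtain u where u: "!!m. u m \<in> Hom C (Fo X m) (L m)"
   and pu: "!!m ss. ss \<in> blocks k m ==> p m ss \<cdot> u m = r m ss" by metis
  have rf: "r n ss \<cdot> Fm X m n f = r m (map (map ((!) f)) ss)" if f: "f \<in> Hom Simp n m" and s: "ss \<in> blocks k n" for m n f ss
   unfolding r_def using assoc[OF o o o A[OF s] sobj_map[OF X f] sobj_map[OF X concat_hom[OF s k]] qin[OF len[OF s]]]
    sobj_comp[OF X concat_hom[OF s k] f] block_map_tuple(2)[OF s f] by (simp add: map_concat)
  have unat: "snat X D u"
   unfolding is_nat_trans_def FoD Simp_obj Simp_op_hom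
  proof (intro conjI ballI u)
   fix m n f assume f: "f \<in> Hom Simp n m"
   show "Fm D m n f \<cdot> u m = u n \<cdot> Fm X m n f"
   proof (rule ext[OF o comp_in[OF o L L u D(1)[OF f]] comp_in[OF o o L sobj_map[OF X f] u]])
    fix ss assume s: "ss \<in> blocks k n"
    show "p n ss \<cdot> (Fm D m n f \<cdot> u m) = p n ss \<cdot> (u n \<cdot> Fm X m n f)"
     using assoc[OF o L L A[OF s] u D(1)[OF f] p1[OF s]] assoc[OF o o L A[OF s] sobj_map[OF X f] u p1[OF s]]
      D(2)[OF f s] pu[OF s] pu[OF block_map_tuple(1)[OF s f]] rf[OF f s] by simp
   qed
  qed
  have eu: "e ns \<cdot> u (conc ns) = q ns" if l: "length ns = k" for ns
   using pu[OF ib[OF l]] id_blocks_tuple(2)[OF l k] id_right[OF o mobj[OF l] qin[OF l]] sobj_id[OF X, of "conc ns"]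
   by (simp add: e_def r_def dims_id_blocks del: upt_Suc)
  have uniq: "u' m = u m" if u': "snat X D u'" "!!ns. length ns = k ==> e ns \<cdot> u' (conc ns) = q ns" for u' m
  proof -
   have in': "u' m \<in> Hom C (Fo X m) (L m)" for m using snat_in[OF u'(1), of m] by (simp add: FoD)
   show ?thesis
   proof (rule ext[OF o in' u])
    fix ss assume s: "ss \<in> blocks k m"
    note cb = concat_hom[OF s k]
    have "p m ss \<cdot> u' m = e (dims ss) \<cdot> (Fm D m (conc (dims ss)) (concat ss) \<cdot> u' m)"
     unfolding p_e[OF s] by (rule assoc[OF o L L A[OF s] in' D(1)[OF cb] ein[OF len[OF s]]])
    also have "\<dots> = e (dims ss) \<cdot> (u' (conc (dims ss)) \<cdot> Fm X m (conc (dims ss)) (concat ss))"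
     using snat_nat[OF u'(1) cb] by simp
    also have "\<dots> = r m ss"
     using assoc[OF o o L A[OF s] sobj_map[OF X cb] in' ein[OF len[OF s]]] u'(2)[OF len[OF s]] by (simp add: r_def)
    finally show "p m ss \<cdot> u' m = p m ss \<cdot> u m" using pu[OF s] by simp
   qed
  qed
  show "\<exists>u. snat X D u \<and>
     (\<forall>ns\<in>pObj k. e ns \<cdot> u (Fo dec ns) = q ns) \<and>
     (\<forall>u'. snat X D u' \<and> (\<forall>ns\<in>pObj k. e ns \<cdot> u' (Fo dec ns) = q ns) -->
       (\<forall>b\<in>Obj Simp_op. u' b = u b))"
  proof (intro exI[of _ u] conjI ballI allI impI unat)
   fix ns assume "ns \<in> pObj k"
   thus "e ns \<cdot> u (Fo dec ns) = q ns" using eu by (simp add: dec_def)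
  next
   fix u' b
   assume "snat X D u' \<and> (\<forall>ns\<in>pObj k. e ns \<cdot> u' (Fo dec ns) = q ns)"
   thus "u' b = u b" by (intro uniq) (simp_all add: dec_def)
  qed
 qed
 thus ?thesis by blast
qed

end

lemma dec_lower_adjoint:
 assumes k: "0 < k"
 shows "is_right_adjoint_value (pow_cat k Simp_op) Simp_op C dec Z (dec_obj C k Z) (dec_counit C k Z)"
proof (cases "k = 1")
 case True
 thus ?thesis using right_adjoint_one Z by (simp add: dec_lower_def)
next
 case False
 have "\<exists>z. case z of (D, e) => is_right_adjoint_value (pow_cat k Simp_op) Simp_op C dec Z D e"
  using right_adjoint_exists[OF k] by auto
 hence "case (SOME (D, e). is_right_adjoint_value (pow_cat k Simp_op) Simp_op C dec Z D e) of
   (D, e) => is_right_adjoint_value (pow_cat k Simp_op) Simp_op C dec Z D e" by (rule someI_ex)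
 thus ?thesis using k False by (simp add: dec_lower_def case_prod_unfold)
qed

lemma dec_sobj: "simplicial (dec_obj C k Z)"
proof (cases "k = 0")
 case True
 thus ?thesis using diag_functor[OF Z] by (simp add: dec_lower_def)
next
 case False
 thus ?thesis using dec_lower_adjoint by (simp add: is_right_adjoint_value_def)
qed

context
 assumes k: "0 < k"
begin

lemma dec_counit_in: "length ns = k ==> dec_counit C k Z ns \<in> Hom C (Fo (dec_obj C k Z) (conc ns)) (Fo Z ns)"
 using dec_lower_adjoint[OF k] by (simp add: is_right_adjoint_value_def is_nat_trans_def restr_def dec_def)

lemma dec_counit_nat:
 assumes "length ms = k" "length ns = k" "ts \<in> pHom k ms ns"
 shows "Fm Z ms ns ts \<cdot> dec_counit C k Z ms = dec_counit C k Z ns \<cdot> Fm (dec_obj C k Z) (conc ms) (conc ns) (join ms ts)"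
proof -
 have "mnat k (restr (dec_obj C k Z) dec) Z (dec_counit C k Z)"
  using dec_lower_adjoint[OF k] by (simp add: is_right_adjoint_value_def)
 thus ?thesis using assms by (simp add: is_nat_trans_def restr_def dec_def)
qed

lemma dec_universal:
 assumes X: "simplicial X" and in': "!!ns. length ns = k ==> q ns \<in> Hom C (Fo X (conc ns)) (Fo Z ns)"
  and nat': "!!ms ns ts. [|length ms = k; length ns = k; ts \<in> pHom k ms ns|] ==>
   Fm Z ms ns ts \<cdot> q ms = q ns \<cdot> Fm X (conc ms) (conc ns) (join ms ts)"
 shows "\<exists>!p. snat X (dec_obj C k Z) p \<and> (\<forall>ns. length ns = k --> dec_counit C k Z ns \<cdot> p (conc ns) = q ns)"
proof -
 have "mnat k (restr X dec) Z q"
  unfolding is_nat_trans_def using in' nat' by (simp add: restr_def dec_def)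
 then obtain p where p: "snat X (dec_obj C k Z) p"
  "\<forall>ns\<in>pObj k. dec_counit C k Z ns \<cdot> p (Fo dec ns) = q ns"
  and uniq: "!!p'. [|snat X (dec_obj C k Z) p';
   \<forall>ns\<in>pObj k. dec_counit C k Z ns \<cdot> p' (Fo dec ns) = q ns|] ==> \<forall>b\<in>Obj Simp_op. p' b = p b"
  using dec_lower_adjoint[OF k] X unfolding is_right_adjoint_value_def by blast
 show ?thesis
 proof (intro ex1I[of _ p] conjI p(1) allI impI)
  fix ns :: "nat list" assume "length ns = k"
  thus "dec_counit C k Z ns \<cdot> p (conc ns) = q ns" using p(2) by (simp add: dec_def)
 next
  fix p' assume "snat X (dec_obj C k Z) p' \<and> (\<forall>ns. length ns = k --> dec_counit C k Z ns \<cdot> p' (conc ns) = q ns)"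
  hence "\<forall>b\<in>Obj Simp_op. p' b = p b" by (intro uniq) (simp_all add: dec_def)
  thus "p' = p" by (simp add: fun_eq_iff)
 qed
qed

lemma dec_proj_eq: "dec_proj C k Z m ns a = dec_counit C k Z ns \<cdot> Fm (dec_obj C k Z) m (conc ns) a"
 using k by (simp add: dec_proj_def)

end

lemma bproj_eq:
 "0 < k ==> bproj k Z m bs = dec_counit C k Z (dims bs) \<cdot> Fm (dec_obj C k Z) m (conc (dims bs)) (concat bs)"
 by (simp add: bproj_def dec_proj_eq)

lemma bproj_in:
 assumes b: "bs \<in> blocks k m"
 shows "bproj k Z m bs \<in> Hom C (Fo (dec_obj C k Z) m) (Fo Z (dims bs))"
proof (cases "k = 0")
 case True
 thus ?thesis using b id_in[OF mobj[of "[]"]] by (simp add: bproj_0 dec_zero blocks_0)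
next
 case False
 hence k: "0 < k" by simp
 note o = sobj_obj[OF dec_sobj]
 show ?thesis unfolding bproj_eq[OF k]
  by (rule comp_in[OF o o mobj[OF dims_len[OF b]] sobj_map[OF dec_sobj concat_hom[OF b k]]
    dec_counit_in[OF k dims_len[OF b]]])
qed

lemma bproj_id_blocks: "[|0 < k; length ns = k|] ==> bproj k Z (conc ns) (id_blocks ns) = dec_counit C k Z ns"
 using id_blocks_tuple(2)[of ns k] sobj_id[OF dec_sobj, of "conc ns"]
  id_right[OF sobj_obj[OF dec_sobj] mobj dec_counit_in]
 by (simp add: bproj_eq dims_id_blocks del: upt_Suc)

text \<open>Equations of morphisms into the right adjoint are tested on its projections. For
  \<open>k = 0\<close> the single projection is an identity; for positive \<open>k\<close> the
  universal tuples already suffice by adjointness.\<close>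

lemma dec_ext:
 assumes X: "simplicial X" and p: "snat X (dec_obj C k Z) p" "snat X (dec_obj C k Z) p'"
  and eq: "!!m bs. bs \<in> blocks k m ==> bproj k Z m bs \<cdot> p m = bproj k Z m bs \<cdot> p' m"
 shows "p = p'"
proof (cases "k = 0")
 case True
 show ?thesis
 proof
  fix m
  have "p m \<in> Hom C (Fo X m) (Fo Z [])" "p' m \<in> Hom C (Fo X m) (Fo Z [])"
   using snat_in[OF p(1), of m] snat_in[OF p(2), of m] True by (simp_all add: dec_zero)
  thus "p m = p' m"
   using eq[of "[]" m] True id_left[OF sobj_obj[OF X] mobj[of "[]"]] by (simp add: bproj_0 blocks_0)
 qed
next
 case False
 hence k: "0 < k" by simp
 note o = sobj_obj[OF dec_sobj] and o' = sobj_obj[OF X]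
 let ?q = "\<lambda>ns. dec_counit C k Z ns \<cdot> p' (conc ns)"
 have "\<exists>!p. snat X (dec_obj C k Z) p \<and> (\<forall>ns. length ns = k --> dec_counit C k Z ns \<cdot> p (conc ns) = ?q ns)"
 proof (rule dec_universal[OF k X])
  fix ns :: "nat list" assume ns: "length ns = k"
  show "?q ns \<in> Hom C (Fo X (conc ns)) (Fo Z ns)"
   by (rule comp_in[OF o' o mobj[OF ns] snat_in[OF p(2)] dec_counit_in[OF k ns]])
  fix ms ts assume ms: "length ms = k" and t: "ts \<in> pHom k ms ns"
  note j = brestr_id_blocks(1)[OF t ms ns k]
  show "Fm Z ms ns ts \<cdot> ?q ms = ?q ns \<cdot> Fm X (conc ms) (conc ns) (join ms ts)"
   using assoc[OF o' o mobj[OF ms] mobj[OF ns] snat_in[OF p(2)] dec_counit_in[OF k ms] mmap[OF ms ns t]]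
    assoc[OF o' o o mobj[OF ns] snat_in[OF p(2)] sobj_map[OF dec_sobj j] dec_counit_in[OF k ns]]
    assoc[OF o' o' o mobj[OF ns] sobj_map[OF X j] snat_in[OF p(2)] dec_counit_in[OF k ns]]
    dec_counit_nat[OF k ms ns t] snat_nat[OF p(2) j] by simp
 qed
 moreover have "dec_counit C k Z ns \<cdot> p (conc ns) = ?q ns" if "length ns = k" for ns
  using eq[OF id_blocks_tuple(1)[OF that k]] bproj_id_blocks[OF k that] by simp
 ultimately show ?thesis using p by blast
qed

lemma bproj_desc:
 assumes k: "0 < k" and X: "simplicial X" and p: "snat X (dec_obj C k Z) p"
  and q: "!!ns. length ns = k ==> dec_counit C k Z ns \<cdot> p (conc ns) = q ns" and b: "bs \<in> blocks k m"
 shows "bproj k Z m bs \<cdot> p m = q (dims bs) \<cdot> Fm X m (conc (dims bs)) (concat bs)"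
proof -
 note d = dims_len[OF b] and cb = concat_hom[OF b k] and o = sobj_obj[OF dec_sobj] and o' = sobj_obj[OF X]
 show ?thesis
  using assoc[OF o' o o mobj[OF d] snat_in[OF p] sobj_map[OF dec_sobj cb] dec_counit_in[OF k d]]
   assoc[OF o' o' o mobj[OF d] sobj_map[OF X cb] snat_in[OF p] dec_counit_in[OF k d]] snat_nat[OF p cb]
  by (simp add: bproj_eq[OF k] q[OF d, symmetric])
qed

text \<open>The defining condition concerns only the inclusions into a concatenation. Pulling it
  back along the concatenated tuple shows that on every tuple the Alexander-Whitney map is
  restriction of the diagonal to the blocks.\<close>

lemma Aw_spec:
 shows Aw_nat: "snat (restr Z (diag k)) (dec_obj C k Z) (Aw C k Z)"
  and bproj_Aw: "bs \<in> blocks k m ==> bproj k Z m bs \<cdot> Aw C k Z m = Fm Z (rep k m) (dims bs) bs"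
proof -
 let ?X = "restr Z (diag k)"
 have X: "simplicial ?X" by (rule diag_functor[OF Z])
 have "snat ?X (dec_obj C k Z) (Aw C k Z) \<and>
  (\<forall>bs\<in>blocks k m. bproj k Z m bs \<cdot> Aw C k Z m = Fm Z (rep k m) (dims bs) bs)"
 proof (cases "k = 0")
  case True
  thus ?thesis using mid[of "[]"] mobj[of "[]"] mmap[of "[]" "[]" "[]"]
   by (simp add: is_nat_trans_def dec_zero restr_def diag_def Aw_def bproj_0 blocks_0 id_left id_in)
 next
  case False
  hence k: "0 < k" by simp
  let ?q = "\<lambda>ns. Fm Z (rep k (conc ns)) ns (map (incl ns) [0..<k])"
  have incl: "?q ns = Fm Z (rep k (conc ns)) ns (id_blocks ns)" if "length ns = k" for ns
   using that by (simp add: id_blocks_def)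
  have ib: "id_blocks ns \<in> pHom k (rep k (conc ns)) ns"
   if "length ns = k" for ns using blocks_hom[OF id_blocks_tuple(1)[OF that k]] by (simp add: dims_id_blocks)
  have shift: "Fm Z (rep k (conc ns)) ns (id_blocks ns) \<cdot> Fm ?X m (conc ns) f = Fm Z (rep k m) ns (map (map ((!) f)) (id_blocks ns))"
   if ns: "length ns = k" and f: "f \<in> Hom Simp (conc ns) m" for ns f m
  proof -
   have "brestr (rep k f) (id_blocks ns) = map (map ((!) f)) (id_blocks ns)"
    using ns by (intro nth_equalityI) (auto simp: brestr_def)
   thus ?thesis using mcomp[OF _ _ ns _ ib[OF ns], of "rep k m" "rep k f"] f by (simp add: restr_def diag_def)
  qed
  have "\<exists>!p. snat ?X (dec_obj C k Z) p \<and> (\<forall>ns. length ns = k --> dec_counit C k Z ns \<cdot> p (conc ns) = ?q ns)"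
  proof (rule dec_universal[OF k X])
   fix ns :: "nat list" assume ns: "length ns = k"
   show "?q ns \<in> Hom C (Fo ?X (conc ns)) (Fo Z ns)"
    unfolding incl[OF ns] using mmap[OF _ ns ib[OF ns]] by (simp add: restr_def diag_def)
   fix ms ts assume ms: "length ms = k" and t: "ts \<in> pHom k ms ns"
   note j = brestr_id_blocks[OF t ms ns k]
   show "Fm Z ms ns ts \<cdot> ?q ms = ?q ns \<cdot> Fm ?X (conc ms) (conc ns) (join ms ts)"
    unfolding incl[OF ns] incl[OF ms] shift[OF ns j(1)] j(2)[symmetric] by (rule mcomp[OF _ ms ns ib[OF ms] t]) simp
  qed
  from theI'[OF this] have A: "snat ?X (dec_obj C k Z) (Aw C k Z)"
   "!!ns. length ns = k ==> dec_counit C k Z ns \<cdot> Aw C k Z (conc ns) = ?q ns"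
   using k by (simp_all add: Aw_def)
  show ?thesis
  proof (intro conjI A(1) ballI)
   fix bs assume b: "bs \<in> blocks k m"
   show "bproj k Z m bs \<cdot> Aw C k Z m = Fm Z (rep k m) (dims bs) bs"
    using bproj_desc[OF k X A b] shift[OF dims_len[OF b] concat_hom[OF b k]] block_map_id_blocks[OF b k]
    by (simp add: incl[OF dims_len[OF b]])
  qed
 qed
 thus "snat (restr Z (diag k)) (dec_obj C k Z) (Aw C k Z)"
  "bs \<in> blocks k m ==> bproj k Z m bs \<cdot> Aw C k Z m = Fm Z (rep k m) (dims bs) bs" by auto
qed

end

lemma dec_map_spec:
 assumes Z: "msimplicial k Z" and Z': "msimplicial k Z'"
  and q: "mnat k Z Z' q"
 shows dec_map_nat: "snat (dec_obj C k Z) (dec_obj C k Z') (dec_map C k Z Z' q)"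
  and bproj_dec_map: "bs \<in> blocks k m ==> bproj k Z' m bs \<cdot> dec_map C k Z Z' q m = q (dims bs) \<cdot> bproj k Z m bs"
proof -
 let ?X = "dec_obj C k Z"
 note X = dec_sobj[OF Z] and oZ = mobj[OF Z] and oZ' = mobj[OF Z']
 note o = sobj_obj[OF X]
 have qin: "q ns \<in> Hom C (Fo Z ns) (Fo Z' ns)" if "length ns = k" for ns using q that by (simp add: is_nat_trans_def)
 have qnat: "Fm Z' ms ns ts \<cdot> q ms = q ns \<cdot> Fm Z ms ns ts"
  if "length ms = k" "length ns = k" "ts \<in> pHom k ms ns" for ms ns ts
  using q that by (simp add: is_nat_trans_def)
 have "snat ?X (dec_obj C k Z') (dec_map C k Z Z' q) \<and>
  (\<forall>bs\<in>blocks k m. bproj k Z' m bs \<cdot> dec_map C k Z Z' q m = q (dims bs) \<cdot> bproj k Z m bs)"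
 proof (cases "k = 0")
  case True
  thus ?thesis using qin[of "[]"] oZ[of "[]"] oZ'[of "[]"] mid[OF Z, of "[]"] mid[OF Z', of "[]"]
   by (simp add: is_nat_trans_def dec_zero dec_map_def bproj_0 blocks_0 id_left id_right)
 next
  case False
  hence k: "0 < k" by simp
  have "\<exists>!p. snat ?X (dec_obj C k Z') p \<and> (\<forall>ns. length ns = k --> dec_counit C k Z' ns \<cdot> p (conc ns) = q ns \<cdot> dec_counit C k Z ns)"
  proof (rule dec_universal[OF Z' k X])
   fix ns :: "nat list" assume ns: "length ns = k"
   show "q ns \<cdot> dec_counit C k Z ns \<in> Hom C (Fo ?X (conc ns)) (Fo Z' ns)"
    by (rule comp_in[OF o oZ[OF ns] oZ'[OF ns] dec_counit_in[OF Z k ns] qin[OF ns]])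
   fix ms ts assume ms: "length ms = k" and t: "ts \<in> pHom k ms ns"
   note j = brestr_id_blocks(1)[OF t ms ns k]
   show "Fm Z' ms ns ts \<cdot> q ms \<cdot> dec_counit C k Z ms = (q ns \<cdot> dec_counit C k Z ns) \<cdot> Fm ?X (conc ms) (conc ns) (join ms ts)"
    using assoc[OF o oZ[OF ms] oZ'[OF ms] oZ'[OF ns] dec_counit_in[OF Z k ms] qin[OF ms] mmap[OF Z' ms ns t]]
     assoc[OF o oZ[OF ms] oZ[OF ns] oZ'[OF ns] dec_counit_in[OF Z k ms] mmap[OF Z ms ns t] qin[OF ns]]
     assoc[OF o o oZ[OF ns] oZ'[OF ns] sobj_map[OF X j] dec_counit_in[OF Z k ns] qin[OF ns]]
     qnat[OF ms ns t] dec_counit_nat[OF Z k ms ns t] by simp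
  qed
  from theI'[OF this] have A: "snat ?X (dec_obj C k Z') (dec_map C k Z Z' q)"
   "!!ns. length ns = k ==> dec_counit C k Z' ns \<cdot> dec_map C k Z Z' q (conc ns) = q ns \<cdot> dec_counit C k Z ns"
   using k by (simp_all add: dec_map_def)
  have "(q (dims bs) \<cdot> dec_counit C k Z (dims bs)) \<cdot> Fm ?X m (conc (dims bs)) (concat bs) = q (dims bs) \<cdot> bproj k Z m bs"
   if b: "bs \<in> blocks k m" for bs
   unfolding bproj_eq[OF Z k] using dims_len[OF b]
   by (intro assoc[OF o o oZ oZ' sobj_map[OF X concat_hom[OF b k]] dec_counit_in[OF Z k] qin])
  thus ?thesis using A(1) bproj_desc[OF Z' k X A] by simp
 qed
 thus "snat (dec_obj C k Z) (dec_obj C k Z') (dec_map C k Z Z' q)"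
  "bs \<in> blocks k m ==> bproj k Z' m bs \<cdot> dec_map C k Z Z' q m = q (dims bs) \<cdot> bproj k Z m bs" by auto
qed

end

section \<open>Iterated products\<close>

context category
begin

lemma is_isom_in: "is_isom C a b f ==> f \<in> Hom C a b"
 by (auto simp: is_isom_def inverse_pair_def)

lemma is_isom_id: "a \<in> Obj C ==> is_isom C a a (Idm C a)"
 using id_in[of a] id_left[of a a "Idm C a"] unfolding is_isom_def inverse_pair_def by metis

lemma is_isom_comp:
 assumes o: "a \<in> Obj C" "b \<in> Obj C" "c \<in> Obj C" and f: "is_isom C a b f" and g: "is_isom C b c g"
 shows "is_isom C a c (g \<cdot> f)"
proof -
 obtain f' g' where f': "f \<in> Hom C a b" "f' \<in> Hom C b a" "f' \<cdot> f = Idm C a" "f \<cdot> f' = Idm C b"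
  and g': "g \<in> Hom C b c" "g' \<in> Hom C c b" "g' \<cdot> g = Idm C b" "g \<cdot> g' = Idm C c"
  using f g by (auto simp: is_isom_def inverse_pair_def)
 have gf: "g \<cdot> f \<in> Hom C a c" "f' \<cdot> g' \<in> Hom C c a"
  using comp_in[OF o f'(1) g'(1)] comp_in[OF o(3,2,1) g'(2) f'(2)] .
 have "(f' \<cdot> g') \<cdot> (g \<cdot> f) = Idm C a"
  using assoc[OF o(1,3,2,1) gf(1) g'(2) f'(2)] assoc[OF o(1,2,3,2) f'(1) g'(1,2)] g'(3) f'(3) id_left[OF o(1,2) f'(1)]
  by simp
 moreover have "(g \<cdot> f) \<cdot> (f' \<cdot> g') = Idm C c"
  using assoc[OF o(3,1,2,3) gf(2) f'(1) g'(1)] assoc[OF o(3,2,1,2) g'(2) f'(2,1)] f'(4) g'(4) id_left[OF o(3,2) g'(2)]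
  by simp
 ultimately show ?thesis using gf unfolding is_isom_def inverse_pair_def by blast
qed

end

lemma tensO_Cons: "ys \<noteq> [] ==> tensO C (x # ys) = TensO C x (tensO C ys)"
 by (cases ys) auto

lemma tensM_Cons: "gs \<noteq> [] ==> tensM C (f # gs) = TensM C f (tensM C gs)"
 by (cases gs) auto

context monoidal_category
begin

lemma is_isom_tens:
 assumes o: "a \<in> Obj C" "b \<in> Obj C" "c \<in> Obj C" "d \<in> Obj C" and f: "is_isom C a b f" and g: "is_isom C c d g"
 shows "is_isom C (TensO C a c) (TensO C b d) (TensM C f g)"
proof -
 obtain f' g' where f': "f \<in> Hom C a b" "f' \<in> Hom C b a" "f' \<cdot> f = Idm C a" "f \<cdot> f' = Idm C b"
  and g': "g \<in> Hom C c d" "g' \<in> Hom C d c" "g' \<cdot> g = Idm C c" "g \<cdot> g' = Idm C d"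
  using f g by (auto simp: is_isom_def inverse_pair_def)
 have "inverse_pair C (TensO C a c) (TensO C b d) (TensM C f g) (TensM C f' g')"
  using tens_in[OF o f'(1) g'(1)] tens_in[OF o(2,1,4,3) f'(2) g'(2)] tens_comp[OF o(1,2,1,3,4,3) f'(1,2) g'(1,2)]
   tens_comp[OF o(2,1,2,4,3,4) f'(2,1) g'(2,1)] f' g' tens_id o
  by (simp add: inverse_pair_def)
 thus ?thesis by (auto simp: is_isom_def)
qed

lemma tensO_obj: "set xs \<subseteq> Obj C ==> tensO C xs \<in> Obj C"
proof (induction xs)
 case (Cons x xs)
 thus ?case by (cases "xs = []") (simp_all add: tensO_Cons tens_obj)
qed (simp add: unit_obj)

text \<open>A typing judgement for lists of arrows, as an arrow does not determine its ends; it also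
  keeps the lists of equal length.\<close>

definition homs :: "'o list => 'o list => 'm list => bool" where
 "homs xs ys fs \<longleftrightarrow> length ys = length xs \<and> length fs = length xs \<and> set xs \<subseteq> Obj C \<and> set ys \<subseteq> Obj C \<and>
   (\<forall>i<length xs. fs ! i \<in> Hom C (xs ! i) (ys ! i))"

lemma homs_Nil: "homs [] ys fs \<longleftrightarrow> ys = [] \<and> fs = []"
 by (auto simp: homs_def)

lemma homs_Cons:
 "homs (x # xs) (y # ys) (f # fs) \<longleftrightarrow> x \<in> Obj C \<and> y \<in> Obj C \<and> f \<in> Hom C x y \<and> homs xs ys fs"
 by (auto simp: homs_def nth_Cons split: nat.splits)

lemma homs_ConsE:
 assumes "homs (x # xs) ys' fs'"
 obtains y ys f fs where "ys' = y # ys" "fs' = f # fs" "x \<in> Obj C" "y \<in> Obj C" "f \<in> Hom C x y" "homs xs ys fs"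
proof -
 obtain y ys f fs where *: "ys' = y # ys" "fs' = f # fs" using assms by (cases ys'; cases fs') (auto simp: homs_def)
 with that assms show ?thesis by (auto simp: homs_Cons)
qed

lemma homs_obj: "homs xs ys fs ==> tensO C xs \<in> Obj C" "homs xs ys fs ==> tensO C ys \<in> Obj C"
 by (simp_all add: homs_def tensO_obj)

lemma homs_length: "homs xs ys fs ==> length ys = length xs \<and> length fs = length xs"
 by (simp add: homs_def)

lemma tensM_in: "homs xs ys fs ==> tensM C fs \<in> Hom C (tensO C xs) (tensO C ys)"
proof (induction xs arbitrary: ys fs)
 case Nil
 thus ?case using id_in[OF unit_obj] by (simp add: homs_Nil)
next
 case (Cons x xs)
 from Cons.prems obtain y ys' f fs' where *: "ys = y # ys'" "fs = f # fs'" "x \<in> Obj C" "y \<in> Obj C" "f \<in> Hom C x y"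
  "homs xs ys' fs'" by (rule homs_ConsE)
 show ?case
 proof (cases "xs = []")
  case True
  thus ?thesis using * by (simp add: homs_Nil)
 next
  case False
  hence "ys' \<noteq> []" "fs' \<noteq> []" using homs_length[OF *(6)] by auto
  thus ?thesis using False * tens_in[OF *(3,4) homs_obj[OF *(6)] *(5) Cons.IH[OF *(6)]] by (simp add: tensO_Cons tensM_Cons)
 qed
qed

lemma tensM_comp:
 "[|homs xs ys fs; homs ys zs gs|] ==> tensM C (map2 (Cmp C) gs fs) = tensM C gs \<cdot> tensM C fs"
proof (induction xs arbitrary: ys zs fs gs)
 case Nil
 thus ?case using id_left[OF unit_obj unit_obj id_in[OF unit_obj]] by (simp add: homs_Nil)
next
 case (Cons x xs)
 from Cons.prems(1) obtain y ys' f fs' where *: "ys = y # ys'" "fs = f # fs'" "x \<in> Obj C" "y \<in> Obj C" "f \<in> Hom C x y"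
  "homs xs ys' fs'" by (rule homs_ConsE)
 from Cons.prems(2)[unfolded *(1)] obtain z zs' g gs' where **: "zs = z # zs'" "gs = g # gs'" "y \<in> Obj C" "z \<in> Obj C" "g \<in> Hom C y z"
  "homs ys' zs' gs'" by (rule homs_ConsE)
 show ?case
 proof (cases "xs = []")
  case True
  thus ?thesis using * ** by (simp add: homs_Nil)
 next
  case False
  hence ne: "fs' \<noteq> []" "gs' \<noteq> []" "map2 (Cmp C) gs' fs' \<noteq> []"
   using homs_length[OF *(6)] homs_length[OF **(6)] by auto
  have "tensM C (map2 (Cmp C) gs fs) = TensM C (g \<cdot> f) (tensM C gs' \<cdot> tensM C fs')"
   using * ** ne Cons.IH[OF *(6) **(6)] by (simp add: tensM_Cons)
  also have "\<dots> = tensM C gs \<cdot> tensM C fs"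
   using ne * ** tens_comp[OF *(3,4) **(4) homs_obj[OF *(6)] homs_obj(2)[OF **(6)] *(5) **(5) tensM_in[OF *(6)] tensM_in[OF **(6)]]
   by (simp add: tensM_Cons)
  finally show ?thesis .
 qed
qed

lemma tensM_id: "set xs \<subseteq> Obj C ==> tensM C (map (Idm C) xs) = Idm C (tensO C xs)"
proof (induction xs)
 case (Cons x xs)
 thus ?case by (cases "xs = []") (simp_all add: tensO_Cons tensM_Cons tens_id tensO_obj)
qed simp

lemma homs_append:
 "[|homs xs ys fs; homs xs' ys' fs'|] ==> homs (xs @ xs') (ys @ ys') (fs @ fs')"
 by (auto simp: homs_def nth_append)

lemma tens_append_Cons:
 "xs \<noteq> [] ==> tens_append C (x # xs) ys = TensM C (Idm C x) (tens_append C xs ys) \<cdot> Assoc C x (tensO C xs) (tensO C ys)"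
 by (cases xs) auto

lemma tens_append_isom:
 "[|set xs \<subseteq> Obj C; set ys \<subseteq> Obj C|] ==>
  is_isom C (TensO C (tensO C xs) (tensO C ys)) (tensO C (xs @ ys)) (tens_append C xs ys)"
proof (induction xs)
 case Nil
 thus ?case using lunit_iso[OF tensO_obj] by simp
next
 case (Cons x xs)
 hence o: "x \<in> Obj C" "tensO C xs \<in> Obj C" "tensO C ys \<in> Obj C" "tensO C (xs @ ys) \<in> Obj C"
  by (simp_all add: tensO_obj)
 show ?case
 proof (cases "xs = []")
  case True
  thus ?thesis using o runit_iso[OF o(1)] is_isom_id[OF tens_obj[OF o(1,3)]]
   by (cases "ys = []") (simp_all add: tensO_Cons)
 next
  case False
  have "is_isom C (TensO C x (TensO C (tensO C xs) (tensO C ys))) (TensO C x (tensO C (xs @ ys))) (TensM C (Idm C x) (tens_append C xs ys))"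
   using Cons o by (intro is_isom_tens is_isom_id tens_obj) auto
  thus ?thesis using False o assoc_iso[OF o(1-3)]
   by (simp add: tensO_Cons tens_append_Cons is_isom_comp[of _ "TensO C x (TensO C (tensO C xs) (tensO C ys))"] tens_obj)
 qed
qed

lemma tens_append_nat:
 "[|homs xs ys fs; homs xs' ys' fs'|] ==>
  tens_append C ys ys' \<cdot> TensM C (tensM C fs) (tensM C fs') = tensM C (fs @ fs') \<cdot> tens_append C xs xs'"
proof (induction xs arbitrary: ys fs)
 case Nil
 thus ?case using lunit_nat[OF homs_obj[OF Nil(2)] tensM_in[OF Nil(2)]] by (simp add: homs_Nil)
next
 case (Cons x xs)
 from Cons.prems(1) obtain y zs f gs where *: "ys = y # zs" "fs = f # gs" "x \<in> Obj C" "y \<in> Obj C" "f \<in> Hom C x y"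
  "homs xs zs gs" by (rule homs_ConsE)
 note h' = Cons.prems(2)
 note o = *(3,4) homs_obj[OF *(6)] homs_obj[OF h'] homs_obj[OF homs_append[OF *(6) h']]
 note t = tensM_in[OF *(6)] and t' = tensM_in[OF h'] and t'' = tensM_in[OF homs_append[OF *(6) h']]
 show ?case
 proof (cases "xs = []")
  case True
  hence n: "zs = []" "gs = []" using *(6) by (auto simp: homs_Nil)
  show ?thesis
  proof (cases "xs' = []")
   case True
   hence n': "ys' = []" "fs' = []" using h' by (auto simp: homs_Nil)
   show ?thesis using \<open>xs = []\<close> True n n' * runit_nat[OF *(3-5)] by simp
  next
   case False
   hence n': "ys' \<noteq> []" "fs' \<noteq> []" using homs_length[OF h'] by auto
   have "TensM C f (tensM C fs') \<in> Hom C (TensO C x (tensO C xs')) (TensO C y (tensO C ys'))"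
    by (rule tens_in[OF *(3,4) homs_obj[OF h'] *(5) t'])
   thus ?thesis
    using \<open>xs = []\<close> False n n' * id_left[OF tens_obj[OF o(1,5)] tens_obj[OF o(2,6)]]
     id_right[OF tens_obj[OF o(1,5)] tens_obj[OF o(2,6)]] by (simp add: tensM_Cons)
  qed
 next
  case False
  hence n: "zs \<noteq> []" "gs \<noteq> []" using homs_length[OF *(6)] by auto
  let ?X = "tensO C xs" and ?Y = "tensO C zs" and ?X' = "tensO C xs'" and ?Y' = "tensO C ys'"
  note ax = is_isom_in[OF assoc_iso[OF o(1,3,5)]] and ay = is_isom_in[OF assoc_iso[OF o(2,4,6)]]
  have sx: "set xs \<subseteq> Obj C" "set xs' \<subseteq> Obj C" "set zs \<subseteq> Obj C" "set ys' \<subseteq> Obj C"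
   using *(6) h' by (auto simp: homs_def)
  note cx = is_isom_in[OF tens_append_isom[OF sx(1,2)]] and cy = is_isom_in[OF tens_append_isom[OF sx(3,4)]]
  note Oxx = tens_obj[OF o(3,5)] and Oyy = tens_obj[OF o(4,6)]
  note Icx = tens_in[OF o(1,1) Oxx o(7) id_in[OF o(1)] cx] and Icy = tens_in[OF o(2,2) Oyy o(8) id_in[OF o(2)] cy]
  note ft = tens_in[OF o(1-4) *(5) t] and tt = tens_in[OF o(3-6) t t'] and ft'' = tens_in[OF o(1,2,7,8) *(5) t'']
  note ftt = tens_in[OF o(1,2) Oxx Oyy *(5) tt] and fftt = tens_in[OF tens_obj[OF o(1,3)] tens_obj[OF o(2,4)] o(5,6) ft t']
  note A1 = tens_obj[OF tens_obj[OF o(1,3)] o(5)] and A2 = tens_obj[OF tens_obj[OF o(2,4)] o(6)]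
   and B1 = tens_obj[OF o(1) Oxx] and B2 = tens_obj[OF o(2) Oyy] and D1 = tens_obj[OF o(1,7)] and D2 = tens_obj[OF o(2,8)]
  have "tens_append C ys ys' \<cdot> TensM C (tensM C fs) (tensM C fs') =
    (TensM C (Idm C y) (tens_append C zs ys') \<cdot> Assoc C y ?Y ?Y') \<cdot> TensM C (TensM C f (tensM C gs)) (tensM C fs')"
   using * n by (simp add: tens_append_Cons tensM_Cons)
  also have "\<dots> = TensM C (Idm C y) (tens_append C zs ys') \<cdot> (Assoc C y ?Y ?Y' \<cdot> TensM C (TensM C f (tensM C gs)) (tensM C fs'))"
   by (rule assoc[OF A1 A2 B2 D2 fftt ay Icy])
  also have "Assoc C y ?Y ?Y' \<cdot> TensM C (TensM C f (tensM C gs)) (tensM C fs') =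
    TensM C f (TensM C (tensM C gs) (tensM C fs')) \<cdot> Assoc C x ?X ?X'"
   by (rule assoc_nat[OF o(1,3,5,2,4,6) *(5) t t'])
  also have "TensM C (Idm C y) (tens_append C zs ys') \<cdot> (TensM C f (TensM C (tensM C gs) (tensM C fs')) \<cdot> Assoc C x ?X ?X') =
    (TensM C (Idm C y) (tens_append C zs ys') \<cdot> TensM C f (TensM C (tensM C gs) (tensM C fs'))) \<cdot> Assoc C x ?X ?X'"
   by (rule assoc[OF A1 B1 B2 D2 ax ftt Icy, symmetric])
  also have "TensM C (Idm C y) (tens_append C zs ys') \<cdot> TensM C f (TensM C (tensM C gs) (tensM C fs')) =
    TensM C f (tensM C (gs @ fs') \<cdot> tens_append C xs xs')"
   using tens_comp[OF o(1,2,2) Oxx Oyy o(8) *(5) id_in[OF o(2)] tt cy] id_left[OF o(1,2) *(5)] Cons.IH[OF *(6) h'] by simp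
  also have "\<dots> = TensM C f (tensM C (gs @ fs')) \<cdot> TensM C (Idm C x) (tens_append C xs xs')"
   using tens_comp[OF o(1,1,2) Oxx o(7,8) id_in[OF o(1)] *(5) cx t''] id_right[OF o(1,2) *(5)] by simp
  also have "\<dots> \<cdot> Assoc C x ?X ?X' = TensM C f (tensM C (gs @ fs')) \<cdot> (TensM C (Idm C x) (tens_append C xs xs') \<cdot> Assoc C x ?X ?X')"
   by (rule assoc[OF A1 B1 D1 D2 ax Icx ft''])
  also have "\<dots> = tensM C (fs @ fs') \<cdot> tens_append C (x # xs) xs'"
   using * n False by (simp add: tens_append_Cons tensM_Cons)
  finally show ?thesis .
 qed
qed

lemma tens_flat_Cons:
 "xss \<noteq> [] ==> tens_flat C (xs # xss) = tens_append C xs (concat xss) \<cdot> TensM C (Idm C (tensO C xs)) (tens_flat C xss)"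
 by (cases xss) auto

lemma tens_flat_isom:
 "set (concat xss) \<subseteq> Obj C ==> is_isom C (tensO C (map (tensO C) xss)) (tensO C (concat xss)) (tens_flat C xss)"
proof (induction xss)
 case Nil
 thus ?case using is_isom_id[OF unit_obj] by simp
next
 case (Cons xs xss)
 hence "set xs \<subseteq> Obj C" "set (concat xss) \<subseteq> Obj C" "!!ys. ys \<in> set xss ==> set ys \<subseteq> Obj C" by auto
 hence o: "tensO C xs \<in> Obj C" "tensO C (map (tensO C) xss) \<in> Obj C" "tensO C (concat xss) \<in> Obj C" "tensO C (xs @ concat xss) \<in> Obj C"
  by (simp_all add: tensO_obj image_subset_iff)
 show ?case
 proof (cases "xss = []")
  case True
  thus ?thesis using is_isom_id[OF o(1)] by simp
 next
  case False
  have "is_isom C (TensO C (tensO C xs) (tensO C (map (tensO C) xss))) (TensO C (tensO C xs) (tensO C (concat xss)))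
    (TensM C (Idm C (tensO C xs)) (tens_flat C xss))"
   using Cons o by (intro is_isom_tens is_isom_id) auto
  moreover have "is_isom C (TensO C (tensO C xs) (tensO C (concat xss))) (tensO C (xs @ concat xss)) (tens_append C xs (concat xss))"
   using Cons by (intro tens_append_isom) auto
  ultimately show ?thesis using False o
   by (simp add: tensO_Cons tens_flat_Cons is_isom_comp[of _ "TensO C (tensO C xs) (tensO C (concat xss))"] tens_obj)
 qed
qed

lemma tens_flat_in:
 "set (concat xss) \<subseteq> Obj C ==> tens_flat C xss \<in> Hom C (tensO C (map (tensO C) xss)) (tensO C (concat xss))"
 by (rule is_isom_in[OF tens_flat_isom])

definition homss :: "'o list list => 'o list list => 'm list list => bool" where
 "homss xss yss fss \<longleftrightarrow> length yss = length xss \<and> length fss = length xss \<and> (\<forall>i<length xss. homs (xss ! i) (yss ! i) (fss ! i))"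

lemma homss_ConsE:
 assumes "homss (x # xs) ys' fs'"
 obtains y ys f fs where "ys' = y # ys" "fs' = f # fs" "homs x y f" "homss xs ys fs"
proof -
 obtain y ys f fs where *: "ys' = y # ys" "fs' = f # fs" using assms by (cases ys'; cases fs') (auto simp: homss_def)
 have "homs x y f" "homss xs ys fs" using assms * by (fastforce simp: homss_def)+
 with that * show ?thesis by blast
qed

lemma homss_concat: "homss xss yss fss ==> homs (concat xss) (concat yss) (concat fss)"
proof (induction xss arbitrary: yss fss)
 case Nil
 thus ?case by (auto simp: homss_def homs_Nil)
next
 case (Cons xs xss)
 from Cons.prems show ?case by (rule homss_ConsE) (auto intro: homs_append Cons.IH)
qed

lemma homss_tens: "homss xss yss fss ==> homs (map (tensO C) xss) (map (tensO C) yss) (map (tensM C) fss)"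
proof (induction xss arbitrary: yss fss)
 case Nil
 thus ?case by (auto simp: homss_def homs_Nil)
next
 case (Cons xs xss)
 from Cons.prems show ?case by (rule homss_ConsE) (auto simp: homs_Cons intro: homs_obj tensM_in Cons.IH)
qed

text \<open>Applied to structure maps it makes the flattening a morphism of simplicial objects;
  applied to restrictions along blocks it gives \<open>box_flat\<close>.\<close>

lemma tens_flat_nat:
 "homss xss yss fss ==> tens_flat C yss \<cdot> tensM C (map (tensM C) fss) = tensM C (concat fss) \<cdot> tens_flat C xss"
proof (induction xss arbitrary: yss fss)
 case Nil
 thus ?case by (simp add: homss_def)
next
 case (Cons xs xss)
 from Cons.prems obtain ys yss' fs fss' where *: "yss = ys # yss'" "fss = fs # fss'" "homs xs ys fs" "homss xss yss' fss'"
  by (rule homss_ConsE)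
 note h = *(3) and ht = homss_tens[OF *(4)] and hc = homss_concat[OF *(4)]
 note t = tensM_in[OF h]
 note o = homs_obj[OF h]
 show ?case
 proof (cases "xss = []")
  case True
  hence "yss' = []" "fss' = []" using *(4) by (auto simp: homss_def)
  thus ?thesis using True * id_left[OF o t] id_right[OF o t] by simp
 next
  case False
  hence n: "yss' \<noteq> []" "fss' \<noteq> []" using *(4) by (auto simp: homss_def)
  have sx: "set (concat xss) \<subseteq> Obj C" "set (concat yss') \<subseteq> Obj C" "set xs \<subseteq> Obj C" "set ys \<subseteq> Obj C"
   using hc h by (auto simp: homs_def)
  note P = homs_obj[OF ht] and Q = homs_obj[OF hc] and R = homs_obj[OF homs_append[OF h hc]]
  note fx = tens_flat_in[OF sx(1)] and fy = tens_flat_in[OF sx(2)]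
  note ax = is_isom_in[OF tens_append_isom[OF sx(3,1)]] and ay = is_isom_in[OF tens_append_isom[OF sx(4,2)]]
  note tt = tensM_in[OF ht] and tc = tensM_in[OF hc] and ta = tensM_in[OF homs_append[OF h hc]]
  note Ifx = tens_in[OF o(1,1) P(1) Q(1) id_in[OF o(1)] fx] and Ify = tens_in[OF o(2,2) P(2) Q(2) id_in[OF o(2)] fy]
  note ttt = tens_in[OF o P t tt] and ttc = tens_in[OF o Q t tc]
  have "tens_flat C yss \<cdot> tensM C (map (tensM C) fss) =
    (tens_append C ys (concat yss') \<cdot> TensM C (Idm C (tensO C ys)) (tens_flat C yss')) \<cdot> TensM C (tensM C fs) (tensM C (map (tensM C) fss'))"
   using * n by (simp add: tens_flat_Cons tensM_Cons)
  also have "\<dots> = tens_append C ys (concat yss') \<cdot> (TensM C (Idm C (tensO C ys)) (tens_flat C yss') \<cdot> TensM C (tensM C fs) (tensM C (map (tensM C) fss')))"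
   by (rule assoc[OF tens_obj[OF o(1) P(1)] tens_obj[OF o(2) P(2)] tens_obj[OF o(2) Q(2)] R(2) ttt Ify ay])
  also have "TensM C (Idm C (tensO C ys)) (tens_flat C yss') \<cdot> TensM C (tensM C fs) (tensM C (map (tensM C) fss')) =
    TensM C (tensM C fs) (tensM C (concat fss') \<cdot> tens_flat C xss)"
   using tens_comp[OF o(1,2,2) P Q(2) t id_in[OF o(2)] tt fy] id_left[OF o t] Cons.IH[OF *(4)] by simp
  also have "\<dots> = TensM C (tensM C fs) (tensM C (concat fss')) \<cdot> TensM C (Idm C (tensO C xs)) (tens_flat C xss)"
   using tens_comp[OF o(1,1,2) P(1) Q id_in[OF o(1)] t fx tc] id_right[OF o t] by simp
  also have "tens_append C ys (concat yss') \<cdot> (TensM C (tensM C fs) (tensM C (concat fss')) \<cdot> TensM C (Idm C (tensO C xs)) (tens_flat C xss)) =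
    (tens_append C ys (concat yss') \<cdot> TensM C (tensM C fs) (tensM C (concat fss'))) \<cdot> TensM C (Idm C (tensO C xs)) (tens_flat C xss)"
   by (rule assoc[OF tens_obj[OF o(1) P(1)] tens_obj[OF o(1) Q(1)] tens_obj[OF o(2) Q(2)] R(2) Ifx ttc ay, symmetric])
  also have "tens_append C ys (concat yss') \<cdot> TensM C (tensM C fs) (tensM C (concat fss')) =
    tensM C (fs @ concat fss') \<cdot> tens_append C xs (concat xss)"
   by (rule tens_append_nat[OF h hc])
  also have "\<dots> \<cdot> TensM C (Idm C (tensO C xs)) (tens_flat C xss) =
    tensM C (fs @ concat fss') \<cdot> (tens_append C xs (concat xss) \<cdot> TensM C (Idm C (tensO C xs)) (tens_flat C xss))"
   by (rule assoc[OF tens_obj[OF o(1) P(1)] tens_obj[OF o(1) Q(1)] R Ifx ax ta])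
  finally show ?thesis using * False by (simp add: tens_flat_Cons)
 qed
qed

end

context abelian_tensor_category
begin

text \<open>Additivity in one factor of an iterated product. It carries an exchange relation into a
  single tensor factor.\<close>

lemma tensM_add:
 assumes "homs xs ys fs" "homs xs' ys' fs'" "a \<in> Obj C" "b \<in> Obj C" "f \<in> Hom C a b" "g \<in> Hom C a b"
 shows "tensM C (fs @ Plus C f g # fs') = Plus C (tensM C (fs @ f # fs')) (tensM C (fs @ g # fs'))"
 using assms(1)
proof (induction xs arbitrary: ys fs)
 case Nil
 thus ?case
  using tens_add_left[OF assms(3,4) homs_obj[OF assms(2)] assms(5,6) tensM_in[OF assms(2)]]
  by (cases "fs' = []") (auto simp: homs_Nil tensM_Cons)
next
 case (Cons x xs)
 from Cons.prems obtain y zs h hs where *: "ys = y # zs" "fs = h # hs" "x \<in> Obj C" "y \<in> Obj C" "h \<in> Hom C x y"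
  "homs xs zs hs" by (rule homs_ConsE)
 have H: "homs (xs @ a # xs') (zs @ b # ys') (hs @ k # fs')" if "k \<in> Hom C a b" for k
  using that assms *(6) by (intro homs_append) (auto simp: homs_Cons)
 show ?case
  using * Cons.IH[OF *(6)] tens_add_right[OF *(3,4) homs_obj[OF H[OF assms(5)]] *(5) tensM_in[OF H[OF assms(5)]] tensM_in[OF H[OF assms(6)]]]
  by (simp add: tensM_Cons)
qed

end

section \<open>The monoidal category of simplicial objects\<close>

lemma Sim_tens_simps [simp]:
 "TensO (Sim C) X Y = \<lparr>Fo = (\<lambda>n. TensO C (Fo X n) (Fo Y n)), Fm = (\<lambda>m n a. TensM C (Fm X m n a) (Fm Y m n a))\<rparr>"
 "TensM (Sim C) f g = (\<lambda>n. TensM C (f n) (g n))"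
 "TUnit (Sim C) = \<lparr>Fo = (\<lambda>n. TUnit C), Fm = (\<lambda>m n a. Idm C (TUnit C))\<rparr>"
 "Assoc (Sim C) X Y Z = (\<lambda>n. Assoc C (Fo X n) (Fo Y n) (Fo Z n))"
 "LUnit (Sim C) X = (\<lambda>n. LUnit C (Fo X n))"
 "RUnit (Sim C) X = (\<lambda>n. RUnit C (Fo X n))"
 by (simp_all add: Sim_def restr_def box_def diag_def numeral_2_eq_2)

lemma Sim_tensO_Fo: "Fo (tensO (Sim C) Xs) n = tensO C (map (\<lambda>X. Fo X n) Xs)"
proof (induction Xs)
 case (Cons X Xs)
 thus ?case by (cases "Xs = []") (simp_all add: tensO_Cons)
qed simp

lemma Sim_tensO_Fm: "Fm (tensO (Sim C) Xs) m n a = tensM C (map (\<lambda>X. Fm X m n a) Xs)"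
proof (induction Xs)
 case (Cons X Xs)
 thus ?case by (cases "Xs = []") (simp_all add: tensO_Cons tensM_Cons)
qed simp

lemma Sim_tensM: "tensM (Sim C) fs n = tensM C (map (\<lambda>f. f n) fs)"
proof (induction fs)
 case (Cons f fs)
 thus ?case by (cases "fs = []") (simp_all add: tensM_Cons)
qed simp

lemma tens_append_Cons':
 "xs \<noteq> [] ==> tens_append C (x # xs) ys = TensM C (Idm C x) (tens_append C xs ys) \<cdot>\<^bsub>C\<^esub> Assoc C x (tensO C xs) (tensO C ys)"
 by (cases xs) auto

lemma tens_flat_Cons':
 "xss \<noteq> [] ==> tens_flat C (xs # xss) = tens_append C xs (concat xss) \<cdot>\<^bsub>C\<^esub> TensM C (Idm C (tensO C xs)) (tens_flat C xss)"
 by (cases xss) auto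

lemma Sim_tens_append: "tens_append (Sim C) Xs Ys n = tens_append C (map (\<lambda>X. Fo X n) Xs) (map (\<lambda>X. Fo X n) Ys)"
proof (induction Xs)
 case (Cons X Xs)
 thus ?case by (cases "Xs = []") (simp_all add: tens_append_Cons' Sim_tensO_Fo)
qed (simp add: Sim_tensO_Fo)

lemma Sim_tens_flat: "tens_flat (Sim C) Xss n = tens_flat C (map (map (\<lambda>X. Fo X n)) Xss)"
proof (induction Xss)
 case (Cons Xs Xss)
 thus ?case by (cases "Xss = []") (simp_all add: tens_flat_Cons' Sim_tensO_Fo Sim_tens_append map_concat)
qed simp

lemma box_Fo: "Fo (box C Ys) ns = tensO C (map2 Fo Ys ns)"
 by (simp add: box_def)

lemma box_Fm: "Fm (box C Ys) ms ns bs = tensM C (map (\<lambda>i. Fm (Ys ! i) (ms ! i) (ns ! i) (bs ! i)) [0..<length Ys])"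
 by (simp add: box_def)

lemma map2_replicate: "length xs = k ==> map2 f xs (rep k y) = map (\<lambda>x. f x y) xs"
 by (intro nth_equalityI) auto

lemma map_index_upt: "map (\<lambda>i. f (xs ! i)) [0..<length xs] = map f xs"
 by (intro nth_equalityI) auto

text \<open>An equality of functors, since both sides are built from the same right-nested iterated
  products. Statements on multi-simplicial objects thus pass to point-wise products without
  intermediate isomorphisms.\<close>

lemma box_diag: "restr (box C Ys) (diag (length Ys)) = tensO (Sim C) Ys"
proof -
 have "map (\<lambda>i. Fm (Ys ! i) (rep (length Ys) m ! i) (rep (length Ys) n ! i) (rep (length Ys) a ! i)) [0..<length Ys]
   = map (\<lambda>Y. Fm Y m n a) Ys" for m n a
  by (intro nth_equalityI) auto
 hence "Fm (restr (box C Ys) (diag (length Ys))) = Fm (tensO (Sim C) Ys)"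
  by (intro ext) (simp add: restr_def diag_def box_Fm Sim_tensO_Fm)
 moreover have "Fo (restr (box C Ys) (diag (length Ys))) = Fo (tensO (Sim C) Ys)"
  by (intro ext) (simp add: restr_def diag_def box_Fo Sim_tensO_Fo map2_replicate)
 ultimately show ?thesis by (intro ftor.equality) auto
qed

context monoidal_category
begin

abbreviation "SC \<equiv> Sim C"

abbreviation scomp (infixr "\<odot>" 70) where "g \<odot> f \<equiv> g \<cdot>\<^bsub>SC\<^esub> f"

lemma Sim_category: "category SC"
proof
 fix X assume "X \<in> Obj SC"
 hence X: "simplicial X" by simp
 note o = sobj_obj[OF X]
 show "Idm SC X \<in> Hom SC X X"
  using id_in[OF o] id_left[OF o o sobj_map[OF X]] id_right[OF o o sobj_map[OF X]] by (simp add: is_nat_trans_def)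
next
 fix X Y Z f g assume "X \<in> Obj SC" "Y \<in> Obj SC" "Z \<in> Obj SC" "f \<in> Hom SC X Y" "g \<in> Hom SC Y Z"
 hence X: "simplicial X" and Y: "simplicial Y" and Z: "simplicial Z"
  and f: "snat X Y f" and g: "snat Y Z g" by auto
 note o = sobj_obj[OF X] sobj_obj[OF Y] sobj_obj[OF Z]
 show "g \<odot> f \<in> Hom SC X Z"
  unfolding Sim_simps mem_Collect_eq is_nat_trans_def
 proof (intro conjI ballI)
  fix n show "g n \<cdot> f n \<in> Hom C (Fo X n) (Fo Z n)" by (rule comp_in[OF o snat_in[OF f] snat_in[OF g]])
 next
  fix m n a assume "a \<in> Hom Simp_op m n"
  hence a: "a \<in> Hom Simp n m" by simp
  show "Fm Z m n a \<cdot> g m \<cdot> f m = (g n \<cdot> f n) \<cdot> Fm X m n a"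
   using assoc[OF o(1,2,3,3) snat_in[OF f] snat_in[OF g] sobj_map[OF Z a]]
    assoc[OF o(1,2,2,3) snat_in[OF f] sobj_map[OF Y a] snat_in[OF g]]
    assoc[OF o(1,1,2,3) sobj_map[OF X a] snat_in[OF f] snat_in[OF g]]
    snat_nat[OF f a] snat_nat[OF g a] by simp
 qed
next
 fix X Y f assume "X \<in> Obj SC" "Y \<in> Obj SC" "f \<in> Hom SC X Y"
 hence X: "simplicial X" and Y: "simplicial Y" and f: "snat X Y f" by auto
 show "Idm SC Y \<odot> f = f" "f \<odot> Idm SC X = f"
  using id_left[OF sobj_obj[OF X] sobj_obj[OF Y] snat_in[OF f]] id_right[OF sobj_obj[OF X] sobj_obj[OF Y] snat_in[OF f]]
  by simp_all
next
 fix X Y Z W f g h assume "X \<in> Obj SC" "Y \<in> Obj SC" "Z \<in> Obj SC" "W \<in> Obj SC"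
  "f \<in> Hom SC X Y" "g \<in> Hom SC Y Z" "h \<in> Hom SC Z W"
 thus "(h \<odot> g) \<odot> f = h \<odot> g \<odot> f"
  using assoc[OF sobj_obj sobj_obj sobj_obj sobj_obj snat_in snat_in snat_in] by simp
qed

text \<open>Inverses chosen in each degree separately are natural, because naturality of
  \<open>f\<close> can be conjugated by them.\<close>

lemma Sim_isom:
 assumes X: "simplicial X" and Y: "simplicial Y" and f: "snat X Y f"
  and iso: "!!n. is_isom C (Fo X n) (Fo Y n) (f n)"
 shows "is_isom SC X Y f"
proof -
 obtain g where g: "!!n. inverse_pair C (Fo X n) (Fo Y n) (f n) (g n)" using iso unfolding is_isom_def by metis
 hence gh: "!!n. g n \<in> Hom C (Fo Y n) (Fo X n)" "!!n. g n \<cdot> f n = Idm C (Fo X n)" "!!n. f n \<cdot> g n = Idm C (Fo Y n)"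
  by (auto simp: inverse_pair_def)
 note o = sobj_obj[OF X] and o' = sobj_obj[OF Y] and fh = snat_in[OF f]
 have "snat Y X g"
  unfolding is_nat_trans_def
 proof (intro conjI ballI gh)
  fix m n a assume "a \<in> Hom Simp_op m n"
  hence a: "a \<in> Hom Simp n m" by simp
  note Xa = sobj_map[OF X a] and Ya = sobj_map[OF Y a]
  note Xg = comp_in[OF o' o o gh(1) Xa]
  have "Fm X m n a \<cdot> g m = g n \<cdot> (f n \<cdot> (Fm X m n a \<cdot> g m))"
   using assoc[OF o' o o' o Xg fh gh(1)] gh(2) id_left[OF o' o Xg] by simp
  also have "f n \<cdot> (Fm X m n a \<cdot> g m) = Fm Y m n a"
   using assoc[OF o' o o o' gh(1) Xa fh] assoc[OF o' o o' o' gh(1) fh Ya] snat_nat[OF f a] gh(3)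
    id_right[OF o' o' Ya] by simp
  finally show "Fm X m n a \<cdot> g m = g n \<cdot> Fm Y m n a" .
 qed
 hence "inverse_pair SC X Y f g" using f gh by (simp add: inverse_pair_def)
 thus ?thesis by (auto simp: is_isom_def)
qed

lemma nth_functor: "[|set Ys \<subseteq> Obj SC; i < length Ys|] ==> simplicial (Ys ! i)"
 using subsetD[OF _ nth_mem, of Ys "Obj SC" i] by simp

context
 fixes Ys
 assumes Ys: "set Ys \<subseteq> Obj SC"
begin

lemma box_objs: "length ns = length Ys ==> set (map2 Fo Ys ns) \<subseteq> Obj C"
proof
 fix x assume "length ns = length Ys" "x \<in> set (map2 Fo Ys ns)"
 then obtain i where "i < length Ys" "x = Fo (Ys ! i) (ns ! i)" by (auto simp: in_set_zip)
 thus "x \<in> Obj C" using sobj_obj[OF nth_functor[OF Ys]] by simp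
qed

lemma box_homs:
 assumes "length ms = length Ys" "length ns = length Ys" "!!i. i < length Ys ==> bs ! i \<in> Hom Simp (ns ! i) (ms ! i)"
 shows "homs (map2 Fo Ys ms) (map2 Fo Ys ns) (map (\<lambda>i. Fm (Ys ! i) (ms ! i) (ns ! i) (bs ! i)) [0..<length Ys])"
 using assms box_objs sobj_map[OF nth_functor[OF Ys]] by (simp add: homs_def)

lemma box_functor: "msimplicial (length Ys) (box C Ys)"
 unfolding is_functor_def
proof (intro conjI ballI)
 let ?k = "length Ys"
 fix ms assume "ms \<in> pObj ?k"
 hence ms: "length ms = ?k" by simp
 show "Fo (box C Ys) ms \<in> Obj C" unfolding box_Fo by (rule tensO_obj[OF box_objs[OF ms]])
 have "map (\<lambda>i. Fm (Ys ! i) (ms ! i) (ms ! i) (map (Idm Simp_op) ms ! i)) [0..<?k] = map (Idm C) (map2 Fo Ys ms)"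
  using ms sobj_id[OF nth_functor[OF Ys]] by (intro nth_equalityI) (simp_all add: Simp_idm del: upt_Suc)
 thus "Fm (box C Ys) ms ms (Idm (pow_cat ?k Simp_op) ms) = Idm C (Fo (box C Ys) ms)"
  unfolding box_Fo box_Fm pow_simps by (simp add: tensM_id[OF box_objs[OF ms]] del: map_map)
 fix ns ss assume "ns \<in> pObj ?k" and a: "ss \<in> pHom ?k ms ns"
 hence ns: "length ns = ?k" by simp
 have s: "!!i. i < ?k ==> ss ! i \<in> Hom Simp (ns ! i) (ms ! i)" and la: "length ss = ?k" using a by auto
 note h = box_homs[OF ms ns s]
 show "Fm (box C Ys) ms ns ss \<in> Hom C (Fo (box C Ys) ms) (Fo (box C Ys) ns)"
  unfolding box_Fo box_Fm by (rule tensM_in[OF h])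
 fix ps fs assume "ps \<in> pObj ?k" and b: "fs \<in> pHom ?k ns ps"
 hence ps: "length ps = ?k" by simp
 have f: "!!i. i < ?k ==> fs ! i \<in> Hom Simp (ps ! i) (ns ! i)" and lb: "length fs = ?k" using b by auto
 note h' = box_homs[OF ns ps f]
 have eq: "map (\<lambda>i. Fm (Ys ! i) (ms ! i) (ps ! i) (map2 (Cmp Simp_op) fs ss ! i)) [0..<?k] =
   map2 (Cmp C) (map (\<lambda>i. Fm (Ys ! i) (ns ! i) (ps ! i) (fs ! i)) [0..<?k]) (map (\<lambda>i. Fm (Ys ! i) (ms ! i) (ns ! i) (ss ! i)) [0..<?k])"
  using sobj_comp[OF nth_functor[OF Ys] f s] la lb by (intro nth_equalityI) simp_all
 show "Fm (box C Ys) ms ps (fs \<cdot>\<^bsub>pow_cat ?k Simp_op\<^esub> ss) = Fm (box C Ys) ns ps fs \<cdot> Fm (box C Ys) ms ns ss"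
  unfolding box_Fm pow_simps eq by (rule tensM_comp[OF h h'])
qed

context
 fixes Ys' gs
 assumes Ys': "set Ys' \<subseteq> Obj SC" and len: "length Ys' = length Ys" "length gs = length Ys"
  and gs: "!!i. i < length Ys ==> gs ! i \<in> Hom SC (Ys ! i) (Ys' ! i)"
begin

lemma box_map_homs:
 assumes "length ns = length Ys"
 shows "homs (map2 Fo Ys ns) (map2 Fo Ys' ns) (map2 (\<lambda>g n. g n) gs ns)"
proof -
 have "set (map2 Fo Ys' ns) \<subseteq> Obj C"
 proof
  fix x assume "x \<in> set (map2 Fo Ys' ns)"
  then obtain i where "i < length Ys'" "x = Fo (Ys' ! i) (ns ! i)" using assms len by (auto simp: in_set_zip)
  thus "x \<in> Obj C" using sobj_obj[OF nth_functor[OF Ys']] by simp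
 qed
 thus ?thesis using assms len box_objs gs snat_in by (simp add: homs_def)
qed

lemma box_map_nat: "mnat (length Ys) (box C Ys) (box C Ys') (box_map C gs)"
 unfolding is_nat_trans_def
proof (intro conjI ballI)
 let ?k = "length Ys"
 fix ms assume "ms \<in> pObj ?k"
 hence ms: "length ms = ?k" by simp
 show "box_map C gs ms \<in> Hom C (Fo (box C Ys) ms) (Fo (box C Ys') ms)"
  unfolding box_map_def box_Fo by (rule tensM_in[OF box_map_homs[OF ms]])
 fix ns bs assume "ns \<in> pObj ?k" and a: "bs \<in> pHom ?k ms ns"
 hence ns: "length ns = ?k" by simp
 have b: "!!i. i < ?k ==> bs ! i \<in> Hom Simp (ns ! i) (ms ! i)" using a by auto
 have fY': "simplicial (Ys' ! i)" if "i < ?k" for i using nth_functor[OF Ys'] that len by simp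
 have h': "homs (map2 Fo Ys' ms) (map2 Fo Ys' ns) (map (\<lambda>i. Fm (Ys' ! i) (ms ! i) (ns ! i) (bs ! i)) [0..<length Ys'])"
  using box_map_homs[OF ms] box_map_homs[OF ns] ms ns len b sobj_map[OF fY'] by (simp add: homs_def)
 have "map2 (Cmp C) (map (\<lambda>i. Fm (Ys' ! i) (ms ! i) (ns ! i) (bs ! i)) [0..<length Ys']) (map2 (\<lambda>g n. g n) gs ms) =
   map2 (Cmp C) (map2 (\<lambda>g n. g n) gs ns) (map (\<lambda>i. Fm (Ys ! i) (ms ! i) (ns ! i) (bs ! i)) [0..<?k])"
  using ms ns len gs b snat_nat by (intro nth_equalityI) auto
 thus "Fm (box C Ys') ms ns bs \<cdot> box_map C gs ms = box_map C gs ns \<cdot> Fm (box C Ys) ms ns bs"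
  unfolding box_Fm box_map_def
  using tensM_comp[OF box_map_homs[OF ms] h'] tensM_comp[OF box_homs[OF ms ns b] box_map_homs[OF ns]] by simp
qed

lemma Sim_tensM_nat: "snat (tensO SC Ys) (tensO SC Ys') (tensM SC gs)"
 using diag_nat[OF box_map_nat] box_diag[of C Ys] box_diag[of C Ys'] len
 by (simp add: box_map_def map2_replicate Sim_tensM[abs_def] cong: map_cong)

end

end

lemma tensO_sobj: "set Xs \<subseteq> Obj SC ==> simplicial (tensO SC Xs)"
 using diag_functor[OF box_functor] by (simp add: box_diag)

lemma Sim_flat_nat:
 assumes "set (concat Zss) \<subseteq> Obj SC"
 shows "snat (tensO SC (map (tensO SC) Zss)) (tensO SC (concat Zss)) (tens_flat SC Zss)"
 unfolding is_nat_trans_def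
proof (intro conjI ballI)
 note S = Sim_tensO_Fo Sim_tensO_Fm Sim_tens_flat
 have X: "simplicial X" if "i < length Zss" "X \<in> set (Zss ! i)" for i X using assms that by force
 have o: "map (\<lambda>Zs. tensO C (map (\<lambda>X. Fo X n) Zs)) Zss = map (tensO C) (map (map (\<lambda>X. Fo X n)) Zss)"
  "map (\<lambda>X. Fo X n) (concat Zss) = concat (map (map (\<lambda>X. Fo X n)) Zss)" for n by (simp_all add: map_concat)
 fix n
 have "set (concat (map (map (\<lambda>X. Fo X n)) Zss)) \<subseteq> Obj C" using assms sobj_obj by fastforce
 from tens_flat_in[OF this] show "tens_flat SC Zss n \<in> Hom C (Fo (tensO SC (map (tensO SC) Zss)) n) (Fo (tensO SC (concat Zss)) n)"
  by (simp add: S o_def map_concat)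
 fix m a assume "a \<in> Hom Simp_op n m"
 hence "homss (map (map (\<lambda>X. Fo X n)) Zss) (map (map (\<lambda>X. Fo X m)) Zss) (map (map (\<lambda>X. Fm X n m a)) Zss)"
  using sobj_obj[OF X] sobj_map[OF X, of _ _ a m n] by (auto simp: homss_def homs_def)
 from tens_flat_nat[OF this]
 show "Fm (tensO SC (concat Zss)) n m a \<cdot> tens_flat SC Zss n = tens_flat SC Zss m \<cdot> Fm (tensO SC (map (tensO SC) Zss)) n m a"
  by (simp add: S o_def map_concat)
qed

end

section \<open>Projections along arbitrary sequences\<close>

lemma join_props:
 assumes "length ss = length ns" "!!i. i < length ns ==> set (ss ! i) \<subseteq> {..ns ! i}"
 shows "length (join ns ss) = sum_list (map length ss)" "set (join ns ss) \<subseteq> {..<sum_list (map Suc ns)}"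
proof -
 have "length (join ns ss) = sum_list (map length ss) \<and> set (join ns ss) \<subseteq> {..<sum_list (map Suc ns)}"
  using assms
 proof (induction ss ns rule: list_induct2)
  case (Cons s ss n ns)
  have "length (join ns ss) = sum_list (map length ss) \<and> set (join ns ss) \<subseteq> {..<sum_list (map Suc ns)}"
   using Cons.prems[of "Suc _"] by (intro Cons.IH) auto
  moreover have "set s \<subseteq> {..n}" using Cons.prems[of 0] by simp
  ultimately show ?case by auto
 qed simp
 thus "length (join ns ss) = sum_list (map length ss)" "set (join ns ss) \<subseteq> {..<sum_list (map Suc ns)}" by auto
qed

text \<open>One block of a join occupies one segment, shifted by the total size of the blocks before
  it; this is the situation of \<open>exchange_rel_context\<close>.\<close>

lemma join_update:
 assumes "length ss = length ns" "j < length ns"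
 shows "\<exists>xs ys. \<forall>s. join ns (ss[j := s]) = xs @ map ((+) (sum_list (map Suc (take j ns)))) s @ ys"
 using assms
proof (induction ss ns arbitrary: j rule: list_induct2)
 case (Cons t ss n ns)
 show ?case
 proof (cases j)
  case 0
  have "\<forall>s. join (n # ns) ((t # ss)[j := s]) = [] @ map ((+) (sum_list (map Suc (take j (n # ns))))) s @ map ((+) (Suc n)) (join ns ss)"
   using 0 by (simp add: map_idI)
  thus ?thesis by blast
 next
  case (Suc i)
  then obtain xs ys where "\<forall>s. join ns (ss[i := s]) = xs @ map ((+) (sum_list (map Suc (take i ns)))) s @ ys"
   using Cons.IH[of i] Cons.prems by auto
  hence "\<forall>s. join (n # ns) ((t # ss)[j := s]) =
    (t @ map ((+) (Suc n)) xs) @ map ((+) (sum_list (map Suc (take j (n # ns))))) s @ map ((+) (Suc n)) ys"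
   using Suc by (simp add: add.assoc)
  thus ?thesis by blast
 qed
qed simp

lemma fold_map_length: "length (fold_map k n) = sum_list (map Suc (rep k n))"
 by (induction k) (simp_all add: fold_map_def del: upt_Suc)

lemma fold_map_values: "set (fold_map k n) \<subseteq> {..n}"
 by (auto simp: fold_map_def simp del: upt_Suc)

text \<open>The fold map is the identity on every copy of \<open>[n]\<close>, so precomposing it
  with maps into the single copies lists these maps one after another.\<close>

lemma fold_map_join:
 assumes "length ts = k" "!!i. i < k ==> set (ts ! i) \<subseteq> {..n}"
 shows "map ((!) (fold_map k n)) (join (rep k n) ts) = concat ts"
proof -
 let ?b = "rep k [0..<Suc n]"
 have "concat (brestr ?b ts) = map ((!) (concat ?b)) (join (dims ?b) ts)"
 proof (rule concat_brestr)
  show "[] \<notin> set ?b" by simp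
  show "set (ts ! i) \<subseteq> {..<length (?b ! i)}" if "i < length ?b" for i
   using assms(2)[of i] that by (auto simp: less_Suc_eq_le simp del: upt_Suc)
 qed (use assms in simp)
 moreover have "brestr ?b ts = ts"
 proof (rule nth_equalityI)
  fix i assume "i < length (brestr ?b ts)"
  hence i: "i < k" using assms by (simp add: brestr_def)
  hence "set (ts ! i) \<subseteq> {..<Suc n}" using assms(2)[OF i] by (auto simp: less_Suc_eq_le)
  thus "brestr ?b ts ! i = ts ! i"
   using i assms(1) map_nth_upt[of "ts ! i" "Suc n"] by (simp add: brestr_def del: upt_Suc)
 qed (use assms in \<open>simp add: brestr_def\<close>)
 moreover have "dims ?b = rep k n" by (simp add: dims_def map_replicate_const del: upt_Suc)
 ultimately show ?thesis by (simp add: fold_map_def del: upt_Suc)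
qed

context monoidal_category
begin

lemma homs_take: "homs xs ys fs ==> homs (take j xs) (take j ys) (take j fs)"
 by (auto simp: homs_def dest: in_set_takeD)

lemma homs_drop: "homs xs ys fs ==> homs (drop j xs) (drop j ys) (drop j fs)"
 by (auto simp: homs_def dest: in_set_dropD)

end

context abelian_tensor_category
begin

text \<open>Splitting the list of factors around position \<open>j\<close> turns each sum into a sum
  in one factor, where \<open>tensM_add\<close> applies.\<close>

lemma tensM_exchange:
 assumes h: "homs xs ys fs" and j: "j < length xs" and F: "exchange_rel L n F"
  and Fin: "!!b. [|length b = L; set b \<subseteq> {..n}|] ==> F b \<in> Hom C (xs ! j) (ys ! j)"
 shows "exchange_rel L n (\<lambda>b. tensM C (fs[j := F b]))"
proof -
 have o: "xs ! j \<in> Obj C" "ys ! j \<in> Obj C" using h j nth_mem[of j xs] nth_mem[of j ys] by (auto simp: homs_def)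
 have j': "j < length fs" using h j by (simp add: homs_def)
 have eq: "tensM C (fs[j := x]) = tensM C (take j fs @ x # drop (Suc j) fs)" for x
  using j' by (simp add: upd_conv_take_nth_drop)
 show ?thesis
  unfolding exchange_rel_def eq
 proof clarify
  fix b i l assume *: "set b \<subseteq> {..n}" "i < length b" "l < length b" "i \<noteq> l" "L = length b"
  let ?s = "b[i := b ! l, l := b ! i]"
  note add = tensM_add[OF homs_take[OF h] homs_drop[OF h] o, of _ _ j "Suc j", symmetric]
  have "F b \<in> Hom C (xs ! j) (ys ! j)" "F ?s \<in> Hom C (xs ! j) (ys ! j)"
   "F (b[l := b ! i]) \<in> Hom C (xs ! j) (ys ! j)" "F (b[i := b ! l]) \<in> Hom C (xs ! j) (ys ! j)"
   using * list_update_values[of b n i l] list_update_values(1)[of b n l i] by (auto intro!: Fin)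
  thus "Plus C (tensM C (take j fs @ F b # drop (Suc j) fs)) (tensM C (take j fs @ F ?s # drop (Suc j) fs)) =
    Plus C (tensM C (take j fs @ F (b[l := b ! i]) # drop (Suc j) fs)) (tensM C (take j fs @ F (b[i := b ! l]) # drop (Suc j) fs))"
   using add exchange_relD[OF F _ *(1), of i l] * by simp
 qed
qed

text \<open>Extends the projections of the right adjoint from monotone sequences to arbitrary ones.
  The Eilenberg-Zilber map is the member at the fold map. For \<open>k = 0\<close> the sequence is a
  dummy and the projection an identity.\<close>

definition gproj :: "nat => ('o, 'm) multi_sobj => nat => nat list => nat list => 'm" where
 "gproj k Z m ns t = (if k = 0 then Idm C (Fo Z []) else dec_counit C k Z ns \<cdot> gamma (dec_obj C k Z) m (conc ns) t)"

lemma Ez_eq_gproj: "Ez C k Z n = gproj k Z n (rep k n) (fold_map k n)"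
 by (simp add: Ez_def gproj_def gam_eq_gamma)

context
 fixes k Z
 assumes Z: "msimplicial k Z"
begin

lemma gproj_length: "[|0 < k; length ns = k; length t = sum_list (map Suc ns)|] ==> length t = Suc (conc ns)"
 by (subst Suc_conc) auto

lemma gproj_in:
 assumes "length ns = k" "length t = sum_list (map Suc ns)" "set t \<subseteq> {..m}"
 shows "gproj k Z m ns t \<in> Hom C (Fo (dec_obj C k Z) m) (Fo Z ns)"
proof (cases "k = 0")
 case True
 thus ?thesis using assms id_in[OF mobj[OF Z, of "[]"]] by (simp add: gproj_def dec_zero)
next
 case False
 hence k: "0 < k" by simp
 note o = sobj_obj[OF dec_sobj[OF Z]]
 have "dec_counit C k Z ns \<cdot> gamma (dec_obj C k Z) m (conc ns) t \<in> Hom C (Fo (dec_obj C k Z) m) (Fo Z ns)"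
  by (rule comp_in[OF o o mobj[OF Z assms(1)] gamma_in[OF dec_sobj[OF Z] gproj_length[OF k assms(1,2)] assms(3)]
     dec_counit_in[OF Z k assms(1)]])
 thus ?thesis using False by (simp add: gproj_def)
qed

lemma gproj_exchange:
 assumes "length ns = k" "L = sum_list (map Suc ns)"
 shows "exchange_rel L m (gproj k Z m ns)"
proof (cases "k = 0")
 case True
 thus ?thesis using assms by (simp add: exchange_rel_def)
next
 case False
 hence k: "0 < k" by simp
 hence L: "L = Suc (conc ns)" using assms by (subst Suc_conc) auto
 note D = dec_sobj[OF Z]
 show ?thesis
  using exchange_rel_comp_left[OF sobj_obj[OF D] sobj_obj[OF D] mobj[OF Z assms(1)] gamma_exchange[OF D] gamma_in[OF D] dec_counit_in[OF Z k assms(1)]]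
  unfolding L gproj_def using False by simp
qed

lemma gproj_block: "bs \<in> blocks k m ==> gproj k Z m (dims bs) (concat bs) = bproj k Z m bs"
 using gamma_mono[OF dec_sobj[OF Z] concat_hom]
 by (cases "k = 0") (simp_all add: gproj_def bproj_0 bproj_eq[OF Z])

text \<open>Naturality of the counit moves the restriction to the left of \<gamma>, and
  \<open>gamma_precomp\<close> absorbs it into the sequence.\<close>

lemma gproj_restrict:
 assumes ns: "length ns = k" "length t = sum_list (map Suc ns)" "set t \<subseteq> {..m}" and ms: "length ms = k"
  and b: "bs \<in> pHom k ns ms"
 shows "Fm Z ns ms bs \<cdot> gproj k Z m ns t = gproj k Z m ms (map ((!) t) (join ns bs))"
proof (cases "k = 0")
 case True
 thus ?thesis
  using assms mid[OF Z, of "[]"] mobj[OF Z, of "[]"] by (simp add: gproj_def id_left id_in)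
next
 case False
 hence k: "0 < k" by simp
 note D = dec_sobj[OF Z] and o = sobj_obj[OF dec_sobj[OF Z]] and l = gproj_length[OF k ns(1,2)]
 note j = brestr_id_blocks(1)[OF b ns(1) ms k]
 have "Fm Z ns ms bs \<cdot> (dec_counit C k Z ns \<cdot> gamma (dec_obj C k Z) m (conc ns) t) =
   (Fm Z ns ms bs \<cdot> dec_counit C k Z ns) \<cdot> gamma (dec_obj C k Z) m (conc ns) t"
  by (rule assoc[OF o o mobj[OF Z ns(1)] mobj[OF Z ms] gamma_in[OF D l ns(3)] dec_counit_in[OF Z k ns(1)]
     mmap[OF Z ns(1) ms b], symmetric])
 also have "\<dots> = dec_counit C k Z ms \<cdot> (Fm (dec_obj C k Z) (conc ns) (conc ms) (join ns bs) \<cdot> gamma (dec_obj C k Z) m (conc ns) t)"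
  unfolding dec_counit_nat[OF Z k ns(1) ms b]
  by (rule assoc[OF o o o mobj[OF Z ms] gamma_in[OF D l ns(3)] sobj_map[OF D j] dec_counit_in[OF Z k ms]])
 also have "Fm (dec_obj C k Z) (conc ns) (conc ms) (join ns bs) \<cdot> gamma (dec_obj C k Z) m (conc ns) t =
   gamma (dec_obj C k Z) m (conc ms) (map ((!) t) (join ns bs))"
  by (rule gamma_precomp[OF D l ns(3) j, symmetric])
 finally show ?thesis using False by (simp add: gproj_def)
qed

lemma gproj_map:
 assumes ns: "length ns = k" "length t = sum_list (map Suc ns)" "set t \<subseteq> {..n}" and f: "f \<in> Hom Simp n m"
 shows "gproj k Z n ns t \<cdot> Fm (dec_obj C k Z) m n f = gproj k Z m ns (map ((!) f) t)"
proof (cases "k = 0")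
 case True
 thus ?thesis
  using mid[OF Z, of "[]"] mobj[OF Z, of "[]"] by (simp add: gproj_def dec_zero id_left id_in)
next
 case False
 hence k: "0 < k" by simp
 note D = dec_sobj[OF Z] and o = sobj_obj[OF dec_sobj[OF Z]] and l = gproj_length[OF k ns(1,2)]
 show ?thesis
  using assoc[OF o o o mobj[OF Z ns(1)] sobj_map[OF D f] gamma_in[OF D l ns(3)] dec_counit_in[OF Z k ns(1)]]
   gamma_postcomp[OF D f l ns(3)] False by (simp add: gproj_def)
qed

text \<open>Both ways around the square are the projection along \<open>k\<close> consecutive copies
  of the monotone sequence \<open>a\<close>.\<close>

lemma Ez_nat: "snat (dec_obj C k Z) (restr Z (diag k)) (Ez C k Z)"
 unfolding is_nat_trans_def
proof (intro conjI ballI)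
 note v = fold_map_length
 fix n
 show "Ez C k Z n \<in> Hom C (Fo (dec_obj C k Z) n) (Fo (restr Z (diag k)) n)"
  using gproj_in[OF _ v fold_map_values] by (simp add: Ez_eq_gproj restr_def diag_def)
 fix m a assume "a \<in> Hom Simp_op n m"
 hence a: "a \<in> Hom Simp m n" by simp
 have r: "rep k a \<in> pHom k (rep k n) (rep k m)" using a by simp
 have "map ((!) a) [0..<Suc m] = a" using a by (intro map_nth_upt') (simp add: Simp_hom)
 hence "map ((!) a) (fold_map k m) = concat (rep k a)" by (simp add: fold_map_def map_concat del: upt_Suc)
 moreover have "map ((!) (fold_map k n)) (join (rep k n) (rep k a)) = concat (rep k a)"
  using a by (intro fold_map_join) (auto simp: Simp_hom)
 ultimately show "Fm (restr Z (diag k)) n m a \<cdot> Ez C k Z n = Ez C k Z m \<cdot> Fm (dec_obj C k Z) n m a"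
  using gproj_restrict[OF _ v fold_map_values _ r] gproj_map[OF _ v fold_map_values a]
  by (simp add: Ez_eq_gproj restr_def diag_def)
qed

text \<open>Restricting the fold map to consecutive blocks leaves a monotone sequence, so all signs
  disappear and an ordinary projection remains.\<close>

lemma bproj_Ez:
 assumes b: "bs \<in> blocks k m"
 shows "Fm Z (rep k m) (dims bs) bs \<cdot> Ez C k Z m = bproj k Z m bs"
proof -
 have "map ((!) (fold_map k m)) (join (rep k m) bs) = concat bs"
  using b blocksD(3)[OF b] by (intro fold_map_join) (auto simp: blocks_def)
 thus ?thesis
  using gproj_restrict[OF _ fold_map_length fold_map_values dims_len[OF b] blocks_hom[OF b]] gproj_block[OF b]
  by (simp add: Ez_eq_gproj)
qed

text \<open>Tested on projections: the one after AW restricts to blocks, and on blocks EZ is again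
  that projection.\<close>

lemma Aw_Ez: "Aw C k Z n \<cdot> Ez C k Z n = Idm C (Fo (dec_obj C k Z) n)"
proof -
 note D = dec_sobj[OF Z] and X = diag_functor[OF Z]
 note o = sobj_obj[OF D] and o' = sobj_obj[OF X]
 note aw = Aw_nat[OF Z] and ez = Ez_nat
 note v = fold_map_length
 interpret S: category SC by (rule Sim_category)
 have "Aw C k Z \<odot> Ez C k Z \<in> Hom SC (dec_obj C k Z) (dec_obj C k Z)"
  using D X aw ez by (intro S.comp_in[of _ "restr Z (diag k)"]) auto
 moreover have "Idm SC (dec_obj C k Z) \<in> Hom SC (dec_obj C k Z) (dec_obj C k Z)"
  using D by (intro S.id_in) auto
 ultimately have "Aw C k Z \<odot> Ez C k Z = Idm SC (dec_obj C k Z)"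
 proof (intro dec_ext[OF Z D])
  fix m bs assume b: "bs \<in> blocks k m"
  note d = dims_len[OF b]
  show "bproj k Z m bs \<cdot> (Aw C k Z \<odot> Ez C k Z) m = bproj k Z m bs \<cdot> Idm SC (dec_obj C k Z) m"
   using assoc[OF o o' o mobj[OF Z d] snat_in[OF ez] snat_in[OF aw] bproj_in[OF Z b]]
    bproj_Aw[OF Z b] bproj_Ez[OF b] id_right[OF o mobj[OF Z d] bproj_in[OF Z b]] by simp
 qed simp_all
 thus ?thesis by (simp add: fun_eq_iff)
qed

lemma EzAw_nat: "snat (restr Z (diag k)) (restr Z (diag k)) (EzAw C k Z)"
proof -
 interpret S: category SC by (rule Sim_category)
 have "EzAw C k Z \<in> Hom SC (restr Z (diag k)) (restr Z (diag k))"
  unfolding EzAw_def using dec_sobj[OF Z] diag_functor[OF Z] Aw_nat[OF Z] Ez_nat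
  by (intro S.comp_in[of _ "dec_obj C k Z"]) auto
 thus ?thesis by simp
qed

end

text \<open>Combines naturality of \<gamma> along the induced morphism of right adjoints with the
  square of counits; at the fold map it is naturality of EZ.\<close>

lemma gproj_dec_map:
 assumes Z: "msimplicial k Z" and Z': "msimplicial k Z'"
  and q: "mnat k Z Z' q"
  and ns: "length ns = k" "length t = sum_list (map Suc ns)" "set t \<subseteq> {..m}"
 shows "gproj k Z' m ns t \<cdot> dec_map C k Z Z' q m = q ns \<cdot> gproj k Z m ns t"
proof (cases "k = 0")
 case True
 hence "q [] \<in> Hom C (Fo Z []) (Fo Z' [])" using q by (simp add: is_nat_trans_def)
 thus ?thesis
  using True ns id_left[OF mobj[OF Z, of "[]"] mobj[OF Z', of "[]"]] id_right[OF mobj[OF Z, of "[]"] mobj[OF Z', of "[]"]]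
  by (simp add: gproj_def dec_map_def)
next
 case False
 hence k: "0 < k" by simp
 note D = dec_sobj[OF Z] and D' = dec_sobj[OF Z'] and l = gproj_length[OF Z k ns(1,2)] and f = dec_map_nat[OF Z Z' q]
 note o = sobj_obj[OF D] and o' = sobj_obj[OF D'] and z = mobj[OF Z ns(1)] and z' = mobj[OF Z' ns(1)]
 have qin: "q ns \<in> Hom C (Fo Z ns) (Fo Z' ns)" using q ns by (simp add: is_nat_trans_def)
 have "dec_counit C k Z' ns \<cdot> dec_map C k Z Z' q (conc ns) = q ns \<cdot> dec_counit C k Z ns"
  using bproj_dec_map[OF Z Z' q id_blocks_tuple(1)[OF ns(1) k]] bproj_id_blocks[OF Z k ns(1)]
   bproj_id_blocks[OF Z' k ns(1)] by (simp add: dims_id_blocks)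
 thus ?thesis
  using assoc[OF o o' o' z' snat_in[OF f] gamma_in[OF D' l ns(3)] dec_counit_in[OF Z' k ns(1)]]
   gamma_natural[OF D D' f l ns(3)]
   assoc[OF o o o' z' gamma_in[OF D l ns(3)] snat_in[OF f] dec_counit_in[OF Z' k ns(1)]]
   assoc[OF o o z z' gamma_in[OF D l ns(3)] dec_counit_in[OF Z k ns(1)] qin] False
  by (simp add: gproj_def)
qed

lemma Aw_natural:
 assumes Z: "msimplicial k Z" and Z': "msimplicial k Z'"
  and q: "mnat k Z Z' q"
 shows "dec_map C k Z Z' q n \<cdot> Aw C k Z n = Aw C k Z' n \<cdot> q (rep k n)"
proof -
 note D = dec_sobj[OF Z] and D' = dec_sobj[OF Z'] and f = dec_map_nat[OF Z Z' q] and X = diag_functor[OF Z] and X' = diag_functor[OF Z']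
 note aw = Aw_nat[OF Z] and aw' = Aw_nat[OF Z'] and qd = diag_nat[OF q]
 note o = sobj_obj[OF X] and oD = sobj_obj[OF D] and o' = sobj_obj[OF X'] and oD' = sobj_obj[OF D']
 interpret S: category SC by (rule Sim_category)
 have 1: "dec_map C k Z Z' q \<odot> Aw C k Z \<in> Hom SC (restr Z (diag k)) (dec_obj C k Z')"
  using X D D' aw f by (intro S.comp_in[of _ "dec_obj C k Z"]) auto
 have 2: "Aw C k Z' \<odot> (\<lambda>n. q (rep k n)) \<in> Hom SC (restr Z (diag k)) (dec_obj C k Z')"
  using X X' D' aw' qd by (intro S.comp_in[of _ "restr Z' (diag k)"]) auto
 have "dec_map C k Z Z' q \<odot> Aw C k Z = Aw C k Z' \<odot> (\<lambda>n. q (rep k n))"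
 proof (rule dec_ext[OF Z' X])
  fix m bs assume b: "bs \<in> blocks k m"
  note d = dims_len[OF b] and h = blocks_hom[OF b]
  have qin: "q (dims bs) \<in> Hom C (Fo Z (dims bs)) (Fo Z' (dims bs))" using q d by (simp add: is_nat_trans_def)
  have nat: "Fm Z' (rep k m) (dims bs) bs \<cdot> q (rep k m) = q (dims bs) \<cdot> Fm Z (rep k m) (dims bs) bs"
   using q d h by (simp add: is_nat_trans_def)
  show "bproj k Z' m bs \<cdot> (dec_map C k Z Z' q \<odot> Aw C k Z) m =
    bproj k Z' m bs \<cdot> (Aw C k Z' \<odot> (\<lambda>n. q (rep k n))) m"
   using assoc[OF o oD oD' mobj[OF Z' d] snat_in[OF aw] snat_in[OF f] bproj_in[OF Z' b]]
    bproj_dec_map[OF Z Z' q b]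
    assoc[OF o oD mobj[OF Z d] mobj[OF Z' d] snat_in[OF aw] bproj_in[OF Z b] qin]
    bproj_Aw[OF Z b] nat bproj_Aw[OF Z' b]
    assoc[OF o o' oD' mobj[OF Z' d] snat_in[OF qd] snat_in[OF aw'] bproj_in[OF Z' b]]
   by simp
 qed (use 1 2 in simp_all)
 thus ?thesis by (simp add: fun_eq_iff)
qed

lemma Ez_natural:
 assumes "msimplicial k Z" "msimplicial k Z'" "mnat k Z Z' q"
 shows "Ez C k Z' n \<cdot> dec_map C k Z Z' q n = q (rep k n) \<cdot> Ez C k Z n"
 unfolding Ez_eq_gproj
 by (rule gproj_dec_map[OF assms]) (simp_all only: fold_map_length fold_map_values length_replicate)

lemma EzAw_natural:
 assumes Z: "msimplicial k Z" and Z': "msimplicial k Z'"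
  and q: "mnat k Z Z' q"
 shows "q (rep k n) \<cdot> EzAw C k Z n = EzAw C k Z' n \<cdot> q (rep k n)"
proof -
 note D = dec_sobj[OF Z] and D' = dec_sobj[OF Z'] and f = dec_map_nat[OF Z Z' q] and X = diag_functor[OF Z] and X' = diag_functor[OF Z']
 note aw = snat_in[OF Aw_nat[OF Z], of n] and aw' = snat_in[OF Aw_nat[OF Z'], of n] and qd = snat_in[OF diag_nat[OF q], of n]
  and ez = snat_in[OF Ez_nat[OF Z], of n] and ez' = snat_in[OF Ez_nat[OF Z'], of n] and fn = snat_in[OF f, of n]
 note o = sobj_obj[OF X, of n] and oD = sobj_obj[OF D, of n] and o' = sobj_obj[OF X', of n] and oD' = sobj_obj[OF D', of n]
 show ?thesis
  using assoc[OF o oD o o' aw ez qd] Ez_natural[OF Z Z' q, of n] assoc[OF o oD oD' o' aw fn ez']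
   Aw_natural[OF Z Z' q, of n] assoc[OF o o' oD' o' qd aw' ez'] by (simp add: EzAw_def)
qed

text \<open>Both sides satisfy the exchange relation in every \<open>ss ! i\<close>, so that it suffices to treat monotone
 sequences, where this is naturality of the counit.\<close>

lemma gproj_gamma:
 assumes Ys: "set Ys \<subseteq> Obj SC" and k: "k = length Ys"
  and ns: "length ns = k" "length t = sum_list (map Suc ns)" "set t \<subseteq> {..x}" and ms: "length ms = k"
  and s: "length ss = k" "!!i. i < k ==> length (ss ! i) = Suc (ms ! i) \<and> set (ss ! i) \<subseteq> {..ns ! i}"
 shows "tensM C (map (\<lambda>i. gamma (Ys ! i) (ns ! i) (ms ! i) (ss ! i)) [0..<k]) \<cdot> gproj k (box C Ys) x ns t =
  gproj k (box C Ys) x ms (map ((!) t) (join ns ss))"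
proof -
 let ?Z = "box C Ys" and ?D = "dec_obj C k (box C Ys)"
 have Z: "msimplicial k ?Z" using box_functor[OF Ys] k by simp
 note Y = nth_functor[OF Ys]
 note D = dec_sobj[OF Z] and o = sobj_obj[OF dec_sobj[OF Z]]
 define G where "G = (\<lambda>ss. map (\<lambda>i. gamma (Ys ! i) (ns ! i) (ms ! i) (ss ! i)) [0..<k])"
 have gin: "gproj k ?Z x ns t \<in> Hom C (Fo ?D x) (tensO C (map2 Fo Ys ns))"
  using gproj_in[OF Z ns] by (simp add: box_Fo)
 have OY: "tensO C (map2 Fo Ys ns) \<in> Obj C" "tensO C (map2 Fo Ys ms) \<in> Obj C"
  using tensO_obj[OF box_objs[OF Ys]] ns ms k by simp_all
 have hG: "homs (map2 Fo Ys ns) (map2 Fo Ys ms) (G ss)"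
  if "length ss = k" "!!i. i < k ==> length (ss ! i) = Suc (ms ! i) \<and> set (ss ! i) \<subseteq> {..ns ! i}" for ss
  using that ns ms k box_objs[OF Ys] gamma_in[OF Y] by (simp add: homs_def G_def)
 have jv: "length (map ((!) t) (join ns ss)) = sum_list (map Suc ms)" "set (map ((!) t) (join ns ss)) \<subseteq> {..x}"
  if "length ss = k" "!!i. i < k ==> length (ss ! i) = Suc (ms ! i) \<and> set (ss ! i) \<subseteq> {..ns ! i}" for ss
 proof -
  have "map length ss = map Suc ms" using that ms by (intro nth_equalityI) auto
  thus "length (map ((!) t) (join ns ss)) = sum_list (map Suc ms)"
   using join_props(1)[of ss ns] that ns(1) by simp
  have "set (join ns ss) \<subseteq> {..<length t}" using join_props(2)[of ss ns] that ns by simp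
  from set_map_nth[OF this] show "set (map ((!) t) (join ns ss)) \<subseteq> {..x}" using ns(3) by blast
 qed
 \<comment> \<open>The first \<open>j\<close> sequences are arbitrary and the others monotone, so
   that one tensor factor is freed at a time.\<close>
 have "tensM C (G ss) \<cdot> gproj k ?Z x ns t = gproj k ?Z x ms (map ((!) t) (join ns ss))"
  if "j \<le> k" "length ss = k" "!!i. i < k ==> length (ss ! i) = Suc (ms ! i) \<and> set (ss ! i) \<subseteq> {..ns ! i}"
   "!!i. [|j \<le> i; i < k|] ==> sorted (ss ! i)" for j ss
  using that
 proof (induction j arbitrary: ss)
  case 0
  have h: "!!i. i < k ==> ss ! i \<in> Hom Simp (ms ! i) (ns ! i)" using 0 by (simp add: Simp_hom)
  hence "ss \<in> pHom k ns ms" using 0(2) by simp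
  moreover have "tensM C (G ss) = Fm ?Z ns ms ss"
   unfolding box_Fm G_def k[symmetric] using gamma_mono[OF Y] h k by (intro arg_cong[where f = "tensM C"] map_cong) auto
  ultimately show ?case using gproj_restrict[OF Z ns ms] by simp
 next
  case (Suc j)
  hence j: "j < k" by simp
  \<comment> \<open>Isolates the segment that the freed sequence occupies on the right hand
    side.\<close>
  obtain xs ys where xy: "!!s. join ns (ss[j := s]) = xs @ map ((+) (sum_list (map Suc (take j ns)))) s @ ys"
   using join_update[of ss ns j] Suc.prems(2) ns(1) j by auto
  let ?f = "\<lambda>y. t ! (sum_list (map Suc (take j ns)) + y)"
  have mxy: "map ((!) t) (join ns (ss[j := s])) = map ((!) t) xs @ map ?f s @ map ((!) t) ys" for s
   by (simp add: xy)
  have G_upd: "G (ss[j := s]) = (G ss)[j := gamma (Ys ! j) (ns ! j) (ms ! j) s]" for s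
   using j Suc.prems(2) by (intro nth_equalityI) (auto simp: G_def nth_list_update)
  have upd: "length (ss[j := s]) = k" "!!i. i < k ==> length (ss[j := s] ! i) = Suc (ms ! i) \<and> set (ss[j := s] ! i) \<subseteq> {..ns ! i}"
   if "length s = Suc (ms ! j)" "set s \<subseteq> {..ns ! j}" for s
   using that Suc.prems(2,3) j by (auto simp: nth_list_update)
  let ?L = "Suc (ms ! j)" and ?n = "ns ! j"
  let ?F = "\<lambda>s. tensM C (G (ss[j := s])) \<cdot> gproj k ?Z x ns t"
  let ?H = "\<lambda>s. gproj k ?Z x ms (map ((!) t) (join ns (ss[j := s])))"
  have "?F (ss ! j) = ?H (ss ! j)"
  proof (rule exchange_rel_unique[OF o[of x] OY(2), of ?L ?n ?F ?H])
   show "exchange_rel ?L ?n (\<lambda>s. tensM C (G (ss[j := s])) \<cdot> gproj k ?Z x ns t)"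
   proof (rule exchange_rel_comp_right[OF o OY])
    show "exchange_rel ?L ?n (\<lambda>s. tensM C (G (ss[j := s])))"
     unfolding G_upd
    proof (rule tensM_exchange[OF hG[OF Suc.prems(2,3)]])
     show "j < length (map2 Fo Ys ns)" using j k ns by simp
     show "exchange_rel ?L ?n (gamma (Ys ! j) (ns ! j) (ms ! j))" using gamma_exchange[OF Y] j k by simp
     fix s :: "nat list" assume "length s = ?L" "set s \<subseteq> {..?n}"
     thus "gamma (Ys ! j) (ns ! j) (ms ! j) s \<in> Hom C (map2 Fo Ys ns ! j) (map2 Fo Ys ms ! j)"
      using gamma_in[OF Y, of j] j k ns ms by simp
    qed
    fix s :: "nat list" assume "length s = ?L" "set s \<subseteq> {..?n}"
    thus "tensM C (G (ss[j := s])) \<in> Hom C (tensO C (map2 Fo Ys ns)) (tensO C (map2 Fo Ys ms))"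
     by (intro tensM_in[OF hG] upd)
   qed (rule gin)
   show "exchange_rel ?L ?n (\<lambda>s. gproj k ?Z x ms (map ((!) t) (join ns (ss[j := s]))))"
    unfolding mxy
   proof (rule exchange_rel_context[OF gproj_exchange[OF Z ms refl]])
    have id: "ss[j := ss ! j] = ss" by simp
    have "length (map ((!) t) xs @ map ?f (ss ! j) @ map ((!) t) ys) = sum_list (map Suc ms)"
     "set (map ((!) t) xs @ map ?f (ss ! j) @ map ((!) t) ys) \<subseteq> {..x}"
     unfolding mxy[symmetric] id by (rule jv[OF Suc.prems(2,3)], assumption)+
    thus "length (map ((!) t) xs) + ?L + length (map ((!) t) ys) = sum_list (map Suc ms)"
     "set (map ((!) t) xs) \<subseteq> {..x}" "set (map ((!) t) ys) \<subseteq> {..x}"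
     using Suc.prems(3)[OF j] by auto
    fix y assume y: "y \<le> ?n"
    have "sum_list (map Suc ns) = sum_list (map Suc (take j ns)) + Suc (ns ! j) + sum_list (map Suc (drop (Suc j) ns))"
     using id_take_nth_drop[of j ns] j ns(1) by (metis (no_types, lifting) add.assoc list.simps(9) map_append sum_list.Cons sum_list_append)
    hence "sum_list (map Suc (take j ns)) + y < length t" using y ns(2) by simp
    thus "?f y \<le> x" using ns(3) nth_mem by (meson atMost_iff subsetD)
   qed
   fix s :: "nat list" assume s: "length s = ?L" "set s \<subseteq> {..?n}"
   show "tensM C (G (ss[j := s])) \<cdot> gproj k ?Z x ns t \<in> Hom C (Fo ?D x) (tensO C (map2 Fo Ys ms))"
    using upd[OF s] by (intro comp_in[OF o OY gin tensM_in[OF hG]])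
   show "gproj k ?Z x ms (map ((!) t) (join ns (ss[j := s]))) \<in> Hom C (Fo ?D x) (tensO C (map2 Fo Ys ms))"
    using gproj_in[OF Z ms jv[OF upd[OF s]]] by (simp add: box_Fo)
   assume "sorted s"
   thus "tensM C (G (ss[j := s])) \<cdot> gproj k ?Z x ns t = gproj k ?Z x ms (map ((!) t) (join ns (ss[j := s])))"
    using upd[OF s] Suc.prems(4) j Suc.prems(2) by (intro Suc.IH) (auto simp: nth_list_update)
  qed (use Suc.prems(3)[OF j] in auto)
  thus ?case by simp
 qed
 from this[of k ss] show ?thesis using s by (simp add: G_def)
qed

end

section \<open>The cooperads of the two products\<close>

lemma concat_index:
 assumes "map length bss = map length ass" "map length css = map length ass" "map length dss = map length ass"
 shows "map (\<lambda>j. F (concat ass ! j) (concat bss ! j) (concat css ! j) (concat dss ! j)) [0..<length (concat ass)] =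
  concat (map (\<lambda>i. map (\<lambda>j. F (ass ! i ! j) (bss ! i ! j) (css ! i ! j) (dss ! i ! j)) [0..<length (ass ! i)]) [0..<length ass])"
proof -
 let ?G = "\<lambda>as bs cs ds. map (\<lambda>(a, b, c, d). F a b c d) (zip as (zip bs (zip cs ds)))"
 have G: "map (\<lambda>j. F (as ! j) (bs ! j) (cs ! j) (ds ! j)) [0..<length as] = ?G as bs cs ds"
  if "length bs = length as" "length cs = length as" "length ds = length as" for as bs cs ds
  using that by (intro nth_equalityI) auto
 have *: "!!i. i < length ass ==> length (bss ! i) = length (ass ! i) \<and> length (css ! i) = length (ass ! i) \<and> length (dss ! i) = length (ass ! i)"
  using assms by (metis length_map nth_map)
 have l: "length (concat bss) = length (concat ass)" "length (concat css) = length (concat ass)" "length (concat dss) = length (concat ass)"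
  using assms by (simp_all add: length_concat)
 have "?G (concat ass) (concat bss) (concat css) (concat dss) =
   concat (map (\<lambda>i. ?G (ass ! i) (bss ! i) (css ! i) (dss ! i)) [0..<length ass])"
  using assms
 proof (induction ass arbitrary: bss css dss)
  case (Cons as ass)
  then obtain bs bss' cs css' ds dss' where e: "bss = bs # bss'" "css = cs # css'" "dss = ds # dss'"
   by (cases bss; cases css; cases dss) auto
  thus ?case
   using Cons.IH[of bss' css' dss'] Cons.prems by (simp add: map_upt_Suc del: upt_Suc)
 qed simp
 moreover have "map (\<lambda>i. map (\<lambda>j. F (ass ! i ! j) (bss ! i ! j) (css ! i ! j) (dss ! i ! j)) [0..<length (ass ! i)]) [0..<length ass] =
   map (\<lambda>i. ?G (ass ! i) (bss ! i) (css ! i) (dss ! i)) [0..<length ass]"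
  using G * by (intro map_cong) auto
 ultimately show ?thesis using G[OF l] by (simp only:)
qed

text \<open>Supplies the dummy blocks for unit factors: \<open>ttens_flat\<close> asks for non-empty
  blocks also at empty lists, and an empty block can be filled by the last value before it without
  disturbing monotonicity.\<close>

lemma sorted_fill:
 fixes m :: nat
 assumes "sorted (concat cs)" "set (concat cs) \<subseteq> {..m}"
 obtains ss where "length ss = length cs" "sorted (concat ss)" "set (concat ss) \<subseteq> {..m}"
  "!!i. i < length cs ==> ss ! i \<noteq> [] \<and> (cs ! i \<noteq> [] --> ss ! i = cs ! i)"
proof -
 have "\<exists>ss. length ss = length cs \<and> sorted (concat ss) \<and> set (concat ss) \<subseteq> {e..m} \<and>
   (\<forall>i<length cs. ss ! i \<noteq> [] \<and> (cs ! i \<noteq> [] --> ss ! i = cs ! i))"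
  if "set (concat cs) \<subseteq> {e..m}" "e \<le> m" for e :: nat
  using that assms(1)
 proof (induction cs arbitrary: e)
  case (Cons c cs)
  \<comment> \<open>\<open>e\<close> is the last value used so far, and 0 at the beginning.\<close>
  define b where "b = (if c = [] then [e] else c)"
  have b: "b \<noteq> []" "sorted b" "last b \<le> m" "!!x. x \<in> set b ==> e \<le> x \<and> x \<le> last b" "set (concat cs) \<subseteq> {last b..m}" "sorted (concat cs)"
   "c \<noteq> [] ==> b = c"
   unfolding b_def using Cons.prems by (cases c rule: rev_cases; auto simp: sorted_append)+
  obtain ss where s: "length ss = length cs" "sorted (concat ss)" "set (concat ss) \<subseteq> {last b..m}"
    "\<forall>i<length cs. ss ! i \<noteq> [] \<and> (cs ! i \<noteq> [] --> ss ! i = cs ! i)"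
   using Cons.IH[OF b(5,3,6)] by blast
  have *: "last b \<le> x \<and> x \<le> m" if "x \<in> set (concat ss)" for x using s(3) that by (meson atLeastAtMost_iff subsetD)
  have "sorted (concat (b # ss))"
   using b(2,4) * s(2) order_trans by (simp add: sorted_append del: set_concat) blast
  moreover have "set (concat (b # ss)) \<subseteq> {e..m}"
  proof
   fix x assume "x \<in> set (concat (b # ss))"
   thus "x \<in> {e..m}" using b(4)[of x] b(4)[OF last_in_set[OF b(1)]] b(3) *[of x] by (auto simp del: set_concat)
  qed
  ultimately show ?case using s(1,4) b(1,7) by (intro exI[of _ "b # ss"]) (simp add: nth_Cons del: set_concat split: nat.splits)
 qed simp
 from this[of 0] assms(2) that show ?thesis by fastforce
qed

text \<open>Removes the dummy blocks at unit factors. Since \<open>xss\<close> is only asked which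
  of its entries are empty, the same operation serves blocks, sequences and positions.\<close>

definition cut :: "'a list list => 'b list list => 'b list list" where
 "cut xss bs = map (\<lambda>i. if xss ! i = [] then [] else bs ! i) [0..<length xss]"

lemma cut_Nil: "cut [] bs = []" and cut_Cons: "cut (xs # xss) (b # bs) = (if xs = [] then [] else b) # cut xss bs"
 by (simp_all add: cut_def map_upt_Suc del: upt_Suc)

lemma map_cut: "length bs = length xss ==> map (map f) (cut xss bs) = cut xss (map (map f) bs)"
 by (simp add: cut_def)

lemma cut_subset: "length bs = length xss ==> set (concat (cut xss bs)) \<subseteq> set (concat bs)"
 by (induction xss bs rule: list_induct2') (auto simp: cut_Nil cut_Cons)

lemma cut_sorted: "length bs = length xss ==> sorted (concat bs) ==> sorted (concat (cut xss bs))"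
proof (induction xss bs rule: list_induct2')
 case (4 x xs y ys)
 thus ?case using cut_subset[of ys xs] by (auto simp: cut_Cons sorted_append simp del: set_concat)
qed (auto simp: cut_Nil)

lemma cut_distinct: "length bs = length xss ==> distinct (concat bs) ==> distinct (concat (cut xss bs))"
proof (induction xss bs rule: list_induct2')
 case (4 x xs y ys)
 thus ?case using cut_subset[of ys xs] by (auto simp: cut_Cons simp del: set_concat)
qed (auto simp: cut_Nil)

context monoidal_category
begin

abbreviation "tens_upt n f \<equiv> tensM C (map f [0..<n])"

lemma homs_upt:
 "(!!i. i < n ==> x i \<in> Obj C \<and> y i \<in> Obj C \<and> f i \<in> Hom C (x i) (y i)) ==> homs (map x [0..<n]) (map y [0..<n]) (map f [0..<n])"
 by (auto simp: homs_def)

lemma tensM_comp_upt: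
 assumes "!!i. i < n ==> x i \<in> Obj C \<and> y i \<in> Obj C \<and> z i \<in> Obj C \<and> f i \<in> Hom C (x i) (y i) \<and> g i \<in> Hom C (y i) (z i)"
 shows "tens_upt n g \<cdot> tens_upt n f = tens_upt n (\<lambda>i. g i \<cdot> f i)"
proof -
 have "map2 (Cmp C) (map g [0..<n]) (map f [0..<n]) = map (\<lambda>i. g i \<cdot> f i) [0..<n]" by (intro nth_equalityI) auto
 thus ?thesis using tensM_comp[OF homs_upt[of n x y f] homs_upt[of n y z g]] assms by simp
qed

end

section \<open>Flattening and unit factors\<close>

context abelian_tensor_category
begin

text \<open>A constant family satisfies the exchange relation, so agreement on monotone sequences
  extends to all of them. This is how a unit factor ignores its dummy block.\<close>

lemma gamma_const:
 assumes X: "simplicial X" and const: "!!a. a \<in> Hom Simp m n ==> Fm X n m a = e"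
  and s: "length s = Suc m" "set s \<subseteq> {..n}"
 shows "gamma X n m s = e"
proof -
 \<comment> \<open>A monotone sequence that always exists; it shows that \<open>e\<close> is a
   morphism between the right objects.\<close>
 have r: "rep (Suc m) 0 \<in> Hom Simp m n" by (auto simp: Simp_hom sorted_replicate simp del: replicate.simps)
 have e: "e \<in> Hom C (Fo X n) (Fo X m)"
  using sobj_map[OF X r] const[OF r] by simp
 have const_rel: "exchange_rel (Suc m) n (\<lambda>_. e)" by (simp add: exchange_rel_def)
 have "gamma X n m s = (\<lambda>_. e) s"
 proof (rule exchange_rel_unique[OF sobj_obj[OF X, of n] sobj_obj[OF X, of m] gamma_exchange[OF X] const_rel gamma_in[OF X] _ _ s])
  fix t :: "nat list" assume "length t = Suc m" "set t \<subseteq> {..n}" "sorted t"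
  hence "t \<in> Hom Simp m n" by (simp add: Simp_hom)
  thus "gamma X n m t = e" using gamma_mono[OF X] const by simp
 qed (use e in simp_all)
 thus ?thesis .
qed

text \<open>Splits an arbitrary projection into \<gamma> followed by the projection at the identity
  sequence. For \<open>k = 0\<close> the right adjoint is constant, so \<open>b\<close> is free and
  \<gamma> is an identity.\<close>

lemma gproj_counit:
 assumes Z: "msimplicial k Z" and ms: "length ms = k" and b: "0 < k ==> b = conc ms"
  and s: "length s = Suc b" "set s \<subseteq> {..m}"
 shows "gproj k Z m ms s = gproj k Z b ms [0..<Suc b] \<cdot> gamma (dec_obj C k Z) m b s"
proof (cases "k = 0")
 case True
 have "gamma (dec_obj C k Z) m b s = Idm C (Fo Z [])"
  using gamma_const[OF dec_sobj[OF Z] _ s] mid[OF Z, of "[]"] True by (simp add: dec_zero)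
 thus ?thesis using True id_left[OF _ _ id_in] mobj[OF Z, of "[]"] by (simp add: gproj_def)
next
 case False
 hence k: "0 < k" by simp
 have "gamma (dec_obj C k Z) (conc ms) (conc ms) [0..<Suc (conc ms)] = Idm C (Fo (dec_obj C k Z) (conc ms))"
  using gamma_mono[OF dec_sobj[OF Z] Simp_id_hom] sobj_id[OF dec_sobj[OF Z]] by simp
 hence "gproj k Z b ms [0..<Suc b] = dec_counit C k Z ms"
  using k b[OF k] id_right[OF sobj_obj[OF dec_sobj[OF Z]] mobj[OF Z ms] dec_counit_in[OF Z k ms]] by (simp add: gproj_def del: upt_Suc)
 thus ?thesis using k b[OF k] by (simp add: gproj_def)
qed

lemma box_flat:
 assumes Zss: "set (concat Zss) \<subseteq> Obj SC"
  and len: "map length mss = map length Zss" "map length nss = map length Zss" "length tss = length Zss"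
  and t: "!!i. i < length Zss ==> tss ! i \<in> Hom (pow_cat (length (Zss ! i)) Simp_op) (mss ! i) (nss ! i)"
 shows "Fm (box C (concat Zss)) (concat mss) (concat nss) (concat tss) \<cdot> tens_flat C (map2 (map2 Fo) Zss mss) =
  tens_flat C (map2 (map2 Fo) Zss nss) \<cdot> tens_upt (length Zss) (\<lambda>i. Fm (box C (Zss ! i)) (mss ! i) (nss ! i) (tss ! i))"
proof -
 let ?fs = "\<lambda>i. map (\<lambda>j. Fm (Zss ! i ! j) (mss ! i ! j) (nss ! i ! j) (tss ! i ! j)) [0..<length (Zss ! i)]"
 have l: "length mss = length Zss" "length nss = length Zss" using len by (metis length_map)+
 have li: "length (mss ! i) = length (Zss ! i)" "length (nss ! i) = length (Zss ! i)" "set (Zss ! i) \<subseteq> Obj SC" if "i < length Zss" for i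
  using that len l Zss nth_mem[OF that] by (metis nth_map, metis nth_map, force)
 have "homss (map2 (map2 Fo) Zss mss) (map2 (map2 Fo) Zss nss) (map ?fs [0..<length Zss])"
  using l li t box_homs[OF li(3)] unfolding homss_def by simp
 note tens_flat_nat[OF this]
 moreover have "map length tss = map length Zss" using t len(3) by (intro nth_equalityI) auto
 note concat_index[OF len(1,2) this, of Fm]
 ultimately show ?thesis by (simp add: box_Fm o_def)
qed

lemma ttens_functor: "set Ys \<subseteq> Obj SC ==> simplicial (ttens C Ys)"
 unfolding ttens_def by (rule dec_sobj[OF box_functor])

lemma ttens_objs: "set (concat Zss) \<subseteq> Obj SC ==> set (map (ttens C) Zss) \<subseteq> Obj SC"
 using ttens_functor by (auto simp: UN_subset_iff)

lemma tensO_objs: "set (concat Zss) \<subseteq> Obj SC ==> set (map (tensO SC) Zss) \<subseteq> Obj SC"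
 using tensO_sobj by (auto simp: UN_subset_iff)

lemma Ez_box: "set Ys \<subseteq> Obj SC ==> snat (ttens C Ys) (tensO SC Ys) (Ez C (length Ys) (box C Ys))"
 using Ez_nat[OF box_functor] unfolding ttens_def box_diag by blast

lemma Aw_box: "set Ys \<subseteq> Obj SC ==> snat (tensO SC Ys) (ttens C Ys) (Aw C (length Ys) (box C Ys))"
 using Aw_nat[OF box_functor] unfolding ttens_def box_diag by blast

lemma gproj_zero: "gproj 0 Z m ns t = Idm C (Fo Z [])"
 by (simp add: gproj_def)

lemma blocks_of:
 assumes "length b = sum_list (map Suc ms)"
 shows "concat (map (map ((!) b)) (id_blocks ms)) = b" "dims (map (map ((!) b)) (id_blocks ms)) = ms"
  "[] \<notin> set (map (map ((!) b)) (id_blocks ms))"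
proof -
 have "concat (map (map ((!) b)) (id_blocks ms)) = map ((!) b) (concat (id_blocks ms))" by (simp add: map_concat)
 thus "concat (map (map ((!) b)) (id_blocks ms)) = b" unfolding concat_id_blocks assms[symmetric] by (simp only: map_nth)
 show "dims (map (map ((!) b)) (id_blocks ms)) = ms" using dims_id_blocks[of ms] by (simp add: dims_def o_def)
 show "[] \<notin> set (map (map ((!) b)) (id_blocks ms))"
  using length_incl[of ms] by (auto simp: id_blocks_def) (metis length_0_conv nat.simps(3))
qed

text \<open>The canonical morphism of the products \<open>dec\<^sub>*\<close> is the one of the pointwise products, conjugated by
 the Eilenberg-Zilber and Alexander-Whitney maps.\<close>

definition tflat :: "('o, 'm) sobj list list => nat => 'm" where
 "tflat Zss = Aw C (length (concat Zss)) (box C (concat Zss)) \<odot> tens_flat SC Zss \<odot>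
   tensM SC (map (\<lambda>Zs. Ez C (length Zs) (box C Zs)) Zss) \<odot> Ez C (length Zss) (box C (map (ttens C) Zss))"

end

text \<open>The targets of a composition: \<open>N\<close> inner products with \<open>Ki i\<close>
  factors each, \<open>K\<close> factors after flattening, and the outer product \<open>T\<close> of
  the inner ones.\<close>

locale sobj_lists = abelian_tensor_category C
 for C :: "('o, 'm, 'z) ab_mon_cat_scheme" (structure) +
 fixes Zss :: "('o, 'm) sobj list list"
 assumes Zss: "set (concat Zss) \<subseteq> Obj SC"
begin

abbreviation (input) "N \<equiv> length Zss"
abbreviation (input) "K \<equiv> length (concat Zss)"
abbreviation (input) "Z \<equiv> box C (concat Zss)"
abbreviation (input) "Zi i \<equiv> box C (Zss ! i)"
abbreviation (input) "Ki i \<equiv> length (Zss ! i)"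
abbreviation (input) "T \<equiv> box C (map (ttens C) Zss)"

lemma Zi: "i < N ==> set (Zss ! i) \<subseteq> Obj SC"
 using Zss nth_mem[of i Zss] by fastforce

lemma box_Zi: "i < N ==> msimplicial (Ki i) (Zi i)"
 by (rule box_functor[OF Zi])

lemma box_Z: "msimplicial K Z"
 by (rule box_functor[OF Zss])

lemma box_T: "msimplicial N T"
 using box_functor[OF ttens_objs[OF Zss]] by simp

lemma flat_hom: "snat (tensO SC (map (tensO SC) Zss)) (tensO SC (concat Zss)) (tens_flat SC Zss)"
 by (rule Sim_flat_nat[OF Zss])

lemma Ezs_hom: "snat (tensO SC (map (ttens C) Zss)) (tensO SC (map (tensO SC) Zss))
  (tensM SC (map (\<lambda>Zs. Ez C (length Zs) (box C Zs)) Zss))"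
 using Ez_box[OF Zi] ttens_objs[OF Zss] tensO_objs[OF Zss] by (intro Sim_tensM_nat) simp_all

lemma EzT_hom: "snat (ttens C (map (ttens C) Zss)) (tensO SC (map (ttens C) Zss)) (Ez C N T)"
 using Ez_box[OF ttens_objs[OF Zss]] by simp

lemma tflat_in: "snat (ttens C (map (ttens C) Zss)) (ttens C (concat Zss)) (tflat Zss)"
proof -
 interpret S: category SC by (rule Sim_category)
 have o: "tensO SC (map (tensO SC) Zss) \<in> Obj SC" "tensO SC (map (ttens C) Zss) \<in> Obj SC"
  "tensO SC (concat Zss) \<in> Obj SC" "ttens C (concat Zss) \<in> Obj SC" "ttens C (map (ttens C) Zss) \<in> Obj SC"
  using tensO_sobj[OF Zss] tensO_sobj[OF ttens_objs[OF Zss]] ttens_functor[OF Zss] ttens_functor[OF ttens_objs[OF Zss]]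
   tensO_sobj[OF tensO_objs[OF Zss]] by simp_all
 have h: "Ez C N T \<in> Hom SC (ttens C (map (ttens C) Zss)) (tensO SC (map (ttens C) Zss))"
  "tensM SC (map (\<lambda>Zs. Ez C (length Zs) (box C Zs)) Zss) \<in> Hom SC (tensO SC (map (ttens C) Zss)) (tensO SC (map (tensO SC) Zss))"
  "tens_flat SC Zss \<in> Hom SC (tensO SC (map (tensO SC) Zss)) (tensO SC (concat Zss))"
  "Aw C K Z \<in> Hom SC (tensO SC (concat Zss)) (ttens C (concat Zss))"
  using EzT_hom Ezs_hom flat_hom Aw_box[OF Zss] by simp_all
 have "tflat Zss \<in> Hom SC (ttens C (map (ttens C) Zss)) (ttens C (concat Zss))"
  unfolding tflat_def
  by (rule S.comp_in[OF o(5,3,4) S.comp_in[OF o(5,1,3) S.comp_in[OF o(5,2,1) h(1,2)] h(3)] h(4)])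
 thus ?thesis by simp
qed

text \<open>Both sides of the next equation factor through the Eilenberg-Zilber map of the outer product.\<close>

lemma gprojs_Ez:
 assumes mss: "!!i. i < N ==> length (mss ! i) = Ki i" and bs: "length bs = N" "!!i. [|i < N; Zss ! i \<noteq> []|] ==> bs ! i = conc (mss ! i)"
  and s: "length ss = N" "!!i. i < N ==> length (ss ! i) = Suc (bs ! i) \<and> set (ss ! i) \<subseteq> {..m}"
 shows "tens_upt N (\<lambda>i. gproj (Ki i) (Zi i) (bs ! i) (mss ! i) [0..<Suc (bs ! i)]) \<cdot> gproj N T m bs (concat ss) =
  tens_upt N (\<lambda>i. gproj (Ki i) (Zi i) m (mss ! i) (ss ! i)) \<cdot> Ez C N T m"
proof -
 let ?T = "\<lambda>i. ttens C (Zss ! i)"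
 have T: "simplicial (?T i)" if "i < N" for i using ttens_functor[OF Zi[OF that]] .
 have len: "sum_list (map Suc (mss ! i)) = Suc (bs ! i)" if "i < N" "Zss ! i \<noteq> []" for i
  using bs(2)[OF that] mss[OF that(1)] that(2) Suc_conc[of "mss ! i"] by fastforce
 have ip: "gproj (Ki i) (Zi i) (bs ! i) (mss ! i) [0..<Suc (bs ! i)] \<in> Hom C (Fo (?T i) (bs ! i)) (Fo (Zi i) (mss ! i))" if i: "i < N" for i
 proof (cases "Zss ! i = []")
  case True
  thus ?thesis using id_in[OF mobj[OF box_Zi[OF i], of "[]"]] mss[OF i] by (simp add: gproj_zero ttens_def dec_zero)
 next
  case False
  hence "length [0..<Suc (bs ! i)] = sum_list (map Suc (mss ! i))" "set [0..<Suc (bs ! i)] \<subseteq> {..bs ! i}"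
   using len[OF i] by auto
  thus ?thesis using gproj_in[OF box_Zi[OF i] mss[OF i]] by (simp add: ttens_def del: upt_Suc)
 qed
 have g: "gamma (?T i) m (bs ! i) (ss ! i) \<in> Hom C (Fo (?T i) m) (Fo (?T i) (bs ! i))" if i: "i < N" for i
  using gamma_in[OF T[OF i]] s(2)[OF i] by blast
 have "gproj (Ki i) (Zi i) (bs ! i) (mss ! i) [0..<Suc (bs ! i)] \<cdot> gamma (?T i) m (bs ! i) (ss ! i) = gproj (Ki i) (Zi i) m (mss ! i) (ss ! i)" if i: "i < N" for i
  using gproj_counit[OF box_Zi[OF i] mss[OF i] bs(2)[OF i] _ _] s(2)[OF i] unfolding ttens_def by auto
 hence e: "tens_upt N (\<lambda>i. gproj (Ki i) (Zi i) m (mss ! i) (ss ! i)) =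
   tens_upt N (\<lambda>i. gproj (Ki i) (Zi i) (bs ! i) (mss ! i) [0..<Suc (bs ! i)]) \<cdot> tens_upt N (\<lambda>i. gamma (?T i) m (bs ! i) (ss ! i))"
  using sobj_obj[OF T] mobj[OF box_Zi mss] g ip
  by (subst tensM_comp_upt[where x = "\<lambda>i. Fo (?T i) m" and y = "\<lambda>i. Fo (?T i) (bs ! i)" and z = "\<lambda>i. Fo (Zi i) (mss ! i)"]) (auto intro!: arg_cong[where f = "tensM C"])
 note h1 = tensM_in[OF homs_upt, of N "\<lambda>i. Fo (?T i) m" "\<lambda>i. Fo (?T i) (bs ! i)" "\<lambda>i. gamma (?T i) m (bs ! i) (ss ! i)"]
 note h2 = tensM_in[OF homs_upt, of N "\<lambda>i. Fo (?T i) (bs ! i)" "\<lambda>i. Fo (Zi i) (mss ! i)" "\<lambda>i. gproj (Ki i) (Zi i) (bs ! i) (mss ! i) [0..<Suc (bs ! i)]"]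
 have o: "tensO C (map (\<lambda>i. Fo (?T i) m) [0..<N]) \<in> Obj C" "tensO C (map (\<lambda>i. Fo (?T i) (bs ! i)) [0..<N]) \<in> Obj C" "tensO C (map (\<lambda>i. Fo (Zi i) (mss ! i)) [0..<N]) \<in> Obj C"
  using sobj_obj[OF T] mobj[OF box_Zi mss] by (auto intro!: tensO_obj)
 have ez: "Ez C N T m \<in> Hom C (Fo (ttens C (map (ttens C) Zss)) m) (tensO C (map (\<lambda>i. Fo (?T i) m) [0..<N]))"
  using snat_in[OF EzT_hom, of m] by (simp add: Sim_tensO_Fo o_def map_index_upt[of "\<lambda>Zs. Fo (ttens C Zs) m" Zss])
 \<comment> \<open>Folding in the outer product and then acting by \<open>ss ! i\<close> in factor
   \<open>i\<close> is the projection along the concatenated sequences.\<close>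
 have G: "tens_upt N (\<lambda>i. gamma (?T i) m (bs ! i) (ss ! i)) \<cdot> Ez C N T m = gproj N T m bs (concat ss)"
 proof -
  have "map ((!) (fold_map N m)) (join (rep N m) ss) = concat ss" using s by (intro fold_map_join) auto
  moreover have e2: "map (\<lambda>i. gamma (map (ttens C) Zss ! i) (rep N m ! i) (bs ! i) (ss ! i)) [0..<N] = map (\<lambda>i. gamma (?T i) m (bs ! i) (ss ! i)) [0..<N]" by simp
  ultimately show ?thesis
   using gproj_gamma[OF ttens_objs[OF Zss] length_map[symmetric] length_replicate fold_map_length fold_map_values bs(1) s(1), of m] s(2)
   unfolding Ez_eq_gproj e2 by simp
 qed
 show ?thesis
  unfolding e G[symmetric]
  by (rule assoc[OF sobj_obj[OF ttens_functor[OF ttens_objs[OF Zss]]] o ez h1 h2, symmetric]) (use sobj_obj[OF T] mobj[OF box_Zi mss] g ip in auto)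
qed

end

lemma chop_exists:
 "length xs = sum_list ks ==> \<exists>xss. concat xss = xs \<and> map length xss = ks"
proof (induction ks arbitrary: xs)
 case (Cons k ks)
 obtain xss where "concat xss = drop k xs" "map length xss = ks" using Cons.IH[of "drop k xs"] Cons.prems by auto
 thus ?case using Cons.prems by (intro exI[of _ "take k xs # xss"]) simp
qed simp

lemma concat_concat_map: "concat (concat xss) = concat (map concat xss)"
 by (induction xss) auto

lemma id_blocks_Nil [simp]: "id_blocks [] = []"
 by (simp add: id_blocks_def)

lemma dims_concat: "dims (concat gss) = concat (map dims gss)"
 by (simp add: dims_def[abs_def] map_concat)

lemma blocks_concat:
 assumes "concat gss \<in> blocks k m" "i < length gss"
 shows "gss ! i \<in> blocks (length (gss ! i)) m"
proof -
 have "concat gss = concat (take i gss) @ gss ! i @ concat (drop (Suc i) gss)"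
  using assms(2) by (metis concat.simps(2) concat_append id_take_nth_drop)
 thus ?thesis using assms(1) by (auto simp: blocks_def sorted_append)
qed

context abelian_tensor_category
begin

text \<open>Restriction to consecutive blocks absorbs \<open>E\<close>: by \<open>bproj_Ez\<close>
  the restriction of EZ is a projection, and by \<open>bproj_Aw\<close> that projection of AW is the
  restriction again.\<close>

lemma block_EzAw:
 assumes Z: "msimplicial k Z" and b: "bs \<in> blocks k m"
 shows "Fm Z (rep k m) (dims bs) bs \<cdot> EzAw C k Z m = Fm Z (rep k m) (dims bs) bs"
proof -
 note d = dims_len[OF b] and o = mobj[OF Z]
 have "Aw C k Z m \<in> Hom C (Fo Z (rep k m)) (Fo (dec_obj C k Z) m)" "Ez C k Z m \<in> Hom C (Fo (dec_obj C k Z) m) (Fo Z (rep k m))"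
  using snat_in[OF Aw_nat[OF Z], of m] snat_in[OF Ez_nat[OF Z], of m] by (simp_all add: restr_def diag_def)
 from assoc[OF o[OF length_replicate] sobj_obj[OF dec_sobj[OF Z]] o[OF length_replicate] o[OF d] this
   mmap[OF Z length_replicate d blocks_hom[OF b]]]
 show ?thesis by (simp add: EzAw_def bproj_Ez[OF Z b] bproj_Aw[OF Z b])
qed

end

section \<open>Projections of the flattened product\<close>

context sobj_lists
begin

text \<open>The flattening at a multi-index. At the diagonal one, \<open>reps m\<close>, it is the
  flattening of the point-wise products in degree \<open>m\<close>.\<close>

definition fl :: "nat list list => 'm" where
 "fl mss = tens_flat C (map2 (map2 Fo) Zss mss)"

definition middle :: "nat list list => 'o" where
 "middle mss = tensO C (map (\<lambda>i. Fo (Zi i) (mss ! i)) [0..<N])"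

definition reps :: "nat => nat list list" where
 "reps m = map (\<lambda>Zs. rep (length Zs) m) Zss"

lemma reps: "length (reps m) = N" "map length (reps m) = map length Zss" "i < N ==> reps m ! i = rep (Ki i) m"
 "concat (reps m) = rep K m"
proof -
 show "concat (reps m) = rep K m"
  unfolding reps_def by (induction Zss) (auto simp: replicate_add)
qed (simp_all add: reps_def o_def)

lemma shape: "map length mss = map length Zss ==> length mss = N"
 "[|map length mss = map length Zss; i < N|] ==> length (mss ! i) = Ki i"
 "map length mss = map length Zss ==> length (concat mss) = K"
proof -
 show 1: "map length mss = map length Zss ==> length mss = N" by (metis length_map)
 show "[|map length mss = map length Zss; i < N|] ==> length (mss ! i) = Ki i" using 1 by (metis nth_map)
qed (simp add: length_concat)

lemma shapeI: "[|length mss = N; !!i. i < N ==> length (mss ! i) = Ki i|] ==> map length mss = map length Zss"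
 by (intro nth_equalityI) auto

lemma middle_obj: "map length mss = map length Zss ==> middle mss \<in> Obj C"
 unfolding middle_def using mobj[OF box_Zi shape(2)] by (auto intro!: tensO_obj)

lemma fl_in: "map length mss = map length Zss ==> fl mss \<in> Hom C (middle mss) (Fo Z (concat mss))"
proof -
 assume s: "map length mss = map length Zss"
 have c: "concat (map2 (map2 Fo) Zss mss) = map2 Fo (concat Zss) (concat mss)"
  using shape(1)[OF s, symmetric] s
  by (induction Zss mss rule: list_induct2) auto
 have "set (concat (map2 (map2 Fo) Zss mss)) \<subseteq> Obj C"
  unfolding c using box_objs[OF Zss shape(3)[OF s]] .
 note tens_flat_in[OF this]
 moreover have "map (tensO C) (map2 (map2 Fo) Zss mss) = map (\<lambda>i. Fo (Zi i) (mss ! i)) [0..<N]"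
  using shape(1)[OF s] by (intro nth_equalityI) (auto simp: box_Fo)
 ultimately show ?thesis by (simp add: fl_def middle_def c box_Fo)
qed

lemma fl_reps: "tens_flat SC Zss m = fl (reps m)"
proof -
 have "map2 (map2 Fo) Zss (reps m) = map (map (\<lambda>X. Fo X m)) Zss"
  by (intro nth_equalityI) (auto simp: reps map2_replicate)
 thus ?thesis by (simp add: fl_def Sim_tens_flat)
qed

lemma tensMs_in:
 assumes "map length mss = map length Zss" "!!i. i < N ==> x i \<in> Obj C \<and> f i \<in> Hom C (x i) (Fo (Zi i) (mss ! i))"
 shows "tens_upt N f \<in> Hom C (tensO C (map x [0..<N])) (middle mss)"
 unfolding middle_def using mobj[OF box_Zi shape(2)[OF assms(1)]] assms(2) by (intro tensM_in homs_upt) blast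

lemma EzT_in: "Ez C N T m \<in> Hom C (Fo (ttens C (map (ttens C) Zss)) m) (tensO C (map (\<lambda>i. Fo (ttens C (Zss ! i)) m) [0..<N]))"
 using snat_in[OF EzT_hom, of m] by (simp add: Sim_tensO_Fo o_def map_index_upt[of "\<lambda>Zs. Fo (ttens C Zs) m" Zss])

lemma Ttens_obj: "tensO C (map (\<lambda>i. Fo (ttens C (Zss ! i)) m) [0..<N]) \<in> Obj C"
 using sobj_obj[OF ttens_functor[OF Zi]] by (auto intro!: tensO_obj)

lemma TT_obj: "Fo (ttens C (map (ttens C) Zss)) m \<in> Obj C"
 by (rule sobj_obj[OF ttens_functor[OF ttens_objs[OF Zss]]])

lemma Fo_reps: "i < N ==> Fo (Zi i) (reps m ! i) = Fo (tensO SC (Zss ! i)) m"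
 using box_diag[of C "Zss ! i"] by (simp add: reps box_Fo Sim_tensO_Fo map2_replicate)

lemma Ezi_in: "i < N ==> Ez C (Ki i) (Zi i) m \<in> Hom C (Fo (ttens C (Zss ! i)) m) (Fo (Zi i) (reps m ! i))"
 using snat_in[OF Ez_box[OF Zi]] by (simp add: Fo_reps)

lemma tflat_eq: "tflat Zss m = Aw C K Z m \<cdot> (fl (reps m) \<cdot> (tens_upt N (\<lambda>i. Ez C (Ki i) (Zi i) m) \<cdot> Ez C N T m))"
 by (simp add: tflat_def fl_reps Sim_tensM o_def map_index_upt[of "\<lambda>Zs. Ez C (length Zs) (box C Zs) m" Zss])

context
 fixes m :: nat and gss
 assumes g: "map length gss = map length Zss" "concat gss \<in> blocks K m"
begin

abbreviation (input) "dss \<equiv> map dims gss"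

lemma dss: "map length dss = map length Zss" "i < N ==> dss ! i = dims (gss ! i)" "concat dss = dims (concat gss)"
 using g shape(1)[OF g(1)] by (simp_all add: o_def dims_concat)

lemma fam_block: "i < N ==> gss ! i \<in> blocks (Ki i) m"
 using blocks_concat[OF g(2)] shape[OF g(1)] by metis

lemma Fm_fam_in: "i < N ==> Fm (Zi i) (reps m ! i) (dss ! i) (gss ! i) \<in> Hom C (Fo (Zi i) (reps m ! i)) (Fo (Zi i) (dss ! i))"
 using mmap[OF box_Zi _ dims_len[OF fam_block] blocks_hom[OF fam_block]] dss(2) by (simp add: reps)

lemma block_fl:
 "Fm Z (rep K m) (dims (concat gss)) (concat gss) \<cdot> fl (reps m) =
  fl dss \<cdot> tens_upt N (\<lambda>i. Fm (Zi i) (reps m ! i) (dss ! i) (gss ! i))"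
 using box_flat[OF Zss reps(2) dss(1) shape(1)[OF g(1)], of m] blocks_hom[OF fam_block] dss(2)
 unfolding fl_def reps(4) dss(3) by (simp add: reps(3))

text \<open>The outermost AW turns the projection into a restriction to blocks, naturality moves
  that restriction through the flattening into the inner factors, and there it absorbs the signs of
  the inner EZ.\<close>

lemma block_tflat:
 "bproj K Z m (concat gss) \<cdot> tflat Zss m =
  fl dss \<cdot> (tens_upt N (\<lambda>i. gproj (Ki i) (Zi i) m (dims (gss ! i)) (concat (gss ! i))) \<cdot> Ez C N T m)"
proof -
 let ?E = "tens_upt N (\<lambda>i. Ez C (Ki i) (Zi i) m)" and ?e = "Ez C N T m"
 let ?F = "tens_upt N (\<lambda>i. Fm (Zi i) (reps m ! i) (dss ! i) (gss ! i))"
 let ?P = "Fm Z (rep K m) (dims (concat gss)) (concat gss)"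
 note d = dims_len[OF g(2)]
 have E: "?E \<in> Hom C (tensO C (map (\<lambda>i. Fo (ttens C (Zss ! i)) m) [0..<N])) (middle (reps m))"
  using sobj_obj[OF ttens_functor[OF Zi]] Ezi_in by (intro tensMs_in reps(2)) blast
 have F: "?F \<in> Hom C (middle (reps m)) (middle dss)"
  unfolding middle_def[of "reps m"] using mobj[OF box_Zi shape(2)[OF reps(2)]] Fm_fam_in by (intro tensMs_in dss(1)) blast
 note o = TT_obj[of m] Ttens_obj[of m] middle_obj[OF reps(2)[of m]] middle_obj[OF dss(1)]
 have oZ: "Fo Z (concat (reps m)) \<in> Obj C" "Fo Z (dims (concat gss)) \<in> Obj C" "Fo Z (concat dss) \<in> Obj C"
  using mobj[OF box_Z] d shape(3)[OF reps(2)] shape(3)[OF dss(1)] by blast+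
 have P: "?P \<in> Hom C (Fo Z (concat (reps m))) (Fo Z (dims (concat gss)))"
  using mmap[OF box_Z _ d blocks_hom[OF g(2)]] by (simp add: reps)
 note Ee = comp_in[OF o(1,2,3) EzT_in E]
 have fEe: "fl (reps m) \<cdot> (?E \<cdot> ?e) \<in> Hom C (Fo (ttens C (map (ttens C) Zss)) m) (Fo Z (concat (reps m)))"
  by (rule comp_in[OF o(1,3) oZ(1) Ee fl_in[OF reps(2)]])
 have FE: "?F \<cdot> ?E = tens_upt N (\<lambda>i. gproj (Ki i) (Zi i) m (dims (gss ! i)) (concat (gss ! i)))"
 proof -
  have "?F \<cdot> ?E = tens_upt N (\<lambda>i. Fm (Zi i) (reps m ! i) (dss ! i) (gss ! i) \<cdot> Ez C (Ki i) (Zi i) m)"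
   by (rule tensM_comp_upt[where x = "\<lambda>i. Fo (ttens C (Zss ! i)) m" and y = "\<lambda>i. Fo (Zi i) (reps m ! i)" and z = "\<lambda>i. Fo (Zi i) (dss ! i)"])
    (intro conjI sobj_obj[OF ttens_functor[OF Zi]] mobj[OF box_Zi shape(2)[OF reps(2)]] mobj[OF box_Zi shape(2)[OF dss(1)]] Ezi_in Fm_fam_in; assumption)
  also have "\<dots> = tens_upt N (\<lambda>i. gproj (Ki i) (Zi i) m (dims (gss ! i)) (concat (gss ! i)))"
   using bproj_Ez[OF box_Zi fam_block] gproj_block[OF box_Zi fam_block] by (intro arg_cong[where f = "tensM C"] map_cong) (simp_all add: reps dss(2))
  finally show ?thesis .
 qed
 have "bproj K Z m (concat gss) \<cdot> tflat Zss m = ?P \<cdot> (fl (reps m) \<cdot> (?E \<cdot> ?e))"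
  unfolding tflat_eq bproj_Aw[OF box_Z g(2), symmetric]
  by (rule assoc[OF o(1) oZ(1) _ oZ(2) fEe _ bproj_in[OF box_Z g(2)], symmetric])
   (use sobj_obj[OF dec_sobj[OF box_Z]] snat_in[OF Aw_nat[OF box_Z], of m] in \<open>simp_all add: reps restr_def diag_def\<close>)
 also have "\<dots> = (?P \<cdot> fl (reps m)) \<cdot> (?E \<cdot> ?e)"
  by (rule assoc[OF o(1,3) oZ(1,2) Ee fl_in[OF reps(2)] P, symmetric])
 also have "\<dots> = fl dss \<cdot> (?F \<cdot> (?E \<cdot> ?e))"
  unfolding block_fl by (rule assoc[OF o(1,3,4) oZ(3) Ee F fl_in[OF dss(1)]])
 also have "?F \<cdot> (?E \<cdot> ?e) = (?F \<cdot> ?E) \<cdot> ?e"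
  by (rule assoc[OF o EzT_in E F, symmetric])
 finally show ?thesis unfolding FE .
qed

end

text \<open>The tensor product of the inner projections at identity sequences, that is, of the inner
  counits, with identities at unit factors. It is the middle factor in the condition that defines
  \<open>ttens_flat\<close>.\<close>

definition ips :: "nat list list => nat list => 'm" where
 "ips mss bs = tens_upt N (\<lambda>i. gproj (Ki i) (Zi i) (bs ! i) (mss ! i) [0..<Suc (bs ! i)])"

context
 fixes m :: nat and mss bs
 assumes mss: "map length mss = map length Zss" and bs: "length bs = N" "!!i. [|i < N; Zss ! i \<noteq> []|] ==> bs ! i = conc (mss ! i)"
begin

lemma sum_list_mss: "[|i < N; Zss ! i \<noteq> []|] ==> sum_list (map Suc (mss ! i)) = Suc (bs ! i)"
 using bs(2)[of i] shape(2)[OF mss, of i] Suc_conc[of "mss ! i"] by fastforce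

lemma ips_in: "ips mss bs \<in> Hom C (Fo T bs) (middle mss)"
proof -
 have "gproj (Ki i) (Zi i) (bs ! i) (mss ! i) [0..<Suc (bs ! i)] \<in> Hom C (Fo (ttens C (Zss ! i)) (bs ! i)) (Fo (Zi i) (mss ! i))" if i: "i < N" for i
 proof (cases "Zss ! i = []")
  case True
  thus ?thesis using id_in[OF mobj[OF box_Zi[OF i], of "[]"]] shape(2)[OF mss i] by (simp add: gproj_zero ttens_def dec_zero)
 next
  case False
  hence "length [0..<Suc (bs ! i)] = sum_list (map Suc (mss ! i))" "set [0..<Suc (bs ! i)] \<subseteq> {..bs ! i}"
   using sum_list_mss[OF i] by auto
  thus ?thesis using gproj_in[OF box_Zi[OF i] shape(2)[OF mss i]] by (simp add: ttens_def del: upt_Suc)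
 qed
 hence "ips mss bs \<in> Hom C (tensO C (map (\<lambda>i. Fo (ttens C (Zss ! i)) (bs ! i)) [0..<N])) (middle mss)"
  unfolding ips_def using sobj_obj[OF ttens_functor[OF Zi]] by (intro tensMs_in mss) blast
 moreover have "map2 Fo (map (ttens C) Zss) bs = map (\<lambda>i. Fo (ttens C (Zss ! i)) (bs ! i)) [0..<N]"
  using bs(1) by (intro nth_equalityI) auto
 ultimately show ?thesis by (simp add: box_Fo)
qed

text \<open>For monotone data the sequences are themselves blocks, so \<open>block_tflat\<close>
  applies, and \<open>gprojs_Ez\<close> rewrites its right hand side.\<close>

lemma gproj_tflat_sorted:
 assumes s: "length ss = N" "!!i. i < N ==> length (ss ! i) = Suc (bs ! i)" "sorted (concat ss)" "set (concat ss) \<subseteq> {..m}"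
 shows "gproj K Z m (concat mss) (concat (cut Zss ss)) \<cdot> tflat Zss m = fl mss \<cdot> (ips mss bs \<cdot> gproj N T m bs (concat ss))"
proof -
 \<comment> \<open>Each outer sequence is subdivided according to the dimensions of the inner
   factors; at a unit factor there is nothing to subdivide and the dummy disappears.\<close>
 define gss where "gss = map (\<lambda>i. map (map ((!) (ss ! i))) (id_blocks (mss ! i))) [0..<N]"
 have si: "set (ss ! i) \<subseteq> {..m}" if "i < N" for i using that s(1,4) nth_mem[of i ss] by fastforce
 have e: "mss ! i = []" if "i < N" "Zss ! i = []" for i using shape(2)[OF mss that(1)] that(2) by simp
 have blk: "concat (gss ! i) = cut Zss ss ! i" "dims (gss ! i) = mss ! i" "[] \<notin> set (gss ! i)" if i: "i < N" for i
 proof -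
  show "concat (gss ! i) = cut Zss ss ! i" "dims (gss ! i) = mss ! i" "[] \<notin> set (gss ! i)"
   using e[OF i] blocks_of[of "ss ! i" "mss ! i"] sum_list_mss[OF i] s(2)[OF i] i
   by (cases "Zss ! i = []"; simp add: gss_def cut_def)+
 qed
 have lg: "length gss = N" by (simp add: gss_def)
 have g1: "map length gss = map length Zss" using shape(2)[OF mss] by (intro shapeI) (simp_all add: gss_def)
 have cc: "concat (concat gss) = concat (cut Zss ss)"
 proof -
  have "concat (concat gss) = concat (map concat gss)" by (rule concat_concat_map)
  also have "map concat gss = cut Zss ss" using blk(1) by (intro nth_equalityI) (simp_all add: lg cut_def)
  finally show ?thesis .
 qed
 have "set (concat (cut Zss ss)) \<subseteq> {..m}" using cut_subset[OF s(1)] s(4) by blast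
 hence g2: "concat gss \<in> blocks K m"
  using shape(3)[OF g1] cut_sorted[OF s(1,3)] blk(3) lg unfolding blocks_def cc mem_Collect_eq by (auto simp: in_set_conv_nth)
 have dm: "map dims gss = mss" using blk(2) shape(1)[OF mss] lg by (intro nth_equalityI) auto
 have "gproj K Z m (concat mss) (concat (cut Zss ss)) = bproj K Z m (concat gss)"
  using gproj_block[OF box_Z g2] by (simp add: dims_concat dm cc)
 hence "gproj K Z m (concat mss) (concat (cut Zss ss)) \<cdot> tflat Zss m =
   fl mss \<cdot> (tens_upt N (\<lambda>i. gproj (Ki i) (Zi i) m (dims (gss ! i)) (concat (gss ! i))) \<cdot> Ez C N T m)"
  using block_tflat[OF g1 g2] by (simp add: dm)
 also have "map (\<lambda>i. gproj (Ki i) (Zi i) m (dims (gss ! i)) (concat (gss ! i))) [0..<N] = map (\<lambda>i. gproj (Ki i) (Zi i) m (mss ! i) (ss ! i)) [0..<N]"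
  using blk by (intro map_cong) (auto simp: cut_def gproj_zero)
 also have "tensM C \<dots> \<cdot> Ez C N T m = ips mss bs \<cdot> gproj N T m bs (concat ss)"
  using gprojs_Ez[OF shape(2)[OF mss] bs s(1), of m] s(2) si by (simp add: ips_def)
 finally show ?thesis .
qed

text \<open>Both sides are exchange families in the concatenated sequence: the right one reads all
  its entries, the left one only those that survive the cut.\<close>

lemma gproj_tflat:
 assumes s: "length ss = N" "!!i. i < N ==> length (ss ! i) = Suc (bs ! i)" "set (concat ss) \<subseteq> {..m}"
 shows "gproj K Z m (concat mss) (concat (cut Zss ss)) \<cdot> tflat Zss m = fl mss \<cdot> (ips mss bs \<cdot> gproj N T m bs (concat ss))"
proof -
 \<comment> \<open>The positions that remain after cutting out the dummy blocks, in the form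
   required by \<open>exchange_rel_select\<close>.\<close>
 define r where "r = concat (cut Zss (id_blocks bs))"
 let ?L = "sum_list (map Suc bs)" and ?R = "sum_list (map Suc (concat mss))"
 let ?blk = "\<lambda>t. map (map ((!) t)) (id_blocks bs)"
 let ?F = "\<lambda>t. gproj K Z m (concat mss) (map ((!) t) r) \<cdot> tflat Zss m" and ?G = "\<lambda>t. fl mss \<cdot> (ips mss bs \<cdot> gproj N T m bs t)"
 note oT = TT_obj[of m] and oX = sobj_obj[OF ttens_functor[OF Zss], of m] and oZ = mobj[OF box_Z shape(3)[OF mss]]
 have lb: "length (id_blocks bs) = N" using bs(1) by simp
 have cutmap: "map ((!) t) r = concat (cut Zss (?blk t))" for t
  unfolding r_def map_concat map_cut[OF lb] ..
 have blen: "length (?blk t ! i) = Suc (bs ! i)" if "i < N" for i t using that bs(1) by (simp add: id_blocks_nth length_incl)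
 have r: "length r = ?R" "distinct r" "set r \<subseteq> {..<?L}"
 proof -
  have "mss ! i = []" if "i < N" "Zss ! i = []" for i using shape(2)[OF mss that(1)] that(2) by simp
  hence "map length (cut Zss (id_blocks bs)) = map (\<lambda>ms. sum_list (map Suc ms)) mss"
   using shape[OF mss] sum_list_mss bs(1) by (intro nth_equalityI) (auto simp: cut_def id_blocks_nth length_incl)
  moreover have "sum_list (map Suc (concat xss)) = sum_list (map (\<lambda>ms. sum_list (map Suc ms)) xss)" for xss by (induction xss) auto
  ultimately show "length r = ?R" by (simp add: r_def length_concat)
  show "distinct r" unfolding r_def using cut_distinct[OF lb] by (simp add: concat_id_blocks)
  show "set r \<subseteq> {..<?L}" unfolding r_def using cut_subset[OF lb] by (auto simp: concat_id_blocks simp del: set_concat)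
 qed
 have gZ: "gproj K Z m (concat mss) t \<in> Hom C (Fo (ttens C (concat Zss)) m) (Fo Z (concat mss))" if "length t = ?R" "set t \<subseteq> {..m}" for t
  using gproj_in[OF box_Z shape(3)[OF mss] that] by (simp add: ttens_def)
 have gT: "gproj N T m bs t \<in> Hom C (Fo (ttens C (map (ttens C) Zss)) m) (Fo T bs)" if "length t = ?L" "set t \<subseteq> {..m}" for t
  using gproj_in[OF box_T bs(1) that] by (simp add: ttens_def)
 note oTb = mobj[OF box_T bs(1)] and om = middle_obj[OF mss]
 have vals: "length (map ((!) t) r) = ?R" "set (map ((!) t) r) \<subseteq> {..m}" if "length t = ?L" "set t \<subseteq> {..m}" for t
  using r(1,3) set_map_nth[of r t] that by auto
 have "?F (concat ss) = ?G (concat ss)"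
 proof (rule exchange_rel_unique[OF oT oZ, of ?L m ?F ?G])
  show "exchange_rel ?L m ?F"
   by (rule exchange_rel_comp_right[OF oT oX oZ exchange_rel_select[OF oX oZ gproj_exchange[OF box_Z shape(3)[OF mss] refl] gZ r]])
    (use gZ vals snat_in[OF tflat_in, of m] in simp_all)
  show "exchange_rel ?L m ?G"
   by (rule exchange_rel_comp_left[OF oT om oZ exchange_rel_comp_left[OF oT oTb om gproj_exchange[OF box_T bs(1) refl] gT ips_in] _ fl_in[OF mss]])
    (assumption | rule comp_in[OF oT oTb om gT ips_in])+
  fix t :: "nat list" assume t: "length t = ?L" "set t \<subseteq> {..m}"
  show "?F t \<in> Hom C (Fo (ttens C (map (ttens C) Zss)) m) (Fo Z (concat mss))"
   by (rule comp_in[OF oT oX oZ snat_in[OF tflat_in] gZ[OF vals[OF t]]])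
  show "?G t \<in> Hom C (Fo (ttens C (map (ttens C) Zss)) m) (Fo Z (concat mss))"
   by (rule comp_in[OF oT om oZ comp_in[OF oT oTb om gT[OF t] ips_in] fl_in[OF mss]])
  assume "sorted t"
  thus "?F t = ?G t"
   using gproj_tflat_sorted[of "?blk t"] blen blocks_of(1)[OF t(1)] bs(1) t(2) unfolding cutmap by simp
 next
  have "map length ss = map Suc bs" using s(1,2) bs(1) by (intro nth_equalityI) auto
  thus "length (concat ss) = ?L" by (simp add: length_concat)
 qed (rule s(3))
 moreover have "?blk (concat ss) = ss"
 proof (rule concat_injective)
  have l: "map length ss = map Suc bs" using s(1,2) bs(1) by (intro nth_equalityI) auto
  thus "concat (?blk (concat ss)) = concat ss" by (intro blocks_of(1)) (simp add: length_concat)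
  show "length (?blk (concat ss)) = length ss" using s(1) bs(1) by simp
  show "\<forall>(x, y)\<in>set (zip (?blk (concat ss)) ss). length x = length y"
   using s(1,2) by (auto simp: in_set_zip id_blocks_nth length_incl)
 qed
 ultimately show ?thesis unfolding cutmap by simp
qed

end

end

context abelian_tensor_category
begin

lemma dec_proj_gproj:
 assumes "msimplicial k Z" "0 < k ==> a \<in> Hom Simp (conc ns) m"
 shows "dec_proj C k Z m ns a = gproj k Z m ns a"
 using assms gamma_mono[OF dec_sobj] by (simp add: dec_proj_def gproj_def)

lemma multi_nat_in: "[|mnat k Z Z' q; length ns = k|] ==> q ns \<in> Hom C (Fo Z ns) (Fo Z' ns)"
 by (simp add: is_nat_trans_def)

lemma diag_in:
 assumes "msimplicial k Y"
 shows "Ez C k Y m \<in> Hom C (Fo (dec_obj C k Y) m) (Fo Y (rep k m))" "Aw C k Y m \<in> Hom C (Fo Y (rep k m)) (Fo (dec_obj C k Y) m)"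
  "EzAw C k Y m \<in> Hom C (Fo Y (rep k m)) (Fo Y (rep k m))"
 using snat_in[OF Ez_nat[OF assms], of m] snat_in[OF Aw_nat[OF assms], of m] snat_in[OF EzAw_nat[OF assms], of m]
 by (simp_all add: restr_def diag_def)

text \<open>Regards a block tuple as the diagonal action of one monotone map followed by the
  inclusions of the blocks. For \<open>k = 0\<close> the map \<open>s\<close> is an arbitrary
  dummy.\<close>

lemma block_factor:
 assumes Z: "msimplicial k Z" and g: "gs \<in> blocks k m" and s: "s \<in> Hom Simp b m" "0 < k ==> s = concat gs"
 shows "id_blocks (dims gs) \<in> pHom k (rep k b) (dims gs)"
  and "Fm Z (rep k b) (dims gs) (id_blocks (dims gs)) \<cdot> Fm (restr Z (diag k)) m b s = Fm Z (rep k m) (dims gs) gs"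
proof -
 note d = dims_len[OF g]
 have "b = conc (dims gs)" if "0 < k"
  using s(1) concat_hom[OF g that] s(2)[OF that] by (simp add: Simp_hom)
 thus h: "id_blocks (dims gs) \<in> pHom k (rep k b) (dims gs)"
  using blocks_hom[OF id_blocks_tuple(1)[OF d]] d dims_id_blocks[of "dims gs"] by (cases "k = 0") auto
 have r: "rep k s \<in> pHom k (rep k m) (rep k b)" using s(1) by simp
 have "brestr (rep k s) (id_blocks (dims gs)) = map (map ((!) s)) (id_blocks (dims gs))"
  using d by (intro nth_equalityI) (auto simp: brestr_def)
 also have "\<dots> = gs"
  using block_map_id_blocks[OF g] s(2) d by (cases "k = 0") auto
 finally show "Fm Z (rep k b) (dims gs) (id_blocks (dims gs)) \<cdot> Fm (restr Z (diag k)) m b s = Fm Z (rep k m) (dims gs) gs"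
  using mcomp[OF Z _ _ d r h] by (simp add: restr_def diag_def)
qed

lemma box_map_family:
 assumes l: "length Ys = n" "length Ws = n" and o: "set Ys \<subseteq> Obj SC" "set Ws \<subseteq> Obj SC"
  and g: "!!i. i < n ==> snat (Ys ! i) (Ws ! i) (g i)"
 shows "mnat n (box C Ys) (box C Ws) (box_map C (map g [0..<n]))"
  and "box_map C (map g [0..<n]) (rep n m) = tens_upt n (\<lambda>i. g i m)"
proof -
 show "mnat n (box C Ys) (box C Ws) (box_map C (map g [0..<n]))"
  using box_map_nat[OF o, of "map g [0..<n]"] l g by simp
 show "box_map C (map g [0..<n]) (rep n m) = tens_upt n (\<lambda>i. g i m)"
  by (simp add: box_map_def map2_replicate o_def)
qed

lemma Fo_box_diag: "Fo (box C Ys) (rep (length Ys) n) = Fo (tensO SC Ys) n"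
 by (simp add: box_Fo Sim_tensO_Fo map2_replicate)

lemma EzAw_family:
 assumes l: "length Ys = n" "length Ws = n" and o: "set Ys \<subseteq> Obj SC" "set Ws \<subseteq> Obj SC"
  and g: "!!i. i < n ==> snat (Ys ! i) (Ws ! i) (g i)"
 shows "tens_upt n (\<lambda>i. g i m) \<in> Hom C (Fo (tensO SC Ys) m) (Fo (tensO SC Ws) m)"
  and "tens_upt n (\<lambda>i. g i m) \<cdot> EzAw C n (box C Ys) m = EzAw C n (box C Ws) m \<cdot> tens_upt n (\<lambda>i. g i m)"
proof -
 note f = box_map_family[OF assms]
 show "tens_upt n (\<lambda>i. g i m) \<in> Hom C (Fo (tensO SC Ys) m) (Fo (tensO SC Ws) m)"
  using multi_nat_in[OF f(1) length_replicate, of m] f(2)[of m] Fo_box_diag[of Ys m] Fo_box_diag[of Ws m] l by simp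
 show "tens_upt n (\<lambda>i. g i m) \<cdot> EzAw C n (box C Ys) m = EzAw C n (box C Ws) m \<cdot> tens_upt n (\<lambda>i. g i m)"
  using EzAw_natural[OF _ _ f(1), of m] box_functor[OF o(1)] box_functor[OF o(2)] f(2)[of m] l by simp
qed

end

section \<open>Compatibility of both maps with flattening\<close>

context sobj_lists
begin

abbreviation (input) "Es m \<equiv> tens_upt N (\<lambda>i. Ez C (Ki i) (Zi i) m)"

lemma Es_in: "Es m \<in> Hom C (tensO C (map (\<lambda>i. Fo (ttens C (Zss ! i)) m) [0..<N])) (middle (reps m))"
 using sobj_obj[OF ttens_functor[OF Zi]] Ezi_in by (intro tensMs_in reps(2)) blast

lemma block_families:
 assumes "gs \<in> blocks K m"
 obtains gss where "concat gss = gs" "map length gss = map length Zss"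
proof -
 have "length gs = sum_list (map length Zss)" using assms by (simp add: blocks_def length_concat)
 thus ?thesis using chop_exists that by blast
qed

text \<open>Joining the inner blocks of each group gives the outer blocks;
  \<open>sorted_fill\<close> provides values for the groups of unit factors.\<close>

lemma concat_families:
 assumes g: "map length gss = map length Zss" "concat gss \<in> blocks K m"
 obtains ss where "ss \<in> blocks N m" "!!i. [|i < N; 0 < Ki i|] ==> ss ! i = concat (gss ! i)"
proof -
 note cc = concat_concat_map[of gss, symmetric]
 obtain ss where s: "length ss = N" "sorted (concat ss)" "set (concat ss) \<subseteq> {..m}"
   "!!i. i < N ==> ss ! i \<noteq> [] \<and> (concat (gss ! i) \<noteq> [] --> ss ! i = concat (gss ! i))"
  using sorted_fill[of "map concat gss" m] g shape(1)[OF g(1)] unfolding cc by (auto simp: blocks_def simp del: set_concat)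
 have "concat (gss ! i) \<noteq> []" if "i < N" "0 < Ki i" for i
  using concat_hom[OF fam_block[OF g that(1)] that(2)] by (auto simp: Simp_hom simp del: concat_eq_Nil_conv)
 thus ?thesis using s by (intro that[of ss]) (auto simp: blocks_def in_set_conv_nth simp del: set_concat)
qed

text \<open>The fold map of \<open>K\<close> copies is the concatenation of the fold maps of
  \<open>Ki i\<close> copies, so this is \<open>gproj_tflat\<close> at fold maps.\<close>

lemma Ez_flat: "Ez C K Z m \<cdot> tflat Zss m = fl (reps m) \<cdot> (Es m \<cdot> Ez C N T m)"
proof -
 \<comment> \<open>At a unit factor the dummy is the list with the single entry 0; its length fits,
   as \<open>conc\<close> of the empty list is 0.\<close>
 define ss where "ss = map (\<lambda>i. if Zss ! i = [] then [0] else fold_map (Ki i) m) [0..<N]"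
 define bs where "bs = map (\<lambda>i. conc (reps m ! i)) [0..<N]"
 have bs: "length bs = N" "!!i. [|i < N; Zss ! i \<noteq> []|] ==> bs ! i = conc (reps m ! i)" by (simp_all add: bs_def)
 have s: "length ss = N" "!!i. i < N ==> length (ss ! i) = Suc (bs ! i)"
  "!!i. i < N ==> set (ss ! i) \<subseteq> {..m}"
  using fold_map_values by (auto simp: ss_def bs_def fold_map_length reps Suc_conc conc_def[of "[]"])
 hence "set (concat ss) \<subseteq> {..m}" by (fastforce simp: in_set_conv_nth[of _ ss])
 note eq = gproj_tflat[OF reps(2) bs s(1,2) this]
 have "cut Zss ss = map (\<lambda>Zs. fold_map (length Zs) m) Zss"
  by (intro nth_equalityI) (auto simp: cut_def ss_def fold_map_def)
 moreover have "concat (map (\<lambda>Zs. fold_map (length Zs) m) Zss) = fold_map K m"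
  by (induction Zss) (simp_all add: fold_map_def replicate_add)
 ultimately have "Ez C K Z m \<cdot> tflat Zss m = fl (reps m) \<cdot> (ips (reps m) bs \<cdot> gproj N T m bs (concat ss))"
  using eq by (simp add: Ez_eq_gproj reps)
 also have "ips (reps m) bs \<cdot> gproj N T m bs (concat ss) = tens_upt N (\<lambda>i. gproj (Ki i) (Zi i) m (reps m ! i) (ss ! i)) \<cdot> Ez C N T m"
  unfolding ips_def using gprojs_Ez[OF shape(2)[OF reps(2)] bs s(1), of m] s(2,3) by (simp del: upt_Suc)
 also have "map (\<lambda>i. gproj (Ki i) (Zi i) m (reps m ! i) (ss ! i)) [0..<N] = map (\<lambda>i. Ez C (Ki i) (Zi i) m) [0..<N]"
  by (intro map_cong) (auto simp: Ez_eq_gproj reps ss_def gproj_zero)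
 finally show ?thesis .
qed

text \<open>The defining equations are the monotone cases of \<open>gproj_tflat\<close>. They
  determine the morphism because, after filling unit factors with dummies, they contain its
  composites with all projections.\<close>

lemma ttens_flat_eq: "ttens_flat C Zss = tflat Zss"
 unfolding ttens_flat_def
proof (rule the_equality)
 let ?P = "\<lambda>p. \<forall>m mss ss.
     length mss = length Zss \<and> length ss = length Zss \<and>
     (\<forall>i<length Zss. length (mss ! i) = length (Zss ! i) \<and> ss ! i \<noteq> [] \<and>
      (Zss ! i \<noteq> [] --> length (ss ! i) = Suc (conc (mss ! i)))) \<and>
     sorted (concat ss) \<and> set (concat ss) \<subseteq> {..m} -->
     ttens_proj C (concat Zss) m (concat mss)
       (concat (map (\<lambda>i. if Zss ! i = [] then [] else ss ! i) [0..<length Zss]))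
      \<cdot> p m
     = tens_flat C (map2 (map2 Fo) Zss mss)
      \<cdot> tens_upt (length Zss) (\<lambda>i. let b = length (ss ! i) - 1 in
         ttens_proj C (Zss ! i) b (mss ! i) (Idm Simp b))
      \<cdot> ttens_proj C (map (ttens C) Zss) m (map (\<lambda>s. length s - 1) ss) (concat ss)"
 have "?P (tflat Zss)"
 proof (intro allI impI)
  fix m mss and ss :: "nat list list"
  assume a: "length mss = length Zss \<and> length ss = length Zss \<and>
     (\<forall>i<length Zss. length (mss ! i) = length (Zss ! i) \<and> ss ! i \<noteq> [] \<and>
      (Zss ! i \<noteq> [] --> length (ss ! i) = Suc (conc (mss ! i)))) \<and>
     sorted (concat ss) \<and> set (concat ss) \<subseteq> {..m}"
  define bs where "bs = dims ss"
  have mss: "map length mss = map length Zss" using a by (intro shapeI) auto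
  have bs: "length bs = N" "!!i. [|i < N; Zss ! i \<noteq> []|] ==> bs ! i = conc (mss ! i)" using a by (simp_all add: bs_def dims_def)
  have l: "length (ss ! i) = Suc (bs ! i)" if "i < N" for i using a that by (simp add: bs_def dims_def)
  have s: "ss \<in> blocks N m" using a by (auto simp: blocks_def in_set_conv_nth simp del: set_concat)
  have "concat (cut Zss ss) \<in> Hom Simp (conc (concat mss)) m" if "0 < K"
  proof -
   have "map length (cut Zss ss) = map (\<lambda>ms. sum_list (map Suc ms)) mss"
    using shape(1,2)[OF mss] sum_list_mss[OF mss bs] l a
    by (intro nth_equalityI) (auto simp: cut_def)
   moreover have "sum_list (map Suc (concat xss)) = sum_list (map (\<lambda>ms. sum_list (map Suc ms)) xss)" for xss by (induction xss) auto
   moreover have "concat mss \<noteq> []" using that shape(3)[OF mss] by (simp only: length_greater_0_conv[symmetric])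
   ultimately have "length (concat (cut Zss ss)) = Suc (conc (concat mss))" by (simp add: length_concat Suc_conc del: concat_eq_Nil_conv)
   moreover have "set (concat (cut Zss ss)) \<subseteq> {..m}" using cut_subset[of ss Zss] a by blast
   ultimately show ?thesis using cut_sorted[of ss Zss] a by (simp add: Simp_hom del: set_concat)
  qed
  hence "ttens_proj C (concat Zss) m (concat mss) (concat (cut Zss ss)) = gproj K Z m (concat mss) (concat (cut Zss ss))"
   by (rule dec_proj_gproj[OF box_Z])
  moreover have "dec_proj C N T m bs (concat ss) = gproj N T m bs (concat ss)"
   unfolding bs_def by (rule dec_proj_gproj[OF box_T concat_hom[OF s]])
  moreover have "map (\<lambda>i. let b = length (ss ! i) - 1 in ttens_proj C (Zss ! i) b (mss ! i) (Idm Simp b)) [0..<length Zss] =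
    map (\<lambda>i. gproj (Ki i) (Zi i) (bs ! i) (mss ! i) [0..<Suc (bs ! i)]) [0..<N]"
  proof (intro map_cong refl)
   fix i assume "i \<in> set [0..<N]"
   hence i: "i < N" by simp
   have "dec_proj C (Ki i) (Zi i) (bs ! i) (mss ! i) (Idm Simp (bs ! i)) = gproj (Ki i) (Zi i) (bs ! i) (mss ! i) (Idm Simp (bs ! i))"
    using bs(2)[OF i] Simp_id_hom by (intro dec_proj_gproj[OF box_Zi[OF i]]) (auto simp: Simp_idm simp del: upt_Suc)
   thus "(let b = length (ss ! i) - 1 in ttens_proj C (Zss ! i) b (mss ! i) (Idm Simp b)) = gproj (Ki i) (Zi i) (bs ! i) (mss ! i) [0..<Suc (bs ! i)]"
    using l[OF i] by (simp add: Simp_idm Let_def del: upt_Suc)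
  qed
  moreover have "gproj K Z m (concat mss) (concat (cut Zss ss)) \<cdot> tflat Zss m = fl mss \<cdot> (ips mss bs \<cdot> gproj N T m bs (concat ss))"
   using a l by (intro gproj_tflat[OF mss bs]) auto
  ultimately show "ttens_proj C (concat Zss) m (concat mss)
       (concat (map (\<lambda>i. if Zss ! i = [] then [] else ss ! i) [0..<length Zss])) \<cdot> tflat Zss m
     = tens_flat C (map2 (map2 Fo) Zss mss)
      \<cdot> tens_upt (length Zss) (\<lambda>i. let b = length (ss ! i) - 1 in
         ttens_proj C (Zss ! i) b (mss ! i) (Idm Simp b))
      \<cdot> ttens_proj C (map (ttens C) Zss) m (map (\<lambda>s. length s - 1) ss) (concat ss)"
   unfolding ips_def fl_def bs_def[unfolded dims_def] length_map cut_def by (simp only:)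
 qed
 thus "tflat Zss \<in> Hom SC (ttens C (map (ttens C) Zss)) (ttens C (concat Zss)) \<and> ?P (tflat Zss)"
  using tflat_in by simp
 fix p assume p: "p \<in> Hom SC (ttens C (map (ttens C) Zss)) (ttens C (concat Zss)) \<and> ?P p"
 show "p = tflat Zss"
 proof (rule dec_ext[OF box_Z ttens_functor[OF ttens_objs[OF Zss]]])
  show "snat (ttens C (map (ttens C) Zss)) (dec_obj C K Z) p"
   "snat (ttens C (map (ttens C) Zss)) (dec_obj C K Z) (tflat Zss)"
   using p tflat_in by (simp_all add: ttens_def[of C "concat Zss"])
  fix m gs assume g: "gs \<in> blocks K m"
  then obtain gss where gss: "concat gss = gs" "map length gss = map length Zss" by (rule block_families)
  note sh = shape[OF gss(2)]
  have g': "concat gss \<in> blocks K m" using g gss(1) by simp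
  obtain ss where s: "ss \<in> blocks N m" "!!i. [|i < N; 0 < Ki i|] ==> ss ! i = concat (gss ! i)"
   using concat_families[OF gss(2) g'] by blast
  have ne: "length (concat (gss ! i)) = Suc (conc (dims (gss ! i)))" if "i < N" "Zss ! i \<noteq> []" for i
   using concat_hom[OF fam_block[OF gss(2) g' that(1)]] that(2) by (simp add: Simp_hom)
  have len: "length (map dims gss) = length Zss \<and> length ss = length Zss \<and>
     (\<forall>i<length Zss. length (map dims gss ! i) = length (Zss ! i) \<and> ss ! i \<noteq> [] \<and>
      (Zss ! i \<noteq> [] --> length (ss ! i) = Suc (conc (map dims gss ! i)))) \<and>
     sorted (concat ss) \<and> set (concat ss) \<subseteq> {..m}"
   using s sh ne blocksD(1)[OF s(1)] by (simp add: blocks_def)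
  have "gss ! i = []" if "i < N" "Zss ! i = []" for i using sh(2)[OF that(1)] that(2) by simp
  hence "map (\<lambda>i. if Zss ! i = [] then [] else ss ! i) [0..<length Zss] = map concat gss"
   using sh s(2) by (intro nth_equalityI) auto
  hence "ttens_proj C (concat Zss) m (concat (map dims gss)) (concat (map (\<lambda>i. if Zss ! i = [] then [] else ss ! i) [0..<length Zss])) =
    bproj K Z m gs"
   unfolding bproj_def gss(1)[symmetric] dims_concat by (simp add: concat_concat_map)
  thus "bproj K Z m gs \<cdot> p m = bproj K Z m gs \<cdot> tflat Zss m"
   using p[THEN conjunct2, rule_format, OF len] \<open>?P (tflat Zss)\<close>[rule_format, OF len] by simp
 qed
qed

abbreviation (input) "TO \<equiv> map (tensO SC) Zss"
abbreviation (input) "As m \<equiv> tens_upt N (\<lambda>i. Aw C (Ki i) (Zi i) m)"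

lemma box_TO: "msimplicial N (box C TO)"
 using box_functor[OF tensO_objs[OF Zss]] by simp

lemma Awi_nat: "i < N ==> snat (TO ! i) (map (ttens C) Zss ! i) (Aw C (Ki i) (Zi i))"
 using Aw_box[OF Zi] by simp

lemma middle_reps: "middle (reps m) = Fo (box C TO) (rep N m)"
 unfolding middle_def box_Fo[of C TO] by (rule arg_cong[where f = "tensO C"]) (intro nth_equalityI; simp add: Fo_reps)

lemma FoT_rep: "tensO C (map (\<lambda>i. Fo (ttens C (Zss ! i)) m) [0..<N]) = Fo T (rep N m)"
 unfolding box_Fo by (rule arg_cong[where f = "tensO C"]) (intro nth_equalityI; simp)

lemma As_in: "As m \<in> Hom C (Fo (box C TO) (rep N m)) (Fo T (rep N m))"
 using multi_nat_in[OF box_map_family(1)[where n = N, OF _ _ tensO_objs[OF Zss] ttens_objs[OF Zss] Awi_nat] length_replicate]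
  box_map_family(2)[OF _ _ tensO_objs[OF Zss] ttens_objs[OF Zss] Awi_nat, of N] by simp

lemma EzAw_As: "EzAw C N T m \<cdot> As m = As m \<cdot> EzAw C N (box C TO) m"
 using EzAw_family(2)[OF _ _ tensO_objs[OF Zss] ttens_objs[OF Zss] Awi_nat, of N] by simp

lemma dec_T: "dec_obj C N T = ttens C (map (ttens C) Zss)"
 by (simp add: ttens_def)

lemma tflat_at: "tflat Zss m \<in> Hom C (Fo (dec_obj C N T) m) (Fo (dec_obj C K Z) m)"
 using snat_in[OF tflat_in, of m] by (simp add: dec_T ttens_def[of C "concat Zss"])

lemma Es_at: "Es m \<in> Hom C (Fo T (rep N m)) (Fo (box C TO) (rep N m))"
 using Es_in[of m] by (simp add: FoT_rep middle_reps)

lemmas oTO = mobj[OF box_TO length_replicate] and oT = mobj[OF box_T length_replicate]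
 and oD = sobj_obj[OF dec_sobj[OF box_T]] and oK = sobj_obj[OF dec_sobj[OF box_Z]] and oZ = mobj[OF box_Z length_replicate]
 and ez = diag_in(1)[OF box_T] and aw = diag_in(2)[OF box_T] and ezZ = diag_in(1)[OF box_Z] and awZ = diag_in(2)[OF box_Z]

lemma tens_Aw_comp:
 assumes "!!i. i < N ==> x i \<in> Obj C" "!!i. i < N ==> f i \<in> Hom C (Fo (ttens C (Zss ! i)) m) (x i)"
 shows "tens_upt N f \<cdot> As m = tens_upt N (\<lambda>i. f i \<cdot> Aw C (Ki i) (Zi i) m)"
 using assms sobj_obj[OF ttens_functor[OF Zi]] sobj_obj[OF tensO_sobj[OF Zi]] snat_in[OF Aw_box[OF Zi]]
 by (intro tensM_comp_upt[where x = "\<lambda>i. Fo (tensO SC (Zss ! i)) m" and y = "\<lambda>i. Fo (ttens C (Zss ! i)) m" and z = x]) blast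

text \<open>The inner AW maps form a morphism between outer products, so naturality moves
  \<open>E = EZ AW\<close> of the outer product to the right of them.\<close>

lemma Ez_Aw_As:
 assumes o: "a \<in> Obj C" and P: "P \<in> Hom C (Fo T (rep N m)) a"
 shows "(P \<cdot> Ez C N T m) \<cdot> (Aw C N T m \<cdot> As m) = (P \<cdot> As m) \<cdot> EzAw C N (box C TO) m"
proof -
 have "(P \<cdot> Ez C N T m) \<cdot> (Aw C N T m \<cdot> As m) = P \<cdot> (Ez C N T m \<cdot> (Aw C N T m \<cdot> As m))"
  by (rule assoc[OF oTO oD oT o comp_in[OF oTO oT oD As_in aw] ez P])
 also have "Ez C N T m \<cdot> (Aw C N T m \<cdot> As m) = EzAw C N T m \<cdot> As m"
  using assoc[OF oTO oT oD oT As_in aw ez] by (simp add: EzAw_def)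
 also have "P \<cdot> \<dots> = (P \<cdot> As m) \<cdot> EzAw C N (box C TO) m"
  unfolding EzAw_As by (rule assoc[OF oTO oTO oT o diag_in(3)[OF box_TO] As_in P, symmetric])
 finally show ?thesis .
qed

text \<open>The inner restrictions factor through a restriction of the outer product to consecutive
  blocks, and such a restriction absorbs \<open>E\<close>.\<close>

lemma blocks_EzAw:
 assumes g: "map length gss = map length Zss" "concat gss \<in> blocks K m"
 shows "tens_upt N (\<lambda>i. Fm (Zi i) (reps m ! i) (dims (gss ! i)) (gss ! i)) \<cdot> EzAw C N (box C TO) m =
  tens_upt N (\<lambda>i. Fm (Zi i) (reps m ! i) (dims (gss ! i)) (gss ! i))"
proof -
 note fam_block = fam_block[OF g]
 obtain ss where sb: "ss \<in> blocks N m" and c: "!!i. [|i < N; 0 < Ki i|] ==> ss ! i = concat (gss ! i)"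
  using concat_families[OF g] by blast
 \<comment> \<open>By \<open>block_factor\<close>, \<open>B\<close> is the outer block acting on an
   inner product and \<open>A\<close> subdivides it into the inner blocks.\<close>
 define A where "A i = Fm (Zi i) (rep (Ki i) (dims ss ! i)) (dims (gss ! i)) (id_blocks (dims (gss ! i)))" for i
 define B where "B i = Fm (TO ! i) (rep N m ! i) (dims ss ! i) (ss ! i)" for i
 have b: "ss ! i \<in> Hom Simp (dims ss ! i) m" if "i < N" for i using blocks_hom[OF sb] that by simp
 note f = block_factor[OF box_Zi fam_block b c]
 have A: "A i \<in> Hom C (Fo (TO ! i) (dims ss ! i)) (Fo (Zi i) (dims (gss ! i)))" if i: "i < N" for i
  using mmap[OF box_Zi[OF i] length_replicate dims_len[OF fam_block[OF i]] f(1)[OF i i i i]] box_diag[of C "Zss ! i"] i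
  by (simp add: A_def restr_def diag_def) (metis ftor.select_convs(1))
 have tO: "simplicial (TO ! i)" if "i < N" for i using tensO_sobj[OF Zi[OF that]] that by simp
 have B: "B i \<in> Hom C (Fo (TO ! i) m) (Fo (TO ! i) (dims ss ! i))" if i: "i < N" for i
  using sobj_map[OF tO[OF i] b[OF i]] i by (simp add: B_def)
 have AB: "A i \<cdot> B i = Fm (Zi i) (reps m ! i) (dims (gss ! i)) (gss ! i)" if i: "i < N" for i
  using f(2)[OF i i i i] i by (simp add: A_def B_def reps box_diag)
 have "tens_upt N A \<cdot> tens_upt N B = tens_upt N (\<lambda>i. A i \<cdot> B i)"
  using A B sobj_obj[OF tO] mobj[OF box_Zi dims_len[OF fam_block]]
  by (intro tensM_comp_upt[where x = "\<lambda>i. Fo (TO ! i) m" and y = "\<lambda>i. Fo (TO ! i) (dims ss ! i)" and z = "\<lambda>i. Fo (Zi i) (dims (gss ! i))"]) blast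
 also have "\<dots> = tens_upt N (\<lambda>i. Fm (Zi i) (reps m ! i) (dims (gss ! i)) (gss ! i))" using AB by (intro arg_cong[where f = "tensM C"] map_cong) auto
 finally have eq: "tens_upt N A \<cdot> tens_upt N B = \<dots>" .
 have tB: "tens_upt N B = Fm (box C TO) (rep N m) (dims ss) ss" unfolding box_Fm B_def by simp
 note d = dims_len[OF sb]
 have e: "Fo (box C TO) (dims ss) = tensO C (map (\<lambda>i. Fo (TO ! i) (dims ss ! i)) [0..<N])"
  unfolding box_Fo using d by (intro arg_cong[where f = "tensO C"] nth_equalityI) auto
 have tA: "tens_upt N A \<in> Hom C (Fo (box C TO) (dims ss)) (tensO C (map (\<lambda>i. Fo (Zi i) (dims (gss ! i))) [0..<N]))"
  unfolding e using A sobj_obj[OF tO] mobj[OF box_Zi dims_len[OF fam_block]] by (intro tensM_in homs_upt) blast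
 have oz: "tensO C (map (\<lambda>i. Fo (Zi i) (dims (gss ! i))) [0..<N]) \<in> Obj C" using mobj[OF box_Zi dims_len[OF fam_block]] by (auto intro!: tensO_obj)
 note o = mobj[OF box_TO length_replicate, of m]
 show ?thesis
  unfolding eq[symmetric] tB
  using assoc[OF o o mobj[OF box_TO d] oz diag_in(3)[OF box_TO] mmap[OF box_TO length_replicate d blocks_hom[OF sb]] tA]
   block_EzAw[OF box_TO sb] by simp
qed

lemma Fm_reps:
 assumes "map length gss = map length Zss"
 shows "map (\<lambda>i. Fm (Zi i) (reps m ! i) (map dims gss ! i) (gss ! i)) [0..<N] = map (\<lambda>i. Fm (Zi i) (reps m ! i) (dims (gss ! i)) (gss ! i)) [0..<N]"
 using shape(1)[OF assms] by simp

lemma fl_reps_in: "fl (reps m) \<in> Hom C (Fo (box C TO) (rep N m)) (Fo Z (rep K m))"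
 using fl_in[OF reps(2)] by (simp add: middle_reps reps)

text \<open>Tested on projections. On a group of blocks the inner AW maps turn projections into
  restrictions, and the remaining outer \<open>E\<close> is absorbed by
  \<open>blocks_EzAw\<close>.\<close>

lemma Aw_flat: "tflat Zss m \<cdot> (Aw C N T m \<cdot> As m) = Aw C K Z m \<cdot> fl (reps m)"
proof -
 interpret S: category SC by (rule Sim_category)
 let ?As = "tensM SC (map (\<lambda>Zs. Aw C (length Zs) (box C Zs)) Zss)"
 have As: "?As n = As n" for n
  by (simp add: Sim_tensM o_def map_index_upt[of "\<lambda>Zs. Aw C (length Zs) (box C Zs) n" Zss])
 have o: "tensO SC TO \<in> Obj SC" "tensO SC (map (ttens C) Zss) \<in> Obj SC"
  "ttens C (map (ttens C) Zss) \<in> Obj SC" "ttens C (concat Zss) \<in> Obj SC" "tensO SC (concat Zss) \<in> Obj SC"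
  using tensO_sobj[OF tensO_objs[OF Zss]] tensO_sobj[OF ttens_objs[OF Zss]] ttens_functor[OF ttens_objs[OF Zss]]
   ttens_functor[OF Zss] tensO_sobj[OF Zss] by simp_all
 have h: "?As \<in> Hom SC (tensO SC TO) (tensO SC (map (ttens C) Zss))"
  using Sim_tensM_nat[OF tensO_objs[OF Zss] ttens_objs[OF Zss]] Awi_nat by simp
 have hT: "Aw C N T \<in> Hom SC (tensO SC (map (ttens C) Zss)) (ttens C (map (ttens C) Zss))" using Aw_box[OF ttens_objs[OF Zss]] by simp
 have "tflat Zss \<odot> (Aw C N T \<odot> ?As) = Aw C K Z \<odot> tens_flat SC Zss"
 proof (rule dec_ext[OF box_Z])
  show "simplicial (tensO SC TO)" using o(1) by simp
  have "tflat Zss \<in> Hom SC (ttens C (map (ttens C) Zss)) (ttens C (concat Zss))" using tflat_in by simp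
  from S.comp_in[OF o(1,3,4) S.comp_in[OF o(1,2,3) h hT] this]
  show "snat (tensO SC TO) (dec_obj C K Z) (tflat Zss \<odot> (Aw C N T \<odot> ?As))"
   by (simp add: ttens_def[of C "concat Zss"])
  have "tens_flat SC Zss \<in> Hom SC (tensO SC TO) (tensO SC (concat Zss))"
   "Aw C K Z \<in> Hom SC (tensO SC (concat Zss)) (ttens C (concat Zss))" using flat_hom Aw_box[OF Zss] by simp_all
  from S.comp_in[OF o(1,5,4) this]
  show "snat (tensO SC TO) (dec_obj C K Z) (Aw C K Z \<odot> tens_flat SC Zss)"
   by (simp add: ttens_def[of C "concat Zss"])
  fix m gs assume gs: "gs \<in> blocks K m"
  then obtain gss where e: "concat gss = gs" and sh: "map length gss = map length Zss" by (rule block_families)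
  have g: "concat gss \<in> blocks K m" using gs e by simp
  note di = dims_len[OF fam_block[OF sh g]]
  let ?dss = "map dims gss"
  let ?F = "\<lambda>i. Fm (Zi i) (reps m ! i) (dims (gss ! i)) (gss ! i)" and ?P = "\<lambda>i. gproj (Ki i) (Zi i) m (dims (gss ! i)) (concat (gss ! i))"
  let ?f = "tens_upt N ?F" and ?p = "tens_upt N ?P"
  have s1: "length gss = N" using shape(1)[OF sh] .
  have dss: "map length ?dss = map length Zss" using sh by (simp add: o_def)
  have mid: "middle ?dss = tensO C (map (\<lambda>i. Fo (Zi i) (dims (gss ! i))) [0..<N])"
   unfolding middle_def using s1 by (intro arg_cong[where f = "tensO C"]) simp
  note oM = middle_obj[OF dss]
  note oZb = mobj[OF box_Z dims_len[OF g]]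
  have oZd: "Fo Z (concat ?dss) = Fo Z (dims (concat gss))" by (simp add: dims_concat)
  have Pin: "?P i \<in> Hom C (Fo (ttens C (Zss ! i)) m) (Fo (Zi i) (dims (gss ! i)))" if i: "i < N" for i
   using gproj_block[OF box_Zi[OF i] fam_block[OF sh g i]] bproj_in[OF box_Zi[OF i] fam_block[OF sh g i]] by (simp add: ttens_def)
  hence p: "?p \<in> Hom C (Fo T (rep N m)) (middle ?dss)"
   unfolding mid FoT_rep[symmetric]
   using sobj_obj[OF ttens_functor[OF Zi]] mobj[OF box_Zi di] by (intro tensM_in homs_upt) blast
  have "?p \<cdot> As m = tens_upt N (\<lambda>i. ?P i \<cdot> Aw C (Ki i) (Zi i) m)"
   by (rule tens_Aw_comp[OF mobj[OF box_Zi di] Pin])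
  also have "\<dots> = ?f"
   using gproj_block[OF box_Zi fam_block[OF sh g]] bproj_Aw[OF box_Zi fam_block[OF sh g]] by (intro arg_cong[where f = "tensM C"] map_cong) (simp_all add: reps)
  finally have pA: "?p \<cdot> As m = ?f" .
  have fd: "fl ?dss \<in> Hom C (middle ?dss) (Fo Z (dims (concat gss)))" using fl_in[OF dss] unfolding oZd .
  note awA = comp_in[OF oTO oT oD As_in aw]
  have "bproj K Z m (concat gss) \<cdot> (tflat Zss m \<cdot> (Aw C N T m \<cdot> As m)) = (bproj K Z m (concat gss) \<cdot> tflat Zss m) \<cdot> (Aw C N T m \<cdot> As m)"
   by (rule assoc[OF oTO oD oK oZb awA tflat_at bproj_in[OF box_Z g], symmetric])
  also have "\<dots> = fl ?dss \<cdot> ((?p \<cdot> Ez C N T m) \<cdot> (Aw C N T m \<cdot> As m))"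
   unfolding block_tflat[OF sh g] by (rule assoc[OF oTO oD oM oZb awA comp_in[OF oD oT oM ez p] fd])
  also have "(?p \<cdot> Ez C N T m) \<cdot> (Aw C N T m \<cdot> As m) = ?f"
   unfolding Ez_Aw_As[OF oM p] pA by (rule blocks_EzAw[OF sh g])
  also have "fl ?dss \<cdot> ?f = Fm Z (rep K m) (dims (concat gss)) (concat gss) \<cdot> fl (reps m)"
   using block_fl[OF sh g] unfolding Fm_reps[OF sh] by simp
  also have "\<dots> = bproj K Z m (concat gss) \<cdot> (Aw C K Z m \<cdot> fl (reps m))"
   using assoc[OF oTO oZ oK oZb fl_reps_in awZ bproj_in[OF box_Z g]] bproj_Aw[OF box_Z g] by simp
  finally show "bproj K Z m gs \<cdot> (tflat Zss \<odot> (Aw C N T \<odot> ?As)) m = bproj K Z m gs \<cdot> (Aw C K Z \<odot> tens_flat SC Zss) m"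
   by (simp add: e As fl_reps)
 qed
 from fun_cong[OF this, of m] show ?thesis by (simp add: As fl_reps)
qed

text \<open>\<open>Aw_flat\<close> inserts the canonical morphism between EZ and AW,
  \<open>Ez_flat\<close> removes it, and naturality of the outer \<open>E\<close> with respect to
  the inner AW maps brings the factors into order.\<close>

lemma EzAw_flat:
 "EzAw C K Z m \<cdot> fl (reps m) = fl (reps m) \<cdot> (tens_upt N (\<lambda>i. EzAw C (Ki i) (Zi i) m) \<cdot> EzAw C N (box C TO) m)"
proof -
 note awA = comp_in[OF oTO oT oD As_in aw]
 have "EzAw C K Z m \<cdot> fl (reps m) = Ez C K Z m \<cdot> (tflat Zss m \<cdot> (Aw C N T m \<cdot> As m))"
  unfolding Aw_flat using assoc[OF oTO oZ oK oZ fl_reps_in awZ ezZ] by (simp add: EzAw_def)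
 also have "\<dots> = (fl (reps m) \<cdot> (Es m \<cdot> Ez C N T m)) \<cdot> (Aw C N T m \<cdot> As m)"
  unfolding Ez_flat[symmetric] by (rule assoc[OF oTO oD oK oZ awA tflat_at ezZ, symmetric])
 also have "\<dots> = fl (reps m) \<cdot> ((Es m \<cdot> Ez C N T m) \<cdot> (Aw C N T m \<cdot> As m))"
  by (rule assoc[OF oTO oD oTO oZ awA comp_in[OF oD oT oTO ez Es_at] fl_reps_in])
 also have "(Es m \<cdot> Ez C N T m) \<cdot> (Aw C N T m \<cdot> As m) = (Es m \<cdot> As m) \<cdot> EzAw C N (box C TO) m"
  by (rule Ez_Aw_As[OF oTO Es_at])
 also have "Es m \<cdot> As m = tens_upt N (\<lambda>i. Ez C (Ki i) (Zi i) m \<cdot> Aw C (Ki i) (Zi i) m)"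
  by (rule tens_Aw_comp[OF sobj_obj[OF tensO_sobj[OF Zi]] snat_in[OF Ez_box[OF Zi]]])
 finally show ?thesis by (simp add: EzAw_def)
qed

context
 fixes Ys :: "('o, 'm) sobj list" and gs :: "(nat => 'm) list" and f :: 'm and a :: 'o and m :: nat
 assumes Ys: "set Ys \<subseteq> Obj SC" "length Ys = N" "length gs = N"
begin

text \<open>\<open>Ez_flat\<close> combined with naturality of the outer EZ in the morphisms
  \<open>gs\<close>, evaluated on a generalized element \<open>f\<close>.\<close>

lemma EzC_composition:
 assumes g: "!!i. i < N ==> gs ! i \<in> Hom SC (Ys ! i) (ttens C (Zss ! i))"
  and a: "a \<in> Obj C" "f \<in> Hom C a (Fo (ttens C Ys) m)"
 shows "Ez C K Z m \<cdot> (tflat Zss m \<cdot> (ttens_map C Ys (map (ttens C) Zss) gs m \<cdot> f)) =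
  fl (reps m) \<cdot> (tens_upt N (\<lambda>i. Ez C (Ki i) (Zi i) m \<cdot> (gs ! i) m) \<cdot> (Ez C N (box C Ys) m \<cdot> f))"
proof -
 have gs: "map (\<lambda>i. gs ! i) [0..<N] = gs" using Ys(3) by (metis map_nth)
 have g': "snat (Ys ! i) (map (ttens C) Zss ! i) (gs ! i)" if "i < N" for i using g[OF that] that by simp
 note fam = box_map_family[OF Ys(2) length_map Ys(1) ttens_objs[OF Zss] g', unfolded gs]
 let ?G = "tens_upt N (\<lambda>i. (gs ! i) m)" and ?t = "ttens_map C Ys (map (ttens C) Zss) gs m"
 have Y: "msimplicial N (box C Ys)" using box_functor[OF Ys(1)] Ys(2) by simp
 note oY = sobj_obj[OF dec_sobj[OF Y], of m] and oYr = mobj[OF Y length_replicate, of m] and ezY = diag_in(1)[OF Y, of m]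
 have f: "f \<in> Hom C a (Fo (dec_obj C N (box C Ys)) m)" using a(2) Ys(2) by (simp add: ttens_def)
 have t: "?t \<in> Hom C (Fo (dec_obj C N (box C Ys)) m) (Fo (dec_obj C N T) m)"
  using snat_in[OF dec_map_nat[OF Y box_T fam(1)], of m] Ys(2) by (simp add: ttens_map_def)
 have G: "?G \<in> Hom C (Fo (box C Ys) (rep N m)) (Fo T (rep N m))"
  using multi_nat_in[OF fam(1) length_replicate, of m] fam(2)[of m] by simp
 note tf' = comp_in[OF a(1) oY oD f t]
 have nat: "Ez C N T m \<cdot> ?t = ?G \<cdot> Ez C N (box C Ys) m"
  using Ez_natural[OF Y box_T fam(1), of m] fam(2)[of m] Ys(2) by (simp add: ttens_map_def)
 have "Ez C K Z m \<cdot> (tflat Zss m \<cdot> (?t \<cdot> f)) = (Ez C K Z m \<cdot> tflat Zss m) \<cdot> (?t \<cdot> f)"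
  by (rule assoc[OF a(1) oD oK oZ tf' tflat_at ezZ, symmetric])
 also have "\<dots> = fl (reps m) \<cdot> ((Es m \<cdot> Ez C N T m) \<cdot> (?t \<cdot> f))"
  unfolding Ez_flat by (rule assoc[OF a(1) oD oTO oZ tf' comp_in[OF oD oT oTO ez Es_at] fl_reps_in])
 also have "(Es m \<cdot> Ez C N T m) \<cdot> (?t \<cdot> f) = Es m \<cdot> (Ez C N T m \<cdot> (?t \<cdot> f))"
  by (rule assoc[OF a(1) oD oT oTO tf' ez Es_at])
 also have "Ez C N T m \<cdot> (?t \<cdot> f) = ?G \<cdot> (Ez C N (box C Ys) m \<cdot> f)"
  using assoc[OF a(1) oY oD oT f t ez] assoc[OF a(1) oY oYr oT f ezY G] nat by simp
 also have "Es m \<cdot> (?G \<cdot> (Ez C N (box C Ys) m \<cdot> f)) = (Es m \<cdot> ?G) \<cdot> (Ez C N (box C Ys) m \<cdot> f)"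
  by (rule assoc[OF a(1) oYr oT oTO comp_in[OF a(1) oY oYr f ezY] G Es_at, symmetric])
 also have "Es m \<cdot> ?G = tens_upt N (\<lambda>i. Ez C (Ki i) (Zi i) m \<cdot> (gs ! i) m)"
 proof (rule tensM_comp_upt[where x = "\<lambda>i. Fo (Ys ! i) m" and y = "\<lambda>i. Fo (ttens C (Zss ! i)) m" and z = "\<lambda>i. Fo (tensO SC (Zss ! i)) m"], intro conjI)
  fix i assume i: "i < N"
  show "Fo (Ys ! i) m \<in> Obj C" using sobj_obj[OF nth_functor[OF Ys(1)]] i Ys(2) by simp
  show "(gs ! i) m \<in> Hom C (Fo (Ys ! i) m) (Fo (ttens C (Zss ! i)) m)" using snat_in[of "Ys ! i"] g[OF i] by simp
  show "Ez C (Ki i) (Zi i) m \<in> Hom C (Fo (ttens C (Zss ! i)) m) (Fo (tensO SC (Zss ! i)) m)" using snat_in[OF Ez_box[OF Zi[OF i]]] .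
 qed (use sobj_obj[OF ttens_functor[OF Zi]] sobj_obj[OF tensO_sobj[OF Zi]] in blast)+
 finally show ?thesis .
qed

text \<open>Naturality of the outer AW collects the inner AW maps behind it; \<open>Aw_flat\<close>
  then replaces all of them by the flattened one.\<close>

lemma AwC_composition:
 assumes g: "!!i. i < N ==> gs ! i \<in> Hom SC (Ys ! i) (tensO SC (Zss ! i))"
  and a: "a \<in> Obj C" "f \<in> Hom C a (Fo (tensO SC Ys) m)"
 shows "tflat Zss m \<cdot> (ttens_map C Ys (map (ttens C) Zss) (map (\<lambda>i. Aw C (Ki i) (Zi i) \<odot> gs ! i) [0..<N]) m \<cdot> (Aw C N (box C Ys) m \<cdot> f)) =
  Aw C K Z m \<cdot> (fl (reps m) \<cdot> (tens_upt N (\<lambda>i. (gs ! i) m) \<cdot> f))"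
proof -
 interpret S: category SC by (rule Sim_category)
 let ?h = "\<lambda>i. Aw C (Ki i) (Zi i) \<odot> gs ! i"
 have h: "snat (Ys ! i) (map (ttens C) Zss ! i) (?h i)" if i: "i < N" for i
 proof -
  have "?h i \<in> Hom SC (Ys ! i) (ttens C (Zss ! i))"
   using nth_functor[OF Ys(1)] Ys(2) i tensO_sobj[OF Zi[OF i]] ttens_functor[OF Zi[OF i]] g[OF i] Aw_box[OF Zi[OF i]]
   by (intro S.comp_in[of _ "tensO SC (Zss ! i)"]) simp_all
  thus ?thesis using i by simp
 qed
 have g': "snat (Ys ! i) (TO ! i) (gs ! i)" if "i < N" for i using g[OF that] that by simp
 note fam = box_map_family[OF Ys(2) length_map Ys(1) ttens_objs[OF Zss] h]
 note famg = box_map_family[OF Ys(2) length_map Ys(1) tensO_objs[OF Zss] g']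
 let ?G = "tens_upt N (\<lambda>i. (gs ! i) m)" and ?t = "ttens_map C Ys (map (ttens C) Zss) (map ?h [0..<N]) m"
 have Y: "msimplicial N (box C Ys)" using box_functor[OF Ys(1)] Ys(2) by simp
 note oY = sobj_obj[OF dec_sobj[OF Y], of m] and oYr = mobj[OF Y length_replicate, of m] and awY = diag_in(2)[OF Y, of m]
 have f: "f \<in> Hom C a (Fo (box C Ys) (rep N m))"
  using a(2) box_diag[of C Ys] Ys(2) by (simp add: restr_def diag_def) (metis ftor.select_convs(1))
 have t: "?t \<in> Hom C (Fo (dec_obj C N (box C Ys)) m) (Fo (dec_obj C N T) m)"
  using snat_in[OF dec_map_nat[OF Y box_T fam(1)], of m] Ys(2) by (simp add: ttens_map_def)
 have G: "?G \<in> Hom C (Fo (box C Ys) (rep N m)) (Fo (box C TO) (rep N m))"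
  using multi_nat_in[OF famg(1) length_replicate, of m] famg(2)[of m] by simp
 have "As m \<cdot> ?G = tens_upt N (\<lambda>i. Aw C (Ki i) (Zi i) m \<cdot> (gs ! i) m)"
 proof (rule tensM_comp_upt[where x = "\<lambda>i. Fo (Ys ! i) m" and y = "\<lambda>i. Fo (tensO SC (Zss ! i)) m" and z = "\<lambda>i. Fo (ttens C (Zss ! i)) m"], intro conjI)
  fix i assume i: "i < N"
  show "Fo (Ys ! i) m \<in> Obj C" using sobj_obj[OF nth_functor[OF Ys(1)]] i Ys(2) by simp
  show "(gs ! i) m \<in> Hom C (Fo (Ys ! i) m) (Fo (tensO SC (Zss ! i)) m)" using snat_in[of "Ys ! i"] g[OF i] by simp
  show "Aw C (Ki i) (Zi i) m \<in> Hom C (Fo (tensO SC (Zss ! i)) m) (Fo (ttens C (Zss ! i)) m)" using snat_in[OF Aw_box[OF Zi[OF i]]] .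
 qed (use sobj_obj[OF ttens_functor[OF Zi]] sobj_obj[OF tensO_sobj[OF Zi]] in blast)+
 hence "?t \<cdot> Aw C N (box C Ys) m = Aw C N T m \<cdot> (As m \<cdot> ?G)"
  using Aw_natural[OF Y box_T fam(1), of m] fam(2)[of m] Ys(2) by (simp add: ttens_map_def)
 hence "?t \<cdot> (Aw C N (box C Ys) m \<cdot> f) = (Aw C N T m \<cdot> (As m \<cdot> ?G)) \<cdot> f"
  using assoc[OF a(1) oYr oY oD f awY t] by simp
 also have "\<dots> = Aw C N T m \<cdot> (As m \<cdot> (?G \<cdot> f))"
  using assoc[OF a(1) oYr oT oD f comp_in[OF oYr oTO oT G As_in] aw] assoc[OF a(1) oYr oTO oT f G As_in] by simp
 also have "\<dots> = (Aw C N T m \<cdot> As m) \<cdot> (?G \<cdot> f)"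
  by (rule assoc[OF a(1) oTO oT oD comp_in[OF a(1) oYr oTO f G] As_in aw, symmetric])
 finally have "tflat Zss m \<cdot> (?t \<cdot> (Aw C N (box C Ys) m \<cdot> f)) = (tflat Zss m \<cdot> (Aw C N T m \<cdot> As m)) \<cdot> (?G \<cdot> f)"
  using assoc[OF a(1) oTO oD oK comp_in[OF a(1) oYr oTO f G] comp_in[OF oTO oT oD As_in aw] tflat_at] by simp
 also have "\<dots> = Aw C K Z m \<cdot> (fl (reps m) \<cdot> (?G \<cdot> f))"
  unfolding Aw_flat by (rule assoc[OF a(1) oTO oZ oK comp_in[OF a(1) oYr oTO f G] fl_reps_in awZ])
 finally show ?thesis .
qed

end

end

section \<open>The two functors of cooperads\<close>

context abelian_tensor_category
begin

lemma fold_map_1: "fold_map (Suc 0) n = [0..<Suc n]"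
 by (simp add: fold_map_def)

lemma dec_one: "dec_obj C (Suc 0) Z = restr Z (diag (Suc 0))" "dec_counit C (Suc 0) Z ns = Idm C (Fo Z ns)"
 by (simp_all add: dec_lower_def)

context
 fixes Y
 assumes Y: "simplicial Y"
begin

lemma box_one: "msimplicial (Suc 0) (box C [Y])"
 using box_functor[of "[Y]"] Y by simp

lemma Ez_one: "Ez C (Suc 0) (box C [Y]) n = Idm C (Fo Y n)"
proof -
 have c: "conc [n] = n" by (simp add: conc_def)
 have Y1: "restr (box C [Y]) (diag (Suc 0)) = Y" using box_diag[of C "[Y]"] by simp
 have "gamma Y n n [0..<Suc n] = Idm C (Fo Y n)" using gamma_mono[OF Y Simp_id_hom] sobj_id[OF Y] by simp
 thus ?thesis
  using id_left[OF sobj_obj[OF Y] sobj_obj[OF Y] id_in[OF sobj_obj[OF Y]]]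
  by (simp add: Ez_eq_gproj gproj_def fold_map_1 dec_one c Y1 box_Fo del: upt_Suc)
qed

text \<open>The fold map of one copy is an identity, hence so is EZ, and \<open>AW EZ = 1\<close>
  settles AW.\<close>

lemma Aw_one: "Aw C (Suc 0) (box C [Y]) n = Idm C (Fo Y n)"
proof -
 have Y1: "restr (box C [Y]) (diag (Suc 0)) = Y" using box_diag[of C "[Y]"] by simp
 have "Aw C (Suc 0) (box C [Y]) n \<in> Hom C (Fo Y n) (Fo Y n)" using snat_in[OF Aw_nat[OF box_one], of n] by (simp add: dec_one Y1)
 thus ?thesis
  using Aw_Ez[OF box_one, of n] id_right[OF sobj_obj[OF Y] sobj_obj[OF Y]] by (simp add: Ez_one dec_one Y1)
qed

end

lemma AW_functor: "is_coop_functor (coop_of SC) (tcoop C) (AW C)"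
 unfolding is_coop_functor_def
proof (intro conjI allI impI ballI)
 interpret S: category SC by (rule Sim_category)
 fix X
 show "X \<in> CObj (coop_of SC) ==> cmo (AW C) X \<in> CObj (tcoop C)" by (simp add: coop_of_def tcoop_def AW_def)
 show "X \<in> CObj (coop_of SC) ==> cmm (AW C) X [X] (CId (coop_of SC) X) = CId (tcoop C) (cmo (AW C) X)"
  using id_left[OF sobj_obj sobj_obj id_in[OF sobj_obj]] by (auto simp: coop_of_def tcoop_def AW_def Aw_one fun_eq_iff)
 show "cmm (AW C) X Ys f \<in> CMor (tcoop C) (cmo (AW C) X) (map (cmo (AW C)) Ys)"
  if "X \<in> CObj (coop_of SC)" "set Ys \<subseteq> CObj (coop_of SC)" "f \<in> CMor (coop_of SC) X Ys" for Ys f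
 proof -
  have *: "X \<in> Obj SC" "set Ys \<subseteq> Obj SC" "f \<in> Hom SC X (tensO SC Ys)" using that by (simp_all add: coop_of_def)
  have "Aw C (length Ys) (box C Ys) \<odot> f \<in> Hom SC X (ttens C Ys)"
   using Aw_box[OF *(2)] tensO_sobj[OF *(2)] ttens_functor[OF *(2)] * by (intro S.comp_in[of _ "tensO SC Ys"]) simp_all
  thus ?thesis by (simp add: tcoop_def AW_def)
 qed
 fix Ys Zss f gs
 assume "composable_coop (coop_of SC) X Ys Zss f gs"
 hence *: "X \<in> Obj SC" "set Ys \<subseteq> Obj SC" "set (concat Zss) \<subseteq> Obj SC" "f \<in> Hom SC X (tensO SC Ys)"
   "length Zss = length Ys" "length gs = length Ys" "!!i. i < length Ys ==> gs ! i \<in> Hom SC (Ys ! i) (tensO SC (Zss ! i))"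
  by (simp_all add: composable_coop_def coop_of_def)
 interpret sobj_lists C Zss by unfold_locales (rule *(3))
 have "(\<lambda>i. (gs ! i) m) = (\<lambda>g. g m) \<circ> (!) gs" for m by (simp add: o_def)
 hence m: "map (\<lambda>g. g m) gs = map (\<lambda>i. (gs ! i) m) [0..<length Zss]" for m using map_index_upt[of "\<lambda>g. g m" gs] *(5,6) by simp
 have "Aw C (length (concat Zss)) (box C (concat Zss)) m \<cdot> (fl (reps m) \<cdot> (tens_upt (length Zss) (\<lambda>i. (gs ! i) m) \<cdot> f m)) =
   tflat Zss m \<cdot> (ttens_map C Ys (map (ttens C) Zss) (map (\<lambda>i. Aw C (length (Zss ! i)) (box C (Zss ! i)) \<odot> gs ! i) [0..<length Zss]) m \<cdot> (Aw C (length Zss) (box C Ys) m \<cdot> f m))" for m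
  using * sobj_obj[of X] snat_in[of X _ f m] by (intro AwC_composition[symmetric]) simp_all
 thus "cmm (AW C) X (concat Zss) (CCmp (coop_of SC) X Ys Zss f gs) =
   CCmp (tcoop C) (cmo (AW C) X) (map (cmo (AW C)) Ys) (map (map (cmo (AW C))) Zss) (cmm (AW C) X Ys f)
    (map (\<lambda>i. cmm (AW C) (Ys ! i) (Zss ! i) (gs ! i)) [0..<length Ys])"
  by (simp add: AW_def coop_of_def tcoop_def ttens_flat_eq Sim_tensM fl_reps m *(5)[symmetric] fun_eq_iff)
qed

lemma EZ_functor: "is_coop_functor (tcoop C) (coop_of SC) (EZ C)"
 unfolding is_coop_functor_def
proof (intro conjI allI impI ballI)
 interpret S: category SC by (rule Sim_category)
 fix X
 show "X \<in> CObj (tcoop C) ==> cmo (EZ C) X \<in> CObj (coop_of SC)" by (simp add: coop_of_def tcoop_def EZ_def)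
 show "X \<in> CObj (tcoop C) ==> cmm (EZ C) X [X] (CId (tcoop C) X) = CId (coop_of SC) (cmo (EZ C) X)"
  using id_left[OF sobj_obj sobj_obj id_in[OF sobj_obj]] by (auto simp: coop_of_def tcoop_def EZ_def Ez_one fun_eq_iff)
 show "cmm (EZ C) X Ys f \<in> CMor (coop_of SC) (cmo (EZ C) X) (map (cmo (EZ C)) Ys)"
  if "X \<in> CObj (tcoop C)" "set Ys \<subseteq> CObj (tcoop C)" "f \<in> CMor (tcoop C) X Ys" for Ys f
 proof -
  have *: "X \<in> Obj SC" "set Ys \<subseteq> Obj SC" "f \<in> Hom SC X (ttens C Ys)" using that by (simp_all add: tcoop_def)
  have "Ez C (length Ys) (box C Ys) \<odot> f \<in> Hom SC X (tensO SC Ys)"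
   using Ez_box[OF *(2)] tensO_sobj[OF *(2)] ttens_functor[OF *(2)] * by (intro S.comp_in[of _ "ttens C Ys"]) simp_all
  thus ?thesis by (simp add: coop_of_def EZ_def)
 qed
 fix Ys Zss f gs
 assume "composable_coop (tcoop C) X Ys Zss f gs"
 hence *: "X \<in> Obj SC" "set Ys \<subseteq> Obj SC" "set (concat Zss) \<subseteq> Obj SC" "f \<in> Hom SC X (ttens C Ys)"
   "length Zss = length Ys" "length gs = length Ys" "!!i. i < length Ys ==> gs ! i \<in> Hom SC (Ys ! i) (ttens C (Zss ! i))"
  by (simp_all add: composable_coop_def tcoop_def)
 interpret sobj_lists C Zss by unfold_locales (rule *(3))
 have "Ez C (length (concat Zss)) (box C (concat Zss)) m \<cdot> (tflat Zss m \<cdot> (ttens_map C Ys (map (ttens C) Zss) gs m \<cdot> f m)) =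
   fl (reps m) \<cdot> (tens_upt (length Zss) (\<lambda>i. Ez C (length (Zss ! i)) (box C (Zss ! i)) m \<cdot> (gs ! i) m) \<cdot> (Ez C (length Zss) (box C Ys) m \<cdot> f m))" for m
  using * sobj_obj[of X] snat_in[of X _ f m] by (intro EzC_composition) simp_all
 thus "cmm (EZ C) X (concat Zss) (CCmp (tcoop C) X Ys Zss f gs) =
   CCmp (coop_of SC) (cmo (EZ C) X) (map (cmo (EZ C)) Ys) (map (map (cmo (EZ C))) Zss) (cmm (EZ C) X Ys f)
    (map (\<lambda>i. cmm (EZ C) (Ys ! i) (Zss ! i) (gs ! i)) [0..<length Ys])"
  by (simp add: EZ_def coop_of_def tcoop_def ttens_flat_eq Sim_tensM fl_reps o_def *(5)[symmetric] fun_eq_iff)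
qed

lemma AW_EZ: "coop_map_eq (tcoop C) (coop_comp (AW C) (EZ C)) coop_id"
 unfolding coop_map_eq_def
proof (intro conjI ballI allI impI)
 fix X Ys f assume "X \<in> CObj (tcoop C)" "set Ys \<subseteq> CObj (tcoop C)" "f \<in> CMor (tcoop C) X Ys"
 hence *: "X \<in> Obj SC" "set Ys \<subseteq> Obj SC" "f \<in> Hom SC X (ttens C Ys)" by (simp_all add: tcoop_def)
 let ?k = "length Ys" and ?Z = "box C Ys"
 have "Aw C ?k ?Z m \<cdot> (Ez C ?k ?Z m \<cdot> f m) = f m" for m
 proof -
  note Z = box_functor[OF *(2)]
  have f: "f m \<in> Hom C (Fo X m) (Fo (dec_obj C ?k ?Z) m)" using snat_in[of X _ f m] *(3) by (simp add: ttens_def)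
  have oX: "Fo X m \<in> Obj C" using sobj_obj[of X m] *(1) by simp
  note oD = sobj_obj[OF dec_sobj[OF Z], of m] and oZ = sobj_obj[OF diag_functor[OF Z], of m]
  show ?thesis
   using assoc[OF oX oD oZ oD f snat_in[OF Ez_nat[OF Z]] snat_in[OF Aw_nat[OF Z]]] id_left[OF oX oD f] by (simp add: Aw_Ez[OF Z])
 qed
 thus "cmm (coop_comp (AW C) (EZ C)) X Ys f = cmm coop_id X Ys f" by (simp add: coop_comp_def coop_id_def AW_def EZ_def fun_eq_iff)
qed (simp add: coop_comp_def coop_id_def AW_def EZ_def)

section \<open>Tensors with simplicial sets\<close>

abbreviation "cyl \<equiv> sten C Delta1"

abbreviation "cyl_in \<equiv> sten_in C Delta1"

context
 fixes K :: "'k sset" and X :: "('o, 'm) sobj" and n :: nat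
 assumes fin: "finite (Fo K n)" and X: "Fo X n \<in> Obj C"
begin

lemma sten_obj: "Fo (sten C K X) n \<in> Obj C"
 using copower_obj[OF fin X] by (simp add: sten_def)

lemma sten_in_in: "k \<in> Fo K n ==> sten_in C K X n k \<in> Hom C (Fo X n) (Fo (sten C K X) n)"
 using copower_in[OF fin X] by (simp add: sten_def sten_in_def)

lemma sten_desc:
 assumes "Fo Y n \<in> Obj C" "!!k. k \<in> Fo K n ==> h n k \<in> Hom C (Fo X n) (Fo Y n)"
 shows "sten_desc C K X Y h n \<in> Hom C (Fo (sten C K X) n) (Fo Y n)"
  and "k \<in> Fo K n ==> sten_desc C K X Y h n \<cdot> sten_in C K X n k = h n k"
 using copower_desc[OF fin X assms] by (simp_all add: sten_def sten_in_def sten_desc_def)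

lemma sten_ext:
 assumes "b \<in> Obj C" "g \<in> Hom C (Fo (sten C K X) n) b" "h \<in> Hom C (Fo (sten C K X) n) b"
  "!!k. k \<in> Fo K n ==> g \<cdot> sten_in C K X n k = h \<cdot> sten_in C K X n k"
 shows "g = h"
 using copower_ext[OF fin X assms(1), of g h] assms(2-4) by (simp add: sten_def sten_in_def)

lemma sten_map:
 assumes Y: "Fo Y n \<in> Obj C" "f n \<in> Hom C (Fo X n) (Fo Y n)"
 shows "sten_map C K X Y f n \<in> Hom C (Fo (sten C K X) n) (Fo (sten C K Y) n)"
  and "k \<in> Fo K n ==> sten_map C K X Y f n \<cdot> sten_in C K X n k = sten_in C K Y n k \<cdot> f n"
proof -
 have Y': "Fo (sten C K Y) n \<in> Obj C" using copower_obj[OF fin Y(1)] by (simp add: sten_def)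
 have "sten_in C K Y n k \<cdot> f n \<in> Hom C (Fo X n) (Fo (sten C K Y) n)" if "k \<in> Fo K n" for k
  using comp_in[OF X Y(1) Y' Y(2)] copower_in[OF fin Y(1) that] by (simp add: sten_def sten_in_def)
 from sten_desc[where Y = "sten C K Y" and h = "\<lambda>n k. sten_in C K Y n k \<cdot> f n", OF Y' this]
 show "sten_map C K X Y f n \<in> Hom C (Fo (sten C K X) n) (Fo (sten C K Y) n)"
  "k \<in> Fo K n ==> sten_map C K X Y f n \<cdot> sten_in C K X n k = sten_in C K Y n k \<cdot> f n"
  unfolding sten_map_def by simp_all
qed

end

text \<open>The copies of \<open>X\<close> are jointly epic, so naturality is an equation on each
  copy, where a structure map also moves the index of the copy.\<close>

lemma sten_nat:
 assumes fin: "!!n. finite (Fo K n)" and act: "!!m n a k. [|a \<in> Hom Simp m n; k \<in> Fo K n|] ==> Fm K n m a k \<in> Fo K m"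
  and X: "simplicial X" and Y: "simplicial Y"
  and F: "!!n. F n \<in> Hom C (Fo (sten C K X) n) (Fo Y n)"
  and Fh: "!!n k. k \<in> Fo K n ==> F n \<cdot> sten_in C K X n k = h n k"
  and nat: "!!m n a k. [|a \<in> Hom Simp m n; k \<in> Fo K n|] ==> Fm Y n m a \<cdot> h n k = h m (Fm K n m a k) \<cdot> Fm X n m a"
 shows "snat (sten C K X) Y F"
 unfolding is_nat_trans_def
proof (intro conjI ballI)
 fix n m a assume "a \<in> Hom Simp_op n m"
 hence a: "a \<in> Hom Simp m n" by simp
 note oX = sobj_obj[OF X] and oY = sobj_obj[OF Y]
 note oS = sten_obj[OF fin oX]
 let ?j = "\<lambda>k. sten_in C K X m (Fm K n m a k)"
 have j: "?j k \<in> Hom C (Fo X m) (Fo (sten C K X) m)" if "k \<in> Fo K n" for k by (rule sten_in_in[OF fin oX act[OF a that]])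
 have "?j k \<cdot> Fm X n m a \<in> Hom C (Fo X n) (Fo (sten C K X) m)" if "k \<in> Fo K n" for k
  by (rule comp_in[OF oX oX oS sobj_map[OF X a] j[OF that]])
 note S = copower_desc[OF fin oX[of n] oS[of m] this]
 have S: "Fm (sten C K X) n m a \<in> Hom C (Fo (sten C K X) n) (Fo (sten C K X) m)"
  "k \<in> Fo K n ==> Fm (sten C K X) n m a \<cdot> sten_in C K X n k = ?j k \<cdot> Fm X n m a" for k
  using S by (simp_all add: sten_def sten_in_def)
 show "Fm Y n m a \<cdot> F n = F m \<cdot> Fm (sten C K X) n m a"
 proof (rule sten_ext[OF fin oX oY])
  show "Fm Y n m a \<cdot> F n \<in> Hom C (Fo (sten C K X) n) (Fo Y m)" by (rule comp_in[OF oS oY oY F sobj_map[OF Y a]])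
  show "F m \<cdot> Fm (sten C K X) n m a \<in> Hom C (Fo (sten C K X) n) (Fo Y m)" by (rule comp_in[OF oS oS oY S(1) F])
  fix k assume k: "k \<in> Fo K n"
  note i = sten_in_in[OF fin oX k]
  show "(Fm Y n m a \<cdot> F n) \<cdot> sten_in C K X n k = (F m \<cdot> Fm (sten C K X) n m a) \<cdot> sten_in C K X n k"
   using assoc[OF oX oS oY oY i F sobj_map[OF Y a]] assoc[OF oX oS oS oY i S(1) F]
    assoc[OF oX oX oS oY sobj_map[OF X a] j[OF k] F] S(2)[OF k] Fh[OF k] Fh[OF act[OF a k]] nat[OF a k] by simp
 qed
qed (rule F)

end

section \<open>The Shih operators\<close>

lemma Delta1_simps: "Fo Delta1 n = Hom Simp n 1" "Fm Delta1 n m a p = map ((!) p) a"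
 by (simp_all add: Delta1_def Simp_cmp)

lemma Delta1_finite: "finite (Fo Delta1 n)"
proof (rule finite_subset)
 show "Fo Delta1 n \<subseteq> {p. set p \<subseteq> {..1} \<and> length p = Suc n}" by (auto simp: Delta1_simps Simp_hom)
qed (simp add: finite_lists_length_eq)

lemma Delta1_act: "[|a \<in> Hom Simp m n; p \<in> Fo Delta1 n|] ==> Fm Delta1 n m a p \<in> Fo Delta1 m"
 using Simp_comp_hom[of a m n p 1] by (simp add: Delta1_simps)

lemma sset_pow_finite: "finite (Fo K n) ==> finite (Fo (sset_pow k K) n)"
 using finite_lists_length_eq[of "Fo K n" k] by (simp add: sset_pow_def conj_commute)

abbreviation "zeros p \<equiv> length (filter (\<lambda>x. x = (0::nat)) p)"

lemma sorted_01: "[|sorted p; set p \<subseteq> {..1}|] ==> p = rep (zeros p) 0 @ rep (length p - zeros p) 1"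
proof (induction p)
 case (Cons x p)
 hence IH: "p = rep (zeros p) 0 @ rep (length p - zeros p) 1" by simp
 consider "x = 0" | "x = 1" "filter (\<lambda>x. x = 0) p = []" using Cons.prems by (fastforce simp: filter_empty_conv)
 thus ?case
 proof cases
  case 1
  thus ?thesis using IH by simp
 next
  case 2
  hence "p = rep (length p) 1" using IH by simp
  thus ?thesis using 2 by simp
 qed
qed simp

lemma sorted_split: "sorted a ==> a = filter (\<lambda>j. j < (c::nat)) a @ filter (\<lambda>j. \<not> j < c) a"
proof (induction a)
 case (Cons x a)
 show ?case
 proof (cases "x < c")
  case False
  hence "filter (\<lambda>j. j < c) a = []" "filter (\<lambda>j. \<not> j < c) a = a" using Cons.prems by (auto simp: filter_empty_conv filter_id_conv)
  thus ?thesis using False by simp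
 qed (use Cons in simp)
qed simp

text \<open>Like a join of two maps, with the size of the front codomain as parameter and both parts
  allowed to be empty. This treats all fibres of a simplex of \<open>Delta1\<close> alike.\<close>

definition glue :: "nat => nat list => nat list => nat list" where
 "glue c a b = a @ map ((+) c) b"

lemma glue_hom: "[|length a = c'; sorted a; set a \<subseteq> {..<c}; b \<in> Hom Simp m n|] ==> glue c a b \<in> Hom Simp (c' + m) (c + n)"
 by (fastforce simp: Simp_hom glue_def sorted_append sorted_map intro: sorted_wrt_mono_rel[of _ "(\<le>)"])

lemma glue_comp:
 assumes "length a = c'" "set a' \<subseteq> {..<c'}" "set b' \<subseteq> {..<length b}"
 shows "map ((!) (glue c a b)) (glue c' a' b') = glue c (map ((!) a) a') (map ((!) b) b')"
 using assms by (auto simp: glue_def nth_append subset_iff)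

lemma upt_id: "sorted [0..<c]" "set [0..<c] \<subseteq> {..<c}" "length [0..<c] = c" "map ((!) [0..<c]) [0..<c] = [0..<c]"
 using map_nth[of "[0..<c]"] by auto

text \<open>Indexed by the number of vertices in front instead of by a simplex; the value 0, absent
  from \<open>shift\<close>, gives the unshifted object and thus the component at the constant map
  1.\<close>

definition shiftc :: "nat => (nat, nat list, nat, nat list) ftor" where
 "shiftc c = \<lparr>Fo = (+) c, Fm = (\<lambda>m n. glue c [0..<c])\<rparr>"

lemma shift_eq: "shift a = shiftc (Suc a)"
 by (simp add: shift_def shiftc_def glue_def fun_eq_iff conc_def Simp_idm del: upt_Suc)

text \<open>The fibre of \<open>p\<close> over 0 consists of the first \<open>c\<close> vertices,
  and \<open>s\<close> maps its own first \<open>c'\<close> vertices there. If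
  \<open>c' = m + 1\<close> the back part is empty and no map of \<Delta>, which is why there are
  two separate conclusions.\<close>

lemma split_simplex:
 assumes s: "s \<in> Hom Simp m n" and p: "p \<in> Hom Simp n 1" and c: "c = zeros p" "c' = zeros (map ((!) p) s)"
 obtains s0 s1 where "s = glue c s0 s1" "length s0 = c'" "sorted s0" "set s0 \<subseteq> {..<c}" "c \<le> Suc n" "c' \<le> Suc m"
  "c' \<le> m --> c \<le> n \<and> s1 \<in> Hom Simp (m - c') (n - c)" "c' = Suc m --> s = s0"
proof -
 have l: "length p = Suc n" "sorted p" "set p \<subseteq> {..1}" "length s = Suc m" "sorted s" "set s \<subseteq> {..n}" using s p by (simp_all add: Simp_hom)
 have cn: "c \<le> Suc n" using length_filter_le[of "\<lambda>x. x = 0" p] l(1) c(1) by simp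
 have z: "p ! j = 0 \<longleftrightarrow> j < c" if "j \<le> n" for j
  using that cn arg_cong[OF sorted_01[OF l(2,3)], of "\<lambda>xs. xs ! j"] l(1) unfolding c(1)[symmetric] by (simp add: nth_append)
 let ?a = "filter (\<lambda>j. j < c) s" and ?b = "filter (\<lambda>j. \<not> j < c) s"
 have "filter (\<lambda>j. p ! j = 0) s = ?a" using z l(6) by (intro filter_cong) auto
 hence la: "length ?a = c'" by (simp add: c(2) filter_map o_def)
 have lb: "length ?a + length ?b = Suc m" using sum_length_filter_compl[of "\<lambda>j. j < c" s] l(4) by simp
 have "map ((+) c) (map (\<lambda>j. j - c) ?b) = ?b" unfolding map_map by (rule map_idI) simp
 hence g: "s = glue c ?a (map (\<lambda>j. j - c) ?b)" using sorted_split[OF l(5), of c] by (simp add: glue_def)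
 have "c \<le> n \<and> map (\<lambda>j. j - c) ?b \<in> Hom Simp (m - c') (n - c)" if "c' \<le> m"
 proof -
  have "?b \<noteq> []" using lb la that by auto
  then obtain x where "x \<in> set s" "\<not> x < c" by (auto simp: filter_empty_conv)
  hence "c \<le> n" using l(6) by auto
  moreover have "sorted (map (\<lambda>j. j - c) ?b)"
   unfolding sorted_map by (rule sorted_wrt_mono_rel[OF _ sorted_wrt_filter[OF l(5)]]) auto
  ultimately show ?thesis using lb la that l(6) by (auto simp: Simp_hom)
 qed
 moreover have "s = ?a" if "c' = Suc m"
 proof -
  have "?b = []" using lb la that by simp
  thus ?thesis using sorted_split[OF l(5), of c] by simp
 qed
 moreover have "c' \<le> Suc m" using lb la by simp
 ultimately show ?thesis using g la cn l(5) by (intro that[of ?a]) (auto intro: sorted_wrt_filter)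
qed

context abelian_tensor_category
begin

text \<open>Composed with AW, the projections form an exchange family that is the identity on
  monotone sequences; a constant family with the same property must agree with it, in particular at
  the fold map.\<close>

lemma EzAw_const:
 assumes W: "msimplicial k W" and b: "b \<in> Obj C"
  and const: "!!ns. length ns = k ==> Fo W ns = b" "!!ns ms ts. [|length ns = k; length ms = k; ts \<in> pHom k ns ms|] ==> Fm W ns ms ts = Idm C b"
 shows "EzAw C k W n = Idm C b"
proof -
 let ?ns = "rep k n" and ?L = "sum_list (map Suc (rep k n))"
 have aw: "Aw C k W n \<in> Hom C b (Fo (dec_obj C k W) n)" using diag_in(2)[OF W, of n] const(1)[OF length_replicate] by simp
 let ?F = "\<lambda>f. gproj k W n ?ns f \<cdot> Aw C k W n" and ?G = "\<lambda>_. Idm C b"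
 note o = sobj_obj[OF dec_sobj[OF W], of n]
 have g: "gproj k W n ?ns f \<in> Hom C (Fo (dec_obj C k W) n) b" if "length f = ?L" "set f \<subseteq> {..n}" for f
  using gproj_in[OF W length_replicate that] const(1) by simp
 have "?F (fold_map k n) = ?G (fold_map k n)"
 proof (rule exchange_rel_unique[OF b b, of ?L n ?F ?G])
  have F: "exchange_rel ?L n (gproj k W n ?ns)" by (rule gproj_exchange[OF W]) simp_all
  show "exchange_rel ?L n ?F" by (rule exchange_rel_comp_right[OF b o b F g aw])
  show "exchange_rel ?L n ?G" by (simp add: exchange_rel_def)
  fix f :: "nat list" assume f: "length f = ?L" "set f \<subseteq> {..n}"
  show "?F f \<in> Hom C b b" by (rule comp_in[OF b o b aw g[OF f]])
  show "?G f \<in> Hom C b b" by (rule id_in[OF b])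
  assume s: "sorted f"
  let ?p = "map (map ((!) f)) (id_blocks ?ns)"
  have p: "?p \<in> blocks k n"
   using blocks_of(3)[OF f(1)] f(2) s unfolding blocks_def mem_Collect_eq blocks_of(1)[OF f(1)] by simp
  have "gproj k W n ?ns f = bproj k W n ?p" using gproj_block[OF W p] blocks_of[OF f(1)] by simp
  thus "?F f = ?G f"
   using bproj_Aw[OF W p] const(2)[OF length_replicate dims_len[OF p] blocks_hom[OF p]] by simp
 qed (simp_all only: fold_map_length fold_map_values)
 thus ?thesis by (simp add: EzAw_def Ez_eq_gproj)
qed

text \<open>Functors that agree on \<open>k\<close>-tuples may differ elsewhere as records, so their
  chosen right adjoints may differ. Naturality with respect to the identity transformation still
  equates the operators.\<close>

lemma EzAw_ext:
 assumes Z: "msimplicial k Z"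
  and e: "!!ns. length ns = k ==> Fo Z' ns = Fo Z ns"
   "!!ms ns ts. [|length ms = k; length ns = k; ts \<in> pHom k ms ns|] ==> Fm Z' ms ns ts = Fm Z ms ns ts"
 shows "EzAw C k Z' n = EzAw C k Z n"
proof -
 have I: "map (Idm Simp_op) ns \<in> pHom k ns ns" if "length ns = k" for ns
  using that Simp_id_hom by (simp add: Simp_idm del: upt_Suc)
 have c: "map2 (Cmp Simp_op) hs ts \<in> pHom k ls ns"
  if "ts \<in> pHom k ls ms" "hs \<in> pHom k ms ns" for ls ms ns ts hs
  using that by (auto intro: Simp_comp_hom)
 have Z': "msimplicial k Z'"
  using Z I c e unfolding is_functor_def by (simp del: pow_simps(2))
 have "mnat k Z Z' (\<lambda>ns. Idm C (Fo Z ns))"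
  using id_left[OF mobj[OF Z] mobj[OF Z] mmap[OF Z]] id_right[OF mobj[OF Z] mobj[OF Z] mmap[OF Z]]
   id_in[OF mobj[OF Z]] e by (simp add: is_nat_trans_def del: pow_simps(2))
 from EzAw_natural[OF Z Z' this, of n]
 show ?thesis
  using id_left[OF mobj[OF Z] mobj[OF Z] diag_in(3)[OF Z], of n] id_right[OF mobj[OF Z'] mobj[OF Z'] diag_in(3)[OF Z'], of n] e(1)[of "rep k n"]
  by simp
qed

section \<open>Shifted simplicial objects and the components of the homotopy\<close>

abbreviation (input) "sh c Y \<equiv> restr Y (shiftc c)"

lemma sh_Fo: "Fo (sh c Y) n = Fo Y (c + n)" and sh_Fm: "Fm (sh c Y) m n a = Fm Y (c + m) (c + n) (glue c [0..<c] a)"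
 by (simp_all add: restr_def shiftc_def)

lemma sh_functor:
 assumes Y: "simplicial Y"
 shows "simplicial (sh c Y)"
 unfolding is_functor_def sh_Fo sh_Fm
proof (intro conjI ballI)
 note u = upt_id(3,1,2)[of c]
 fix n
 show "Fo Y (c + n) \<in> Obj C" by (rule sobj_obj[OF Y])
 have "glue c [0..<c] [0..<Suc n] = [0..<Suc (c + n)]"
  using upt_add_eq_append[of 0 c "Suc n"] by (simp add: glue_def map_add_upt_left del: upt_Suc)
 thus "Fm Y (c + n) (c + n) (glue c [0..<c] (Idm Simp_op n)) = Idm C (Fo Y (c + n))"
  using sobj_id[OF Y] by (simp add: Simp_idm del: upt_Suc)
 fix m a assume "a \<in> Hom Simp_op n m"
 hence a: "a \<in> Hom Simp m n" by simp
 show "Fm Y (c + n) (c + m) (glue c [0..<c] a) \<in> Hom C (Fo Y (c + n)) (Fo Y (c + m))" by (rule sobj_map[OF Y glue_hom[OF u a]])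
 fix l b assume "b \<in> Hom Simp_op m l"
 hence b: "b \<in> Hom Simp l m" by simp
 have "map ((!) (glue c [0..<c] a)) (glue c [0..<c] b) = glue c (map ((!) [0..<c]) [0..<c]) (map ((!) a) b)"
  using a b by (intro glue_comp) (auto simp: Simp_hom)
 thus "Fm Y (c + n) (c + l) (glue c [0..<c] (b \<cdot>\<^bsub>Simp_op\<^esub> a)) =
   Fm Y (c + m) (c + l) (glue c [0..<c] b) \<cdot> Fm Y (c + n) (c + m) (glue c [0..<c] a)"
  using sobj_comp[OF Y glue_hom[OF u b] glue_hom[OF u a]] by (simp add: Simp_cmp upt_id(4))
qed

lemma sh_objs: "set Ys \<subseteq> Obj SC ==> set (map (sh c) Ys) \<subseteq> Obj SC"
 using sh_functor by auto

lemma tensO_sh: "tensO SC (map (sh c) Ys) = sh c (tensO SC Ys)"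
proof (rule ftor.equality)
 show "Fo (tensO SC (map (sh c) Ys)) = Fo (sh c (tensO SC Ys))" by (rule ext) (simp add: sh_Fo Sim_tensO_Fo o_def)
 show "Fm (tensO SC (map (sh c) Ys)) = Fm (sh c (tensO SC Ys))" by (intro ext) (simp add: sh_Fm Sim_tensO_Fm o_def)
qed simp

text \<open>A map of the front vertices acts independently of the back. The second part splits a
  glued map into its front and its back action.\<close>

lemma sh_nat:
 assumes Y: "simplicial Y" and b: "length b = c'" "sorted b" "set b \<subseteq> {..<c}"
 shows "snat (sh c Y) (sh c' Y) (\<lambda>l. Fm Y (c + l) (c' + l) (glue c b [0..<Suc l]))"
  and "a \<in> Hom Simp m l ==> Fm (sh c' Y) l m a \<cdot> Fm Y (c + l) (c' + l) (glue c b [0..<Suc l]) = Fm Y (c + l) (c' + m) (glue c b a)"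
proof -
 note u = upt_id(3,1,2)
 have r: "map ((!) b) [0..<c'] = b" "map ((!) [0..<c]) b = b" using b by (auto simp: map_nth_upt map_nth)
 show *: "Fm (sh c' Y) l m a \<cdot> Fm Y (c + l) (c' + l) (glue c b [0..<Suc l]) = Fm Y (c + l) (c' + m) (glue c b a)"
  if a: "a \<in> Hom Simp m l" for l m a
 proof -
  have "map ((!) (glue c b [0..<Suc l])) (glue c' [0..<c'] a) = glue c b a"
   using glue_comp[OF b(1) upt_id(2), of a "[0..<Suc l]" c] Simp_lessThan[OF a] by (simp add: r map_nth_upt del: upt_Suc)
  thus ?thesis using sobj_comp[OF Y glue_hom[OF u a] glue_hom[OF b Simp_id_hom]] by (simp add: sh_Fm del: upt_Suc)
 qed
 show "snat (sh c Y) (sh c' Y) (\<lambda>l. Fm Y (c + l) (c' + l) (glue c b [0..<Suc l]))"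
  unfolding is_nat_trans_def
 proof (intro conjI ballI)
  fix l
  show "Fm Y (c + l) (c' + l) (glue c b [0..<Suc l]) \<in> Hom C (Fo (sh c Y) l) (Fo (sh c' Y) l)"
   unfolding sh_Fo by (rule sobj_map[OF Y glue_hom[OF b Simp_id_hom]])
  fix m a assume "a \<in> Hom Simp_op l m"
  hence a: "a \<in> Hom Simp m l" by simp
  have "map ((!) (glue c [0..<c] a)) (glue c b [0..<Suc m]) = glue c b a"
   using glue_comp[OF upt_id(3) b(3), of "[0..<Suc m]" a c] a by (simp add: r map_nth_upt' Simp_hom atLeast0LessThan del: upt_Suc)
  thus "Fm (sh c' Y) l m a \<cdot> Fm Y (c + l) (c' + l) (glue c b [0..<Suc l]) = Fm Y (c + m) (c' + m) (glue c b [0..<Suc m]) \<cdot> Fm (sh c Y) l m a"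
   using *[OF a] sobj_comp[OF Y glue_hom[OF b Simp_id_hom] glue_hom[OF u a]] by (simp add: sh_Fm del: upt_Suc)
 qed
qed

lemma EzAw_box: "set Ys \<subseteq> Obj SC ==> snat (tensO SC Ys) (tensO SC Ys) (EzAw C (length Ys) (box C Ys))"
 using EzAw_nat[OF box_functor] unfolding box_diag by blast

abbreviation (input) "Shc Ys n p \<equiv> Shih_component C (length Ys) (box C Ys) n p"

text \<open>Shifting the box product is the box product of the shifted factors, so each component
  other than the identity is an operator \<open>E\<close> for simplicial objects; shift 0 covers the
  unshifted case.\<close>

lemma Shc_eq:
 assumes Ys: "set Ys \<subseteq> Obj SC"
 shows "Shc Ys n p = (if zeros p = Suc n then Idm C (Fo (tensO SC Ys) n) else EzAw C (length Ys) (box C (map (sh (zeros p)) Ys)) (n - zeros p))"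
proof -
 have sh: "EzAw C (length Ys) (restr (box C Ys) (pow_ftor (length Ys) (shiftc c))) b = EzAw C (length Ys) (box C (map (sh c) Ys)) b" for c b
 proof (rule EzAw_ext)
  show "msimplicial (length Ys) (box C (map (sh c) Ys))" using box_functor[OF sh_objs[OF Ys]] by simp
 qed (auto simp: restr_def pow_ftor_def shiftc_def box_Fo box_Fm intro!: arg_cong[where f = "tensO C"] arg_cong[where f = "tensM C"] nth_equalityI)
 have "sh 0 Y = Y" for Y :: "('o, 'm) sobj" by (rule ftor.equality) (simp_all add: sh_Fo sh_Fm glue_def fun_eq_iff map_idI)
 thus ?thesis
  by (cases "zeros p") (simp_all add: Shih_component_def shifted_EzAw_def shift_eq Let_def sh Fo_box_diag)
qed

lemma Shc_in:
 assumes "set Ys \<subseteq> Obj SC" "zeros p \<le> Suc n"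
 shows "Shc Ys n p \<in> Hom C (Fo (tensO SC Ys) n) (Fo (tensO SC Ys) n)"
proof (cases "zeros p = Suc n")
 case True
 thus ?thesis using id_in[OF sobj_obj[OF tensO_sobj[OF assms(1)]]] by (simp add: Shc_eq[OF assms(1)])
next
 case False
 thus ?thesis
  using assms(2) snat_in[OF EzAw_box[OF sh_objs[OF assms(1)]], of "zeros p" "n - zeros p"] by (simp add: Shc_eq[OF assms(1)] tensO_sh sh_Fo)
qed

lemma Shc_family:
 assumes l: "length Ys = k" "length Ws = k" and o: "set Ys \<subseteq> Obj SC" "set Ws \<subseteq> Obj SC"
  and g: "!!i. i < k ==> snat (Ys ! i) (Ws ! i) (g i)" and p: "zeros p \<le> Suc n"
 shows "tens_upt k (\<lambda>i. g i n) \<cdot> Shc Ys n p = Shc Ws n p \<cdot> tens_upt k (\<lambda>i. g i n)"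
proof (cases "zeros p = Suc n")
 case True
 note o' = sobj_obj[OF tensO_sobj[OF o(1)]] sobj_obj[OF tensO_sobj[OF o(2)]] and f = EzAw_family(1)[OF l o g]
 show ?thesis using True id_left[OF o' f] id_right[OF o' f] unfolding Shc_eq[OF o(1)] Shc_eq[OF o(2)] by simp
next
 case False
 let ?c = "zeros p"
 have "snat (map (sh ?c) Ys ! i) (map (sh ?c) Ws ! i) (\<lambda>n. g i (?c + n))" if i: "i < k" for i
 proof -
  have "glue ?c [0..<?c] a \<in> Hom Simp (?c + m) (?c + n)" if "a \<in> Hom Simp m n" for a m n by (rule glue_hom[OF upt_id(3,1,2) that])
  thus ?thesis using g[OF i] l i by (simp add: is_nat_trans_def sh_Fo sh_Fm)
 qed
 from EzAw_family(2)[where m = "n - ?c", OF _ _ sh_objs[OF o(1)] sh_objs[OF o(2)] this]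
 show ?thesis using False p l unfolding Shc_eq[OF o(1)] Shc_eq[OF o(2)] by simp
qed

text \<open>The identity components are trivial. If only the restricted simplex lies in the fibre
  over 0, \<open>E\<close> meets a constant object. Otherwise \<open>E\<close> commutes with the
  front action by naturality in the multi-simplicial object and with the back action because it is
  simplicial.\<close>

lemma Shc_simplicial:
 assumes Ys: "set Ys \<subseteq> Obj SC" and a: "a \<in> Hom Simp m n" and s: "s \<in> Fo Delta1 n"
 shows "Fm (tensO SC Ys) n m a \<cdot> Shc Ys n s = Shc Ys m (Fm Delta1 n m a s) \<cdot> Fm (tensO SC Ys) n m a"
proof -
 let ?P = "tensO SC Ys" and ?k = "length Ys"
 define c c' where c: "c = zeros s" and c': "c' = zeros (map ((!) s) a)"
 have s1: "s \<in> Hom Simp n 1" and s2: "Fm Delta1 n m a s = map ((!) s) a" using s by (simp_all add: Delta1_simps)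
 note S1 = Shc_eq[OF Ys, of n s, folded c] and S2 = Shc_eq[OF Ys, of m "map ((!) s) a", folded c']
 obtain a0 a1 where g: "a = glue c a0 a1" and a0: "length a0 = c'" "sorted a0" "set a0 \<subseteq> {..<c}"
  and cn: "c \<le> Suc n" "c' \<le> Suc m" and c1: "c' \<le> m --> c \<le> n \<and> a1 \<in> Hom Simp (m - c') (n - c)" and c2: "c' = Suc m --> a = a0"
  by (rule split_simplex[OF a s1 c c']) blast
 note P = tensO_sobj[OF Ys]
 note o = sobj_obj[OF P] and A = sobj_map[OF P a]
 have fam: "tens_upt ?k (\<lambda>i. Fm (Ys ! i) x y f) = Fm ?P x y f" for x y f
  using map_index_upt[of "\<lambda>Y. Fm Y x y f" Ys] by (simp add: Sim_tensO_Fm)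
 consider "c = Suc n" "c' = Suc m" | "c \<le> n" "c' = Suc m" | "c \<le> n" "c' \<le> m" using cn c1 by linarith
 thus ?thesis
 proof cases
  case 1
  thus ?thesis using id_left[OF o o A] id_right[OF o o A] by (simp add: S1 S2 s2)
 next
  case 2
  \<comment> \<open>Since \<open>a\<close> takes all its values in the front, it acts on every
    \<open>Y\<close> in degree \<open>c + l\<close> independently of \<open>l\<close>: a morphism
    from the shifted object to the constant one at \<open>Y\<close> in degree
    \<open>m\<close>.\<close>
  let ?C = "\<lambda>Y. \<lparr>Fo = (\<lambda>_. Fo Y m), Fm = (\<lambda>_ _ _. Idm C (Fo Y m))\<rparr>"
  have "simplicial (?C Y)" if "simplicial Y" for Y
   using sobj_obj[OF that] id_left[OF _ _ id_in] by (simp add: is_functor_def id_in)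
  hence W: "set (map ?C Ys) \<subseteq> Obj SC" using Ys by auto
  have aA: "set a \<subseteq> {..<c}" using a0 c2 2 by simp
  have h: "a \<in> Hom Simp m (c + l)" for l using a aA by (fastforce simp: Simp_hom)
  have aa: "map ((!) (glue c [0..<c] b)) a = a" for b using aA by (intro map_idI) (auto simp: glue_def nth_append)
  have nat: "snat (map (sh c) Ys ! i) (map ?C Ys ! i) (\<lambda>l. Fm (Ys ! i) (c + l) m a)" if i: "i < ?k" for i
  proof -
   note Y = nth_functor[OF Ys i]
   show ?thesis
    using i sobj_map[OF Y h] id_left[OF sobj_obj[OF Y] sobj_obj[OF Y] sobj_map[OF Y h]] sobj_comp[OF Y h glue_hom[OF upt_id(3,1,2)]]
    by (simp add: is_nat_trans_def sh_Fo sh_Fm aa)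
  qed
  have "EzAw C ?k (box C (map ?C Ys)) (n - c) = Idm C (Fo ?P m)"
  proof (rule EzAw_const)
   show "msimplicial ?k (box C (map ?C Ys))" using box_functor[OF W] by simp
   show "Fo (box C (map ?C Ys)) ns = Fo ?P m" if "length ns = ?k" for ns
    unfolding box_Fo Sim_tensO_Fo using that by (intro arg_cong[where f = "tensO C"] nth_equalityI) simp_all
   have "set (map (\<lambda>Y. Fo Y m) Ys) \<subseteq> Obj C" using Ys sobj_obj by auto
   moreover have "map (\<lambda>i. Fm (map ?C Ys ! i) (ns ! i) (ms ! i) (ts ! i)) [0..<?k] = map (Idm C) (map (\<lambda>Y. Fo Y m) Ys)" for ns ms ts
    by (intro nth_equalityI) simp_all
   ultimately show "Fm (box C (map ?C Ys)) ns ms ts = Idm C (Fo ?P m)" for ns ms ts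
    using tensM_id[of "map (\<lambda>Y. Fo Y m) Ys"] unfolding box_Fm Sim_tensO_Fo length_map by metis
  qed (rule o)
  thus ?thesis
   using 2 EzAw_family(2)[OF length_map length_map sh_objs[OF Ys] W nat, of "n - c"] id_left[OF o o A] by (simp add: S1 S2 s2 fam)
 next
  case 3
  note a1 = c1[rule_format, OF 3(2), THEN conjunct2]
  let ?Q = "tensO SC (map (sh c) Ys)" and ?Q' = "tensO SC (map (sh c') Ys)"
  let ?e = "EzAw C ?k (box C (map (sh c) Ys))" and ?e' = "EzAw C ?k (box C (map (sh c') Ys))"
  let ?G = "Fm ?P (c + (n - c)) (c' + (n - c)) (glue c a0 [0..<Suc (n - c)])" and ?B = "Fm ?Q' (n - c) (m - c') a1"
  \<comment> \<open>Front action first, then the structure map of the object shifted by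
    \<open>c'\<close>.\<close>
  have AB: "Fm ?P n m a = ?B \<cdot> ?G" using sh_nat(2)[OF P a0 a1] g 3 by (simp add: tensO_sh)
  have nat: "snat (map (sh c) Ys ! i) (map (sh c') Ys ! i) (\<lambda>l. Fm (Ys ! i) (c + l) (c' + l) (glue c a0 [0..<Suc l]))" if "i < ?k" for i
   using sh_nat(1)[OF nth_functor[OF Ys that] a0] that by simp
  note G = EzAw_family[OF length_map length_map sh_objs[OF Ys] sh_objs[OF Ys] nat, of "n - c", unfolded fam]
  note Q = sobj_obj[OF tensO_sobj[OF sh_objs[OF Ys]]] and B = sobj_map[OF tensO_sobj[OF sh_objs[OF Ys, of c']] a1]
  note E = EzAw_box[OF sh_objs[OF Ys], unfolded length_map]
  have "?B \<cdot> ?e' (n - c) = ?e' (m - c') \<cdot> ?B" by (rule snat_nat[OF E a1])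
  hence "(?B \<cdot> ?G) \<cdot> ?e (n - c) = ?e' (m - c') \<cdot> (?B \<cdot> ?G)"
   using assoc[OF Q Q Q Q snat_in[OF E] G(1) B] G(2) assoc[OF Q Q Q Q G(1) snat_in[OF E] B]
    assoc[OF Q Q Q Q G(1) B snat_in[OF E]] by simp
  thus ?thesis unfolding AB using 3 by (simp add: S1 S2 s2)
 qed
qed

lemma Shc_one:
 assumes "set [Y] \<subseteq> Obj SC" "zeros p \<le> Suc n"
 shows "Shc [Y] n p = Idm C (Fo Y n)"
proof (cases "zeros p = Suc n")
 case False
 let ?Y = "sh (zeros p) Y"
 have Y: "simplicial ?Y" using assms(1) by (intro sh_functor) simp
 have "EzAw C (Suc 0) (box C [?Y]) (n - zeros p) = Idm C (Fo ?Y (n - zeros p))"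
  using id_left[OF sobj_obj[OF Y] sobj_obj[OF Y] id_in[OF sobj_obj[OF Y]]] by (simp add: EzAw_def Ez_one[OF Y] Aw_one[OF Y])
 thus ?thesis using False assms(2) unfolding Shc_eq[OF assms(1)] by (simp add: sh_Fo)
qed (unfold Shc_eq[OF assms(1)], simp)

end

section \<open>Composition of the homotopy components\<close>

context sobj_lists
begin

abbreviation (input) "Fl n \<equiv> tens_flat SC Zss n"
abbreviation (input) "P n \<equiv> Fo (tensO SC (concat Zss)) n"
abbreviation (input) "Q n \<equiv> Fo (tensO SC TO) n"
abbreviation (input) "SI n p \<equiv> tens_upt N (\<lambda>i. Shc (Zss ! i) n p)"

lemma P_obj: "P n \<in> Obj C" and Q_obj: "Q n \<in> Obj C"
 using sobj_obj[OF tensO_sobj[OF Zss]] sobj_obj[OF tensO_sobj[OF tensO_objs[OF Zss]]] by blast+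

lemma Q_eq: "Q n = tensO C (map (\<lambda>i. Fo (tensO SC (Zss ! i)) n) [0..<N])"
 using map_index_upt[of "\<lambda>Zs. Fo (tensO SC Zs) n" Zss] by (simp add: Sim_tensO_Fo o_def)

lemma Fl_in: "Fl n \<in> Hom C (Q n) (P n)"
 by (rule snat_in[OF flat_hom])

lemma SI_in: "zeros p \<le> Suc n ==> SI n p \<in> Hom C (Q n) (Q n)"
 unfolding Q_eq using Shc_in[OF Zi] sobj_obj[OF tensO_sobj[OF Zi]] by (intro tensM_in homs_upt) blast

lemma EzAw_commute:
 "EzAw C N (box C TO) n \<cdot> tens_upt N (\<lambda>i. EzAw C (Ki i) (Zi i) n) = tens_upt N (\<lambda>i. EzAw C (Ki i) (Zi i) n) \<cdot> EzAw C N (box C TO) n"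
proof -
 have "snat (TO ! i) (TO ! i) (EzAw C (Ki i) (Zi i))" if "i < N" for i using EzAw_box[OF Zi[OF that]] that by simp
 from EzAw_family(2)[OF length_map length_map tensO_objs[OF Zss] tensO_objs[OF Zss] this] show ?thesis by simp
qed

text \<open>\<open>EzAw_flat\<close> and \<open>EzAw_commute\<close> for the shifted lists. The
  commutation serves the operad, where the inner operators come before the outer one.\<close>

lemma Shc_flat:
 assumes p: "zeros p \<le> Suc n"
 shows "Shc (concat Zss) n p \<cdot> Fl n = Fl n \<cdot> (SI n p \<cdot> Shc TO n p)" "Shc TO n p \<cdot> SI n p = SI n p \<cdot> Shc TO n p"
proof -
 have "Shc (concat Zss) n p \<cdot> Fl n = Fl n \<cdot> (SI n p \<cdot> Shc TO n p) \<and> Shc TO n p \<cdot> SI n p = SI n p \<cdot> Shc TO n p"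
 proof (cases "zeros p = Suc n")
  case True
  have "SI n p = tensM C (map (Idm C) (map (\<lambda>i. Fo (tensO SC (Zss ! i)) n) [0..<N]))"
   using True Shc_eq[OF Zi] by (intro arg_cong[where f = "tensM C"]) simp
  also have "\<dots> = Idm C (Q n)" unfolding Q_eq using sobj_obj[OF tensO_sobj[OF Zi]] by (intro tensM_id) auto
  finally have "SI n p = Idm C (Q n)" .
  moreover have "Shc TO n p = Idm C (Q n)" "Shc (concat Zss) n p = Idm C (P n)"
   using True unfolding Shc_eq[OF Zss] Shc_eq[OF tensO_objs[OF Zss]] by simp_all
  ultimately show ?thesis
   using id_left[OF Q_obj P_obj Fl_in] id_right[OF Q_obj P_obj Fl_in] id_left[OF Q_obj Q_obj id_in[OF Q_obj]] by (simp only: simp_thms)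
 next
  case False
  let ?c = "zeros p" and ?b = "n - zeros p"
  \<comment> \<open>Shifting commutes with concatenation of lists and with point-wise products, so
    the earlier results apply to these lists as they stand.\<close>
  let ?Zss = "map (map (sh ?c)) Zss"
  have Zss': "set (concat ?Zss) \<subseteq> Obj SC" using sh_objs[OF Zss] by (simp add: map_concat)
  interpret L: sobj_lists C ?Zss by unfold_locales (rule Zss')
  have cat: "concat ?Zss = map (sh ?c) (concat Zss)" by (simp add: map_concat)
  have T: "map (tensO SC) ?Zss = map (sh ?c) TO" by (simp add: tensO_sh)
  have f: "L.fl (L.reps ?b) = Fl n"
   using p False unfolding L.fl_reps[symmetric] Sim_tens_flat by (simp add: sh_Fo o_def)
  have I: "map (\<lambda>i. EzAw C (length (?Zss ! i)) (box C (?Zss ! i)) ?b) [0..<length ?Zss] = map (\<lambda>i. Shc (Zss ! i) n p) [0..<N]"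
   using False Shc_eq[OF Zi] by simp
  have cc: "EzAw C (length (concat ?Zss)) (box C (concat ?Zss)) ?b = Shc (concat Zss) n p" unfolding cat using False by (simp add: Shc_eq[OF Zss])
  have tt: "EzAw C (length ?Zss) (box C (map (tensO SC) ?Zss)) ?b = Shc TO n p" unfolding T Shc_eq[OF tensO_objs[OF Zss]] using False by (simp del: map_map)
  show ?thesis using L.EzAw_flat[of ?b] L.EzAw_commute[of ?b] unfolding f I cc tt by simp
 qed
 thus "Shc (concat Zss) n p \<cdot> Fl n = Fl n \<cdot> (SI n p \<cdot> Shc TO n p)" "Shc TO n p \<cdot> SI n p = SI n p \<cdot> Shc TO n p" by blast+
qed

context
 fixes Ys :: "('o, 'm) sobj list" and gs :: "(nat => 'm) list" and p :: "nat list" and n :: nat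
 assumes Ys: "set Ys \<subseteq> Obj SC" "length Ys = N" and p: "zeros p \<le> Suc n"
begin

abbreviation (input) "G \<equiv> tens_upt N (\<lambda>i. (gs ! i) n)"
abbreviation (input) "R \<equiv> Fo (tensO SC Ys) n"

lemma R_obj: "R \<in> Obj C"
 by (rule sobj_obj[OF tensO_sobj[OF Ys(1)]])

lemma G_out:
 assumes "!!i. i < N ==> gs ! i \<in> Hom SC (Ys ! i) (tensO SC (Zss ! i))"
 shows "G \<in> Hom C R (Q n)" "G \<cdot> Shc Ys n p = Shc TO n p \<cdot> G"
proof -
 have "snat (Ys ! i) (TO ! i) (gs ! i)" if "i < N" for i using assms[OF that] that by simp
 note f = Ys(2) length_map Ys(1) tensO_objs[OF Zss] this
 show "G \<in> Hom C R (Q n)" "G \<cdot> Shc Ys n p = Shc TO n p \<cdot> G"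
  using EzAw_family(1)[OF f] Shc_family[OF f p] by blast+
qed

lemma G_into:
 assumes "!!i. i < N ==> gs ! i \<in> Hom SC (tensO SC (Zss ! i)) (Ys ! i)"
 shows "G \<in> Hom C (Q n) R" "G \<cdot> Shc TO n p = Shc Ys n p \<cdot> G"
proof -
 have "snat (TO ! i) (Ys ! i) (gs ! i)" if "i < N" for i using assms[OF that] that by simp
 note f = length_map Ys(2) tensO_objs[OF Zss] Ys(1) this
 show "G \<in> Hom C (Q n) R" "G \<cdot> Shc TO n p = Shc Ys n p \<cdot> G"
  using EzAw_family(1)[OF f] Shc_family[OF f p] by blast+
qed

text \<open>After \<open>Shc_flat\<close>, the outer operator is moved past the morphisms
  \<open>gs\<close> by naturality, and the inner operators merge with them factor by factor.\<close>

lemma Shc_composition: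
 assumes g: "!!i. i < N ==> gs ! i \<in> Hom SC (Ys ! i) (tensO SC (Zss ! i))" and a: "a \<in> Obj C" "f \<in> Hom C a R"
 shows "Shc (concat Zss) n p \<cdot> (Fl n \<cdot> (G \<cdot> f)) = Fl n \<cdot> (tens_upt N (\<lambda>i. Shc (Zss ! i) n p \<cdot> (gs ! i) n) \<cdot> (Shc Ys n p \<cdot> f))"
proof -
 note G = G_out[OF g] and H = SI_in[OF p] and hP = Shc_in[OF Zss p] and hQ = Shc_in[OF tensO_objs[OF Zss] p] and hR = Shc_in[OF Ys(1) p]
 note oP = P_obj[of n] and oQ = Q_obj[of n] and Gf = comp_in[OF a(1) R_obj Q_obj a(2) G(1)]
 have "Shc (concat Zss) n p \<cdot> (Fl n \<cdot> (G \<cdot> f)) = (Fl n \<cdot> (SI n p \<cdot> Shc TO n p)) \<cdot> (G \<cdot> f)"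
  unfolding Shc_flat(1)[OF p, symmetric] by (rule assoc[OF a(1) oQ oP oP Gf Fl_in hP, symmetric])
 also have "\<dots> = Fl n \<cdot> (SI n p \<cdot> (Shc TO n p \<cdot> (G \<cdot> f)))"
  using assoc[OF a(1) oQ oQ oP Gf comp_in[OF oQ oQ oQ hQ H] Fl_in] assoc[OF a(1) oQ oQ oQ Gf hQ H] by simp
 also have "Shc TO n p \<cdot> (G \<cdot> f) = G \<cdot> (Shc Ys n p \<cdot> f)"
  using assoc[OF a(1) R_obj oQ oQ a(2) G(1) hQ] assoc[OF a(1) R_obj R_obj oQ a(2) hR G(1)] G(2) by simp
 also have "SI n p \<cdot> (G \<cdot> (Shc Ys n p \<cdot> f)) = (SI n p \<cdot> G) \<cdot> (Shc Ys n p \<cdot> f)"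
  by (rule assoc[OF a(1) R_obj oQ oQ comp_in[OF a(1) R_obj R_obj a(2) hR] G(1) H, symmetric])
 also have "SI n p \<cdot> G = tens_upt N (\<lambda>i. Shc (Zss ! i) n p \<cdot> (gs ! i) n)"
 proof (rule tensM_comp_upt[where x = "\<lambda>i. Fo (Ys ! i) n" and y = "\<lambda>i. Fo (tensO SC (Zss ! i)) n" and z = "\<lambda>i. Fo (tensO SC (Zss ! i)) n"], intro conjI)
  fix i assume i: "i < N"
  show "Fo (Ys ! i) n \<in> Obj C" using sobj_obj[OF nth_functor[OF Ys(1)]] i Ys(2) by simp
  show "(gs ! i) n \<in> Hom C (Fo (Ys ! i) n) (Fo (tensO SC (Zss ! i)) n)" using snat_in[of "Ys ! i"] g[OF i] by simp
  show "Shc (Zss ! i) n p \<in> Hom C (Fo (tensO SC (Zss ! i)) n) (Fo (tensO SC (Zss ! i)) n)" by (rule Shc_in[OF Zi[OF i] p])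
 qed (use sobj_obj[OF tensO_sobj[OF Zi]] in blast)+
 finally show ?thesis .
qed

lemma Shc_op_composition:
 assumes g: "!!i. i < N ==> gs ! i \<in> Hom SC (tensO SC (Zss ! i)) (Ys ! i)" and a: "a \<in> Obj C" "f \<in> Hom C R a"
  and u: "u \<in> Hom C (P n) (Q n)" "u \<cdot> Fl n = Idm C (Q n)" "Fl n \<cdot> u = Idm C (P n)"
 shows "(f \<cdot> (G \<cdot> u)) \<cdot> Shc (concat Zss) n p = f \<cdot> (Shc Ys n p \<cdot> (tens_upt N (\<lambda>i. (gs ! i) n \<cdot> Shc (Zss ! i) n p) \<cdot> u))"
proof -
 note G = G_into[OF g] and H = SI_in[OF p] and hP = Shc_in[OF Zss p] and hQ = Shc_in[OF tensO_objs[OF Zss] p] and hR = Shc_in[OF Ys(1) p]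
 note oP = P_obj[of n] and oQ = Q_obj[of n] and oR = R_obj and Gu = comp_in[OF P_obj Q_obj R_obj u(1) G(1)] and Hu = comp_in[OF P_obj Q_obj Q_obj u(1) H]
 note Hh = comp_in[OF oQ oQ oQ hQ H]
 \<comment> \<open>Insert \<open>Fl u = 1\<close> on the right so that \<open>Shc_flat\<close>
   applies, then cancel \<open>u Fl = 1\<close>.\<close>
 have "u \<cdot> Shc (concat Zss) n p = u \<cdot> ((Shc (concat Zss) n p \<cdot> Fl n) \<cdot> u)"
  using assoc[OF oP oQ oP oP u(1) Fl_in hP] id_right[OF oP oP hP] u(3) by simp
 also have "\<dots> = (SI n p \<cdot> Shc TO n p) \<cdot> u"
  unfolding Shc_flat(1)[OF p]
  using assoc[OF oP oQ oQ oP u(1) Hh Fl_in] assoc[OF oP oQ oP oQ comp_in[OF oP oQ oQ u(1) Hh] Fl_in u(1)]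
   id_left[OF oP oQ comp_in[OF oP oQ oQ u(1) Hh]] u(2) by simp
 also have "\<dots> = Shc TO n p \<cdot> (SI n p \<cdot> u)"
  unfolding Shc_flat(2)[OF p, symmetric] by (rule assoc[OF oP oQ oQ oQ u(1) H hQ])
 finally have uS: "u \<cdot> Shc (concat Zss) n p = Shc TO n p \<cdot> (SI n p \<cdot> u)" .
 have GH: "G \<cdot> SI n p = tens_upt N (\<lambda>i. (gs ! i) n \<cdot> Shc (Zss ! i) n p)"
 proof (rule tensM_comp_upt[where x = "\<lambda>i. Fo (tensO SC (Zss ! i)) n" and y = "\<lambda>i. Fo (tensO SC (Zss ! i)) n" and z = "\<lambda>i. Fo (Ys ! i) n"], intro conjI)
  fix i assume i: "i < N"
  show "Fo (Ys ! i) n \<in> Obj C" using sobj_obj[OF nth_functor[OF Ys(1)]] i Ys(2) by simp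
  show "(gs ! i) n \<in> Hom C (Fo (tensO SC (Zss ! i)) n) (Fo (Ys ! i) n)" using snat_in[of _ "Ys ! i"] g[OF i] by simp
  show "Shc (Zss ! i) n p \<in> Hom C (Fo (tensO SC (Zss ! i)) n) (Fo (tensO SC (Zss ! i)) n)" by (rule Shc_in[OF Zi[OF i] p])
 qed (use sobj_obj[OF tensO_sobj[OF Zi]] in blast)+
 have "(f \<cdot> (G \<cdot> u)) \<cdot> Shc (concat Zss) n p = f \<cdot> (G \<cdot> (Shc TO n p \<cdot> (SI n p \<cdot> u)))"
  using assoc[OF oP oP oR a(1) hP Gu a(2)] assoc[OF oP oP oQ oR hP u(1) G(1)] uS by simp
 also have "G \<cdot> (Shc TO n p \<cdot> (SI n p \<cdot> u)) = Shc Ys n p \<cdot> (G \<cdot> (SI n p \<cdot> u))"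
  using assoc[OF oP oQ oQ oR Hu hQ G(1)] assoc[OF oP oQ oR oR Hu G(1) hR] G(2) by simp
 also have "G \<cdot> (SI n p \<cdot> u) = (G \<cdot> SI n p) \<cdot> u" by (rule assoc[OF oP oQ oQ oR u(1) H G(1), symmetric])
 finally show ?thesis unfolding GH .
qed

end

end

lemma zeros_Delta1: "p \<in> Fo Delta1 n ==> zeros p \<le> Suc n"
 using length_filter_le[of "\<lambda>x. x = 0" p] by (simp add: Delta1_simps Simp_hom)

section \<open>Families over the standard 1-simplex\<close>

context abelian_tensor_category
begin

lemmas cyl_obj = sten_obj[where K = Delta1, OF Delta1_finite] and cyl_in_in = sten_in_in[where K = Delta1, OF Delta1_finite]

lemma Shih_at:
 assumes Ys: "set Ys \<subseteq> Obj SC"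
 shows "Shih C (length Ys) (box C Ys) n \<in> Hom C (Fo (cyl (tensO SC Ys)) n) (Fo (tensO SC Ys) n)"
  and "p \<in> Fo Delta1 n ==> Shih C (length Ys) (box C Ys) n \<cdot> cyl_in (tensO SC Ys) n p = Shc Ys n p"
 using sten_desc[where Y = "tensO SC Ys" and h = "Shih_component C (length Ys) (box C Ys)",
   OF Delta1_finite sobj_obj[OF tensO_sobj[OF Ys]] sobj_obj[OF tensO_sobj[OF Ys]] Shc_in[OF Ys zeros_Delta1]]
 unfolding Shih_def box_diag by simp_all

lemma Shih_coop_at:
 assumes X: "simplicial X" and Ys: "set Ys \<subseteq> Obj SC" and f: "f \<in> Hom SC X (tensO SC Ys)"
 shows "Shih_coop C X Ys f n \<in> Hom C (Fo (cyl X) n) (Fo (tensO SC Ys) n)"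
  and "p \<in> Fo Delta1 n ==> Shih_coop C X Ys f n \<cdot> cyl_in X n p = Shc Ys n p \<cdot> f n"
proof -
 note oX = sobj_obj[OF X, of n] and oY = sobj_obj[OF tensO_sobj[OF Ys], of n]
 note oSX = cyl_obj[OF oX] and oSY = cyl_obj[OF oY]
 have fn: "f n \<in> Hom C (Fo X n) (Fo (tensO SC Ys) n)" using snat_in[of X _ f n] f by simp
 note m = sten_map[where K = Delta1 and f = f, OF Delta1_finite oX oY fn]
 show "Shih_coop C X Ys f n \<in> Hom C (Fo (cyl X) n) (Fo (tensO SC Ys) n)"
  unfolding Shih_coop_def Sim_simps by (rule comp_in[OF oSX oSY oY m(1) Shih_at(1)[OF Ys]])
 assume p: "p \<in> Fo Delta1 n"
 note i = cyl_in_in[OF oX p] and j = cyl_in_in[OF oY p]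
 show "Shih_coop C X Ys f n \<cdot> cyl_in X n p = Shc Ys n p \<cdot> f n"
  using assoc[OF oX oSX oSY oY i m(1) Shih_at(1)[OF Ys]] m(2)[OF p] assoc[OF oX oY oSY oY fn j Shih_at(1)[OF Ys]] Shih_at(2)[OF Ys p]
  by (simp add: Shih_coop_def)
qed

lemma Shih_op_at:
 assumes Xs: "set Xs \<subseteq> Obj SC" and Y: "simplicial Y" and f: "f \<in> Hom SC (tensO SC Xs) Y"
 shows "Shih_op C Xs Y f n \<in> Hom C (Fo (cyl (tensO SC Xs)) n) (Fo Y n)"
  and "p \<in> Fo Delta1 n ==> Shih_op C Xs Y f n \<cdot> cyl_in (tensO SC Xs) n p = f n \<cdot> Shc Xs n p"
proof -
 note oX = sobj_obj[OF tensO_sobj[OF Xs], of n] and oY = sobj_obj[OF Y, of n]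
 note oSX = cyl_obj[OF oX]
 have fn: "f n \<in> Hom C (Fo (tensO SC Xs) n) (Fo Y n)" using snat_in[of _ Y f n] f by simp
 show "Shih_op C Xs Y f n \<in> Hom C (Fo (cyl (tensO SC Xs)) n) (Fo Y n)"
  unfolding Shih_op_def Sim_simps by (rule comp_in[OF oSX oX oY Shih_at(1)[OF Xs] fn])
 assume p: "p \<in> Fo Delta1 n"
 show "Shih_op C Xs Y f n \<cdot> cyl_in (tensO SC Xs) n p = f n \<cdot> Shc Xs n p"
  using assoc[OF oX oSX oX oY cyl_in_in[OF oX p] Shih_at(1)[OF Xs] fn] Shih_at(2)[OF Xs p] by (simp add: Shih_op_def)
qed

lemma Shih_coop_nat:
 assumes X: "simplicial X" and Ys: "set Ys \<subseteq> Obj SC" and f: "f \<in> Hom SC X (tensO SC Ys)"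
 shows "snat (cyl X) (tensO SC Ys) (Shih_coop C X Ys f)"
proof (rule sten_nat[where h = "\<lambda>n p. Shc Ys n p \<cdot> f n", OF Delta1_finite Delta1_act X tensO_sobj[OF Ys] Shih_coop_at[OF assms]])
 fix m n a p assume a: "a \<in> Hom Simp m n" and p: "p \<in> Fo Delta1 n"
 note P = tensO_sobj[OF Ys]
 note oX = sobj_obj[OF X] and oP = sobj_obj[OF P]
 have fn: "f l \<in> Hom C (Fo X l) (Fo (tensO SC Ys) l)" for l using snat_in[of X _ f l] f by simp
 note h = Shc_in[OF Ys zeros_Delta1[OF p]] and h' = Shc_in[OF Ys zeros_Delta1[OF Delta1_act[OF a p]]]
 have nat: "Fm (tensO SC Ys) n m a \<cdot> f n = f m \<cdot> Fm X n m a" using snat_nat[of X _ f a] f a by simp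
 show "Fm (tensO SC Ys) n m a \<cdot> (Shc Ys n p \<cdot> f n) = (Shc Ys m (Fm Delta1 n m a p) \<cdot> f m) \<cdot> Fm X n m a"
  using assoc[OF oX oP oP oP fn h sobj_map[OF P a]] Shc_simplicial[OF Ys a p] assoc[OF oX oP oP oP fn sobj_map[OF P a] h']
   nat assoc[OF oX oX oP oP sobj_map[OF X a] fn h'] by simp
qed

lemma Shih_op_nat:
 assumes Xs: "set Xs \<subseteq> Obj SC" and Y: "simplicial Y" and f: "f \<in> Hom SC (tensO SC Xs) Y"
 shows "snat (cyl (tensO SC Xs)) Y (Shih_op C Xs Y f)"
proof (rule sten_nat[where h = "\<lambda>n p. f n \<cdot> Shc Xs n p", OF Delta1_finite Delta1_act tensO_sobj[OF Xs] Y Shih_op_at[OF assms]])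
 fix m n a p assume a: "a \<in> Hom Simp m n" and p: "p \<in> Fo Delta1 n"
 note P = tensO_sobj[OF Xs]
 note oY = sobj_obj[OF Y] and oP = sobj_obj[OF P]
 have fn: "f l \<in> Hom C (Fo (tensO SC Xs) l) (Fo Y l)" for l using snat_in[of _ Y f l] f by simp
 note h = Shc_in[OF Xs zeros_Delta1[OF p]] and h' = Shc_in[OF Xs zeros_Delta1[OF Delta1_act[OF a p]]]
 have nat: "Fm Y n m a \<cdot> f n = f m \<cdot> Fm (tensO SC Xs) n m a" using snat_nat[of _ Y f a] f a by simp
 show "Fm Y n m a \<cdot> (f n \<cdot> Shc Xs n p) = (f m \<cdot> Shc Xs m (Fm Delta1 n m a p)) \<cdot> Fm (tensO SC Xs) n m a"
  using assoc[OF oP oP oY oY h fn sobj_map[OF Y a]] nat assoc[OF oP oP oP oY h sobj_map[OF P a] fn]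
   Shc_simplicial[OF Xs a p] assoc[OF oP oP oP oY sobj_map[OF P a] h' fn] by simp
qed

lemma Delta1_pow: "finite (Fo (sset_pow k Delta1) n)"
 by (rule sset_pow_finite[OF Delta1_finite])

lemmas pow_obj = sten_obj[OF Delta1_pow] and pow_in = sten_in_in[OF Delta1_pow]

lemma replicate_pow: "p \<in> Fo K n ==> rep k p \<in> Fo (sset_pow k K) n"
 by (auto simp: sset_pow_def)

text \<open>Evaluation is recorded only on constant tuples of indices, the copies that the diagonal
  reaches.\<close>

lemma sten_distr_at:
 assumes Ys: "set Ys \<subseteq> Obj SC"
 defines "W \<equiv> \<lambda>n. tensO C (map (\<lambda>i. Fo (cyl (Ys ! i)) n) [0..<length Ys])"
  and "J \<equiv> \<lambda>n p. tens_upt (length Ys) (\<lambda>i. cyl_in (Ys ! i) n p)"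
 shows "W n \<in> Obj C"
  and "sten_distr C Delta1 Ys n \<in> Hom C (Fo (sten C (sset_pow (length Ys) Delta1) (tensO SC Ys)) n) (W n)"
  and "p \<in> Fo Delta1 n ==> J n p \<in> Hom C (Fo (tensO SC Ys) n) (W n)"
  and "p \<in> Fo Delta1 n ==> sten_distr C Delta1 Ys n \<cdot> sten_in C (sset_pow (length Ys) Delta1) (tensO SC Ys) n (rep (length Ys) p) = J n p"
proof -
 let ?k = "length Ys" and ?P = "tensO SC Ys" and ?Q = "tensO SC (map (cyl) Ys)"
 note oY = sobj_obj[OF nth_functor[OF Ys]]
 note oS = cyl_obj[OF oY]
 have Q: "Fo ?Q n = W n" unfolding W_def using map_index_upt[of "\<lambda>Y. Fo (cyl Y) n" Ys] by (simp add: Sim_tensO_Fo o_def)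
 have P: "Fo ?P n = tensO C (map (\<lambda>i. Fo (Ys ! i) n) [0..<?k])" using map_index_upt[of "\<lambda>Y. Fo Y n" Ys] by (simp add: Sim_tensO_Fo)
 show W: "W n \<in> Obj C" unfolding W_def using oS by (auto intro!: tensO_obj)
 define h where "h n bs = tensM C (map2 (\<lambda>Y b. cyl_in Y n b) Ys bs)" for n bs
 have hin: "h n bs \<in> Hom C (Fo ?P n) (Fo ?Q n)" if b: "bs \<in> Fo (sset_pow ?k Delta1) n" for bs
 proof -
  have l: "length bs = ?k" "!!i. i < ?k ==> bs ! i \<in> Fo Delta1 n" using b by (auto simp: sset_pow_def)
  have e: "h n bs = tens_upt ?k (\<lambda>i. cyl_in (Ys ! i) n (bs ! i))"
   unfolding h_def using l(1) by (intro arg_cong[where f = "tensM C"] nth_equalityI) auto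
  have "cyl_in (Ys ! i) n (bs ! i) \<in> Hom C (Fo (Ys ! i) n) (Fo (cyl (Ys ! i)) n)" if "i < ?k" for i
   by (rule cyl_in_in[OF oY[OF that] l(2)[OF that]])
  thus ?thesis unfolding e Q P W_def using oY oS by (intro tensM_in homs_upt) blast
 qed
 note d = sten_desc[where K = "sset_pow ?k Delta1" and Y = ?Q and h = h, OF Delta1_pow sobj_obj[OF tensO_sobj[OF Ys]] W[folded Q] hin]
 have D: "sten_distr C Delta1 Ys = sten_desc C (sset_pow ?k Delta1) ?P ?Q h" by (simp add: sten_distr_def h_def[abs_def])
 show "sten_distr C Delta1 Ys n \<in> Hom C (Fo (sten C (sset_pow ?k Delta1) ?P) n) (W n)" unfolding D Q[symmetric] by (rule d(1))
 assume p: "p \<in> Fo Delta1 n"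
 have J: "h n (rep ?k p) = J n p"
  unfolding h_def J_def by (intro arg_cong[where f = "tensM C"] nth_equalityI) auto
 show "J n p \<in> Hom C (Fo ?P n) (W n)" using hin[OF replicate_pow[OF p]] unfolding J Q .
 show "sten_distr C Delta1 Ys n \<cdot> sten_in C (sset_pow ?k Delta1) ?P n (rep ?k p) = J n p"
  unfolding D J[symmetric] by (rule d(2)[OF _ replicate_pow[OF p]])
qed

lemma sten_diag_at:
 fixes k :: nat
 assumes oX: "Fo X n \<in> Obj C"
 defines "S \<equiv> sten C (sset_pow k Delta1) (cyl X)"
 shows "sten_diag C k Delta1 X n \<in> Hom C (Fo (cyl X) n) (Fo S n)"
  and "p \<in> Fo Delta1 n ==> sten_diag C k Delta1 X n \<cdot> cyl_in X n p =
   sten_in C (sset_pow k Delta1) (cyl X) n (rep k p) \<cdot> cyl_in X n p"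
proof -
 note o1 = cyl_obj[OF oX]
 note o2 = pow_obj[OF o1]
 let ?h = "\<lambda>n b. sten_in C (sset_pow k Delta1) (cyl X) n (rep k b) \<cdot> cyl_in X n b"
 have "?h n p \<in> Hom C (Fo X n) (Fo S n)" if "p \<in> Fo Delta1 n" for p
  unfolding S_def by (rule comp_in[OF oX o1 o2 cyl_in_in[OF oX that] pow_in[OF o1 replicate_pow[OF that]]])
 from sten_desc[where Y = S and h = ?h, OF Delta1_finite oX _ this] o2
 show "sten_diag C k Delta1 X n \<in> Hom C (Fo (cyl X) n) (Fo S n)"
  "p \<in> Fo Delta1 n ==> sten_diag C k Delta1 X n \<cdot> cyl_in X n p = ?h n p"
  unfolding sten_diag_def S_def by blast+
qed

lemma sten_diag'_at:
 fixes k :: nat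
 assumes oX: "Fo X n \<in> Obj C"
 defines "S \<equiv> cyl (sten C (sset_pow k Delta1) X)"
 shows "sten_diag' C k Delta1 X n \<in> Hom C (Fo (cyl X) n) (Fo S n)"
  and "p \<in> Fo Delta1 n ==> sten_diag' C k Delta1 X n \<cdot> cyl_in X n p =
   cyl_in (sten C (sset_pow k Delta1) X) n p \<cdot> sten_in C (sset_pow k Delta1) X n (rep k p)"
proof -
 note o1 = pow_obj[OF oX]
 note o2 = cyl_obj[OF o1]
 let ?h = "\<lambda>n b. cyl_in (sten C (sset_pow k Delta1) X) n b \<cdot> sten_in C (sset_pow k Delta1) X n (rep k b)"
 have "?h n p \<in> Hom C (Fo X n) (Fo S n)" if "p \<in> Fo Delta1 n" for p
  unfolding S_def by (rule comp_in[OF oX o1 o2 pow_in[OF oX replicate_pow[OF that]] cyl_in_in[OF o1 that]])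
 from sten_desc[where Y = S and h = ?h, OF Delta1_finite oX _ this] o2
 show "sten_diag' C k Delta1 X n \<in> Hom C (Fo (cyl X) n) (Fo S n)"
  "p \<in> Fo Delta1 n ==> sten_diag' C k Delta1 X n \<cdot> cyl_in X n p = ?h n p"
  unfolding sten_diag'_def S_def by blast+
qed

lemma sten_pr_at:
 assumes oX: "Fo X n \<in> Obj C" and fin: "finite (Fo K n)"
 shows "sten_pr C K X n \<in> Hom C (Fo (sten C K X) n) (Fo X n)" and "p \<in> Fo K n ==> sten_pr C K X n \<cdot> sten_in C K X n p = Idm C (Fo X n)"
 using sten_desc[where Y = X and h = "\<lambda>n _. Idm C (Fo X n)", OF fin oX oX id_in[OF oX]] unfolding sten_pr_def by blast+

text \<open>Equality of morphisms out of a tensor with \<open>Delta1\<close> is tested on each copy.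
  There the composite of families becomes the composite of their components at one and the same
  simplex, which is \<open>Shc_composition\<close>; arity one gives identities.\<close>

lemma Shih_coop_deformation: "is_coop_deformation C Delta1 (Shih_coop C)"
 unfolding is_coop_deformation_def Let_def
proof (intro conjI ballI allI impI)
 fix X assume "X \<in> CObj (coop_of SC)"
 hence X: "simplicial X" by (simp add: coop_of_def)
 note oX = sobj_obj[OF X]
 show "Shih_coop C X Ys f \<in> Hom SC (cyl X) (tensO SC Ys)"
  if "set Ys \<subseteq> CObj (coop_of SC)" "f \<in> CMor (coop_of SC) X Ys" for Ys f
  using Shih_coop_nat[OF X, of Ys f] that by (simp add: coop_of_def)
 fix Y f assume "Y \<in> CObj (coop_of SC)" "f \<in> CMor (coop_of SC) X [Y]"
 hence Y: "set [Y] \<subseteq> Obj SC" and f: "f \<in> Hom SC X (tensO SC [Y])" by (simp_all add: coop_of_def)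
 have oY: "Fo Y n \<in> Obj C" for n using sobj_obj[of Y] Y by simp
 have fn: "f n \<in> Hom C (Fo X n) (Fo Y n)" for n using snat_in[of X _ f n] f by simp
 have "Shih_coop C X [Y] f n = f n \<cdot> sten_pr C Delta1 X n" for n
 proof (rule sten_ext[OF Delta1_finite oX oY])
  note p = sten_pr_at[where K = Delta1, OF oX[of n] Delta1_finite] and oS = cyl_obj[OF oX[of n]]
  note at = Shih_coop_at[where n = n, OF X Y f]
  show "Shih_coop C X [Y] f n \<in> Hom C (Fo (cyl X) n) (Fo Y n)" using at(1) by simp
  show "f n \<cdot> sten_pr C Delta1 X n \<in> Hom C (Fo (cyl X) n) (Fo Y n)" by (rule comp_in[OF oS oX oY p(1) fn])
  fix b assume b: "b \<in> Fo Delta1 n"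
  show "Shih_coop C X [Y] f n \<cdot> cyl_in X n b = (f n \<cdot> sten_pr C Delta1 X n) \<cdot> cyl_in X n b"
   using at(2)[OF b] Shc_one[OF Y zeros_Delta1[OF b]] id_left[OF oX oY fn] id_right[OF oX oY fn]
    assoc[OF oX oS oX oY cyl_in_in[OF oX b] p(1) fn] p(2)[OF b] by simp
 qed
 thus "Shih_coop C X [Y] f = f \<odot> sten_pr C Delta1 X" by (simp add: fun_eq_iff)
next
 interpret S: category SC by (rule Sim_category)
 fix X Ys Zss f gs assume "composable_coop (coop_of SC) X Ys Zss f gs"
 hence X: "simplicial X" and Ys: "set Ys \<subseteq> Obj SC" and Z: "set (concat Zss) \<subseteq> Obj SC"
  and f: "f \<in> Hom SC X (tensO SC Ys)" and l: "length Zss = length Ys" "length gs = length Ys"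
  and g: "!!i. i < length Zss ==> gs ! i \<in> Hom SC (Ys ! i) (tensO SC (Zss ! i))"
  by (simp_all add: composable_coop_def coop_of_def)
 interpret sobj_lists C Zss by unfold_locales (rule Z)
 let ?N = "length Zss" and ?PY = "tensO SC Ys" and ?SX = "cyl X"
 let ?u = "Shih_coop C X Ys f" and ?us = "\<lambda>i. Shih_coop C (Ys ! i) (Zss ! i) (gs ! i)" and ?pow = "sset_pow ?N Delta1"
 have lY: "length Ys = ?N" using l(1) by simp
 have gm: "map (\<lambda>g. g n) gs = map (\<lambda>i. (gs ! i) n) [0..<?N]" for n using map_index_upt[of "\<lambda>g. g n" gs] l by simp
 have Xo: "X \<in> Obj SC" using X by simp
 have Yi: "simplicial (Ys ! i)" if "i < ?N" for i using nth_functor[OF Ys] that l(1) by simp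
 define F where "F = tens_flat SC Zss \<odot> tensM SC gs \<odot> f"
 have F: "F \<in> Hom SC X (tensO SC (concat Zss))"
 proof -
  have "tensM SC gs \<in> Hom SC ?PY (tensO SC (map (tensO SC) Zss))"
   using Sim_tensM_nat[OF Ys tensO_objs[OF Z]] l g by simp
  thus ?thesis
   unfolding F_def using Xo f flat_hom tensO_sobj[OF Ys] tensO_sobj[OF Z] tensO_sobj[OF tensO_objs[OF Z]]
   by (intro S.comp_in[of X "tensO SC (map (tensO SC) Zss)"] S.comp_in[of X ?PY]) (simp_all del: Sim_simps(4))
 qed
 have "Shih_coop C X (concat Zss) F n = tens_flat SC Zss n \<cdot> (tens_upt ?N (\<lambda>i. ?us i n)
   \<cdot> (sten_distr C Delta1 Ys n \<cdot> (sten_map C ?pow ?SX ?PY ?u n \<cdot> sten_diag C ?N Delta1 X n)))" for n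
 proof -
  note oX = sobj_obj[OF X, of n] and oP = sobj_obj[OF tensO_sobj[OF Ys], of n]
  note oS = cyl_obj[OF oX]
  note oPS = pow_obj[OF oS] and oPP = pow_obj[OF oP]
  note u = Shih_coop_at[where n = n, OF X Ys f]
  note dg = sten_diag_at[where k = ?N, OF oX] and dt = sten_distr_at[where n = n, OF Ys, unfolded lY]
  note sm = sten_map[where K = ?pow and f = ?u, OF Delta1_pow oS oP u(1)]
  let ?M = "tens_upt ?N (\<lambda>i. ?us i n)" and ?W = "tensO C (map (\<lambda>i. Fo (cyl (Ys ! i)) n) [0..<?N])"
  have oYi: "Fo (Ys ! i) n \<in> Obj C" "Fo (cyl (Ys ! i)) n \<in> Obj C" "Fo (tensO SC (Zss ! i)) n \<in> Obj C"
   "?us i n \<in> Hom C (Fo (cyl (Ys ! i)) n) (Fo (tensO SC (Zss ! i)) n)" if "i < ?N" for i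
   using sobj_obj[OF Yi[OF that]] cyl_obj sobj_obj[OF tensO_sobj[OF Zi[OF that]]]
    Shih_coop_at(1)[OF Yi[OF that] Zi[OF that] g[OF that]] by blast+
  have M: "?M \<in> Hom C ?W (Q n)" unfolding Q_eq using oYi by (intro tensM_in homs_upt) blast
  note c1 = comp_in[OF oS oPS oPP dg(1) sm(1)]
  note c2 = comp_in[OF oS oPP dt(1) c1 dt(2)]
  note c3 = comp_in[OF oS dt(1) Q_obj c2 M]
  show ?thesis
  proof (rule sten_ext[OF Delta1_finite oX P_obj])
   show "Shih_coop C X (concat Zss) F n \<in> Hom C (Fo ?SX n) (P n)" by (rule Shih_coop_at(1)[OF X Z F])
   show "tens_flat SC Zss n \<cdot> (?M \<cdot> (sten_distr C Delta1 Ys n \<cdot> (sten_map C ?pow ?SX ?PY ?u n \<cdot> sten_diag C ?N Delta1 X n))) \<in> Hom C (Fo ?SX n) (P n)"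
    by (rule comp_in[OF oS Q_obj P_obj c3 Fl_in])
   fix b assume b: "b \<in> Fo Delta1 n"
   note z = zeros_Delta1[OF b]
   note i = cyl_in_in[OF oX b] and j = pow_in[OF oS replicate_pow[OF b], of ?N] and j' = pow_in[OF oP replicate_pow[OF b], of ?N]
   let ?J = "tens_upt ?N (\<lambda>i. cyl_in (Ys ! i) n b)" and ?y = "Shc Ys n b \<cdot> f n"
   have fn: "f n \<in> Hom C (Fo X n) (Fo ?PY n)" using snat_in[of X _ f n] f by simp
   note y = comp_in[OF oX oP oP fn Shc_in[OF Ys z]]
   \<comment> \<open>The diagonal sends copy \<open>b\<close> to the copy indexed by the constant
     tuple of \<open>b\<close>, so all families are evaluated at the same \<open>b\<close>.\<close>
   have "(sten_map C ?pow ?SX ?PY ?u n \<cdot> sten_diag C ?N Delta1 X n) \<cdot> cyl_in X n b = sten_in C ?pow ?PY n (rep ?N b) \<cdot> ?y"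
    using assoc[OF oX oS oPS oPP i dg(1) sm(1)] dg(2)[OF b] assoc[OF oX oS oPS oPP i j sm(1)] sm(2)[OF replicate_pow[OF b]]
     assoc[OF oX oS oP oPP i u(1) j'] u(2)[OF b] by simp
   hence "(sten_distr C Delta1 Ys n \<cdot> (sten_map C ?pow ?SX ?PY ?u n \<cdot> sten_diag C ?N Delta1 X n)) \<cdot> cyl_in X n b = ?J \<cdot> ?y"
    using assoc[OF oX oS oPP dt(1) i c1 dt(2)] assoc[OF oX oP oPP dt(1) y j' dt(2)] dt(4)[OF b] by simp
   moreover have "?M \<cdot> ?J = tens_upt ?N (\<lambda>i. Shc (Zss ! i) n b \<cdot> (gs ! i) n)"
   proof -
    have "?M \<cdot> ?J = tens_upt ?N (\<lambda>i. ?us i n \<cdot> cyl_in (Ys ! i) n b)"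
     using oYi cyl_in_in[OF oYi(1) b]
     by (intro tensM_comp_upt[where x = "\<lambda>i. Fo (Ys ! i) n" and y = "\<lambda>i. Fo (cyl (Ys ! i)) n" and z = "\<lambda>i. Fo (tensO SC (Zss ! i)) n"]) blast
    also have "\<dots> = tens_upt ?N (\<lambda>i. Shc (Zss ! i) n b \<cdot> (gs ! i) n)"
     using Shih_coop_at(2)[OF Yi Zi g b] by (intro arg_cong[where f = "tensM C"] map_cong) auto
    finally show ?thesis .
   qed
   ultimately have "(tens_flat SC Zss n \<cdot> (?M \<cdot> (sten_distr C Delta1 Ys n \<cdot> (sten_map C ?pow ?SX ?PY ?u n \<cdot> sten_diag C ?N Delta1 X n)))) \<cdot> cyl_in X n b =
     tens_flat SC Zss n \<cdot> (tens_upt ?N (\<lambda>i. Shc (Zss ! i) n b \<cdot> (gs ! i) n) \<cdot> ?y)"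
    using assoc[OF oX oS Q_obj P_obj i c3 Fl_in] assoc[OF oX oS dt(1) Q_obj i c2 M] assoc[OF oX oP dt(1) Q_obj y dt(3)[OF b] M] by simp
   also have "\<dots> = Shc (concat Zss) n b \<cdot> F n"
    using Shc_composition[OF Ys lY z g oX fn] by (simp add: F_def Sim_tensM gm)
   finally show "Shih_coop C X (concat Zss) F n \<cdot> cyl_in X n b =
     (tens_flat SC Zss n \<cdot> (?M \<cdot> (sten_distr C Delta1 Ys n \<cdot> (sten_map C ?pow ?SX ?PY ?u n \<cdot> sten_diag C ?N Delta1 X n)))) \<cdot> cyl_in X n b"
    using Shih_coop_at(2)[OF X Z F b] by simp
  qed
 qed
 thus "Shih_coop C X (concat Zss) (CCmp (coop_of SC) X Ys Zss f gs) = tens_flat SC Zss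
   \<odot> tensM SC (map (\<lambda>i. Shih_coop C (Ys ! i) (Zss ! i) (gs ! i)) [0..<length Ys])
   \<odot> sten_distr C Delta1 Ys
   \<odot> sten_map C (sset_pow (length Ys) Delta1) (cyl X) (tensO SC Ys) (Shih_coop C X Ys f)
   \<odot> sten_diag C (length Ys) Delta1 X"
  unfolding coop_of_def cooperad.simps F_def[symmetric] lY by (simp add: fun_eq_iff Sim_tensM o_def)
qed

text \<open>The same test on copies, with the inverse of the flattening in front; the order of inner
  and outer operators is restored by their commutation in \<open>Shc_op_composition\<close>.\<close>

lemma Shih_op_deformation: "is_op_deformation C Delta1 (Shih_op C)"
 unfolding is_op_deformation_def Let_def
proof (intro conjI ballI allI impI)
 fix Y assume "Y \<in> OObj (op_of SC)"
 hence Y: "simplicial Y" by (simp add: op_of_def)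
 show "Shih_op C Xs Y f \<in> Hom SC (cyl (tensO SC Xs)) Y"
  if "set Xs \<subseteq> OObj (op_of SC)" "f \<in> OMor (op_of SC) Xs Y" for Xs f
  using Shih_op_nat[OF _ Y, of Xs f] that by (simp add: op_of_def)
next
 fix X Y f assume "X \<in> OObj (op_of SC)" "Y \<in> OObj (op_of SC)" "f \<in> OMor (op_of SC) [X] Y"
 hence X: "set [X] \<subseteq> Obj SC" and Y: "simplicial Y" and f: "f \<in> Hom SC (tensO SC [X]) Y" by (simp_all add: op_of_def)
 note oY = sobj_obj[OF Y]
 have oX: "Fo X n \<in> Obj C" for n using sobj_obj[of X] X by simp
 have fn: "f n \<in> Hom C (Fo X n) (Fo Y n)" for n using snat_in[of X Y f n] f by simp
 have "Shih_op C [X] Y f n = f n \<cdot> sten_pr C Delta1 X n" for n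
 proof (rule sten_ext[OF Delta1_finite oX oY])
  note p = sten_pr_at[where K = Delta1, OF oX[of n] Delta1_finite] and oS = cyl_obj[OF oX[of n]]
  note at = Shih_op_at[where n = n, OF X Y f]
  show "Shih_op C [X] Y f n \<in> Hom C (Fo (cyl X) n) (Fo Y n)" using at(1) by simp
  show "f n \<cdot> sten_pr C Delta1 X n \<in> Hom C (Fo (cyl X) n) (Fo Y n)" by (rule comp_in[OF oS oX oY p(1) fn])
  fix b assume b: "b \<in> Fo Delta1 n"
  show "Shih_op C [X] Y f n \<cdot> cyl_in X n b = (f n \<cdot> sten_pr C Delta1 X n) \<cdot> cyl_in X n b"
   using at(2)[OF b] Shc_one[OF X zeros_Delta1[OF b]] assoc[OF oX oS oX oY cyl_in_in[OF oX b] p(1) fn] p(2)[OF b] by simp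
 qed
 thus "Shih_op C [X] Y f = f \<odot> sten_pr C Delta1 X" by (simp add: fun_eq_iff)
next
 interpret S: category SC by (rule Sim_category)
 fix Xss Ys B gs f assume "composable_op (op_of SC) Xss Ys B gs f"
 hence B: "simplicial B" and Ys: "set Ys \<subseteq> Obj SC" and Z: "set (concat Xss) \<subseteq> Obj SC"
  and f: "f \<in> Hom SC (tensO SC Ys) B" and l: "length Xss = length Ys" "length gs = length Ys"
  and g: "!!i. i < length Xss ==> gs ! i \<in> Hom SC (tensO SC (Xss ! i)) (Ys ! i)"
  by (simp_all add: composable_op_def op_of_def)
 interpret sobj_lists C Xss by unfold_locales (rule Z)
 let ?N = "length Xss" and ?PY = "tensO SC Ys" and ?PX = "tensO SC (concat Xss)" and ?Vs = "map (tensO SC) Xss" and ?u = "tens_unflat SC Xss"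
 let ?W = "tensO SC ?Vs" and ?KV = "tensO SC (map (cyl) ?Vs)" and ?pow = "sset_pow ?N Delta1"
 let ?s = "Shih_op C Ys B f" and ?ss = "\<lambda>i. Shih_op C (Xss ! i) (Ys ! i) (gs ! i)"
 have lY: "length Ys = ?N" using l(1) by simp
 have gm: "map (\<lambda>g. g n) gs = map (\<lambda>i. (gs ! i) n) [0..<?N]" for n using map_index_upt[of "\<lambda>g. g n" gs] l by simp
 have Yi: "simplicial (Ys ! i)" if "i < ?N" for i using nth_functor[OF Ys] that l(1) by simp
 have Po: "?PX \<in> Obj SC" and Wo: "?W \<in> Obj SC" and PYo: "?PY \<in> Obj SC" and Bo: "B \<in> Obj SC"
  using tensO_sobj[OF Z] tensO_sobj[OF tensO_objs[OF Z]] tensO_sobj[OF Ys] B by simp_all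
 \<comment> \<open>The flattening is invertible in each degree, hence among simplicial objects. Its
   inverse \<open>?u\<close> satisfies the two equations that \<open>Shc_op_composition\<close> asks
   for.\<close>
 have "set (concat (map (map (\<lambda>X. Fo X n)) Xss)) \<subseteq> Obj C" for n using Z sobj_obj by fastforce
 from tens_flat_isom[OF this]
 have "is_isom SC ?W ?PX (tens_flat SC Xss)"
  using Wo Po Sim_flat_nat[OF Z] by (intro Sim_isom) (simp_all add: Sim_tens_flat Sim_tensO_Fo o_def map_concat)
 from S.inverse_pair_inv_mor[OF Wo Po this]
 have ip: "inverse_pair SC ?W ?PX (tens_flat SC Xss) ?u" unfolding tens_unflat_def .
 have u: "?u \<in> Hom SC ?PX ?W" using ip by (simp add: inverse_pair_def)
 have un: "?u n \<in> Hom C (P n) (Q n)" "?u n \<cdot> Fl n = Idm C (Q n)" "Fl n \<cdot> ?u n = Idm C (P n)" for n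
  using ip snat_in[of ?PX ?W ?u n] by (auto simp: inverse_pair_def fun_eq_iff)
 define F where "F = f \<odot> tensM SC gs \<odot> ?u"
 have F: "F \<in> Hom SC ?PX B"
 proof -
  have "tensM SC gs \<in> Hom SC ?W ?PY" using Sim_tensM_nat[OF tensO_objs[OF Z] Ys] l g by simp
  from S.comp_in[OF Po Wo PYo u this]
  show ?thesis unfolding F_def by (rule S.comp_in[OF Po PYo Bo _ f])
 qed
 have "Shih_op C (concat Xss) B F n = ?s n \<cdot> (sten_map C Delta1 ?KV ?PY (tensM SC (map ?ss [0..<?N])) n
   \<cdot> (sten_map C Delta1 (sten C ?pow ?W) ?KV (sten_distr C Delta1 ?Vs) n \<cdot> (sten_diag' C ?N Delta1 ?W n \<cdot> sten_map C Delta1 ?PX ?W ?u n)))" for n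
 proof -
  note oP = P_obj[of n] and oQ = Q_obj[of n] and oR = sobj_obj[OF tensO_sobj[OF Ys], of n] and oB = sobj_obj[OF B, of n]
  note dt = sten_distr_at[where n = n, OF tensO_objs[OF Z], unfolded length_map]
  have KV: "Fo ?KV n = tensO C (map (\<lambda>i. Fo (cyl (?Vs ! i)) n) [0..<?N])"
   using map_index_upt[of "\<lambda>Y. Fo (cyl Y) n" ?Vs] by (simp add: Sim_tensO_Fo o_def)
  note dt = dt[folded KV]
  let ?M = "tensM SC (map ?ss [0..<?N])" and ?J = "\<lambda>b. tens_upt ?N (\<lambda>i. cyl_in (?Vs ! i) n b)"
  have oi: "Fo (Ys ! i) n \<in> Obj C" "Fo (tensO SC (Xss ! i)) n \<in> Obj C" "Fo (cyl (?Vs ! i)) n \<in> Obj C"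
   "?ss i n \<in> Hom C (Fo (cyl (?Vs ! i)) n) (Fo (Ys ! i) n)" if "i < ?N" for i
   using sobj_obj[OF Yi[OF that]] cyl_obj sobj_obj[OF tensO_sobj[OF Zi[OF that]]]
    Shih_op_at(1)[OF Zi[OF that] Yi[OF that] g[OF that]] that by simp_all
  have M: "?M n \<in> Hom C (Fo ?KV n) (Fo ?PY n)"
  proof -
   have "Fo ?PY n = tensO C (map (\<lambda>i. Fo (Ys ! i) n) [0..<?N])"
    using map_index_upt[of "\<lambda>Y. Fo Y n" Ys] lY by (simp add: Sim_tensO_Fo)
   moreover have "?M n = tens_upt ?N (\<lambda>i. ?ss i n)" by (simp add: Sim_tensM o_def)
   moreover have "homs (map (\<lambda>i. Fo (cyl (?Vs ! i)) n) [0..<?N]) (map (\<lambda>i. Fo (Ys ! i) n) [0..<?N]) (map (\<lambda>i. ?ss i n) [0..<?N])"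
    using oi by (intro homs_upt) blast
   ultimately show ?thesis using tensM_in KV by (simp only:)
  qed
  note oPS = pow_obj[OF oQ]
  note o1 = cyl_obj[OF oP] and o2 = cyl_obj[OF oQ]
   and o3 = cyl_obj[OF oPS] and o4 = cyl_obj[OF dt(1)] and o5 = cyl_obj[OF oR]
  note m1 = sten_map[where K = Delta1 and f = ?u, OF Delta1_finite oP oQ un(1)] and dg = sten_diag'_at[where k = ?N, OF oQ]
   and m2 = sten_map[where K = Delta1 and f = "sten_distr C Delta1 ?Vs", OF Delta1_finite oPS dt(1) dt(2)]
   and m3 = sten_map[where K = Delta1 and f = ?M, OF Delta1_finite dt(1) oR M] and s = Shih_op_at[where n = n, OF Ys B f]
  note c1 = comp_in[OF o1 o2 o3 m1(1) dg(1)]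
  note c2 = comp_in[OF o1 o3 o4 c1 m2(1)]
  note c3 = comp_in[OF o1 o4 o5 c2 m3(1)]
  show ?thesis
  proof (rule sten_ext[OF Delta1_finite oP oB])
   let ?R = "?s n \<cdot> (sten_map C Delta1 ?KV ?PY ?M n \<cdot> (sten_map C Delta1 (sten C ?pow ?W) ?KV (sten_distr C Delta1 ?Vs) n \<cdot> (sten_diag' C ?N Delta1 ?W n \<cdot> sten_map C Delta1 ?PX ?W ?u n)))"
   show "Shih_op C (concat Xss) B F n \<in> Hom C (Fo (cyl ?PX) n) (Fo B n)" by (rule Shih_op_at(1)[OF Z B F])
   show "?R \<in> Hom C (Fo (cyl ?PX) n) (Fo B n)" by (rule comp_in[OF o1 o5 oB c3 s(1)])
   fix b assume b: "b \<in> Fo Delta1 n"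
   note z = zeros_Delta1[OF b]
   note i1 = cyl_in_in[OF oP b] and i2 = cyl_in_in[OF oQ b] and i3 = cyl_in_in[OF oPS b]
    and i4 = cyl_in_in[OF dt(1) b] and i5 = cyl_in_in[OF oR b] and j = pow_in[OF oQ replicate_pow[OF b], of ?N]
   note ju = comp_in[OF oP oQ oPS un(1) j] and Ju = comp_in[OF oP oQ dt(1) un(1) dt(3)[OF b]]
   have fn: "f n \<in> Hom C (Fo ?PY n) (Fo B n)" using snat_in[of _ B f n] f by simp
   have "(sten_diag' C ?N Delta1 ?W n \<cdot> sten_map C Delta1 ?PX ?W ?u n) \<cdot> cyl_in ?PX n b =
     cyl_in (sten C ?pow ?W) n b \<cdot> (sten_in C ?pow ?W n (rep ?N b) \<cdot> ?u n)"
    using assoc[OF oP o1 o2 o3 i1 m1(1) dg(1)] m1(2)[OF b] assoc[OF oP oQ o2 o3 un(1) i2 dg(1)] dg(2)[OF b]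
     assoc[OF oP oQ oPS o3 un(1) j i3] by simp
   hence "(sten_map C Delta1 (sten C ?pow ?W) ?KV (sten_distr C Delta1 ?Vs) n \<cdot> (sten_diag' C ?N Delta1 ?W n \<cdot> sten_map C Delta1 ?PX ?W ?u n)) \<cdot> cyl_in ?PX n b =
     cyl_in ?KV n b \<cdot> (?J b \<cdot> ?u n)"
    using assoc[OF oP o1 o3 o4 i1 c1 m2(1)] assoc[OF oP oPS o3 o4 ju i3 m2(1)] m2(2)[OF b] assoc[OF oP oPS dt(1) o4 ju dt(2) i4]
     assoc[OF oP oQ oPS dt(1) un(1) j dt(2)] dt(4)[OF b] by simp
   moreover have MJ: "?M n \<cdot> ?J b = tens_upt ?N (\<lambda>i. (gs ! i) n \<cdot> Shc (Xss ! i) n b)"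
   proof -
    have "tens_upt ?N (\<lambda>i. ?ss i n) \<cdot> ?J b = tens_upt ?N (\<lambda>i. ?ss i n \<cdot> cyl_in (?Vs ! i) n b)"
     using oi cyl_in_in[OF oi(2) b]
     by (intro tensM_comp_upt[where x = "\<lambda>i. Fo (tensO SC (Xss ! i)) n" and y = "\<lambda>i. Fo (cyl (?Vs ! i)) n" and z = "\<lambda>i. Fo (Ys ! i) n"]) simp
    also have "\<dots> = tens_upt ?N (\<lambda>i. (gs ! i) n \<cdot> Shc (Xss ! i) n b)"
     using Shih_op_at(2)[OF Zi Yi g b] by (intro arg_cong[where f = "tensM C"] map_cong) auto
    finally show ?thesis by (simp add: Sim_tensM o_def)
   qed
   ultimately have "?R \<cdot> cyl_in ?PX n b = f n \<cdot> (Shc Ys n b \<cdot> (tens_upt ?N (\<lambda>i. (gs ! i) n \<cdot> Shc (Xss ! i) n b) \<cdot> ?u n))"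
    using assoc[OF oP o1 o5 oB i1 c3 s(1)] assoc[OF oP o1 o4 o5 i1 c2 m3(1)] assoc[OF oP dt(1) o4 o5 Ju i4 m3(1)] m3(2)[OF b]
     assoc[OF oP dt(1) oR o5 Ju M i5] assoc[OF oP oR o5 oB comp_in[OF oP dt(1) oR Ju M] i5 s(1)] s(2)[OF b]
     assoc[OF oP oR oR oB comp_in[OF oP dt(1) oR Ju M] Shc_in[OF Ys z] fn] assoc[OF oP oQ dt(1) oR un(1) dt(3)[OF b] M] by simp
   also have "\<dots> = F n \<cdot> Shc (concat Xss) n b"
    using Shc_op_composition[OF Ys lY z g oB fn un] by (simp add: F_def Sim_tensM gm)
   finally show "Shih_op C (concat Xss) B F n \<cdot> cyl_in ?PX n b = ?R \<cdot> cyl_in ?PX n b"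
    using Shih_op_at(2)[OF Z B F b] by simp
  qed
 qed
 thus "Shih_op C (concat Xss) B (OCmp (op_of SC) Xss Ys B gs f) = Shih_op C Ys B f
   \<odot> sten_map C Delta1 ?KV (tensO SC Ys) (tensM SC (map (\<lambda>i. Shih_op C (Xss ! i) (Ys ! i) (gs ! i)) [0..<length Ys]))
   \<odot> sten_map C Delta1 (sten C (sset_pow (length Ys) Delta1) ?W) ?KV (sten_distr C Delta1 ?Vs)
   \<odot> sten_diag' C (length Ys) Delta1 ?W
   \<odot> sten_map C Delta1 (tensO SC (concat Xss)) ?W (tens_unflat SC Xss)"
  unfolding op_of_def operad.simps F_def[symmetric] lY by (simp add: fun_eq_iff)
qed

lemma vertex_Delta1: "v \<le> 1 ==> rep (Suc n) v \<in> Fo Delta1 n"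
 by (auto simp: Delta1_simps Simp_hom sorted_replicate simp del: replicate.simps)

text \<open>Over vertex 0 the whole simplex lies in the fibre over 0 and the component is an
  identity; over vertex 1 that fibre is empty and the component is the full operator
  \<open>EZ AW\<close>.\<close>

lemma Shih_homotopy: "is_coop_homotopy C (Shih_coop C) coop_id (coop_comp (EZ C) (AW C))"
proof -
 have at: "cmm (at_vertex C v (Shih_coop C)) X Ys f n = Shc Ys n (rep (Suc n) v) \<cdot> f n"
  if "simplicial X" "set Ys \<subseteq> Obj SC" "f \<in> Hom SC X (tensO SC Ys)" "v \<le> 1" for X Ys f v n
  using Shih_coop_at(2)[OF that(1-3) vertex_Delta1[OF that(4)]] by (simp add: at_vertex_def del: replicate.simps)
 have "coop_map_eq (coop_of SC) (at_vertex C 0 (Shih_coop C)) coop_id \<and>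
   coop_map_eq (coop_of SC) (at_vertex C 1 (Shih_coop C)) (coop_comp (EZ C) (AW C))"
  unfolding coop_map_eq_def
 proof (intro conjI ballI allI impI)
  fix X Ys f assume *: "X \<in> CObj (coop_of SC)" "set Ys \<subseteq> CObj (coop_of SC)" "f \<in> CMor (coop_of SC) X Ys"
  hence X: "simplicial X" and Ys: "set Ys \<subseteq> Obj SC" and f: "f \<in> Hom SC X (tensO SC Ys)" by (simp_all add: coop_of_def)
  note oX = sobj_obj[OF X] and oP = sobj_obj[OF tensO_sobj[OF Ys]] and oT = sobj_obj[OF ttens_functor[OF Ys]]
  have fn: "f n \<in> Hom C (Fo X n) (Fo (tensO SC Ys) n)" for n using snat_in[of X _ f n] f by simp
  have "Shc Ys n (rep (Suc n) 0) \<cdot> f n = f n" for n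
   using Shc_eq[OF Ys, of n "rep (Suc n) 0"] id_left[OF oX oP fn] by simp
  thus "cmm (at_vertex C 0 (Shih_coop C)) X Ys f = cmm coop_id X Ys f"
   using at[OF X Ys f, of 0] by (simp add: fun_eq_iff coop_id_def)
  have "Shc Ys n (rep (Suc n) 1) \<cdot> f n = Ez C (length Ys) (box C Ys) n \<cdot> (Aw C (length Ys) (box C Ys) n \<cdot> f n)" for n
   using assoc[OF oX oP oT oP fn snat_in[OF Aw_box[OF Ys]] snat_in[OF Ez_box[OF Ys]]] by (simp add: Shih_component_def EzAw_def)
  thus "cmm (at_vertex C 1 (Shih_coop C)) X Ys f = cmm (coop_comp (EZ C) (AW C)) X Ys f"
   using at[OF X Ys f, of 1] by (simp add: fun_eq_iff coop_comp_def EZ_def AW_def)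
 qed (simp_all add: at_vertex_def coop_id_def coop_comp_def EZ_def AW_def)
 thus ?thesis unfolding is_coop_homotopy_def using Shih_coop_deformation by blast
qed

end

theorem corollary5p16:
 fixes C :: "('o, 'm) ab_mon_cat"
 assumes "abelian_tensor_category C"
 shows "is_coop_functor (coop_of (Sim C)) (tcoop C) (AW C)
  \<and> is_coop_functor (tcoop C) (coop_of (Sim C)) (EZ C)
  \<and> (\<forall>X\<in>Obj (Sim C). cmo (AW C) X = X \<and> cmo (EZ C) X = X)
  \<and> coop_map_eq (tcoop C) (coop_comp (AW C) (EZ C)) coop_id
  \<and> is_coop_deformation C Delta1 (Shih_coop C)
  \<and> is_coop_homotopy C (Shih_coop C) coop_id (coop_comp (EZ C) (AW C))
  \<and> is_op_deformation C Delta1 (Shih_op C)"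
proof -
 interpret abelian_tensor_category C by (rule assms)
 show ?thesis
  using AW_functor EZ_functor AW_EZ Shih_coop_deformation Shih_homotopy Shih_op_deformation by (simp add: AW_def EZ_def)
qed

end
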